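(* Let $\Omega$ be a Lipschitz domain in a Euclidean space $\mathbb{R}^n$, let $X$ be a CAT($\kappa$) space for some $\kappa\in\mathbb{R}$, and let $u:\Omega\to X$ be a harmonic map. Let $\lambda\in\mathbb{R}$ and let $f:X\to\mathbb{R}$ be a Lipschitz continuous $\lambda$-convex function. Then for the composition $f\circ u\in W^{1,2}_{loc}(\Omega)$ the distributional Laplacian $\Delta(f\circ u)$ is a signed locally finite measure which satisfies $$\Delta(f\circ u)\ \ge\ \lambda\cdot e^2_u ,$$ where $e^2_u\in L^1(\Omega)$ is the energy density of $u$ (the function $\lambda e_u^2$ being identified with the measure having this density with respect to Lebesgue measure).
   Context: All CAT($\kappa$) spaces are complete length spaces by definition. A geodesic is an isometric embedding of an interval. A function $f:X\to\mathbb{R}$ is $\lambda$-convex if for every unit speed geodesic $\gamma$ in $X$ the function $t\mapsto f\circ\gamma(t)-\frac{\lambda}{2}t^2$ is convex. Sobolev maps: $L^2(\Omega,X)$ is the set of measurable, essentially separably valued maps $u:\Omega\to X$ such that $u_x(z):=d(x,u(z))$ is in $L^2(\Omega)$ for some (hence every) $x\in X$. A map $u\in L^2(\Omega,X)$ belongs to $W^{1,2}(\Omega,X)$ if there is $h\in L^2(\Omega)$ such that for every $x\in X$ the function $u_x$ is in $W^{1,2}(\Omega)$ and $|\nabla u_x|\le h$ almost everywhere. Each such $u$ has a trace $\mathrm{tr}(u)\in L^2(\partial\Omega,X)$ in the sense of Korevaar–Schoen; two maps $u,w\in W^{1,2}(\Omega,X)$ have the same trace if and only if $d(u,w)\in W^{1,2}_0(\Omega)$.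 Energy: $u$ has a representative which is absolutely continuous on almost every segment; for almost every $(z,v)\in\Omega\times\mathbb{R}^n$ let $m_u(z,v)$ be the metric velocity at $t=0$ of the curve $t\mapsto u(z+tv)$. The energy density is $e^2_u(z)=\frac{1}{\omega_n}\int_{S^{n-1}}|m_u(z,v)|^2\,dv$, where $\omega_n$ is the Lebesgue measure of the unit ball in $\mathbb{R}^n$, and the Korevaar–Schoen energy is $E^2(u)=\int_\Omega e^2_u(z)\,dz$. A map $u\in W^{1,2}(\Omega,X)$ is harmonic if $E^2(u)\le E^2(w)$ for all $w\in W^{1,2}(\Omega,X)$ with the same trace as $u$. *)

theory Defs
  imports "HOL-Analysis.Analysis"
begin

section \<open>CAT(\<kappa>) spaces and convex functions\<close>

text \<open>Metric spaces are types of class \<open>metric_space\<close>; the whole type is the space.\<close>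

definition geodesic_on :: "real set \<Rightarrow> (real \<Rightarrow> 'x::metric_space) \<Rightarrow> bool" where
  "geodesic_on I c \<longleftrightarrow> is_interval I \<and> (\<forall>s\<in>I. \<forall>t\<in>I. dist (c s) (c t) = \<bar>s - t\<bar>)"

definition geodesic_from_to :: "(real \<Rightarrow> 'x::metric_space) \<Rightarrow> 'x \<Rightarrow> 'x \<Rightarrow> bool" where
  "geodesic_from_to c x y \<longleftrightarrow>
     geodesic_on {0..dist x y} c \<and> c 0 = x \<and> c (dist x y) = y"

definition curve_length :: "(real \<Rightarrow> 'x::metric_space) \<Rightarrow> ereal" where
  "curve_length c =
     (SUP ts \<in> {ts. sorted ts \<and> set ts \<subseteq> {0..1}}.
        ereal (\<Sum>i<length ts - 1. dist (c (ts ! i)) (c (ts ! Suc i))))"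

definition length_space :: "'x::metric_space itself \<Rightarrow> bool" where
  "length_space T \<longleftrightarrow>
     (\<forall>x y::'x. ereal (dist x y) =
        (INF c \<in> {c. path c \<and> pathstart c = x \<and> pathfinish c = y}. curve_length c))"

text \<open>
  The model plane of constant curvature \<open>\<kappa>\<close>, inside \<open>(real^2) \<times> real\<close>: the unit sphere with its
  angular metric divided by \<open>sqrt \<kappa>\<close>, the Euclidean plane, or the upper sheet of the hyperboloid
  with its hyperbolic metric divided by \<open>sqrt (- \<kappa>)\<close>.
\<close>

definition model_plane :: "real \<Rightarrow> ((real^2) \<times> real) set" where
  "model_plane \<kappa> =
     (if \<kappa> > 0 then {(v, s). v \<bullet> v + s\<^sup>2 = 1}
      else if \<kappa> = 0 then {(v, s). s = 0}
      else {(v, s). s\<^sup>2 - v \<bullet> v = 1 \<and> s > 0})"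

definition model_dist :: "real \<Rightarrow> (real^2) \<times> real \<Rightarrow> (real^2) \<times> real \<Rightarrow> real" where
  "model_dist \<kappa> p q =
     (if \<kappa> > 0 then arccos (fst p \<bullet> fst q + snd p * snd q) / sqrt \<kappa>
      else if \<kappa> = 0 then dist (fst p) (fst q)
      else arcosh (snd p * snd q - fst p \<bullet> fst q) / sqrt (- \<kappa>))"

definition model_diam :: "real \<Rightarrow> ereal" where
  "model_diam \<kappa> = (if \<kappa> > 0 then ereal (pi / sqrt \<kappa>) else \<infinity>)"

text \<open>
  In the comparison condition the point at parameter \<open>s\<close> on the side \<open>pq\<close> and the point at
  parameter \<open>t\<close> on the side \<open>pr\<close> are compared; since \<open>p, q, r\<close> are arbitrary, this covers any two
  points on two different sides. The third side exists by the second conjunct.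
  Below \<open>x'\<close> and \<open>y'\<close> are the comparison points on the sides \<open>p'q'\<close> and \<open>p'r'\<close>.
\<close>

definition CAT_space :: "real \<Rightarrow> 'x::metric_space itself \<Rightarrow> bool" where
  "CAT_space \<kappa> T \<longleftrightarrow>
     complete (UNIV :: 'x set) \<and> length_space T \<and>
     (\<forall>x y::'x. ereal (dist x y) < model_diam \<kappa> \<longrightarrow> (\<exists>c. geodesic_from_to c x y)) \<and>
     (\<forall>(p::'x) q r a b.
        geodesic_from_to a p q \<longrightarrow> geodesic_from_to b p r \<longrightarrow>
        ereal (dist p q + dist q r + dist r p) < 2 * model_diam \<kappa> \<longrightarrow>
        (\<forall>p'\<in>model_plane \<kappa>. \<forall>q'\<in>model_plane \<kappa>. \<forall>r'\<in>model_plane \<kappa>.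
           model_dist \<kappa> p' q' = dist p q \<longrightarrow>
           model_dist \<kappa> q' r' = dist q r \<longrightarrow>
           model_dist \<kappa> r' p' = dist r p \<longrightarrow>
           (\<forall>s\<in>{0..dist p q}. \<forall>t\<in>{0..dist p r}.
              \<forall>x'\<in>model_plane \<kappa>. \<forall>y'\<in>model_plane \<kappa>.
                model_dist \<kappa> p' x' = s \<longrightarrow> model_dist \<kappa> x' q' = dist p q - s \<longrightarrow>
                model_dist \<kappa> p' y' = t \<longrightarrow> model_dist \<kappa> y' r' = dist p r - t \<longrightarrow>
                dist (a s) (b t) \<le> model_dist \<kappa> x' y')))"

definition semiconvex :: "real \<Rightarrow> ('x::metric_space \<Rightarrow> real) \<Rightarrow> bool" where
  "semiconvex lam f \<longleftrightarrow>
     (\<forall>I c. geodesic_on I c \<longrightarrow> convex_on I (\<lambda>t. f (c t) - lam / 2 * t\<^sup>2))"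


section \<open>Lipschitz domains and test functions\<close>

text \<open>Near each boundary point the domain lies on one side of the graph of a Lipschitz function
  over the hyperplane orthogonal to some unit vector \<open>e\<close>.\<close>

definition lipschitz_domain :: "'a::euclidean_space set \<Rightarrow> bool" where
  "lipschitz_domain \<Omega> \<longleftrightarrow>
     open \<Omega> \<and> connected \<Omega> \<and> bounded \<Omega> \<and> \<Omega> \<noteq> {} \<and>
     (\<forall>p\<in>frontier \<Omega>. \<exists>U e g L.
        open U \<and> p \<in> U \<and> norm e = 1 \<and> L-lipschitz_on {y. y \<bullet> e = 0} g \<and>
        \<Omega> \<inter> U = {x\<in>U. x \<bullet> e > g (x - (x \<bullet> e) *\<^sub>R e)})"

definition dir_deriv :: "('a::euclidean_space \<Rightarrow> real) \<Rightarrow> 'a \<Rightarrow> 'a \<Rightarrow> real" where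
  "dir_deriv \<phi> v x = frechet_derivative \<phi> (at x) v"

definition gradient :: "('a::euclidean_space \<Rightarrow> real) \<Rightarrow> 'a \<Rightarrow> 'a" where
  "gradient \<phi> x = (\<Sum>b\<in>Basis. dir_deriv \<phi> b x *\<^sub>R b)"

definition laplacian :: "('a::euclidean_space \<Rightarrow> real) \<Rightarrow> 'a \<Rightarrow> real" where
  "laplacian \<phi> x = (\<Sum>b\<in>Basis. dir_deriv (dir_deriv \<phi> b) b x)"

primrec C_k :: "nat \<Rightarrow> ('a::euclidean_space \<Rightarrow> real) \<Rightarrow> bool" where
  "C_k 0 \<phi> \<longleftrightarrow> continuous_on UNIV \<phi>"
| "C_k (Suc k) \<phi> \<longleftrightarrow> (\<forall>x. \<phi> differentiable (at x)) \<and> (\<forall>v. C_k k (dir_deriv \<phi> v))"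

definition test_function :: "'a::euclidean_space set \<Rightarrow> ('a \<Rightarrow> real) \<Rightarrow> bool" where
  "test_function \<Omega> \<phi> \<longleftrightarrow>
     (\<forall>k. C_k k \<phi>) \<and> compact (closure {x. \<phi> x \<noteq> 0}) \<and> closure {x. \<phi> x \<noteq> 0} \<subseteq> \<Omega>"


section \<open>Sobolev functions and Sobolev maps\<close>

text \<open>Functions on \<open>\<Omega>\<close> are total functions whose values outside \<open>\<Omega>\<close> are irrelevant, and
  elements of \<open>L\<^sup>2\<close> are represented by functions rather than by classes.\<close>

definition L2_fun :: "'a::euclidean_space set \<Rightarrow> ('a \<Rightarrow> 'b::euclidean_space) \<Rightarrow> bool" where
  "L2_fun \<Omega> g \<longleftrightarrow>
     g \<in> borel_measurable (lebesgue_on \<Omega>) \<and> integrable (lebesgue_on \<Omega>) (\<lambda>z. (norm (g z))\<^sup>2)"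

text \<open>\<open>g \<in> W\<^sup>1\<^sup>,\<^sup>2(\<Omega>)\<close> with weak gradient \<open>G\<close>\<close>

definition W12_gradient ::
    "'a::euclidean_space set \<Rightarrow> ('a \<Rightarrow> real) \<Rightarrow> ('a \<Rightarrow> 'a) \<Rightarrow> bool" where
  "W12_gradient \<Omega> g G \<longleftrightarrow>
     L2_fun \<Omega> g \<and> L2_fun \<Omega> G \<and>
     (\<forall>\<phi> v. test_function \<Omega> \<phi> \<longrightarrow>
        (LINT z|lebesgue_on \<Omega>. g z * dir_deriv \<phi> v z) =
        - (LINT z|lebesgue_on \<Omega>. (G z \<bullet> v) * \<phi> z))"

definition W12 :: "'a::euclidean_space set \<Rightarrow> ('a \<Rightarrow> real) \<Rightarrow> bool" where
  "W12 \<Omega> g \<longleftrightarrow> (\<exists>G. W12_gradient \<Omega> g G)"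

definition W12_loc :: "'a::euclidean_space set \<Rightarrow> ('a \<Rightarrow> real) \<Rightarrow> bool" where
  "W12_loc \<Omega> g \<longleftrightarrow> (\<forall>U. open U \<and> compact (closure U) \<and> closure U \<subseteq> \<Omega> \<longrightarrow> W12 U g)"

text \<open>The closure of the test functions in \<open>W\<^sup>1\<^sup>,\<^sup>2(\<Omega>)\<close>\<close>

definition W12_zero :: "'a::euclidean_space set \<Rightarrow> ('a \<Rightarrow> real) \<Rightarrow> bool" where
  "W12_zero \<Omega> g \<longleftrightarrow>
     (\<exists>G \<phi>. W12_gradient \<Omega> g G \<and> (\<forall>k::nat. test_function \<Omega> (\<phi> k)) \<and>
        (\<lambda>k. LINT z|lebesgue_on \<Omega>. (\<phi> k z - g z)\<^sup>2) \<longlonglongrightarrow> 0 \<and>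
        (\<lambda>k. LINT z|lebesgue_on \<Omega>. (norm (gradient (\<phi> k) z - G z))\<^sup>2) \<longlonglongrightarrow> 0)"

definition L2_map :: "'a::euclidean_space set \<Rightarrow> ('a \<Rightarrow> 'x::metric_space) \<Rightarrow> bool" where
  "L2_map \<Omega> u \<longleftrightarrow>
     u \<in> borel_measurable (lebesgue_on \<Omega>) \<and>
     (\<exists>D. countable D \<and> (AE z in lebesgue_on \<Omega>. u z \<in> closure D)) \<and>
     (\<exists>x. L2_fun \<Omega> (\<lambda>z. dist x (u z)))"

definition W12_map :: "'a::euclidean_space set \<Rightarrow> ('a \<Rightarrow> 'x::metric_space) \<Rightarrow> bool" where
  "W12_map \<Omega> u \<longleftrightarrow>
     L2_map \<Omega> u \<and>
     (\<exists>h::'a \<Rightarrow> real. L2_fun \<Omega> h \<and>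
        (\<forall>x. \<exists>G. W12_gradient \<Omega> (\<lambda>z. dist x (u z)) G \<and>
              (AE z in lebesgue_on \<Omega>. norm (G z) \<le> h z)))"


section \<open>Energy and harmonic maps\<close>

definition abs_cont_on :: "real \<Rightarrow> real \<Rightarrow> (real \<Rightarrow> 'x::metric_space) \<Rightarrow> bool" where
  "abs_cont_on a b c \<longleftrightarrow>
     (\<forall>\<epsilon>>0. \<exists>\<delta>>0. \<forall>(N::nat set) l r.
        finite N \<longrightarrow> (\<forall>i\<in>N. a \<le> l i \<and> l i \<le> r i \<and> r i \<le> b) \<longrightarrow>
        disjoint_family_on (\<lambda>i. {l i<..<r i}) N \<longrightarrow>
        (\<Sum>i\<in>N. r i - l i) < \<delta> \<longrightarrow> (\<Sum>i\<in>N. dist (c (l i)) (c (r i))) < \<epsilon>)"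

text \<open>Almost every segment means for almost every pair of endpoints, with respect to Lebesgue
  measure on the product. Two such representatives of the same map agree on almost every segment,
  so the energy density below does not depend, up to null sets, on the choice made.\<close>

definition segment_ac_representative ::
    "'a::euclidean_space set \<Rightarrow> ('a \<Rightarrow> 'x::metric_space) \<Rightarrow> ('a \<Rightarrow> 'x) \<Rightarrow> bool" where
  "segment_ac_representative \<Omega> u w \<longleftrightarrow>
     (AE z in lebesgue_on \<Omega>. w z = u z) \<and>
     (AE (x, y) in (lborel :: ('a \<times> 'a) measure).
        closed_segment x y \<subseteq> \<Omega> \<longrightarrow> abs_cont_on 0 1 (\<lambda>t. w (x + t *\<^sub>R (y - x))))"

definition metric_velocity ::
    "'a::euclidean_space set \<Rightarrow> ('a \<Rightarrow> 'x::metric_space) \<Rightarrow> 'a \<Rightarrow> 'a \<Rightarrow> real" where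
  "metric_velocity \<Omega> u z v =
     (let w = (SOME w. segment_ac_representative \<Omega> u w)
      in Lim (at 0) (\<lambda>t. dist (w (z + t *\<^sub>R v)) (w z) / \<bar>t\<bar>))"

text \<open>
  Surface measure of the unit sphere, normalised by polar coordinates: the measure of \<open>A\<close> is
  \<open>n\<close> times the Lebesgue measure of \<open>{t v | 0 < t < 1, v \<in> A}\<close>. It is completed because
  \<open>metric_velocity \<Omega> u z\<close> need not be Borel measurable.
\<close>

definition sphere_measure :: "'a::euclidean_space measure" where
  "sphere_measure =
     completion (scale_measure (of_nat DIM('a))
       (distr (restrict_space lborel (ball 0 1 - {0})) borel sgn))"

definition energy_density ::
    "'a::euclidean_space set \<Rightarrow> ('a \<Rightarrow> 'x::metric_space) \<Rightarrow> 'a \<Rightarrow> real" where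
  "energy_density \<Omega> u z =
     (LINT v|sphere_measure. (metric_velocity \<Omega> u z v)\<^sup>2) / measure lborel (ball (0::'a) 1)"

definition energy :: "'a::euclidean_space set \<Rightarrow> ('a \<Rightarrow> 'x::metric_space) \<Rightarrow> real" where
  "energy \<Omega> u = (LINT z|lebesgue_on \<Omega>. energy_density \<Omega> u z)"

text \<open>For Sobolev maps on a Lipschitz domain, this is equality of the Korevaar--Schoen traces.\<close>

definition same_trace ::
    "'a::euclidean_space set \<Rightarrow> ('a \<Rightarrow> 'x::metric_space) \<Rightarrow> ('a \<Rightarrow> 'x) \<Rightarrow> bool" where
  "same_trace \<Omega> u w \<longleftrightarrow> W12_zero \<Omega> (\<lambda>z. dist (u z) (w z))"

definition harmonic_map :: "'a::euclidean_space set \<Rightarrow> ('a \<Rightarrow> 'x::metric_space) \<Rightarrow> bool" where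
  "harmonic_map \<Omega> u \<longleftrightarrow>
     W12_map \<Omega> u \<and> (\<forall>w. W12_map \<Omega> w \<and> same_trace \<Omega> u w \<longrightarrow> energy \<Omega> u \<le> energy \<Omega> w)"


section \<open>Measures as distributional Laplacians\<close>

definition locally_finite_measure :: "'a::euclidean_space set \<Rightarrow> 'a measure \<Rightarrow> bool" where
  "locally_finite_measure \<Omega> \<mu> \<longleftrightarrow>
     sets \<mu> = sets (restrict_space borel \<Omega>) \<and>
     (\<forall>K. compact K \<and> K \<subseteq> \<Omega> \<longrightarrow> emeasure \<mu> K < \<infinity>)"

text \<open>A signed locally finite measure on \<open>\<Omega>\<close> is a difference \<open>\<mu> - \<nu>\<close> of two locally finite
  measures. Both may have infinite mass, so the difference is evaluated on relatively compact
  Borel sets and on test functions only.\<close>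

definition distributional_laplacian ::
    "'a::euclidean_space set \<Rightarrow> ('a \<Rightarrow> real) \<Rightarrow> 'a measure \<Rightarrow> 'a measure \<Rightarrow> bool" where
  "distributional_laplacian \<Omega> g \<mu> \<nu> \<longleftrightarrow>
     locally_finite_measure \<Omega> \<mu> \<and> locally_finite_measure \<Omega> \<nu> \<and>
     (\<forall>\<phi>. test_function \<Omega> \<phi> \<longrightarrow>
        (LINT z|lebesgue_on \<Omega>. g z * laplacian \<phi> z) = (LINT z|\<mu>. \<phi> z) - (LINT z|\<nu>. \<phi> z))"

definition signed_measure_ge_density ::
    "'a::euclidean_space set \<Rightarrow> 'a measure \<Rightarrow> 'a measure \<Rightarrow> ('a \<Rightarrow> real) \<Rightarrow> bool" where
  "signed_measure_ge_density \<Omega> \<mu> \<nu> h \<longleftrightarrow>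
     (\<forall>A\<in>sets borel. compact (closure A) \<and> closure A \<subseteq> \<Omega> \<longrightarrow>
        measure \<mu> A - measure \<nu> A \<ge> (LINT z:A|lebesgue. h z))"

end

theory Submission
  imports Defs
begin

text \<open>Let \<open>J a\<close>, the resolvent of \<open>f\<close>, take \<open>x\<close> to the minimiser of \<open>2 a f + d(x, -)\<^sup>2\<close>. Comparison
with the sphere and \<open>\<lambda>\<close>-convexity give, for small \<open>a, b \<le> \<epsilon>\<close>,
\<open>(1 - C \<epsilon>\<^sup>2 + \<lambda> (a + b)) d(J a x, J b y)\<^sup>2 + 2 (b - a) (f (J b y) - f (J a x)) \<le> d(x, y)\<^sup>2\<close>.
For a test function \<open>0 \<le> \<eta> \<le> 1\<close> the map \<open>u\<^sub>\<epsilon> z = J (\<epsilon> \<eta> z) (u z)\<close> has the trace of \<open>u\<close>. Dividing by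
\<open>t\<^sup>2\<close> along the segments \<open>z + t v\<close> and averaging over \<open>v\<close> compares the energy densities of \<open>u\<^sub>\<epsilon>\<close> and \<open>u\<close>;
since \<open>u\<close> minimises the energy, \<open>\<epsilon> \<rightarrow> 0\<close> leaves \<open>\<integral> (f \<circ> u) \<Delta>\<eta> \<ge> \<lambda> \<integral> \<eta> e\<^sub>u\<close>. Hence \<open>\<Delta>(f \<circ> u) - \<lambda> e\<^sub>u\<close> is
a positive functional on test functions, that is, a measure.\<close>

text \<open>For positive curvature comparison is only local, and squared distances may violate the
  flat Stewart inequality. The chordal quantity \<open>2 - 2 cos (k d)\<close> replaces them: on the
  sphere it obeys Stewart's relation exactly, and flat or hyperbolic triangles are thinner, so one
  inequality serves every \<open>\<kappa>\<close>. Resolvents with parameter at most \<epsilon> move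
  points by \<open>O(\<epsilon>)\<close>, so curvature costs only a factor
  \<open>1 - C \<epsilon>^2\<close>, which disappears in the division by \<epsilon>. The variable
  parameter is what produces the Laplacian: the mixed term \<open>(b - a) (f q - f p)\<close>
  becomes the product of the derivatives of \<open>\<eta>\<close> and of \<open>f\<close> along
  \<open>u\<^sub>\<epsilon>\<close>, whose mean over directions is an inner product of gradients.
  Convergence of these gradients is avoided, since an integration by parts leaves \<open>f\<close>
  along \<open>u\<^sub>\<epsilon>\<close> itself, which converges uniformly to \<open>f\<close>
  along \<open>u\<close>. The energy refers to the metric velocities of an unspecified
  representative; they are expressed by the weak gradients of the distances to a dense sequence of
  values.\<close>

abbreviation (input) segment_in :: "'a::euclidean_space set => 'a * 'a => bool" where
 "segment_in Om p \<equiv> closed_segment (fst p) (fst p + snd p) <= Om"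

text \<open>A pair \<open>p\<close> stands for a base point \<open>fst p\<close> with a direction
  \<open>snd p\<close>, not for two endpoints. Directions can be rescaled without moving the base
  point, which turns statements on segments inside the domain into statements about limits at the
  base point.\<close>

abbreviation (input) pt :: "'a * 'a => real => 'a::real_vector" where
 "pt p t \<equiv> fst p + t *\<^sub>R snd p"

abbreviation (input) L1 :: "('a::euclidean_space => 'b::{banach, second_countable_topology}) => bool" where
 "L1 \<equiv> integrable lborel"

abbreviation (input) Borel :: "('a::topological_space => 'b::topological_space) set" where
 "Borel \<equiv> borel_measurable borel"

abbreviation (input) ind :: "'a set => 'a => 'b::zero_neq_one" where
 "ind \<equiv> indicator"

abbreviation (input) scale (infixr "*R" 75) where
 "c *R x \<equiv> c *\<^sub>R x"

abbreviation (input) lint :: "('a::euclidean_space => 'b::{banach, second_countable_topology}) => 'b" (binder "LI " [60] 60) where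
 "lint g \<equiv> integral\<^sup>L lborel g"

abbreviation (input) aelb :: "('a::euclidean_space => bool) => bool" (binder "ae " 10) where
 "aelb P \<equiv> almost_everywhere lborel P"

section \<open>Test functions\<close>

lemma dir_deriv_eq: "(f has_derivative D) (at x) ==> dir_deriv f v x = D v"
 by (simp add: dir_deriv_def frechet_derivative_at[symmetric])

text \<open>The closure properties of \<open>C_k\<close> below are inductions on \<open>k\<close>
  through this rule: the derivative of a combination has to be a combination of functions of class
  \<open>C_k\<close> again.\<close>

lemma C_k_SucI:
 assumes "!!x. (f has_derivative D x) (at x)" "!!v. C_k k (%x. D x v)"
 shows "C_k (Suc k) f"
proof -
 have "dir_deriv f v = (%x. D x v)" for v
  using dir_deriv_eq[OF assms(1)] by auto
 then show ?thesis using assms by (auto simp: differentiable_def)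
qed

lemma C_k_Suc_has_derivative:
 assumes "C_k (Suc k) f"
 shows "(f has_derivative (%v. dir_deriv f v x)) (at x)"
 using assms by (simp add: dir_deriv_def[abs_def] frechet_derivative_works)

lemma C_k_Suc_imp: "C_k (Suc k) f ==> C_k k f"
proof (induction k arbitrary: f)
 case 0
 then show ?case
  by (auto intro!: differentiable_imp_continuous_on simp: differentiable_on_def)
next
 case (Suc k)
 then show ?case by (metis C_k.simps(2))
qed

lemma C_k_const: "C_k k (%x::'a::euclidean_space. c)"
proof (induction k arbitrary: c)
 case (Suc k)
 show ?case by (rule C_k_SucI[where D="%x v. 0"]) (auto intro: Suc)
qed auto

lemma C_k_add: "C_k k f ==> C_k k g ==> C_k k (%x. f x + g x)"
proof (induction k arbitrary: f g)
 case 0 then show ?case by (auto intro: continuous_intros)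
next
 case (Suc k)
 show ?case
  by (rule C_k_SucI, rule has_derivative_add[OF C_k_Suc_has_derivative[OF Suc.prems(1)] C_k_Suc_has_derivative[OF Suc.prems(2)]])
    (use Suc in auto)
qed

lemma C_k_mult: "C_k k f ==> C_k k g ==> C_k k (%x. f x * g x)"
proof (induction k arbitrary: f g)
 case 0 then show ?case by (auto intro: continuous_intros)
next
 case (Suc k)
 show ?case
  by (rule C_k_SucI, rule has_derivative_mult[OF C_k_Suc_has_derivative[OF Suc.prems(1)] C_k_Suc_has_derivative[OF Suc.prems(2)]])
    (use Suc C_k_Suc_imp[OF Suc.prems(1)] C_k_Suc_imp[OF Suc.prems(2)] in \<open>auto intro!: C_k_add\<close>)
qed

lemma C_k_uminus: "C_k k f ==> C_k k (%x. - f x)"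
 using C_k_mult[OF C_k_const[of k "-1"], of f] by simp

lemma C_k_diff: "C_k k f ==> C_k k g ==> C_k k (%x. f x - g x)"
 using C_k_add[OF _ C_k_uminus, of k f g] by simp

lemma C_k_power: "C_k k f ==> C_k k (%x. f x ^ n)"
 by (induction n) (auto intro: C_k_const C_k_mult)

lemma C_k_prod: "(!!i. i \<in> I ==> C_k k (f i)) ==> C_k k (%x. \<Prod>i\<in>I. f i x)"
 by (induction I rule: infinite_finite_induct) (auto intro: C_k_const C_k_mult)

lemma C_k_sum: "(!!i. i \<in> I ==> C_k k (f i)) ==> C_k k (%x. \<Sum>i\<in>I. f i x)"
 by (induction I rule: infinite_finite_induct) (auto intro: C_k_const C_k_add)

lemma C_k_inverse: "C_k k f ==> (!!x. f x \<noteq> 0) ==> C_k k (%x. inverse (f x))"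
proof (induction k)
 case 0 then show ?case by (auto intro!: continuous_intros)
next
 case (Suc k)
 show ?case
 proof (rule C_k_SucI)
  show "((%x. inverse (f x)) has_derivative (%v. - (inverse (f x) * dir_deriv f v x * inverse (f x)))) (at x)" for x
   by (rule Deriv.has_derivative_inverse[OF Suc.prems(2) C_k_Suc_has_derivative[OF Suc.prems(1)]])
  show "C_k k (%x. - (inverse (f x) * dir_deriv f v x * inverse (f x)))" for v
   using Suc.IH[OF C_k_Suc_imp[OF Suc.prems(1)] Suc.prems(2)] Suc.prems(1)
   by (intro C_k_uminus C_k_mult) auto
 qed
qed

lemma C_k_comp:
 fixes th :: "real => real" and g :: "'a::euclidean_space => real"
 shows "C_k k th ==> C_k k g ==> C_k k (%x. th (g x))"
proof (induction k arbitrary: th)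
 case 0
 then show ?case by (auto intro: continuous_on_compose2[of UNIV th])
next
 case (Suc k)
 show ?case
 proof (rule C_k_SucI)
  fix x :: 'a
  have D: "((%x. th (g x)) has_derivative (%v. dir_deriv th (dir_deriv g v x) (g x))) (at x)"
   by (rule has_derivative_compose[OF C_k_Suc_has_derivative[OF Suc.prems(2)] C_k_Suc_has_derivative[OF Suc.prems(1)]])
  have eq: "dir_deriv th t y = dir_deriv th 1 y * t" for t y
   using linear_cmul[OF has_derivative_linear[OF C_k_Suc_has_derivative[OF Suc.prems(1), of y]], of t 1]
   by (simp add: mult.commute)
  show "((%x. th (g x)) has_derivative (%v. dir_deriv th 1 (g x) * dir_deriv g v x)) (at x)"
   using D unfolding eq[of "dir_deriv g _ x"] .
 next
  show "C_k k (%x. dir_deriv th 1 (g x) * dir_deriv g v x)" for v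
   by (rule C_k_mult[OF Suc.IH]) (use Suc.prems C_k_Suc_imp[OF Suc.prems(2)] in auto)
 qed
qed

lemma C_k_inner: "C_k k (%x::'a::euclidean_space. x \<bullet> b)"
proof (cases k)
 case (Suc n)
 show ?thesis unfolding Suc
  by (rule C_k_SucI[where D="%x v. v \<bullet> b"]) (auto intro!: derivative_eq_intros C_k_const)
qed (auto intro: continuous_intros)

lemma has_derivative_affine_comp:
 fixes f :: "'a::euclidean_space => real"
 assumes "(f has_derivative D) (at (t + c *R x))"
 shows "((%x. f (t + c *R x)) has_derivative (%v. D (c *R v))) (at x)"
proof -
 have "((%x. t + c *R x) has_derivative (%v. c *R v)) (at x)"
  by (auto intro!: derivative_eq_intros)
 from has_derivative_compose[OF this assms] show ?thesis .
qed

lemma C_k_affine: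
 fixes f :: "'a::euclidean_space => real"
 shows "C_k k f ==> C_k k (%x. f (t + c *R x))"
proof (induction k arbitrary: f)
 case 0
 then show ?case by (auto intro!: continuous_intros continuous_on_compose2[of UNIV f])
next
 case (Suc k)
 show ?case
  by (rule C_k_SucI, rule has_derivative_affine_comp, rule C_k_Suc_has_derivative[OF Suc.prems], rule Suc.IH)
   (use Suc.prems in auto)
qed

lemma dir_deriv_affine:
 fixes f :: "'a::euclidean_space => real"
 assumes "C_k (Suc 0) f"
 shows "dir_deriv (%x. f (t + c *R x)) v x = c * dir_deriv f v (t + c *R x)"
proof -
 have d: "(f has_derivative (%v. dir_deriv f v (t + c *R x))) (at (t + c *R x))"
  by (rule C_k_Suc_has_derivative[OF assms])
 show ?thesis
  using dir_deriv_eq[OF has_derivative_affine_comp[OF d], of v] linear_cmul[OF has_derivative_linear[OF d]]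
  by simp
qed

subsection \<open>Bump functions\<close>

text \<open>A polynomial in \<open>1 / x\<close> times the flat function
  \<open>exp (- 1 / x)\<close>. Carrying the polynomial along makes the family closed under
  differentiation, so that smoothness is a single induction over all polynomials.\<close>

definition flat_exp :: "real poly => real => real" where
 "flat_exp p x = (if x > 0 then poly p (1 / x) * exp (- 1 / x) else 0)"

lemma poly_over_exp: "((%x::real. poly p x * exp (- x)) \<longlongrightarrow> 0) at_top"
proof (induction p)
 case (pCons a p)
 have "((%x::real. poly p x * x / exp x) \<longlongrightarrow> 0) at_top"
 proof -
  have *: "((%x::real. \<Sum>i\<le>degree p. coeff p i * (x ^ (Suc i) / exp x)) \<longlongrightarrow> (\<Sum>i\<le>degree p. coeff p i * 0)) at_top"
   by (intro tendsto_sum tendsto_mult tendsto_const tendsto_power_div_exp_0)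
  show ?thesis
   by (rule Lim_transform_eventually[OF *[simplified]])
    (auto simp: poly_altdef sum_distrib_left sum_divide_distrib mult_ac)
 qed
 moreover have "((%x::real. a * exp (- x)) \<longlongrightarrow> a * 0) at_top"
  by (intro tendsto_mult tendsto_const filterlim_compose[OF exp_at_bot] filterlim_uminus_at_bot_at_top)
 ultimately have "((%x::real. a * exp (- x) + poly p x * x / exp x) \<longlongrightarrow> 0) at_top"
  using tendsto_add by fastforce
 then show ?case by (rule Lim_transform_eventually) (auto simp: algebra_simps exp_minus divide_inverse)
qed auto

lemma flat_exp_tendsto: "(flat_exp p \<longlongrightarrow> 0) (at 0)"
proof (rule filterlim_split_at)
 show "(flat_exp p \<longlongrightarrow> 0) (at_left 0)"
  by (rule Lim_transform_eventually[OF tendsto_const])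
   (auto simp: eventually_at_filter flat_exp_def)
 have "((%x. poly p (inverse x) * exp (- inverse x)) \<longlongrightarrow> 0) (at_right (0::real))"
  by (rule filterlim_compose[OF poly_over_exp filterlim_inverse_at_top_right])
 then show "(flat_exp p \<longlongrightarrow> 0) (at_right 0)"
  by (rule Lim_transform_eventually)
   (auto simp: eventually_at_filter flat_exp_def divide_inverse)
qed

text \<open>In the variable \<open>y = 1 / x\<close> the derivative of \<open>p(y) exp (- y)\<close>
  picks up the factor \<open>dy/dx = - y^2\<close>, which is the polynomial \<open>[:0,0,1:]\<close>
  up to sign.\<close>

lemma flat_exp_deriv:
 "(flat_exp p has_real_derivative flat_exp ([:0,0,1:] * (p - pderiv p)) x) (at x)"
proof (cases "x = 0")
 case True
 \<comment> \<open>At 0 the difference quotient is again a member of the family, with one more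
   factor \<open>1 / h\<close>, so it tends to 0.\<close>
 have "((%h. flat_exp ([:0,1:] * p) h) \<longlongrightarrow> 0) (at 0)"
  by (rule flat_exp_tendsto)
 then have "((%h. (flat_exp p (0 + h) - flat_exp p 0) / h) \<longlongrightarrow> 0) (at 0)"
  by (rule Lim_transform_eventually) (auto simp: flat_exp_def eventually_at intro: exI[of _ 1])
 then show ?thesis by (simp add: DERIV_def True flat_exp_def)
next
 case False
 show ?thesis
 proof (cases "x > 0")
  case True
  have "((%x. poly p (1 / x) * exp (- 1 / x)) has_real_derivative
    (poly (pderiv p) (1/x) * (- 1 / x^2)) * exp (-1/x) + poly p (1/x) * (exp (-1/x) * (1 / x^2))) (at x)"
   using True by (auto intro!: derivative_eq_intros DERIV_chain2[OF poly_DERIV] simp: power2_eq_square)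
  then have "(flat_exp p has_real_derivative
    (poly (pderiv p) (1/x) * (- 1 / x^2)) * exp (-1/x) + poly p (1/x) * (exp (-1/x) * (1 / x^2))) (at x)"
   by (rule has_field_derivative_transform_within_open[where S="{0<..}"]) (auto simp: flat_exp_def True)
  moreover have "(poly (pderiv p) (1/x) * (- 1 / x^2)) * exp (-1/x) + poly p (1/x) * (exp (-1/x) * (1 / x^2))
   = flat_exp ([:0,0,1:] * (p - pderiv p)) x"
   using True by (simp add: flat_exp_def field_simps power2_eq_square)
  ultimately show ?thesis by simp
 next
  case f: False
  have "((%x::real. 0::real) has_real_derivative 0) (at x)" by simp
  then have "(flat_exp p has_real_derivative 0) (at x)"
   by (rule has_field_derivative_transform_within_open[where S="{..<0}"]) (use f False in \<open>auto simp: flat_exp_def\<close>)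
  then show ?thesis using f by (simp add: flat_exp_def)
 qed
qed

lemma C_k_flat_exp: "C_k k (flat_exp p)"
proof (induction k arbitrary: p)
 case 0
 have "continuous (at x) (flat_exp p)" for x
  using DERIV_isCont[OF flat_exp_deriv] by blast
 then show ?case by (simp add: continuous_at_imp_continuous_on)
next
 case (Suc k)
 show ?case
 proof (rule C_k_SucI)
  show "(flat_exp p has_derivative (%v. flat_exp ([:0,0,1:] * (p - pderiv p)) x * v)) (at x)" for x
   using flat_exp_deriv[of p x] by (simp add: has_field_derivative_def)
  show "C_k k (%x. flat_exp ([:0, 0, 1:] * (p - pderiv p)) x * v)" for v
   by (intro C_k_mult Suc C_k_const)
 qed
qed

definition smooth_step :: "real => real" where
 "smooth_step x = flat_exp 1 x * inverse (flat_exp 1 x + flat_exp 1 (1 - x))"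

text \<open>One of \<open>x\<close> and \<open>1 - x\<close> is positive, so the two flat functions
  never vanish together.\<close>

lemma smooth_step_denominator: "flat_exp 1 x + flat_exp 1 (1 - x) > 0"
 by (cases "x > 0") (auto simp: flat_exp_def add_pos_nonneg)

lemma C_k_smooth_step: "C_k k smooth_step"
proof -
 have "C_k k (%x. flat_exp 1 (1 - x))"
  using C_k_affine[OF C_k_flat_exp, of k 1 1 "-1"] by simp
 then have "C_k k (%x. flat_exp 1 x * inverse (flat_exp 1 x + flat_exp 1 (1 - x)))"
  by (intro C_k_mult C_k_flat_exp C_k_inverse C_k_add) (use smooth_step_denominator in \<open>auto simp: less_imp_neq[THEN not_sym]\<close>)
 then show ?thesis by (simp add: smooth_step_def[abs_def])
qed

lemma smooth_step_simps:
 "x <= 0 ==> smooth_step x = 0" "x \<ge> 1 ==> smooth_step x = 1"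
 "smooth_step x \<ge> 0" "smooth_step x <= 1" "x > 0 ==> smooth_step x > 0"
 using smooth_step_denominator[of x] by (auto simp: smooth_step_def flat_exp_def field_simps)

section \<open>Calculus of smooth functions and test functions\<close>

definition smooth :: "('a::euclidean_space => real) => bool" where
 "smooth ph \<longleftrightarrow> (\<forall>k. C_k k ph)"

named_theorems smooth_intros

lemma smooth_const[smooth_intros]: "smooth (%x. c)"
 and smooth_add[smooth_intros]: "smooth f ==> smooth g ==> smooth (%x. f x + g x)"
 and smooth_diff[smooth_intros]: "smooth f ==> smooth g ==> smooth (%x. f x - g x)"
 and smooth_uminus[smooth_intros]: "smooth f ==> smooth (%x. - f x)"
 and smooth_mult[smooth_intros]: "smooth f ==> smooth g ==> smooth (%x. f x * g x)"
 and smooth_sum[smooth_intros]: "(!!i. i \<in> I ==> smooth (F i)) ==> smooth (%x. \<Sum>i\<in>I. F i x)"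
 and smooth_prod[smooth_intros]: "(!!i. i \<in> I ==> smooth (F i)) ==> smooth (%x. \<Prod>i\<in>I. F i x)"
 and smooth_power[smooth_intros]: "smooth f ==> smooth (%x. f x ^ n)"
 and smooth_inner[smooth_intros]: "smooth (%x. x \<bullet> b)"
 and smooth_affine: "smooth f ==> smooth (%x. f (t + c *R x))"
 and smooth_dir_deriv[smooth_intros]: "smooth f ==> smooth (dir_deriv f v)"
 and smooth_smooth_step[smooth_intros]: "smooth f ==> smooth (%x. smooth_step (f x))"
 by (auto simp: smooth_def intro: C_k_const C_k_add C_k_diff C_k_uminus C_k_mult C_k_sum C_k_prod C_k_power
   C_k_inner C_k_affine C_k_comp C_k_smooth_step) (use C_k.simps(2) in blast)

lemma smooth_has_derivative: "smooth f ==> (f has_derivative (%v. dir_deriv f v x)) (at x)"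
 by (rule C_k_Suc_has_derivative) (auto simp: smooth_def)

lemma smooth_continuous_on: "smooth f ==> continuous_on S f"
 unfolding smooth_def using C_k.simps(1) continuous_on_subset by blast

lemma smooth_borel_measurable[measurable_dest]: "smooth f ==> f \<in> Borel"
 by (intro borel_measurable_continuous_onI smooth_continuous_on)

lemma dir_deriv_add: "smooth f ==> smooth g ==> dir_deriv (%x. f x + g x) v x = dir_deriv f v x + dir_deriv g v x"
 by (rule dir_deriv_eq[OF has_derivative_add[OF smooth_has_derivative smooth_has_derivative]])

lemma dir_deriv_cmult: "smooth f ==> dir_deriv (%x. c * f x) v x = c * dir_deriv f v x"
 by (rule dir_deriv_eq[OF has_derivative_mult_right[OF smooth_has_derivative]])

lemma linear_dir_deriv: "smooth f ==> linear (%v. dir_deriv f v x)"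
 using smooth_has_derivative has_derivative_linear by blast

lemma dir_deriv_gradient: "smooth f ==> dir_deriv f v x = gradient f x \<bullet> v"
proof -
 assume f: "smooth f"
 have "dir_deriv f v x = dir_deriv f (\<Sum>b\<in>Basis. (v \<bullet> b) *R b) x" by (simp add: euclidean_representation)
 also have "... = (\<Sum>b\<in>Basis. (v \<bullet> b) * dir_deriv f b x)"
  by (subst linear_sum[OF linear_dir_deriv[OF f, of x]]) (simp add: linear_cmul[OF linear_dir_deriv[OF f, of x]])
 finally show ?thesis by (simp add: gradient_def inner_sum_left mult.commute inner_commute[of v])
qed

text \<open>The squared distance is a polynomial, hence smooth, and
  \<open>(4 r^2 - d^2) / (3 r^2)\<close> is at least 1 for \<open>d <= r\<close> and at most 0 for
  \<open>d >= 2 r\<close>.\<close>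

lemma smooth_ball_bump:
 fixes x :: "'a::euclidean_space"
 assumes "r > 0"
 obtains \<zeta> where "smooth \<zeta>" "!!y. 0 <= \<zeta> y" "!!y. \<zeta> y <= 1" "!!y. y \<in> ball x r ==> \<zeta> y = 1"
  "!!y. y \<notin> ball x (2 * r) ==> \<zeta> y = 0"
proof
 define \<zeta> where "\<zeta> = (%y. smooth_step ((4 * r^2 - (\<Sum>b\<in>Basis. (y \<bullet> b - x \<bullet> b)^2)) * inverse (3 * r^2)))"
 have eq: "(\<Sum>b\<in>Basis. (y \<bullet> b - x \<bullet> b)^2) = (dist x y)^2" for y
  by (subst dist_commute, subst euclidean_dist_l2) (simp add: L2_set_def dist_norm sum_nonneg)
 show "smooth \<zeta>" unfolding \<zeta>_def by (intro smooth_intros)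
 show "0 <= \<zeta> y" "\<zeta> y <= 1" for y by (simp_all add: \<zeta>_def smooth_step_simps)
 show "\<zeta> y = 1" if "y \<in> ball x r" for y
 proof -
  have "(dist x y)^2 <= r^2" using that by (intro power_mono) auto
  then show ?thesis unfolding \<zeta>_def eq using assms by (intro smooth_step_simps) (simp add: field_simps)
 qed
 show "\<zeta> y = 0" if "y \<notin> ball x (2 * r)" for y
 proof -
  have "(2 * r)^2 <= (dist x y)^2" using that assms by (intro power_mono) auto
  then show ?thesis unfolding \<zeta>_def eq using assms
   by (intro smooth_step_simps mult_nonpos_nonneg) (auto simp: power_mult_distrib)
 qed
qed

text \<open>Any compact subset of the domain off which the function vanishes will do; naming one is
  easier than computing with the closure of the nonzero set.\<close>

lemma test_function_iff:
 "test_function Om ph \<longleftrightarrow> smooth ph \<and> (\<exists>K. compact K \<and> K <= Om \<and> (\<forall>x. x \<notin> K --> ph x = 0))"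
proof safe
 assume "test_function Om ph"
 then show "smooth ph" "\<exists>K. compact K \<and> K <= Om \<and> (\<forall>x. x \<notin> K --> ph x = 0)"
  by (auto simp: test_function_def smooth_def intro!: exI[of _ "closure {x. ph x \<noteq> 0}"] closure_subset[THEN subsetD])
next
 fix K assume K: "smooth ph" "compact K" "K <= Om" "\<forall>x. x \<notin> K --> ph x = 0"
 then have "closure {x. ph x \<noteq> 0} <= K"
  by (intro closure_minimal) (auto simp: compact_imp_closed)
 moreover from this have "compact (closure {x. ph x \<noteq> 0})"
  by (metis K(2) closed_closure compact_Int_closed inf.absorb_iff2)
 ultimately show "test_function Om ph" using K by (auto simp: test_function_def smooth_def)
qed

lemma test_functionI:
 "smooth ph ==> compact K ==> K <= Om ==> (!!x. x \<notin> K ==> ph x = 0) ==> test_function Om ph"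
 unfolding test_function_iff by blast

lemma test_function_smooth: "test_function Om ph ==> smooth ph"
 by (simp add: test_function_iff)

lemma test_function_mono: "test_function U ph ==> U <= V ==> test_function V ph"
 by (auto simp: test_function_def)

lemma test_function_outside: "test_function Om ph ==> x \<notin> Om ==> ph x = 0"
 unfolding test_function_iff by blast

lemma test_function_mult: "test_function Om ph ==> smooth f ==> test_function Om (%x. ph x * f x)"
 unfolding test_function_iff using smooth_mult[of ph f] by auto

lemma test_function_zero: "test_function Om (%x. 0)"
 by (rule test_functionI[of _ "{}"]) (auto simp: smooth_const)

lemma test_function_add:
 assumes "test_function Om ph" "test_function Om \<psi>"
 shows "test_function Om (%x. ph x + \<psi> x)"
proof -
 obtain K where K: "smooth ph" "compact K" "K <= Om" "\<forall>x. x \<notin> K --> ph x = 0"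
  using assms(1) unfolding test_function_iff by blast
 obtain L where L: "smooth \<psi>" "compact L" "L <= Om" "\<forall>x. x \<notin> L --> \<psi> x = 0"
  using assms(2) unfolding test_function_iff by blast
 show ?thesis
  using K L by (intro test_functionI[of _ "K \<union> L"] smooth_add) auto
qed

lemma test_function_cmult:
 assumes "test_function Om ph" shows "test_function Om (%x. c * ph x)"
 using test_function_mult[OF assms smooth_const[of c]] by (simp only: mult.commute)

lemma test_function_diff:
 assumes "test_function Om ph" "test_function Om \<psi>"
 shows "test_function Om (%x. ph x - \<psi> x)"
 using test_function_add[OF assms(1) test_function_cmult[OF assms(2), of "-1"]] by simp

lemma test_function_sum:
 assumes "!!i. i \<in> I ==> test_function Om (F i)"
 shows "test_function Om (%x. \<Sum>i\<in>I. F i x)"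
 using assms
proof (induction I rule: infinite_finite_induct)
 case (insert i I)
 have "test_function Om (%x. F i x + (\<Sum>i\<in>I. F i x))"
  by (rule test_function_add) (use insert in auto)
 then show ?case using insert by simp
qed (simp_all add: test_function_zero)

lemma dir_deriv_outside:
 assumes "closed K" "!!x. x \<notin> K ==> ph x = 0" "x \<notin> K"
 shows "dir_deriv ph v x = 0"
proof -
 have "((%x. 0::real) has_derivative (%v. 0)) (at x)" by simp
 then have "(ph has_derivative (%v. 0)) (at x)"
  by (rule has_derivative_transform_within_open[of _ _ _ _ "- K"]) (use assms in auto)
 then show ?thesis by (rule dir_deriv_eq)
qed

lemma test_function_dir_deriv:
 assumes "test_function Om ph" shows "test_function Om (dir_deriv ph v)"
proof -
 obtain K where K: "smooth ph" "compact K" "K <= Om" "\<forall>x. x \<notin> K --> ph x = 0"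
  using assms unfolding test_function_iff by blast
 show ?thesis
  by (rule test_functionI[OF smooth_dir_deriv[OF K(1)] K(2,3)])
   (rule dir_deriv_outside[OF compact_imp_closed[OF K(2)] K(4)[rule_format]])
qed

text \<open>Finitely many balls whose doubles stay in \<open>U\<close> cover \<open>K\<close>; one
  minus the product of the complementary bumps is 1 wherever one bump is 1. The open set
  \<open>V\<close> on which the value is 1 makes the integral positive when mollifiers are
  built.\<close>

lemma test_function_plateau:
 fixes K :: "'a::euclidean_space set"
 assumes "compact K" "open U" "K <= U"
 obtains \<zeta> V where "test_function U \<zeta>" "!!x. 0 <= \<zeta> x" "!!x. \<zeta> x <= 1" "open V" "K <= V" "!!x. x \<in> V ==> \<zeta> x = 1"
proof -
 have "\<exists>r>0. cball x (2 * r) <= U" if "x \<in> K" for x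
 proof -
  have "x \<in> U" using that assms(3) by auto
  then obtain e where "e > 0" "cball x e <= U" using assms(2) open_contains_cball[of U] by auto
  then show ?thesis by (intro exI[of _ "e/2"]) auto
 qed
 then obtain r where r: "!!x. x \<in> K ==> r x > 0" "!!x. x \<in> K ==> cball x (2 * r x) <= U" by metis
 obtain F where F: "F <= K" "finite F" "K <= (\<Union>x\<in>F. ball x (r x))"
  by (rule compactE_image[OF assms(1), of K "%x. ball x (r x)"]) (use r in auto)
 have "\<forall>x\<in>F. \<exists>\<zeta>. smooth \<zeta> \<and> (\<forall>y. 0 <= \<zeta> y \<and> \<zeta> y <= 1) \<and> (\<forall>y\<in>ball x (r x). \<zeta> y = 1) \<and> (\<forall>y. y \<notin> ball x (2 * r x) --> \<zeta> y = 0)"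
 proof
  fix x assume "x \<in> F"
  then have "r x > 0" using F r by auto
  from smooth_ball_bump[OF this, of x]
  show "\<exists>\<zeta>. smooth \<zeta> \<and> (\<forall>y. 0 <= \<zeta> y \<and> \<zeta> y <= 1) \<and> (\<forall>y\<in>ball x (r x). \<zeta> y = 1) \<and> (\<forall>y. y \<notin> ball x (2 * r x) --> \<zeta> y = 0)"
   by metis
 qed
 from bchoice[OF this] obtain c where c: "!!x. x \<in> F ==> smooth (c x)" "!!x y. x \<in> F ==> 0 <= c x y" "!!x y. x \<in> F ==> c x y <= 1"
  "!!x y. x \<in> F ==> y \<in> ball x (r x) ==> c x y = 1" "!!x y. x \<in> F ==> y \<notin> ball x (2 * r x) ==> c x y = 0"
  by blast
 define \<zeta> where "\<zeta> = (%y. 1 - (\<Prod>x\<in>F. 1 - c x y))"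
 show ?thesis
 proof (rule that[of \<zeta> "\<Union>x\<in>F. ball x (r x)"])
  show "test_function U \<zeta>"
  proof (rule test_functionI[of _ "\<Union>x\<in>F. cball x (2 * r x)"])
   show "smooth \<zeta>" unfolding \<zeta>_def by (intro smooth_intros c)
   show "compact (\<Union>x\<in>F. cball x (2 * r x))" using F by auto
   show "(\<Union>x\<in>F. cball x (2 * r x)) <= U" using F r by blast
   show "\<zeta> y = 0" if "y \<notin> (\<Union>x\<in>F. cball x (2 * r x))" for y
    unfolding \<zeta>_def using that c(5)[of _ y] ball_subset_cball by (fastforce intro: prod.neutral)
  qed
  show "0 <= \<zeta> x" "\<zeta> x <= 1" for x
   unfolding \<zeta>_def using c by (auto intro!: prod_le_1 prod_nonneg)
  show "\<zeta> y = 1" if "y \<in> (\<Union>x\<in>F. ball x (r x))" for y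
   unfolding \<zeta>_def using that c(4) F(2) by (force simp: prod_zero_iff)
 qed (use F in auto)
qed

lemma test_function_integrable:
 fixes ph :: "'a::euclidean_space => real"
 assumes "test_function U ph"
 shows "L1 ph"
proof -
 obtain K where K: "smooth ph" "compact K" "K <= U" "\<forall>x. x \<notin> K --> ph x = 0"
  using assms unfolding test_function_iff by blast
 then have "L1 (%x. ind K x *R ph x)"
  by (intro borel_integrable_compact) (auto intro!: smooth_continuous_on)
 moreover have "(%x. ind K x *R ph x) = ph" using K(4) by (auto simp: indicator_def fun_eq_iff)
 ultimately show ?thesis by simp
qed

lemma test_function_bounded:
 assumes "test_function U ph"
 obtains B where "B > 0" "!!x. \<bar>ph x\<bar> <= B"
proof -
 obtain K where K: "smooth ph" "compact K" "K <= U" "\<forall>x. x \<notin> K --> ph x = 0"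
  using assms unfolding test_function_iff by blast
 have "bounded (ph ` K)"
  using K by (intro compact_imp_bounded compact_continuous_image smooth_continuous_on)
 then obtain B where "B > 0" "!!x. x \<in> K ==> \<bar>ph x\<bar> <= B"
  by (auto simp: bounded_pos)
 then show ?thesis using that K(4) by (metis abs_zero less_imp_le)
qed

section \<open>Comparison inequalities in CAT(\<kappa>) spaces\<close>

text \<open>The Wronskians of \<open>F\<close> with the solutions \<open>sin t\<close> and
  \<open>sin (l - t)\<close> of \<open>y'' + y = 0\<close> are monotone, because their derivatives
  are \<open>F'' + F\<close> times a nonnegative sine. Evaluated at \<open>s\<close> they bound
  \<open>F\<close> at the two ends, and the combination with weights \<open>sin (l - s)\<close> and
  \<open>sin s\<close> eliminates the derivative of \<open>F\<close> at \<open>s\<close>.\<close>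

lemma sturm_comparison:
 fixes F F1 F2 :: "real => real"
 assumes "0 <= s" "s <= l" "l <= pi"
  and F1: "!!t. 0 <= t ==> t <= l ==> (F has_real_derivative F1 t) (at t)"
  and F2: "!!t. 0 <= t ==> t <= l ==> (F1 has_real_derivative F2 t) (at t)"
  and le: "!!t. 0 <= t ==> t <= l ==> F2 t + F t <= 0"
 shows "F 0 * sin (l - s) + F l * sin s <= F s * sin l"
proof -
 define A where "A = (%t. F1 t * sin t - F t * cos t)"
 define B where "B = (%t. F1 t * sin (l - t) + F t * cos (l - t))"
 have "A s <= A 0"
 proof (rule DERIV_nonpos_imp_nonincreasing[OF assms(1)])
  fix t assume t: "0 <= t" "t <= s"
  have "(A has_real_derivative (F2 t + F t) * sin t) (at t)"
   unfolding A_def using t assms by (auto intro!: derivative_eq_intros F1 F2 simp: algebra_simps)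
  moreover have "(F2 t + F t) * sin t <= 0"
   using t assms by (intro mult_nonpos_nonneg le sin_ge_zero) auto
  ultimately show "\<exists>y. (A has_real_derivative y) (at t) \<and> y <= 0" by blast
 qed
 then have 1: "F1 s * sin s - F s * cos s <= - F 0" by (simp add: A_def)
 have "B l <= B s"
 proof (rule DERIV_nonpos_imp_nonincreasing[OF assms(2)])
  fix t assume t: "s <= t" "t <= l"
  have "(B has_real_derivative (F2 t + F t) * sin (l - t)) (at t)"
   unfolding B_def using t assms by (auto intro!: derivative_eq_intros F1 F2 simp: algebra_simps)
  moreover have "(F2 t + F t) * sin (l - t) <= 0"
   using t assms by (intro mult_nonpos_nonneg le sin_ge_zero) auto
  ultimately show "\<exists>y. (B has_real_derivative y) (at t) \<and> y <= 0" by blast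
 qed
 then have 2: "F l <= F1 s * sin (l - s) + F s * cos (l - s)" by (simp add: B_def)
 have s: "sin s \<ge> 0" "sin (l - s) \<ge> 0" using assms by (auto intro!: sin_ge_zero)
 have "F 0 * sin (l - s) + F l * sin s \<le>
   (F s * cos s - F1 s * sin s) * sin (l - s) + (F1 s * sin (l - s) + F s * cos (l - s)) * sin s"
  using 1 2 s by (intro add_mono mult_right_mono) auto
 also have "... = F s * (sin s * cos (l - s) + cos s * sin (l - s))" by (simp add: algebra_simps)
 also have "sin s * cos (l - s) + cos s * sin (l - s) = sin l" by (simp flip: sin_add)
 finally show ?thesis .
qed

text \<open>Meant for the distance \<open>e\<close> from a fixed point to the points of a unit speed
  geodesic in the Euclidean or hyperbolic plane. There \<open>e'' = (1 - e'^2) ct\<close> with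
  \<open>ct\<close> equal to \<open>1 / e\<close> or \<open>coth e\<close>; since \<open>ct\<close>
  dominates the cotangent of \<open>e\<close>, the sum of \<open>cos e\<close> and its second
  derivative is at most 0, whereas it vanishes on the sphere.\<close>

lemma sturm_cos:
 fixes e e1 ct :: "real => real"
 assumes "0 <= s" "s <= l" "l <= pi"
  and e1: "!!t. 0 <= t ==> t <= l ==> (e has_real_derivative e1 t) (at t)"
  and e2: "!!t. 0 <= t ==> t <= l ==> (e1 has_real_derivative (1 - (e1 t)^2) * ct t) (at t)"
  and le1: "!!t. 0 <= t ==> t <= l ==> (e1 t)^2 <= 1"
  and ct: "!!t. 0 <= t ==> t <= l ==> cos (e t) <= ct t * sin (e t)"
 shows "cos (e 0) * sin (l - s) + cos (e l) * sin s <= cos (e s) * sin l"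
proof (rule sturm_comparison[OF assms(1-3), of "%t. cos (e t)" "%t. - sin (e t) * e1 t"
   "%t. - cos (e t) * (e1 t)^2 - sin (e t) * ((1 - (e1 t)^2) * ct t)"])
 fix t assume t: "0 <= t" "t <= l"
 show "((%t. cos (e t)) has_real_derivative - sin (e t) * e1 t) (at t)"
  using e1[OF t] by (auto intro!: derivative_eq_intros)
 show "((%t. - sin (e t) * e1 t) has_real_derivative - cos (e t) * (e1 t)^2 - sin (e t) * ((1 - (e1 t)^2) * ct t)) (at t)"
  using e1[OF t] e2[OF t] by (auto intro!: derivative_eq_intros simp: power2_eq_square algebra_simps)
 have "(1 - (e1 t)^2) * (cos (e t) - ct t * sin (e t)) <= 0"
  using le1[OF t] ct[OF t] by (intro mult_nonneg_nonpos) auto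
 then show "- cos (e t) * (e1 t)^2 - sin (e t) * ((1 - (e1 t)^2) * ct t) + cos (e t) <= 0"
  by (simp add: algebra_simps)
qed

text \<open>This is \<open>cot e <= 1 / e\<close>, the condition on \<open>ct\<close> in the
  Euclidean plane.\<close>

lemma mult_cos_le_sin:
 fixes e :: real assumes "0 <= e" "e <= pi" shows "e * cos e <= sin e"
proof -
 have "sin 0 - 0 * cos 0 <= sin e - e * cos e"
 proof (rule DERIV_nonneg_imp_nondecreasing[OF assms(1)])
  fix x assume "0 <= x" "x <= e"
  then have "x * sin x \<ge> 0" using assms by (intro mult_nonneg_nonneg sin_ge_zero) auto
  moreover have "((%e. sin e - e * cos e) has_real_derivative x * sin x) (at x)"
   by (auto intro!: derivative_eq_intros)
  ultimately show "\<exists>y. ((%e. sin e - e * cos e) has_real_derivative y) (at x) \<and> 0 <= y" by blast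
 qed
 then show ?thesis by simp
qed

text \<open>This is \<open>cot e <= coth e\<close>, the condition on \<open>ct\<close> in the
  hyperbolic plane.\<close>

lemma cos_sinh_le_sin_cosh:
 fixes e :: real assumes "0 <= e" "e <= pi" shows "cos e * sinh e <= sin e * cosh e"
proof -
 have "sin 0 * cosh 0 - cos 0 * sinh 0 <= sin e * cosh e - cos e * sinh e"
 proof (rule DERIV_nonneg_imp_nondecreasing[OF assms(1)])
  fix x assume "0 <= x" "x <= e"
  then have "2 * (sin x * sinh x) \<ge> 0" using assms by (intro mult_nonneg_nonneg sin_ge_zero) auto
  moreover have "((%e. sin e * cosh e - cos e * sinh e) has_real_derivative 2 * (sin x * sinh x)) (at x)"
   by (auto intro!: derivative_eq_intros simp: algebra_simps)
  ultimately show "\<exists>y. ((%e. sin e * cosh e - cos e * sinh e) has_real_derivative y) (at x) \<and> 0 <= y" by blast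
 qed
 then show ?thesis by simp
qed

definition vec2 :: "real => real => real^2" where
 "vec2 a b = a *R axis 1 1 + b *R axis 2 1"

lemma inner_vec2 [simp]: "vec2 a b \<bullet> vec2 c d = a * c + b * d"
 by (simp add: vec2_def inner_add_left inner_add_right inner_axis_axis)

lemma vec2_diff: "vec2 a b - vec2 c d = vec2 (a - c) (b - d)"
 by (simp add: vec2_def algebra_simps)

lemma dist_vec2: "dist (vec2 a b) (vec2 c d) = sqrt ((a - c)^2 + (b - d)^2)"
 by (simp add: dist_norm vec2_diff norm_eq_sqrt_inner power2_eq_square)

text \<open>Comparison between a vertex and the opposite side: the second comparison point is taken
  at the far end of the geodesic from \<open>p\<close> to \<open>x\<close>, so that it is
  \<open>r'\<close> itself.\<close>

lemma CAT_comparison_vertex: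
 fixes x p q :: "'x::metric_space"
 assumes CAT: "CAT_space \<kappa> TYPE('x)"
  and c: "geodesic_from_to c p q" and s: "0 <= s" "s <= dist p q"
  and small: "ereal (dist p x) < model_diam \<kappa>" "ereal (dist p q + dist q x + dist x p) < 2 * model_diam \<kappa>"
  and model: "p' \<in> model_plane \<kappa>" "q' \<in> model_plane \<kappa>" "r' \<in> model_plane \<kappa>" "x' \<in> model_plane \<kappa>"
   "model_dist \<kappa> p' q' = dist p q" "model_dist \<kappa> q' r' = dist q x" "model_dist \<kappa> r' p' = dist x p"
   "model_dist \<kappa> p' x' = s" "model_dist \<kappa> x' q' = dist p q - s"
   "model_dist \<kappa> p' r' = dist p x" "model_dist \<kappa> r' r' = 0"
 shows "dist x (c s) <= model_dist \<kappa> x' r'"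
proof -
 obtain b where b: "geodesic_from_to b p x" using CAT small(1) unfolding CAT_space_def by blast
 have "dist (c s) (b (dist p x)) <= model_dist \<kappa> x' r'"
  using CAT unfolding CAT_space_def
  by (elim conjE) (drule spec[of _ p], drule spec[of _ q], drule spec[of _ x], drule spec[of _ c], drule spec[of _ b],
    use c b s small model in auto)
 then show ?thesis using b by (simp add: geodesic_from_to_def dist_commute)
qed

text \<open>The comparison angle at \<open>p\<close> exists: the Gram determinant of three unit vectors with
 mutual angles \<open>A, B, C\<close> satisfying the triangle inequalities is nonnegative.\<close>

lemma spherical_gram:
 fixes A B C :: real
 assumes "0 <= A" "0 <= B" "\<bar>A - B\<bar> <= C" "C <= A + B" "A + B <= pi"
 shows "(cos C - cos B * cos A)^2 <= (sin A * sin B)^2"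
proof -
 have "cos (A + B) <= cos C" using assms by (intro cos_monotone_0_pi_le) auto
 moreover have "cos C <= cos \<bar>A - B\<bar>" using assms by (intro cos_monotone_0_pi_le) auto
 ultimately have "\<bar>cos C - cos B * cos A\<bar> <= sin A * sin B"
  by (simp add: cos_add cos_diff abs_le_iff mult.commute)
 then show ?thesis by (metis abs_ge_zero order_trans power2_abs power_mono)
qed

text \<open>The same bound for hyperbolic cosines: it places the third vertex on the hyperboloid at
  prescribed distances from the other two.\<close>

lemma hyperbolic_gram:
 fixes A B C :: real
 assumes "\<bar>A - B\<bar> <= C" "C <= A + B"
 shows "\<bar>cosh B * cosh A - cosh C\<bar> <= sinh A * sinh B"
proof -
 have "cosh C <= cosh (A + B)" using assms by (subst cosh_real_nonneg_le_iff) auto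
 moreover have "cosh \<bar>A - B\<bar> <= cosh C" using assms by (subst cosh_real_nonneg_le_iff) auto
 ultimately show ?thesis by (simp add: cosh_add cosh_diff abs_le_iff mult.commute)
qed

text \<open>Stewart's inequality on the sphere of curvature \<open>k^2\<close>, for triangles near a point. It holds with
\<open>k^2 = \<bar>\<kappa>\<bar>\<close>, or \<open>k = 1\<close> in the flat case, as flat and hyperbolic triangles are thinner than spherical ones.\<close>

definition stewart :: "real => real => 'x::metric_space itself => bool" where
 "stewart k \<rho> T \<longleftrightarrow> k > 0 \<and> \<rho> > 0 \<and> 4 * (k * \<rho>) <= 1 \<and>
   (\<forall>x y::'x. dist x y < 2 * \<rho> --> (\<exists>c. geodesic_from_to c x y)) \<and>
   (\<forall>(x::'x) p q c s. geodesic_from_to c p q --> dist x p < \<rho> --> dist x q < \<rho> --> 0 <= s --> s <= dist p q -->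
    sin (k * (dist p q - s)) * cos (k * dist x p) + sin (k * s) * cos (k * dist x q)
     <= sin (k * dist p q) * cos (k * dist x (c s)))"

text \<open>On the sphere Stewart's relation is an identity, since along a great circle the cosine
  of the distance from a fixed point has the form \<open>X sin th + Z cos th\<close>. The comparison
  triangle has \<open>p'\<close> at the pole and \<open>q'\<close> at angle \<open>A\<close> on the
  meridian of the first axis; only the passage from \<open>x\<close> to \<open>r'\<close> is an
  inequality.\<close>

lemma stewart_inequality_pos:
 fixes x p q :: "'x::metric_space"
 assumes CAT: "CAT_space \<kappa> TYPE('x)" and \<kappa>: "\<kappa> > 0" and k: "k = sqrt \<kappa>"
  and c: "geodesic_from_to c p q" and s: "0 <= s" "s <= dist p q"
  and small: "4 * (k * dist x p) < 1" "4 * (k * dist x q) < 1" and pos: "0 < dist p q" "x \<noteq> p"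
 shows "sin (k * (dist p q - s)) * cos (k * dist x p) + sin (k * s) * cos (k * dist x q)
     <= sin (k * dist p q) * cos (k * dist x (c s))"
proof -
 have k0: "k > 0" using \<kappa> k by simp
 define A where "A = k * dist p q"
 define B where "B = k * dist x p"
 define C where "C = k * dist x q"
 define th where "th = k * s"
 have tri: "A <= B + C" "B <= A + C" "C <= A + B"
  unfolding A_def B_def C_def distrib_left[symmetric] using k0
  by (auto intro!: mult_left_mono dist_triangle3 dist_triangle2 dist_triangle simp: dist_commute add.commute[of "dist p q"])
    (metis dist_commute dist_triangle)+
 have rng: "0 < A" "0 <= B" "0 <= C" "B < 1/4" "C < 1/4" "0 <= th" "th <= A"
  using small s pos k0 by (auto simp: A_def B_def C_def th_def)
 have pi: "pi > 3" by (rule pi_gt3)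
 have sA: "sin A > 0" using rng tri pi by (intro sin_gt_zero) auto
 \<comment> \<open>\<open>Z = cos B\<close> puts \<open>r'\<close> at angle \<open>B\<close> from
   the pole \<open>p'\<close>, and \<open>X\<close> solves \<open>sin A X + cos A Z = cos C\<close>,
   the condition on its angle from \<open>q'\<close>. The Gram bound makes room for
   \<open>Y\<close>.\<close>
 define X where "X = (cos C - cos B * cos A) / sin A"
 define Z where "Z = cos B"
 have X2: "X^2 <= (sin B)^2"
 proof -
  have "(cos C - cos B * cos A)^2 <= (sin A * sin B)^2"
   using rng tri pi by (intro spherical_gram) auto
  then show ?thesis using sA by (simp add: X_def power_divide power_mult_distrib divide_le_eq mult.commute)
 qed
 then have Y0: "1 - X^2 - Z^2 \<ge> 0" by (simp add: Z_def cos_squared_eq)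
 define Y where "Y = sqrt (1 - X^2 - Z^2)"
 have Y2: "Y^2 = 1 - X^2 - Z^2" unfolding Y_def using Y0 by simp
 \<comment> \<open>Cauchy-Schwarz, written as a sum of two squares; it puts the argument of the arc
   cosine into its range.\<close>
 have dot: "\<bar>X * sin th + Z * cos th\<bar> <= 1"
 proof -
  have "(X * sin th + Z * cos th)^2 + (X * cos th - Z * sin th)^2 = (X^2 + Z^2) * ((sin th)^2 + (cos th)^2)"
   by (simp only: power2_eq_square) (simp only: algebra_simps)
  then have *: "(X * sin th + Z * cos th)^2 + (X * cos th - Z * sin th)^2 = X^2 + Z^2"
   by simp
  have "(X * sin th + Z * cos th)^2 <= X^2 + Z^2"
   unfolding *[symmetric] by simp
  also have "... <= 1^2" using Y0 by simp
  finally have "(X * sin th + Z * cos th)^2 <= 1^2" .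
  then show ?thesis by (simp only: abs_le_square_iff[symmetric] abs_one)
 qed
 have "dist x (c s) <= model_dist \<kappa> (vec2 (sin th) 0, cos th) (vec2 X Y, Z)"
 proof (rule CAT_comparison_vertex[OF CAT c s, where p'="(vec2 0 0, 1)" and q'="(vec2 (sin A) 0, cos A)"])
  have "dist p x * k < pi" using rng pi by (auto simp: B_def dist_commute mult.commute)
  then show "ereal (dist p x) < model_diam \<kappa>"
   using \<kappa> k k0 by (simp add: model_diam_def pos_less_divide_eq)
  have "A + C + B < 2 * pi" using rng tri pi by linarith
  then have "k * (dist p q + dist q x + dist x p) < 2 * pi"
   by (simp add: A_def B_def C_def dist_commute algebra_simps)
  then have "dist p q + dist q x + dist x p < 2 * pi / k" using k0 by (metis mult.commute pos_less_divide_eq)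
  then show "ereal (dist p q + dist q x + dist x p) < 2 * model_diam \<kappa>"
   using \<kappa> k by (simp add: model_diam_def numeral_eq_ereal)
  show "(vec2 0 0, 1) \<in> model_plane \<kappa>" "(vec2 (sin A) 0, cos A) \<in> model_plane \<kappa>"
   "(vec2 X Y, Z) \<in> model_plane \<kappa>" "(vec2 (sin th) 0, cos th) \<in> model_plane \<kappa>"
   using \<kappa> Y2 by (auto simp: model_plane_def power2_eq_square[symmetric])
  have *: "arccos (cos A) = A" "arccos (cos th) = th" "arccos (cos (th - A)) = A - th" "arccos (cos B) = B" "arccos (cos C) = C"
   using rng tri pi arccos_cos[of "A - th"] cos_minus[of "A - th"] by (auto intro!: arccos_cos)
  show "model_dist \<kappa> (vec2 0 0, 1) (vec2 (sin A) 0, cos A) = dist p q"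
   "model_dist \<kappa> (vec2 0 0, 1) (vec2 (sin th) 0, cos th) = s"
   using \<kappa> k k0 * by (auto simp: model_dist_def A_def th_def)
  show "model_dist \<kappa> (vec2 (sin th) 0, cos th) (vec2 (sin A) 0, cos A) = dist p q - s"
   using \<kappa> k k0 *(3) by (simp add: model_dist_def cos_diff add.commute) (simp add: A_def th_def field_simps)
  have "sin A * X + cos A * Z = cos C" using sA by (simp add: X_def Z_def)
  then show "model_dist \<kappa> (vec2 (sin A) 0, cos A) (vec2 X Y, Z) = dist q x"
   using \<kappa> k k0 * by (simp add: model_dist_def C_def dist_commute)
  show "model_dist \<kappa> (vec2 X Y, Z) (vec2 0 0, 1) = dist x p" "model_dist \<kappa> (vec2 0 0, 1) (vec2 X Y, Z) = dist p x"
   using \<kappa> k k0 * by (simp_all add: model_dist_def Z_def B_def dist_commute)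
  show "model_dist \<kappa> (vec2 X Y, Z) (vec2 X Y, Z) = 0"
   using \<kappa> Y2 by (simp add: model_dist_def flip: power2_eq_square)
 qed
 then have "k * dist x (c s) <= arccos (X * sin th + Z * cos th)"
  using \<kappa> k k0 by (simp add: model_dist_def pos_le_divide_eq mult.commute)
 then have "cos (arccos (X * sin th + Z * cos th)) <= cos (k * dist x (c s))"
  using dot k0 by (intro cos_monotone_0_pi_le arccos_ubound) (auto simp: abs_le_iff)
 then have "sin A * (X * sin th + Z * cos th) <= sin A * cos (k * dist x (c s))"
  using dot sA by (intro mult_left_mono) auto
 moreover have "sin A * (X * sin th + Z * cos th) = sin (A - th) * cos B + sin th * cos C"
  using sA by (simp add: X_def Z_def sin_diff field_simps)
 ultimately show ?thesis by (simp add: A_def B_def C_def th_def algebra_simps)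
qed

text \<open>In the plane Stewart's relation holds for squares of distances, not for cosines, so the
  spherical form comes from \<open>sturm_cos\<close> applied to the planar distance \<open>e\<close>
  from the third vertex to the points of the side.\<close>

lemma stewart_inequality_zero:
 fixes x p q :: "'x::metric_space"
 assumes CAT: "CAT_space 0 TYPE('x)"
  and c: "geodesic_from_to c p q" and s: "0 <= s" "s <= dist p q"
  and small: "4 * dist x p < 1" "4 * dist x q < 1" and pos: "0 < dist p q" "x \<noteq> p"
 shows "sin (dist p q - s) * cos (dist x p) + sin s * cos (dist x q)
     <= sin (dist p q) * cos (dist x (c s))"
proof -
 define A where "A = dist p q"
 define B where "B = dist x p"
 define C where "C = dist x q"
 have tri: "A <= B + C" "B <= A + C" "C <= A + B"
  unfolding A_def B_def C_def by (metis dist_commute dist_triangle add.commute)+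
 have rng: "0 < A" "0 <= B" "0 <= C" "B < 1/4" "C < 1/4" "s <= A"
  using small s pos by (auto simp: A_def B_def C_def)
 have pi: "pi > 3" by (rule pi_gt3)
 \<comment> \<open>Law of cosines: \<open>X\<close> is the position on the line \<open>p' q'\<close>
   of the foot of the perpendicular from \<open>r'\<close>, and \<open>Y\<close> is the
   height.\<close>
 define X where "X = (B^2 + A^2 - C^2) / (2 * A)"
 have XB: "\<bar>X\<bar> <= B"
 proof -
  have "(A - B)^2 <= C^2" using tri rng by (intro abs_le_square_iff[THEN iffD1]) auto
  moreover have "C^2 <= (A + B)^2" using tri rng by (intro power_mono) auto
  ultimately have "\<bar>B^2 + A^2 - C^2\<bar> <= B * (2 * A)"
   by (simp add: power2_eq_square algebra_simps abs_le_iff)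
  then show ?thesis unfolding X_def using rng by (simp add: abs_mult pos_divide_le_eq)
 qed
 then have Y0: "0 <= B^2 - X^2" using rng by (simp add: abs_le_square_iff[symmetric])
 define Y where "Y = sqrt (B^2 - X^2)"
 have Y2: "Y^2 = B^2 - X^2" unfolding Y_def using Y0 by simp
 define e where "e = (%t. sqrt ((t - X)^2 + Y^2))"
 have e0: "e 0 = B" using rng by (simp add: e_def Y2)
 have eA: "e A = C"
 proof -
  have "(A - X)^2 + Y^2 = C^2" using rng unfolding Y2 by (simp add: X_def power2_diff)
  then show ?thesis using rng by (simp add: e_def)
 qed
 have em: "e t <= pi" if "0 <= t" "t <= A" for t
 proof -
  have "(t - X)^2 + Y^2 <= (t + B)^2"
   using XB that mult_left_mono[of "- X" B "2 * t"] unfolding Y2 by (auto simp: power2_eq_square algebra_simps abs_le_iff)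
  then have "e t <= t + B" unfolding e_def using that rng by (intro real_le_lsqrt) auto
  then show ?thesis using that rng tri pi by linarith
 qed
 have main: "dist x (c s) <= e s"
 proof -
  have "dist x (c s) <= model_dist 0 (vec2 s 0, 0) (vec2 X Y, 0)"
  proof (rule CAT_comparison_vertex[OF CAT c s, where p'="(vec2 0 0, 0)" and q'="(vec2 A 0, 0)"])
   show "model_dist 0 (vec2 A 0, 0) (vec2 X Y, 0) = dist q x"
    using eA by (simp add: model_dist_def dist_vec2 e_def C_def dist_commute)
   show "model_dist 0 (vec2 X Y, 0) (vec2 0 0, 0) = dist x p"
    using e0 by (simp add: model_dist_def dist_vec2 e_def B_def dist_commute)
   show "model_dist 0 (vec2 0 0, 0) (vec2 X Y, 0) = dist p x"
    using e0 by (simp add: model_dist_def dist_vec2 e_def B_def dist_commute)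
  qed (use rng s in \<open>auto simp: model_diam_def model_plane_def model_dist_def dist_vec2 A_def real_sqrt_abs\<close>)
  then show ?thesis by (simp add: model_dist_def dist_vec2 e_def)
 qed
 \<comment> \<open>For height 0 the distance is \<open>|t - X|\<close>, which is not differentiable
   at the foot, but its cosine is \<open>cos (t - X)\<close> and equality holds by the addition
   formulas.\<close>
 have S: "cos (e 0) * sin (A - s) + cos (e A) * sin s <= cos (e s) * sin A"
 proof (cases "Y = 0")
  case True
  have "cos (e t) = cos (t - X)" for t by (simp add: e_def True)
  then have "cos (e 0) * sin (A - s) + cos (e A) * sin s = cos (e s) * sin A"
   by (simp add: cos_diff sin_diff algebra_simps)
  then show ?thesis by simp
 next
  case False
  then have q: "(t - X)^2 + Y^2 > 0" for t by (simp add: sum_power2_gt_zero_iff)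
  then have ep: "e t > 0" for t by (simp add: e_def)
  have esq: "(e t)^2 = (t - X)^2 + Y^2" for t using q[of t] by (simp add: e_def)
  show ?thesis
  proof (rule sturm_cos[where ?e1.0="%t. (t - X) / e t" and ct="%t. 1 / e t"])
   show "A <= pi" using rng tri pi by linarith
   fix t assume t: "0 <= t" "t <= A"
   have d: "(e has_real_derivative (t - X) / e t) (at t)"
    unfolding e_def using q[of t] by (auto intro!: derivative_eq_intros simp: divide_simps)
   then show "(e has_real_derivative (t - X) / e t) (at t)" .
   show "((%t. (t - X) / e t) has_real_derivative (1 - ((t - X) / e t)^2) * (1 / e t)) (at t)"
    using ep[of t] by (auto intro!: derivative_eq_intros d simp: field_simps power2_eq_square)
   show "((t - X) / e t)^2 <= 1" using q[of t] by (simp add: power_divide esq divide_le_eq_1)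
   show "cos (e t) <= 1 / e t * sin (e t)"
    using mult_cos_le_sin[of "e t"] ep[of t] em[OF t] by (simp add: field_simps)
  qed (use s rng in auto)
 qed
 have "sin A > 0" using rng tri pi by (intro sin_gt_zero) auto
 moreover have "cos (e s) <= cos (dist x (c s))"
  using main em[of s] s rng by (intro cos_monotone_0_pi_le) auto
 ultimately have "sin A * cos (e s) <= sin A * cos (dist x (c s))" by (intro mult_left_mono) auto
 then show ?thesis using S unfolding e0 eA by (simp add: A_def B_def C_def algebra_simps)
qed

text \<open>As in the flat case, with \<open>h = cosh e\<close> for the hyperbolic distance
  \<open>e\<close> to the third vertex. Here \<open>e' = h' / sinh e\<close> and
  \<open>e'' = (1 - e'^2) coth e\<close>, so that \<open>sturm_cos\<close> applies.\<close>

lemma stewart_inequality_neg: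
 fixes x p q :: "'x::metric_space"
 assumes CAT: "CAT_space \<kappa> TYPE('x)" and \<kappa>: "\<kappa> < 0" and k: "k = sqrt (- \<kappa>)"
  and c: "geodesic_from_to c p q" and s: "0 <= s" "s <= dist p q"
  and small: "4 * (k * dist x p) < 1" "4 * (k * dist x q) < 1" and pos: "0 < dist p q" "x \<noteq> p"
 shows "sin (k * (dist p q - s)) * cos (k * dist x p) + sin (k * s) * cos (k * dist x q)
     <= sin (k * dist p q) * cos (k * dist x (c s))"
proof -
 have k0: "k > 0" using \<kappa> k by simp
 define A where "A = k * dist p q"
 define B where "B = k * dist x p"
 define C where "C = k * dist x q"
 define th where "th = k * s"
 have tri: "A <= B + C" "B <= A + C" "C <= A + B"
  unfolding A_def B_def C_def distrib_left[symmetric] using k0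
  by (auto intro!: mult_left_mono dist_triangle3 dist_triangle2 dist_triangle simp: dist_commute add.commute[of "dist p q"])
    (metis dist_commute dist_triangle)+
 have rng: "0 < A" "0 <= B" "0 <= C" "B < 1/4" "C < 1/4" "0 <= th" "th <= A"
  using small s pos k0 by (auto simp: A_def B_def C_def th_def)
 have pi: "pi > 3" by (rule pi_gt3)
 have sA: "sinh A > 0" using rng by simp
 define Z where "Z = cosh B"
 define X where "X = (cosh B * cosh A - cosh C) / sinh A"
 have XB: "\<bar>X\<bar> <= sinh B"
 proof -
  have "\<bar>cosh B * cosh A - cosh C\<bar> <= sinh A * sinh B" using tri rng by (intro hyperbolic_gram) auto
  then have "\<bar>cosh B * cosh A - cosh C\<bar> / sinh A <= sinh B" using sA by (simp add: pos_divide_le_eq mult.commute)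
  then show ?thesis using sA by (simp add: X_def abs_divide)
 qed
 have sB: "sinh B \<ge> 0" using rng by simp
 have "X^2 <= (sinh B)^2" using XB sB by (simp add: abs_le_square_iff[symmetric])
 then have Y0: "Z^2 - X^2 - 1 \<ge> 0" by (simp add: Z_def cosh_square_eq)
 define Y where "Y = sqrt (Z^2 - X^2 - 1)"
 have Y2: "Y^2 = Z^2 - X^2 - 1" unfolding Y_def using Y0 by simp
 have Z1: "Z \<ge> 1" by (simp add: Z_def cosh_real_ge_1)
 \<comment> \<open>Minus the Lorentz product of \<open>r'\<close> with the point at parameter
   \<open>t\<close> of the side \<open>p' q'\<close>, that is the hyperbolic cosine of their
   distance; \<open>h1\<close> is its derivative, and \<open>h^2 - h1^2\<close> is constant.\<close>
 define h where "h = (%t. Z * cosh t - X * sinh t)"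
 define h1 where "h1 = (%t. Z * sinh t - X * cosh t)"
 have hh1: "(h t)^2 - (h1 t)^2 = 1 + Y^2" for t
 proof -
  have "(h t)^2 - (h1 t)^2 = (Z^2 - X^2) * ((cosh t)^2 - (sinh t)^2)"
   by (simp add: h_def h1_def power2_eq_square algebra_simps)
  then show ?thesis unfolding Y2 cosh_square_eq by simp
 qed
 have hpos: "h t > 0" for t
 proof -
  have XZ: "\<bar>X\<bar> < Z" using XB sinh_less_cosh_real[of B] by (simp add: Z_def)
  have "\<bar>sinh t\<bar> <= cosh t"
   using sinh_less_cosh_real[of t] sinh_less_cosh_real[of "- t"] by simp
  then have "\<bar>X\<bar> * \<bar>sinh t\<bar> <= \<bar>X\<bar> * cosh t" by (intro mult_left_mono) auto
  moreover have "\<bar>X\<bar> * cosh t < Z * cosh t"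
   using XZ by (intro mult_strict_right_mono) auto
  ultimately have "\<bar>X * sinh t\<bar> < Z * cosh t" unfolding abs_mult by linarith
  then show ?thesis by (simp add: h_def)
 qed
 have h_ge1: "h t \<ge> 1" for t
 proof (rule power2_le_imp_le)
  show "1^2 <= (h t)^2" unfolding one_power2 using hh1[of t] zero_le_power2[of Y] zero_le_power2[of "h1 t"] by linarith
 qed (use hpos[of t] in simp)
 define e where "e = (%t. arcosh (h t))"
 have ce: "cosh (e t) = h t" "e t \<ge> 0" for t
  using h_ge1[of t] by (auto simp: e_def arcosh_nonneg_real)
 have e0: "e 0 = B" using rng by (simp add: e_def h_def Z_def arcosh_cosh_real)
 have hA: "h A = cosh C"
 proof -
  have "h A = Z * cosh A - (cosh B * cosh A - cosh C)" using sA by (simp add: h_def X_def)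
  then show ?thesis by (simp add: Z_def)
 qed
 have eA: "e A = C" using rng by (simp add: e_def hA arcosh_cosh_real)
 have em: "e t <= pi" if "0 <= t" "t <= A" for t
 proof -
  have "- X * sinh t <= sinh B * sinh t" using XB that by (intro mult_right_mono) auto
  then have "cosh (e t) <= cosh (B + t)" by (simp add: ce h_def Z_def cosh_add)
  then have "e t <= B + t" using ce(2)[of t] rng that by (subst (asm) cosh_real_nonneg_le_iff) auto
  then show ?thesis using that rng tri pi by linarith
 qed
 have main: "k * dist x (c s) <= e th"
 proof -
  have "dist x (c s) <= model_dist \<kappa> (vec2 (sinh th) 0, cosh th) (vec2 X Y, Z)"
  proof (rule CAT_comparison_vertex[OF CAT c s, where p'="(vec2 0 0, 1)" and q'="(vec2 (sinh A) 0, cosh A)"])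
   show "ereal (dist p x) < model_diam \<kappa>" "ereal (dist p q + dist q x + dist x p) < 2 * model_diam \<kappa>"
    using \<kappa> by (simp_all add: model_diam_def)
   show "(vec2 0 0, 1) \<in> model_plane \<kappa>" "(vec2 (sinh A) 0, cosh A) \<in> model_plane \<kappa>"
    "(vec2 X Y, Z) \<in> model_plane \<kappa>" "(vec2 (sinh th) 0, cosh th) \<in> model_plane \<kappa>"
    using \<kappa> Y2 Z1 by (auto simp: model_plane_def power2_eq_square[symmetric] cosh_square_eq)
   have *: "arcosh (cosh A) = A" "arcosh (cosh th) = th" "arcosh (cosh (A - th)) = A - th" "arcosh (cosh B) = B" "arcosh (cosh C) = C"
    using rng by (auto intro!: arcosh_cosh_real)
   show "model_dist \<kappa> (vec2 0 0, 1) (vec2 (sinh A) 0, cosh A) = dist p q"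
    "model_dist \<kappa> (vec2 0 0, 1) (vec2 (sinh th) 0, cosh th) = s"
    using \<kappa> k k0 * by (auto simp: model_dist_def A_def th_def)
   have "cosh th * cosh A - sinh th * sinh A = cosh (A - th)" by (simp add: cosh_diff mult.commute)
   then show "model_dist \<kappa> (vec2 (sinh th) 0, cosh th) (vec2 (sinh A) 0, cosh A) = dist p q - s"
    using \<kappa> k k0 *(3) by (simp add: model_dist_def) (simp add: A_def th_def field_simps)
   have "cosh A * Z - sinh A * X = cosh C" using hA by (simp add: h_def mult.commute)
   then show "model_dist \<kappa> (vec2 (sinh A) 0, cosh A) (vec2 X Y, Z) = dist q x"
    using \<kappa> k k0 * by (simp add: model_dist_def C_def dist_commute)
   show "model_dist \<kappa> (vec2 X Y, Z) (vec2 0 0, 1) = dist x p" "model_dist \<kappa> (vec2 0 0, 1) (vec2 X Y, Z) = dist p x"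
    using \<kappa> k k0 * by (simp_all add: model_dist_def Z_def B_def dist_commute)
   show "model_dist \<kappa> (vec2 X Y, Z) (vec2 X Y, Z) = 0"
    using \<kappa> Y2 by (simp add: model_dist_def flip: power2_eq_square)
  qed
  then show ?thesis
   using \<kappa> k k0 by (simp add: model_dist_def pos_le_divide_eq mult.commute e_def h_def)
 qed
 \<comment> \<open>For \<open>Y = 0\<close> the third vertex lies on the line of the side; then
   \<open>e t = |t - X0|\<close> is not smooth, but its cosine is.\<close>
 have S: "cos (e 0) * sin (A - th) + cos (e A) * sin th <= cos (e th) * sin A"
 proof (cases "Y = 0")
  case True
  define X0 where "X0 = arsinh X"
  have X0: "sinh X0 = X" by (simp add: X0_def)
  then have "(cosh X0)^2 = Z^2" using Y2 True by (simp add: cosh_square_eq)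
  then have Z0: "cosh X0 = Z" using Z1 by (simp add: power2_eq_iff_nonneg)
  have "h t = cosh (t - X0)" for t by (simp add: h_def cosh_diff X0 Z0 mult.commute)
  then have "h t = cosh \<bar>t - X0\<bar>" for t by simp
  then have "e t = \<bar>t - X0\<bar>" for t by (simp only: e_def arcosh_cosh_real abs_ge_zero)
  then have "cos (e t) = cos (t - X0)" for t by simp
  then have "cos (e 0) * sin (A - th) + cos (e A) * sin th = cos (e th) * sin A"
   by (simp add: cos_diff sin_diff algebra_simps)
  then show ?thesis by simp
 next
  case False
  define S where "S = (%t. sqrt ((h t)^2 - 1))"
  have q: "(h t)^2 - 1 > 0" for t 
  proof -
   have "(h t)^2 - 1 = (h1 t)^2 + Y^2" using hh1[of t] by simp
   then show ?thesis using False by (simp add: sum_power2_gt_zero_iff)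
  qed
  then have Sp: "S t > 0" for t by (simp add: S_def)
  have S2: "(S t)^2 = (h t)^2 - 1" for t using q[of t] by (simp add: S_def)
  have Se: "S t = sinh (e t)" for t
   by (rule power2_eq_imp_eq) (use S2[of t] Sp[of t] ce[of t] sinh_square_eq[of "e t"] in auto)
  have h1: "h t > 1" for t
   by (rule power2_less_imp_less) (use q[of t] hpos[of t] in auto)
  have dh: "(h has_real_derivative h1 t) (at t)" for t
   unfolding h_def h1_def by (auto intro!: derivative_eq_intros)
  have dh1: "(h1 has_real_derivative h t) (at t)" for t
   unfolding h_def h1_def by (auto intro!: derivative_eq_intros)
  have dS: "(S has_real_derivative h t * h1 t / S t) (at t)" for t
   unfolding S_def using q[of t] by (auto intro!: derivative_eq_intros dh simp: field_simps)
  show ?thesis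
  proof (rule sturm_cos[where ?e1.0="%t. h1 t / S t" and ct="%t. h t / S t"])
   show "A <= pi" using rng tri pi by linarith
   fix t assume t: "0 <= t" "t <= A"
   show "(e has_real_derivative h1 t / S t) (at t)"
    unfolding e_def
    using DERIV_chain2[OF arcosh_real_has_field_derivative[OF h1[of t]] dh] by (simp add: S_def)
   show "((%t. h1 t / S t) has_real_derivative (1 - (h1 t / S t)^2) * (h t / S t)) (at t)"
    using Sp[of t] by (auto intro!: derivative_eq_intros dh1 dS simp: field_simps power2_eq_square)
   show "(h1 t / S t)^2 <= 1" 
   proof -
    have "(h1 t)^2 <= (h t)^2 - 1" using hh1[of t] zero_le_power2[of Y] by linarith
    then show ?thesis using q[of t] by (simp add: power_divide S2 divide_le_eq_1)
   qed
   show "cos (e t) <= h t / S t * sin (e t)"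
    using cos_sinh_le_sin_cosh[of "e t"] em[OF t] ce[of t] Sp[of t] by (simp add: Se field_simps)
  qed (use rng in auto)
 qed
 have "sin A > 0" using rng tri pi by (intro sin_gt_zero) auto
 moreover have "cos (e th) <= cos (k * dist x (c s))"
  using main em[of th] rng k0 by (intro cos_monotone_0_pi_le) auto
 ultimately have "sin A * cos (e th) <= sin A * cos (k * dist x (c s))" by (intro mult_left_mono) auto
 then show ?thesis using S unfolding e0 eA by (simp add: A_def B_def C_def th_def algebra_simps)
qed

lemma CAT_stewart:
 assumes CAT: "CAT_space \<kappa> TYPE('x::metric_space)"
 obtains k \<rho> where "stewart k \<rho> TYPE('x)"
proof -
 define k where "k = (if \<kappa> > 0 then sqrt \<kappa> else if \<kappa> = 0 then 1 else sqrt (- \<kappa>))"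
 have k0: "k > 0" by (simp add: k_def)
 \<comment> \<open>All angles \<open>k d\<close> with \<open>d < \<rho>\<close> stay below
   \<open>1/4\<close>, so sides and perimeters of the triangles are far from the bounds
   \<open>pi / k\<close> and \<open>2 pi / k\<close> that the comparison condition imposes for
   positive curvature.\<close>
 define \<rho> where "\<rho> = 1 / (4 * k)"
 have \<rho>: "\<rho> > 0" "4 * (k * \<rho>) = 1" using k0 by (auto simp: \<rho>_def)
 have "stewart k \<rho> TYPE('x)"
  unfolding stewart_def
 proof (intro conjI allI impI)
  fix x y :: 'x assume "dist x y < 2 * \<rho>"
  then have *: "2 * (k * dist x y) < 1" using k0 \<rho> by (simp add: \<rho>_def field_simps)
  have "ereal (dist x y) < model_diam \<kappa>"
  proof (cases "\<kappa> > 0")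
   case True
   have "dist x y * k < pi" using * pi_gt3 by (simp add: mult.commute)
   then show ?thesis using True k0 by (simp add: model_diam_def k_def pos_less_divide_eq)
  qed (simp add: model_diam_def)
  then show "\<exists>c. geodesic_from_to c x y" using CAT by (simp add: CAT_space_def)
 next
  fix x p q :: 'x and c s
  assume c: "geodesic_from_to c p q" and d: "dist x p < \<rho>" "dist x q < \<rho>" and s: "0 <= s" "s <= dist p q"
  have d': "4 * (k * dist x p) < 1" "4 * (k * dist x q) < 1" using d k0 by (simp_all add: \<rho>_def field_simps)
  \<comment> \<open>For \<open>p = q\<close> both sides vanish, and for \<open>x = p\<close> the
    claim is the addition formula, as \<open>dist x (c s) = s\<close>. What remains has a side of
    positive length and \<open>x\<close> different from its initial point.\<close>
  consider "p = q" | "p \<noteq> q" "x = p" | "p \<noteq> q" "x \<noteq> p" by blast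
  then show "sin (k * (dist p q - s)) * cos (k * dist x p) + sin (k * s) * cos (k * dist x q)
     <= sin (k * dist p q) * cos (k * dist x (c s))"
  proof cases
   case 1
   then show ?thesis using s by simp
  next
   case 2
   have "dist (c 0) (c s) = \<bar>0 - s\<bar>" using c s unfolding geodesic_from_to_def geodesic_on_def by auto
   then have "dist x (c s) = s" using c s 2 by (simp add: geodesic_from_to_def)
   then show ?thesis using 2 by (simp add: right_diff_distrib sin_diff algebra_simps)
  next
   case ne: 3
   consider "\<kappa> > 0" | "\<kappa> = 0" | "\<kappa> < 0" by linarith
   then show ?thesis
   proof cases
    case 1
    then show ?thesis using ne CAT c d' s by (intro stewart_inequality_pos[of \<kappa>]) (auto simp: k_def)
   next
    case 2
    then have "k = 1" by (simp add: k_def)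
    then show ?thesis using ne 2 CAT c d' s stewart_inequality_zero[of c p q s x] by auto
   next
    case 3
    then show ?thesis using 3 ne CAT c d' s by (intro stewart_inequality_neg[of \<kappa>]) (auto simp: k_def)
   qed
  qed
 qed (use k0 \<rho> in auto)
 then show ?thesis by (rule that)
qed

section \<open>Resolvents of semiconvex functions\<close>

lemma cos_ge_quadratic: "1 - t^2 / 2 <= cos (t::real)"
proof -
 have "\<bar>sin (t/2)\<bar> <= \<bar>t/2\<bar>" by (rule abs_sin_x_le_abs_x)
 then have "(sin (t/2))^2 <= (t/2)^2" by (simp only: abs_le_square_iff)
 then show ?thesis using cos_double_sin[of "t/2"] by (simp add: power_divide)
qed

lemma sin_ge_cubic:
 assumes "0 <= (t::real)" shows "t - t^3 / 6 <= sin t"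
proof -
 have "sin 0 - 0 + 0^3 / 6 <= sin t - t + t^3/6"
 proof (rule DERIV_nonneg_imp_nondecreasing[OF assms])
  fix x :: real
  have "((%t. sin t - t + t^3/6) has_real_derivative (cos x - 1 + x^2/2)) (at x)"
   by (auto intro!: derivative_eq_intros)
  then show "\<exists>y. ((%t. sin t - t + t^3/6) has_real_derivative y) (at x) \<and> 0 <= y"
   using cos_ge_quadratic[of x] by (intro exI[of _ "cos x - 1 + x^2/2"]) auto
 qed
 then show ?thesis by simp
qed

lemma cos_le_quartic:
 assumes "0 <= (t::real)" shows "cos t <= 1 - t^2 / 2 + t^4 / 24"
proof -
 have "1 - 0^2 / 2 + 0^4 / 24 - cos 0 <= 1 - t^2 / 2 + t^4 / 24 - cos t"
 proof (rule DERIV_nonneg_imp_nondecreasing[OF assms])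
  fix x :: real assume "0 <= x"
  have "((%t. 1 - t^2 / 2 + t^4 / 24 - cos t) has_real_derivative (sin x - x + x^3/6)) (at x)"
   by (auto intro!: derivative_eq_intros)
  then show "\<exists>y. ((%t. 1 - t^2 / 2 + t^4 / 24 - cos t) has_real_derivative y) (at x) \<and> 0 <= y"
   using sin_ge_cubic[OF \<open>0 <= x\<close>] by (intro exI[of _ "sin x - x + x^3/6"]) auto
 qed
 then show ?thesis by simp
qed

text \<open>Triangle inequality between the points at angles \<open>A\<close>, \<open>- B\<close> of the unit circle and the point \<open>m\<close>.\<close>

lemma planar_triangle:
 fixes A B m :: real
 shows "sqrt (2 - 2 * cos (A + B)) <= sqrt (1 + m^2 - 2 * m * cos A) + sqrt (1 + m^2 - 2 * m * cos B)"
proof -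
 have n: "cmod (cis t - of_real m) = sqrt (1 + m^2 - 2 * m * cos t)" for t
 proof -
  have "(cos t - m)^2 + (sin t)^2 = 1 + m^2 - 2 * m * cos t"
   using sin_cos_squared_add[of t] by (simp add: power2_diff)
  then show ?thesis by (simp add: cmod_def)
 qed
 have "cmod (cis A - cis (- B)) = sqrt (2 - 2 * cos (A + B))"
 proof -
  have "(cos A - cos B)^2 + (sin A + sin B)^2 = ((sin A)^2 + (cos A)^2) + ((sin B)^2 + (cos B)^2) - 2 * (cos A * cos B - sin A * sin B)"
   by (simp only: power2_eq_square) (simp only: algebra_simps)
  then show ?thesis by (simp add: cmod_def cos_add)
 qed
 moreover have "cmod (cis A - cis (- B)) <= cmod (cis A - of_real m) + cmod (of_real m - cis (- B))"
  using norm_triangle_ineq[of "cis A - of_real m" "of_real m - cis (- B)"] by simp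
 ultimately show ?thesis using n[of A] n[of "- B"] by (simp add: norm_minus_commute)
qed

lemma weighted_square:
 fixes P Q t :: real assumes "0 < t" "t < 1"
 shows "(P + Q)^2 <= P^2 / t + Q^2 / (1 - t)"
proof -
 have "P^2 / t + Q^2 / (1 - t) - (P + Q)^2 = ((1 - t) * P - t * Q)^2 / (t * (1 - t))"
  using assms by (simp add: field_simps power2_eq_square)
 also have "... \<ge> 0" using assms by auto
 finally show ?thesis by simp
qed

lemma geodesic_dist:
 assumes "geodesic_from_to c p q" "0 <= s" "s <= dist p q"
 shows "dist p (c s) = s" "dist (c s) q = dist p q - s"
proof -
 have g: "!!s t. s \<in> {0..dist p q} ==> t \<in> {0..dist p q} ==> dist (c s) (c t) = \<bar>s - t\<bar>"
  and e: "c 0 = p" "c (dist p q) = q"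
  using assms(1) unfolding geodesic_from_to_def geodesic_on_def by blast+
 show "dist p (c s) = s" using g[of 0 s] assms e by simp
 show "dist (c s) q = dist p q - s" using g[of s "dist p q"] assms e by simp
qed

lemma sqrt_chord_le: "0 <= t ==> sqrt (2 - 2 * cos t) <= t"
 using cos_ge_quadratic[of t] by (intro real_le_lsqrt) auto

lemma stewartD:
 fixes x p q :: "'x::metric_space"
 assumes "stewart k \<rho> TYPE('x)"
 shows "k > 0" "\<rho> > 0" "4 * (k * \<rho>) <= 1"
  "dist p q < 2 * \<rho> ==> \<exists>c. geodesic_from_to c p q"
  "geodesic_from_to c p q ==> dist x p < \<rho> ==> dist x q < \<rho> ==> 0 <= s ==> s <= dist p q ==>
    sin (k * (dist p q - s)) * cos (k * dist x p) + sin (k * s) * cos (k * dist x q)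
     <= sin (k * dist p q) * cos (k * dist x (c s))"
 using assms unfolding stewart_def by blast+

text \<open>A distance of at most \<open>n \<rho>\<close> is an angle of at most
  \<open>n / 4\<close>. The bound 12 on \<open>n\<close> is there because \<open>12 / 4 = 3\<close>
  is below \<open>pi\<close>.\<close>

lemma small_angle:
 assumes "stewart k \<rho> TYPE('x::metric_space)" "0 <= d" "d <= n * \<rho>" "n <= 12"
 shows "k * d <= n / 4" "k * d <= pi" "0 <= k * d"
proof -
 have "k * d <= n * (k * \<rho>)" using assms stewartD(1)[OF assms(1)] mult_left_mono[of d "n * \<rho>" k] by (simp add: mult_ac)
 moreover have "0 <= n"
 proof (rule ccontr)
  assume "\<not> 0 <= n"
  then have "n * \<rho> < 0" using stewartD(2)[OF assms(1)] by (intro mult_neg_pos) auto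
  then show False using assms by linarith
 qed
 ultimately show *: "k * d <= n / 4" using stewartD(3)[OF assms(1)] mult_left_mono[of "k * \<rho>" "1/4" n] by simp
 then show "k * d <= pi" using assms(4) pi_gt3 by linarith
 show "0 <= k * d" using assms(2) stewartD(1)[OF assms(1)] by simp
qed

text \<open>Reshetnyak's quadrilateral comparison in chordal form, for the diagonals
  \<open>x q\<close> and \<open>y p\<close>. A point \<open>z\<close> of the diagonal
  \<open>x q\<close> is chosen; Stewart's inequality bounds the chords from \<open>y\<close> and
  from \<open>p\<close> to \<open>z\<close>, and a planar triangle through \<open>z\<close> bounds
  the other diagonal. The ratio \<open>t\<close> in which \<open>z\<close> divides the diagonal is
  then optimised.\<close>

lemma quadrilateral_inequality:
 fixes x y p q :: "'x::metric_space"
 assumes st: "stewart k \<rho> TYPE('x)"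
  and d: "dist x y < \<rho>" "dist x p < \<rho>" "dist y q < \<rho>" "dist p q < \<rho>" "dist x q < \<rho>"
 shows "(2 - 2 * cos (k * dist x q)) + (2 - 2 * cos (k * dist y p))
   <= (2 - 2 * cos (k * dist x p)) + (2 - 2 * cos (k * dist y q)) + 2 * (k * dist x y) * (k * dist p q)"
proof -
 note k0 = stewartD(1)[OF st] and \<rho>0 = stewartD(2)[OF st]
 define U where "U = (%a b::'x. 2 - 2 * cos (k * dist a b))"
 have U0: "U a b \<ge> 0" for a b by (simp add: U_def)
 have Us: "sqrt (U a b) <= k * dist a b" for a b using k0 by (simp add: U_def sqrt_chord_le)
 have Ucom: "U a b = U b a" for a b by (simp add: U_def dist_commute)
 \<comment> \<open>The triangle inequality for \<open>y\<close>, \<open>z\<close>, \<open>p\<close>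
   is drawn in the plane with \<open>y\<close> and \<open>p\<close> on the unit circle and
   \<open>z\<close> moved to radius \<open>m\<close>, because the chord from \<open>x\<close> to
   \<open>q\<close> runs inside the circle.\<close>
 have tri: "sqrt (U y p) <= sqrt (1 + m^2 - 2 * m * cos (k * dist y z)) + sqrt (1 + m^2 - 2 * m * cos (k * dist z p))"
  if "dist y z + dist z p <= 12 * \<rho>" for m z
 proof -
  have "cos (k * dist y z + k * dist z p) <= cos (k * dist y p)"
  proof (rule cos_monotone_0_pi_le)
   show "k * dist y p <= k * dist y z + k * dist z p"
    using k0 dist_triangle[of y p z] by (simp flip: distrib_left add: dist_commute)
   show "k * dist y z + k * dist z p <= pi"
    using small_angle(2)[OF st _ that] by (simp add: distrib_left)
  qed (use k0 in auto)
  then have "sqrt (U y p) <= sqrt (2 - 2 * cos (k * dist y z + k * dist z p))" by (simp add: U_def)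
  also note planar_triangle[of "k * dist y z" "k * dist z p" m]
  finally show ?thesis .
 qed
 have "U x q + U y p <= U x p + U y q + 2 * (k * dist x y) * (k * dist p q)"
 proof -
  consider "x = y \<or> p = q" | "x = q" "x \<noteq> y" "p \<noteq> q" | "x \<noteq> q" "x \<noteq> y" "p \<noteq> q" by blast
  then show ?thesis
  proof cases
   case 1
   then show ?thesis using k0 by (auto simp: Ucom)
  next
   \<comment> \<open>A degenerate diagonal has no interior point; the planar triangle with
     \<open>m = 1\<close>, that is with all three points on the circle, takes over.\<close>
   case 2
   have "dist y x + dist x p <= 12 * \<rho>" using d \<rho>0 by (simp add: dist_commute)
   from tri[OF this, of 1] have "sqrt (U y p) <= sqrt (U y x) + sqrt (U x p)"
    by (simp add: U_def)
   then have "(sqrt (U y p))^2 <= (sqrt (U y x) + sqrt (U x p))^2"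
    by (intro power_mono) (auto simp: U0)
   then have "U y p <= U y x + U x p + 2 * (sqrt (U y x) * sqrt (U x p))"
    using U0 by (simp add: power2_sum)
   also have "sqrt (U y x) * sqrt (U x p) <= (k * dist y x) * (k * dist x p)"
    using Us U0 k0 by (intro mult_mono) auto
   finally show ?thesis using 2 by (simp add: U_def dist_commute)
  next
   case 3
   define l where "l = dist x q"
   have l: "0 < l" "l < \<rho>" using 3 d by (auto simp: l_def)
   have kl: "0 < k * l" "k * l < pi" using l k0 small_angle(1)[OF st, of l 1] pi_gt3 by auto
   have sl: "sin (k * l) > 0" using kl by (intro sin_gt_zero)
   have Upos: "U a b > 0" if "a \<noteq> b" "dist a b < \<rho>" for a b
   proof -
    have "0 < k * dist a b" "k * dist a b <= 1/4" using that k0 small_angle(1)[OF st, of "dist a b" 1] by auto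
    then have "cos (k * dist a b) < cos 0" using pi_gt3 by (intro cos_monotone_0_pi) auto
    then show ?thesis by (simp add: U_def)
   qed
   define r where "r = sqrt (U x y)"
   define D where "D = sqrt (U p q)"
   have rD: "r > 0" "D > 0" using Upos 3 d by (auto simp: r_def D_def)
   \<comment> \<open>With this ratio \<open>(1 - t) / t U x y\<close> and
     \<open>t / (1 - t) U p q\<close> are both equal to \<open>r D\<close>, which minimises their
     sum.\<close>
   define t where "t = r / (r + D)"
   have t: "0 < t" "t < 1" using rD by (auto simp: t_def)
   have t1: "1 - t = D / (r + D)" using rD by (simp add: t_def field_simps)
   have UrD: "U x y = r * r" "U p q = D * D" using U0 by (simp_all add: r_def D_def)
   \<comment> \<open>\<open>ph s\<close> is the ratio in which the radius at angle
     \<open>k s\<close> divides the chord spanned by the angle \<open>k l\<close>; it runs from 0 to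
     1, so some \<open>s\<close> realises \<open>t\<close>.\<close>
   define ph where "ph = (%s. sin (k * s) / (sin (k * (l - s)) + sin (k * s)))"
   have den: "sin (k * (l - s)) + sin (k * s) > 0" if "0 <= s" "s <= l" for s
   proof (cases "s = 0")
    case False
    have "k * s <= k * l" "k * (l - s) <= k * l" using that k0 by (auto intro!: mult_left_mono)
    then have *: "k * s < pi" "k * (l - s) <= pi" using kl by linarith+
    have "sin (k * s) > 0" using False that k0 * by (intro sin_gt_zero) auto
    moreover have "sin (k * (l - s)) \<ge> 0" using that k0 * by (intro sin_ge_zero) auto
    ultimately show ?thesis by simp
   qed (use sl in simp)
   have "\<exists>s\<ge>0. s <= l \<and> ph s = t"
   proof (rule IVT')
    show "ph 0 <= t" "t <= ph l" "0 <= l" using t l sl by (auto simp: ph_def)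
    show "continuous_on {0..l} ph" unfolding ph_def using den by (intro continuous_intros) fastforce
   qed
   then obtain s where s: "0 <= s" "s <= l" "ph s = t" by blast
   obtain c where c: "geodesic_from_to c x q" using stewartD(4)[OF st, of x q] d \<rho>0 by auto
   define z where "z = c s"
   define a where "a = sin (k * (l - s))"
   define b where "b = sin (k * s)"
   define S where "S = a + b"
   have S0: "S > 0" using den s by (simp add: S_def a_def b_def)
   have tb: "b = t * S" "a = (1 - t) * S" using s(3) S0 by (auto simp: ph_def S_def a_def b_def field_simps)
   \<comment> \<open>The distance from the centre to the point that divides the chord in the ratio
     \<open>t\<close>; dividing Stewart's inequality by \<open>S\<close> makes this factor
     appear.\<close>
   define m where "m = sin (k * l) / S"
   have m0: "m > 0" using S0 sl by (simp add: m_def)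
   have m2: "m^2 = 1 - t * (1 - t) * U x q"
   proof -
    have "(sin (k * l))^2 = a^2 + b^2 + 2 * a * b * cos (k * l)"
    proof -
     define A where "A = k * (l - s)"
     define B where "B = k * s"
     have e: "k * l = A + B" by (simp add: A_def B_def algebra_simps)
     have AB: "(cos A)^2 = 1 - (sin A)^2" "(cos B)^2 = 1 - (sin B)^2" by (simp_all add: cos_squared_eq)
     have "(sin (A + B))^2 = (sin A)^2 * (cos B)^2 + (cos A)^2 * (sin B)^2 + 2 * sin A * sin B * (cos A * cos B)"
      by (simp add: sin_add power2_eq_square algebra_simps)
     also have "... = (sin A)^2 + (sin B)^2 + 2 * sin A * sin B * cos (A + B)"
      unfolding AB by (simp add: cos_add power2_eq_square algebra_simps)
     finally show ?thesis by (simp add: e a_def b_def A_def B_def)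
    qed
    also have "... = S^2 * ((1 - t)^2 + t^2 + 2 * t * (1 - t) * cos (k * l))"
     unfolding tb by (simp add: power2_eq_square algebra_simps)
    finally have "m^2 = (1 - t)^2 + t^2 + 2 * t * (1 - t) * cos (k * l)"
     using S0 by (simp add: m_def power_divide)
    also have "... = 1 - t * (1 - t) * U x q"
     by (simp add: U_def l_def power2_eq_square algebra_simps)
    finally show ?thesis .
   qed
   \<comment> \<open>Stewart's inequality takes its Euclidean form here, with chords in place of
     squared distances.\<close>
   have P: "1 + m^2 - 2 * m * cos (k * dist w z) <= (1 - t) * U w x + t * U w q - t * (1 - t) * U x q"
    if "dist w x < \<rho>" "dist w q < \<rho>" for w
   proof -
    have "a * cos (k * dist w x) + b * cos (k * dist w q) <= sin (k * l) * cos (k * dist w z)"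
     using stewartD(5)[OF st c that] s by (simp add: a_def b_def l_def z_def)
    then have "S * ((1 - t) * cos (k * dist w x) + t * cos (k * dist w q)) <= S * (m * cos (k * dist w z))"
     using S0 by (simp add: tb m_def algebra_simps)
    then have "(1 - t) * cos (k * dist w x) + t * cos (k * dist w q) <= m * cos (k * dist w z)"
     using S0 by simp
    then show ?thesis unfolding m2 by (simp add: U_def algebra_simps)
   qed
   have dz: "dist y z + dist z p <= 12 * \<rho>"
   proof -
    have "dist x z <= l" using geodesic_dist(1)[OF c, of s] s by (simp add: z_def l_def)
    moreover have "dist y z <= dist x y + dist x z" "dist z p <= dist x z + dist x p"
     by (metis dist_triangle3 dist_commute dist_triangle)+
    ultimately show ?thesis using d l by linarith
   qed
   define Py where "Py = 1 + m^2 - 2 * m * cos (k * dist y z)"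
   define Pp where "Pp = 1 + m^2 - 2 * m * cos (k * dist z p)"
   have nn: "0 <= 1 + m^2 - 2 * m * cos w" for w
   proof -
    have "m * cos w <= m * 1" using m0 by (intro mult_left_mono) auto
    moreover have "0 <= (1 - m)^2" by simp
    ultimately show ?thesis by (simp add: power2_diff)
   qed
   have "U y p = (sqrt (U y p))^2" using U0 by simp
   also have "... <= (sqrt Py + sqrt Pp)^2"
    unfolding Py_def Pp_def by (intro power_mono tri dz) (simp add: U0)
   also have "... <= Py / t + Pp / (1 - t)"
    using weighted_square[OF t, of "sqrt Py" "sqrt Pp"] nn by (simp add: Py_def Pp_def)
   also have "... <= ((1 - t) * U y x + t * U y q - t * (1 - t) * U x q) / t
     + ((1 - t) * U p x + t * U p q - t * (1 - t) * U x q) / (1 - t)"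
    using t P[of y] P[of p] d
    by (intro add_mono divide_right_mono) (auto simp: Py_def Pp_def dist_commute)
   also have "... = (1 - t) / t * U x y + U y q + U x p + t / (1 - t) * U p q - U x q"
    using t by (simp add: field_simps Ucom)
   also have "(1 - t) / t = D / r" using rD unfolding t1 by (simp add: t_def)
   also have "t / (1 - t) = r / D" using rD unfolding t1 by (simp add: t_def)
   also have "D / r * U x y = r * D" using rD unfolding UrD by simp
   also have "r / D * U p q = r * D" using rD unfolding UrD by simp
   finally have "U x q + U y p <= U x p + U y q + 2 * (r * D)" by (simp add: mult.commute)
   also have "r * D <= (k * dist x y) * (k * dist p q)"
    unfolding r_def D_def using Us U0 k0 by (intro mult_mono) auto
   finally show ?thesis by simp
  qed
 qed
 then show ?thesis by (simp add: U_def)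
qed

section \<open>Minimisers of semiconvex perturbations of the chordal distance\<close>

lemma semiconvex_geodesic:
 fixes f :: "'x::metric_space => real"
 assumes "semiconvex lam f" "geodesic_from_to c p q" "0 <= s" "s <= dist p q" "0 < dist p q"
 shows "f (c s) <= f p + s / dist p q * (f q - f p) - lam / 2 * s * (dist p q - s)"
proof -
 define l where "l = dist p q"
 have l: "0 < l" "s <= l" "c 0 = p" "c l = q" using assms by (auto simp: l_def geodesic_from_to_def)
 have "convex_on {0..l} (%t. f (c t) - lam / 2 * t^2)"
  using assms(1,2) unfolding semiconvex_def geodesic_from_to_def l_def by blast
 from convex_onD[OF this, of "s / l" 0 l]
 have "f (c s) - lam / 2 * s^2 <= (1 - s / l) * f p + s / l * (f q - lam / 2 * l^2)"
  using assms l by simp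
 also have "... = f p + s / l * (f q - f p) - lam / 2 * s * l"
  using l by (simp add: field_simps power2_eq_square)
 finally show ?thesis
  by (simp add: l_def algebra_simps power2_eq_square diff_divide_distrib add_divide_distrib)
qed

text \<open>Completeness replaces compactness: the midpoint condition makes a minimising sequence
  Cauchy, since the point \<open>m\<close> that belongs to two almost minimal points cannot go below
  the infimum.\<close>

lemma strongly_convex_minimizer:
 fixes F :: "'x::metric_space => real"
 assumes "complete (UNIV :: 'x set)" "closed S" "S \<noteq> {}" "continuous_on S F" "bdd_below (F ` S)" "0 < e"
  and mid: "!!p q. p \<in> S ==> q \<in> S ==> \<exists>m\<in>S. F m <= (F p + F q) / 2 - e * (dist p q)^2"
 shows "\<exists>p\<in>S. \<forall>q\<in>S. F p <= F q"
proof -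
 define I where "I = Inf (F ` S)"
 have I: "I <= F q" if "q \<in> S" for q
  unfolding I_def using that assms(5) by (intro cInf_lower) auto
 have "\<exists>p\<in>S. F p < I + 1 / Suc n" for n
 proof -
  have "\<exists>y\<in>F ` S. y < I + 1 / Suc n"
   unfolding I_def using assms(3,5) by (intro cInf_lessD) (auto simp flip: I_def)
  then show ?thesis by blast
 qed
 then obtain p where p: "!!n. p n \<in> S" "!!n. F (p n) < I + 1 / Suc n" by metis
 have d: "e * (dist (p m) (p n))^2 <= 1 / Suc N" if "N <= m" "N <= n" for N m n
 proof -
  obtain z where z: "z \<in> S" "F z <= (F (p m) + F (p n)) / 2 - e * (dist (p m) (p n))^2" using mid p(1) by blast
  have "1 / Suc m <= 1 / Suc N" "1 / Suc n <= 1 / Suc N" using that by (auto simp: field_simps)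
  note N = this
  have "e * (dist (p m) (p n))^2 <= (F (p m) + F (p n)) / 2 - I" using I[OF z(1)] z(2) by linarith
  also have "... <= ((I + 1 / Suc m) + (I + 1 / Suc n)) / 2 - I"
   using p(2)[of m] p(2)[of n] by (intro diff_right_mono divide_right_mono add_mono) auto
  also have "... <= ((I + 1 / Suc N) + (I + 1 / Suc N)) / 2 - I"
   using N by (intro diff_right_mono divide_right_mono add_mono) auto
  also have "((I + A) + (I + A)) / 2 - I = A" for A by (simp add: field_simps)
  finally show ?thesis .
 qed
 have "Cauchy p"
 proof (rule metric_CauchyI)
  fix r :: real assume "0 < r"
  then obtain N where N: "1 / Suc N < e * r^2"
   using assms(6) reals_Archimedean[of "e * r^2"] by (auto simp: divide_inverse)
  have "dist (p m) (p n) < r" if "m \<ge> N" "n \<ge> N" for m n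
  proof -
   have "e * (dist (p m) (p n))^2 < e * r^2" using d[of N m n] that N by linarith
   then show ?thesis using assms(6) \<open>0 < r\<close> by (metis less_le mult_less_cancel_left_pos power2_less_imp_less)
  qed
  then show "\<exists>M. \<forall>m\<ge>M. \<forall>n\<ge>M. dist (p m) (p n) < r" by blast
 qed
 then obtain z where z: "p \<longlonglongrightarrow> z" using assms(1) unfolding complete_def by blast
 have zS: "z \<in> S" using closed_sequentially[OF assms(2) _ z] p(1) by blast
 have "(%n. F (p n)) \<longlonglongrightarrow> F z"
  using continuous_on_tendsto_compose[OF assms(4) z zS] p(1) by simp
 moreover have "(%n. I + 1 / Suc n) \<longlonglongrightarrow> I"
  using LIMSEQ_inverse_real_of_nat_add[of I] by (simp add: divide_inverse)
 ultimately have "F z <= I"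
  by (rule LIMSEQ_le) (use p(2) less_imp_le in blast)
 then show ?thesis using zS I by (meson order_trans)
qed

text \<open>\<open>L\<close> is any Lipschitz constant that is at least 1, so that a distance bound
  \<open>e\<close> can be absorbed into \<open>L e\<close> in the estimates.\<close>

locale resolvent_setup =
 fixes k \<rho> L lam :: real and f :: "'x::metric_space => real"
 assumes st: "stewart k \<rho> TYPE('x)" and complete_UNIV: "complete (UNIV :: 'x set)"
  and lip: "L-lipschitz_on UNIV f" and sc: "semiconvex lam f" and L1: "1 <= L"
begin

lemmas k0 = stewartD(1)[OF st] and rho0 = stewartD(2)[OF st]

text \<open>Two points in the ball of radius \<open>R\<close> about \<open>x\<close> are at distance
  at most \<open>\<rho>\<close>, so a geodesic joins them, and both are closer than
  \<open>\<rho>\<close> to \<open>x\<close>, so Stewart's inequality applies along it.\<close>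

definition R :: real where "R = \<rho> / 2"

lemma R0: "R > 0" using rho0 by (simp add: R_def)

text \<open>The chordal distance \<open>(2 - 2 cos (k d)) / k^2\<close> replaces \<open>d^2\<close> since it is what Stewart's inequality
controls; only its minimisers in a small ball are needed.\<close>

definition functional :: "real => 'x => 'x => real" where
 "functional a x y = 2 * a * f y + (2 - 2 * cos (k * dist x y)) / k^2"

definition resolvent :: "real => 'x => 'x" where
 "resolvent a x = (SOME p. dist x p <= R \<and> (\<forall>q. dist x q <= R --> functional a x p <= functional a x q))"

lemma f_lip: "\<bar>f x - f y\<bar> <= L * dist x y"
 using lipschitz_onD[OF lip, of x y] by (simp add: dist_real_def)

text \<open>Convexity of balls: with \<open>k dist x p\<close> and \<open>k dist x q\<close> at most
  \<open>k R\<close>, Stewart's inequality and the subadditivity of the sine give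
  \<open>cos (k R) <= cos (k dist x (c s))\<close>.\<close>

lemma geodesic_in_ball:
 fixes p q x :: 'x
 assumes "geodesic_from_to c p q" "dist x p <= R" "dist x q <= R" "0 <= s" "s <= dist p q"
 shows "dist x (c s) <= R"
proof (cases "p = q")
 case True
 then show ?thesis using assms by (auto simp: geodesic_from_to_def)
next
 case False
 define l where "l = dist p q"
 have l: "0 < l" "l <= 2 * R" using False dist_triangle3[of p q x] assms by (auto simp: l_def)
 have ang: "k * l <= 1" "k * R <= 1" "k * s <= k * l" "k * (l - s) <= k * l"
  using small_angle(1)[OF st, of l 4] small_angle(1)[OF st, of R 4] l R0 assms k0
  by (auto simp: R_def l_def intro!: mult_left_mono)
 have pi: "pi > 3" by (rule pi_gt3)
 have sn: "sin (k * l) > 0" "sin (k * s) \<ge> 0" "sin (k * (l - s)) \<ge> 0"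
 proof -
  have "k * l < pi" "k * s <= pi" "k * (l - s) <= pi" using ang pi by linarith+
  then show "sin (k * l) > 0" "sin (k * s) \<ge> 0" "sin (k * (l - s)) \<ge> 0"
   using l k0 assms by (auto intro!: sin_gt_zero sin_ge_zero simp: l_def)
 qed
 have cm: "cos (k * R) <= cos (k * dist x p)" "cos (k * R) <= cos (k * dist x q)"
  using assms k0 ang pi by (auto intro!: cos_monotone_0_pi_le mult_left_mono)
 have cR: "0 <= cos (k * R)" using cos_ge_quadratic[of "k * R"] ang k0 R0 power_mono[of "k * R" 1 2] by auto
 have "sin (k * l) <= sin (k * s) + sin (k * (l - s))"
 proof -
  have "sin (k * l) = sin (k * s) * cos (k * (l - s)) + cos (k * s) * sin (k * (l - s))"
   by (simp flip: sin_add distrib_left)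
  also have "... <= sin (k * s) * 1 + 1 * sin (k * (l - s))"
   using sn by (intro add_mono mult_left_mono mult_right_mono) auto
  finally show ?thesis by simp
 qed
 then have "sin (k * l) * cos (k * R) <= (sin (k * s) + sin (k * (l - s))) * cos (k * R)"
  using cR by (rule mult_right_mono)
 also have "... <= sin (k * (l - s)) * cos (k * dist x p) + sin (k * s) * cos (k * dist x q)"
  using mult_left_mono[OF cm(1) sn(3)] mult_left_mono[OF cm(2) sn(2)] by (simp add: algebra_simps)
 also have "... <= sin (k * l) * cos (k * dist x (c s))"
  using stewartD(5)[OF st assms(1), of x s] assms R0 rho0 by (simp add: l_def R_def)
 finally have *: "cos (k * R) <= cos (k * dist x (c s))" using sn by simp
 \<comment> \<open>A cosine bound can be inverted only for angles up to \<open>pi\<close>, so a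
   crude bound on the distance comes beforehand.\<close>
 have "dist x (c s) <= R + 2 * R"
  using dist_triangle[of x "c s" p] geodesic_dist(1)[OF assms(1), of s] assms l by (simp add: l_def)
 then have "k * dist x (c s) <= pi" using small_angle(2)[OF st, of "dist x (c s)" 2] rho0 by (simp add: R_def)
 then have "k * dist x (c s) <= k * R"
  using * cos_monotone_0_pi[of "k * R" "k * dist x (c s)"] R0 k0 by (auto simp: not_le[symmetric])
 then show ?thesis using k0 by simp
qed

text \<open>The chordal term gains \<open>l^2 / 10\<close> at the midpoint, and \<open>2 a f\<close>
  loses at most \<open>a |lam| l^2 / 4\<close>, which the bound on \<open>a\<close> makes at most
  \<open>l^2 / 20\<close>.\<close>

lemma functional_midpoint:
 assumes a: "0 <= a" "5 * (a * \<bar>lam\<bar>) <= 1" and pq: "dist x p <= R" "dist x q <= R"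
 shows "\<exists>m. dist x m <= R \<and> functional a x m <= (functional a x p + functional a x q) / 2 - 1 / 20 * (dist p q)^2"
proof (cases "p = q")
 case True
 then show ?thesis using pq by (intro exI[of _ p]) auto
next
 case False
 define l where "l = dist p q"
 have l: "0 < l" "l <= 2 * R" using False dist_triangle3[of p q x] pq by (auto simp: l_def)
 obtain c where c: "geodesic_from_to c p q" using stewartD(4)[OF st, of p q] l R0 by (auto simp: l_def R_def)
 define m where "m = c (l / 2)"
 have mR: "dist x m <= R" unfolding m_def using geodesic_in_ball[OF c pq, of "l/2"] l by (simp add: l_def)
 define th where "th = k * l / 2"
 have th: "0 < th" "th <= 1/2" using l k0 small_angle(1)[OF st, of l 4] rho0 by (auto simp: th_def R_def)
 have "sin th * (cos (k * dist x p) + cos (k * dist x q)) <= sin (2 * th) * cos (k * dist x m)"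
  using stewartD(5)[OF st c, of x "l/2"] pq R0 rho0 l by (simp add: l_def R_def m_def th_def algebra_simps)
 then have "sin th * (cos (k * dist x p) + cos (k * dist x q)) <= sin th * (2 * cos th * cos (k * dist x m))"
  by (simp add: sin_double)
 moreover have "sin th > 0" using th pi_gt3 by (intro sin_gt_zero) auto
 ultimately have 1: "cos (k * dist x p) + cos (k * dist x q) <= 2 * cos th * cos (k * dist x m)" by simp
 have cm: "1/2 <= cos (k * dist x m)"
 proof -
  have "0 <= k * dist x m" "k * dist x m <= 1" using small_angle[OF st, of "dist x m" 4] mR rho0 by (auto simp: R_def)
  then have "(k * dist x m)^2 <= 1" by (simp add: power_le_one)
  then show ?thesis using cos_ge_quadratic[of "k * dist x m"] by simp
 qed
 \<comment> \<open>\<open>1 - cos th >= th^2 / 2 - th^4 / 24\<close> with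
   \<open>th^4 <= th^2\<close>, and \<open>11 / 24\<close> exceeds \<open>2 / 5\<close>.\<close>
 have cth: "2 * th^2 / 5 <= 1 - cos th"
 proof -
  have "th^4 <= th^2" using th by (intro power_decreasing) auto
  then show ?thesis using cos_le_quartic[OF less_imp_le[OF th(1)]] zero_le_power2[of th] by linarith
 qed
 have 2: "th^2 / 5 <= (1 - cos th) * cos (k * dist x m)"
  using mult_mono[OF cth cm] by simp
 have "functional a x m <= (functional a x p + functional a x q) / 2 - a * lam * l^2 / 4 - l^2 / 10"
 proof -
  have "f m <= f p + (f q - f p) / 2 - lam / 2 * (l/2) * (l/2)"
   using semiconvex_geodesic[OF sc c, of "l/2"] l by (simp add: l_def m_def)
  then have "2 * a * f m <= 2 * a * (f p + (f q - f p) / 2 - lam / 2 * (l/2) * (l/2))"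
   using a by (intro mult_left_mono) auto
  moreover have "(2 - 2 * cos (k * dist x m)) / k^2
    <= ((2 - 2 * cos (k * dist x p)) / k^2 + (2 - 2 * cos (k * dist x q)) / k^2) / 2 - l^2 / 10"
  proof -
   have "2 - 2 * cos (k * dist x m) <= (2 - 2 * cos (k * dist x p) + (2 - 2 * cos (k * dist x q))) / 2 - 2 * th^2 / 5"
    using 1 2 by (simp add: algebra_simps)
   also have "2 * th^2 / 5 = k^2 * (l^2 / 10)" by (simp add: th_def power2_eq_square)
   finally have "(2 - 2 * cos (k * dist x m)) / k^2
     <= ((2 - 2 * cos (k * dist x p) + (2 - 2 * cos (k * dist x q))) / 2 - k^2 * (l^2 / 10)) / k^2"
    by (rule divide_right_mono) simp
   also have "... = ((2 - 2 * cos (k * dist x p)) / k^2 + (2 - 2 * cos (k * dist x q)) / k^2) / 2 - l^2 / 10"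
    using k0 by (simp add: diff_divide_distrib add_divide_distrib)
   finally show ?thesis .
  qed
  ultimately have "functional a x m <= 2 * a * (f p + (f q - f p) / 2 - lam / 2 * (l/2) * (l/2))
    + (((2 - 2 * cos (k * dist x p)) / k^2 + (2 - 2 * cos (k * dist x q)) / k^2) / 2 - l^2 / 10)"
   unfolding functional_def by (rule add_mono)
  also have "2 * a * (f p + (f q - f p) / 2 - lam / 2 * (l/2) * (l/2)) = (2 * a * f p + 2 * a * f q) / 2 - a * lam * l^2 / 4"
   by (simp add: field_simps power2_eq_square)
  finally show ?thesis unfolding functional_def by (simp add: add_divide_distrib)
 qed
 moreover have "- (a * lam * l^2) <= 1 / 5 * l^2"
 proof -
  have "- (a * lam) <= a * \<bar>lam\<bar>" using a mult_left_mono[of "- lam" "\<bar>lam\<bar>" a] by simp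
  then have "- (a * lam) <= 1 / 5" using a by simp
  then have "- (a * lam) * l^2 <= 1 / 5 * l^2" by (intro mult_right_mono) auto
  then show ?thesis by simp
 qed
 ultimately show ?thesis using mR by (intro exI[of _ m]) (auto simp: l_def)
qed

lemma resolvent_minimizer:
 assumes a: "0 <= a" "5 * (a * \<bar>lam\<bar>) <= 1"
 shows "dist x (resolvent a x) <= R"
  "dist x q <= R ==> functional a x (resolvent a x) <= functional a x q"
proof -
 have "\<exists>p\<in>cball x R. \<forall>q\<in>cball x R. functional a x p <= functional a x q"
 proof (rule strongly_convex_minimizer[OF complete_UNIV])
  have "continuous_on UNIV f" by (rule lipschitz_on_continuous_on[OF lip])
  then show "continuous_on (cball x R) (functional a x)"
   unfolding functional_def using k0 continuous_on_subset[of UNIV f "cball x R"]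
   by (intro continuous_intros) auto
  show "bdd_below (functional a x ` cball x R)"
  proof (rule bdd_belowI2)
   fix y assume y: "y \<in> cball x R"
   then have "L * dist x y <= L * R" using L1 by (intro mult_left_mono) auto
   then have "f x - L * R <= f y" using f_lip[of x y] by linarith
   then have "2 * a * (f x - L * R) <= 2 * a * f y" using a by (intro mult_left_mono) auto
   moreover have "0 <= (2 - 2 * cos (k * dist x y)) / k^2" by simp
   ultimately show "2 * a * (f x - L * R) <= functional a x y" unfolding functional_def by linarith
  qed
  show "\<exists>m\<in>cball x R. functional a x m <= (functional a x p + functional a x q) / 2 - 1/20 * (dist p q)^2"
   if "p \<in> cball x R" "q \<in> cball x R" for p q
   using functional_midpoint[OF a, of x p q] that by auto
 qed (use R0 in auto)
 then have "\<exists>p. dist x p <= R \<and> (\<forall>q. dist x q <= R --> functional a x p <= functional a x q)" by auto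
 from someI_ex[OF this] show "dist x (resolvent a x) <= R"
  "dist x q <= R ==> functional a x (resolvent a x) <= functional a x q"
  unfolding resolvent_def by auto
qed

lemma chord_lower:
 assumes "0 <= d" "d <= 2 * \<rho>"
 shows "d^2 / 2 <= (2 - 2 * cos (k * d)) / k^2"
proof -
 define th where "th = k * d"
 have th: "0 <= th" "th <= 1" using small_angle[OF st assms(1), of 4] assms rho0 by (auto simp: th_def)
 have "th^4 <= th^2" using th by (intro power_decreasing) auto
 then have "th^2 / 2 <= 2 - 2 * cos th" using cos_le_quartic[OF th(1)] zero_le_power2[of th] by linarith
 then show ?thesis using k0 by (simp add: th_def field_simps)
qed

text \<open>Comparing the minimiser with \<open>x\<close> itself gives
  \<open>d^2 / 2 <= 2 a L d\<close> for the displacement \<open>d\<close>, the left side being a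
  lower bound of the chordal term.\<close>

lemma resolvent_displacement:
 assumes a: "0 <= a" "5 * (a * \<bar>lam\<bar>) <= 1"
 shows "dist x (resolvent a x) <= 4 * L * a"
proof -
 define d where "d = dist x (resolvent a x)"
 have d: "0 <= d" "d <= R" using resolvent_minimizer[OF a] by (auto simp: d_def)
 have "functional a x (resolvent a x) <= functional a x x" using resolvent_minimizer(2)[OF a] R0 by simp
 then have "(2 - 2 * cos (k * d)) / k^2 <= 2 * a * (f x - f (resolvent a x))"
  by (simp add: functional_def d_def algebra_simps)
 also have "... <= 2 * a * (L * d)"
  using f_lip[of x "resolvent a x"] a by (intro mult_left_mono) (auto simp: d_def)
 finally have c: "(2 - 2 * cos (k * d)) / k^2 <= 2 * a * (L * d)" .
 have "d^2 / 2 <= (2 - 2 * cos (k * d)) / k^2" using d R0 rho0 by (intro chord_lower) (auto simp: R_def)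
 with c have "d^2 / 2 <= 2 * a * (L * d)" by linarith
 then have "d * d <= (4 * L * a) * d" by (simp add: power2_eq_square algebra_simps)
 then show ?thesis using d a L1 by (cases "d = 0") (auto simp: d_def[symmetric])
qed

text \<open>The first variation of the functional at its minimiser \<open>p\<close> along the
  geodesic to an arbitrary \<open>q\<close>. The leading part is
  \<open>(1 + lam a) l^2 <= 2 a (f q - f p)\<close> plus the difference of the chordal terms; the
  spherical corrections are of higher order and are collected in the factor with
  \<open>k^2\<close>.\<close>

lemma resolvent_variational_inequality:
 fixes x q :: 'x
 assumes a: "0 <= a" "5 * (a * \<bar>lam\<bar>) <= 1" and q: "dist x q <= R"
 defines "p \<equiv> resolvent a x"
 defines "l \<equiv> dist p q"
 shows "(1 + lam * a - k^2 * (a * L * l + a * \<bar>lam\<bar> * l^2 + (dist x p)^2 + l^2)) * l^2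
  <= 2 * a * (f q - f p) + (2 - 2 * cos (k * dist x q)) / k^2 - (2 - 2 * cos (k * dist x p)) / k^2"
proof (cases "p = q")
 case True
 then show ?thesis by (simp add: l_def)
next
 case False
 have p: "dist x p <= R" using resolvent_minimizer[OF a] by (simp add: p_def)
 have l: "0 < l" "l <= 2 * R" using False dist_triangle3[of p q x] p q by (auto simp: l_def)
 obtain c where c: "geodesic_from_to c p q" using stewartD(4)[OF st, of p q] l R0 by (auto simp: l_def R_def)
 define th where "th = k * l"
 have th: "0 < th" "th <= 1" using l k0 small_angle(1)[OF st, of l 4] rho0 by (auto simp: th_def R_def)
 have sl: "sin th > 0" using th pi_gt3 by (intro sin_gt_zero) auto
 define u where "u = cos (k * dist x p)"
 define w where "w = cos (k * dist x q)"
 \<comment> \<open>Up to the factor \<open>sin th\<close> a bound for the increase of the functional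
   from \<open>p\<close> to \<open>c s\<close>: Stewart's inequality replaces the distance to
   \<open>c s\<close>, which may fail to be differentiable in \<open>s\<close>, by an explicit
   function. It is nonnegative and vanishes at 0.\<close>
 define \<Phi> where "\<Phi> = (%s. 2 * a * (s / l * (f q - f p) - lam / 2 * s * (l - s)) * sin th
   + 2 / k^2 * (u * sin th - (sin (k * (l - s)) * u + sin (k * s) * w)))"
 have \<Phi>_nonneg: "0 <= \<Phi> s" if s: "0 <= s" "s <= l" for s
 proof -
  define v where "v = cos (k * dist x (c s))"
  have "dist x (c s) <= R" using geodesic_in_ball[OF c p q, of s] s by (simp add: l_def)
  then have "functional a x p <= functional a x (c s)" unfolding p_def by (rule resolvent_minimizer(2)[OF a])
  then have 1: "2 * a * f p + (2 - 2 * u) / k^2 <= 2 * a * f (c s) + (2 - 2 * v) / k^2"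
   by (simp add: functional_def u_def v_def)
  have "f (c s) <= f p + s / l * (f q - f p) - lam / 2 * s * (l - s)"
   using semiconvex_geodesic[OF sc c, of s] s l by (simp add: l_def)
  then have "2 * a * f (c s) <= 2 * a * (f p + s / l * (f q - f p) - lam / 2 * s * (l - s))"
   using a by (intro mult_left_mono) auto
  with 1 have "0 <= 2 * a * (s / l * (f q - f p) - lam / 2 * s * (l - s)) + ((2 - 2 * v) / k^2 - (2 - 2 * u) / k^2)"
   by (simp add: algebra_simps)
  also have "(2 - 2 * v) / k^2 - (2 - 2 * u) / k^2 = 2 / k^2 * (u - v)"
   by (simp add: diff_divide_distrib algebra_simps)
  finally have "0 <= (2 * a * (s / l * (f q - f p) - lam / 2 * s * (l - s)) + 2 / k^2 * (u - v)) * sin th"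
   using sl by simp
  also have "... = 2 * a * (s / l * (f q - f p) - lam / 2 * s * (l - s)) * sin th + 2 / k^2 * (u * sin th - sin th * v)"
   by (simp add: algebra_simps)
  also have "... <= \<Phi> s"
  proof -
   have "sin (k * (l - s)) * u + sin (k * s) * w <= sin th * v"
    using stewartD(5)[OF st c, of x s] p q R0 rho0 s by (simp add: l_def R_def u_def v_def w_def th_def)
   then have "2 / k^2 * (u * sin th - sin th * v) <= 2 / k^2 * (u * sin th - (sin (k * (l - s)) * u + sin (k * s) * w))"
    by (intro mult_left_mono) auto
   then show ?thesis by (simp add: \<Phi>_def)
  qed
  finally show ?thesis .
 qed
 \<comment> \<open>This is the derivative of \<open>\<Phi>\<close> at 0; a negative value would make
   \<open>\<Phi>\<close> negative just to the right of 0.\<close>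
 define d where "d = 2 * a * ((f q - f p) / l - lam / 2 * l) * sin th + 2 / k * (cos th * u - w)"
 have d0: "0 <= d"
 proof (rule ccontr)
  assume "\<not> 0 <= d"
  have "(\<Phi> has_real_derivative d) (at 0)"
   unfolding \<Phi>_def d_def using l k0
   by (auto intro!: derivative_eq_intros simp: th_def) (simp add: field_simps power2_eq_square power4_eq_xxxx)
  from has_real_derivative_neg_dec_right[OF this] obtain e where e: "0 < e" "!!h. 0 < h ==> h < e ==> \<Phi> (0 + h) < \<Phi> 0"
   using \<open>\<not> 0 <= d\<close> by auto
  have "\<Phi> 0 = 0" by (simp add: \<Phi>_def th_def)
  moreover have m: "0 < min (e/2) l" "min (e/2) l < e" "min (e/2) l <= l" using e(1) l by auto
  ultimately show False using e(2)[OF m(1,2)] \<Phi>_nonneg[of "min (e/2) l"] by simp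
 qed
 \<comment> \<open>\<open>S\<close> is close to 1 and \<open>Q\<close> close to
   \<open>th^2 / 2\<close>. The estimates \<open>E1\<close>, \<open>E2\<close>, \<open>E3\<close>
   bound what is lost when these values are put in, with numerical factors below 1 dropped.\<close>
 define S where "S = sin th / th"
 define Q where "Q = 1 - cos th"
 have S: "1 - th^2 / 6 <= S" "S <= 1"
 proof -
  have "th * (1 - th^2 / 6) <= sin th" using sin_ge_cubic[of th] th by (simp add: algebra_simps power2_eq_square power3_eq_cube)
  then show "1 - th^2 / 6 <= S" using th by (simp add: S_def pos_le_divide_eq mult.commute)
  show "S <= 1" using th sin_x_le_x[of th] by (simp add: S_def)
 qed
 have d_eq: "d / k = S * (2 * a * (f q - f p) - a * lam * l^2) + 2 / k^2 * (u - w) - 2 / k^2 * (Q * u)"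
  unfolding d_def S_def Q_def th_def using k0 l by (simp add: field_simps power2_eq_square)
 have "0 <= d / k" using d0 k0 by simp
 then have main: "2 / k^2 * (Q * u) - S * (2 * a * (f q - f p) - a * lam * l^2) <= 2 / k^2 * (u - w)"
  unfolding d_eq using diff_le_eq le_diff_eq by (simp add: algebra_simps)
 have third: "X / 3 <= X" "X / 6 <= X" if "0 <= X" for X :: real using that by auto
 have E1: "- (k^2 * (a * L * l) * l^2) <= (1 - S) * (2 * a * (f q - f p))"
 proof -
  have "\<bar>(1 - S) * (2 * a * (f q - f p))\<bar> <= (th^2 / 6) * (2 * a * (L * l))"
   unfolding abs_mult using S a f_lip[of q p] L1 by (intro mult_mono) (auto simp: l_def dist_commute)
  also have "... = k^2 * (a * L * l) * l^2 / 3" by (simp add: th_def power2_eq_square)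
  also have "... <= k^2 * (a * L * l) * l^2"
   using a l L1 third[of "k^2 * (a * L * l) * l^2"] by simp
  finally show ?thesis by linarith
 qed
 have E2: "a * lam * l^2 - k^2 * (a * \<bar>lam\<bar> * l^2) * l^2 <= S * (a * lam * l^2)"
 proof -
  have "\<bar>(1 - S) * (a * lam * l^2)\<bar> <= (th^2 / 6) * (a * \<bar>lam\<bar> * l^2)"
   unfolding abs_mult using S a by (intro mult_mono) auto
  also have "... = k^2 * (a * \<bar>lam\<bar> * l^2) * l^2 / 6" by (simp add: th_def power2_eq_square)
  also have "... <= k^2 * (a * \<bar>lam\<bar> * l^2) * l^2"
   using a third[of "k^2 * (a * \<bar>lam\<bar> * l^2) * l^2"] by simp
  finally have "(1 - S) * (a * lam * l^2) <= k^2 * (a * \<bar>lam\<bar> * l^2) * l^2" by linarith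
  then show ?thesis by (simp add: algebra_simps)
 qed
 have E3: "l^2 - k^2 * ((dist x p)^2 + l^2) * l^2 <= 2 / k^2 * (Q * u)"
 proof -
  define h where "h = k * dist x p"
  have h: "0 <= h" "h <= 1" using small_angle[OF st, of "dist x p" 4] p rho0 by (auto simp: h_def R_def)
  have "th^2 / 2 * (1 - th^2 / 12) <= Q"
   using cos_le_quartic[of th] th by (simp add: Q_def algebra_simps power2_eq_square power4_eq_xxxx)
  moreover have "1 - h^2 / 2 <= u" using cos_ge_quadratic[of h] by (simp add: u_def h_def)
  moreover have h2: "h^2 <= 1" "th^2 <= 1" using h th by (auto simp: power_le_one)
  ultimately have "th^2 / 2 * (1 - th^2 / 12) * (1 - h^2 / 2) <= Q * u"
   by (intro mult_mono) (auto simp: Q_def)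
  moreover have "th^2 / 2 * (1 - h^2 - th^2) <= th^2 / 2 * ((1 - th^2 / 12) * (1 - h^2 / 2))"
  proof (rule mult_left_mono)
   have "0 <= th^2 * h^2" by simp
   then show "1 - h^2 - th^2 <= (1 - th^2 / 12) * (1 - h^2 / 2)"
    using zero_le_power2[of th] zero_le_power2[of h] by (simp add: algebra_simps)
  qed auto
  ultimately have "th^2 / 2 * (1 - h^2 - th^2) <= Q * u"
   unfolding mult.assoc[of _ _ "1 - h^2 / 2"] by linarith
  then have "2 / k^2 * (th^2 / 2 * (1 - h^2 - th^2)) <= 2 / k^2 * (Q * u)" by (intro mult_left_mono) auto
  moreover have "2 / k^2 * (th^2 / 2 * (1 - h^2 - th^2)) = l^2 - k^2 * ((dist x p)^2 + l^2) * l^2"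
   using k0 by (simp add: th_def h_def power2_eq_square field_simps)
  ultimately show ?thesis by simp
 qed
 have "(2 - 2 * w) / k^2 - (2 - 2 * u) / k^2 = 2 / k^2 * (u - w)"
  by (simp add: diff_divide_distrib algebra_simps)
 moreover have "(1 + lam * a - k^2 * (a * L * l + a * \<bar>lam\<bar> * l^2 + (dist x p)^2 + l^2)) * l^2
  = - (k^2 * (a * L * l) * l^2) + (a * lam * l^2 - k^2 * (a * \<bar>lam\<bar> * l^2) * l^2) + (l^2 - k^2 * ((dist x p)^2 + l^2) * l^2)"
  by (simp add: algebra_simps)
 moreover have "(1 - S) * (2 * a * (f q - f p)) = 2 * a * (f q - f p) - S * (2 * a * (f q - f p))"
  "S * (2 * a * (f q - f p) - a * lam * l^2) = S * (2 * a * (f q - f p)) - S * (a * lam * l^2)"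
  by (simp_all add: algebra_simps)
 ultimately show ?thesis using main E1 E2 E3 unfolding u_def[symmetric] w_def[symmetric] by linarith
qed

text \<open>The 9 is \<open>4 + 1 + 4\<close>: two displacements of at most \<open>4 L e\<close> and
  a distance of at most \<open>e <= L e\<close>. The distances that occur in
  \<open>resolvent_pair\<close> then stay below \<open>R\<close>, and the last entry gives the bound
  on the parameter that \<open>functional_midpoint\<close> asks for.\<close>

definition step_max :: real where
 "step_max = Min {1, R / (9 * L), 1 / (5 * (\<bar>lam\<bar> + 1))}"

text \<open>The bracket adds \<open>9 + 16 + 81\<close> and \<open>81 |lam|\<close> from the four
  error terms, with distances at most \<open>9 L e\<close> and \<open>4 L e\<close>; the factor 2
  accounts for the two variational inequalities that are summed.\<close>

definition error_const :: real where
 "error_const = 2 * (k^2 * L^2 * (106 + 81 * \<bar>lam\<bar>))"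

lemma step_max: "0 < step_max" "step_max <= 1" "9 * L * step_max <= R" "5 * (step_max * (\<bar>lam\<bar> + 1)) <= 1"
proof -
 show "0 < step_max" using R0 L1 by (simp add: step_max_def)
 show "step_max <= 1" by (simp add: step_max_def)
 have "step_max <= R / (9 * L)" "step_max <= 1 / (5 * (\<bar>lam\<bar> + 1))" by (simp_all add: step_max_def)
 then show "9 * L * step_max <= R" "5 * (step_max * (\<bar>lam\<bar> + 1)) <= 1"
  using L1 by (simp_all add: pos_le_divide_eq algebra_simps)
qed

lemma step_admissible:
 assumes "0 <= a" "a <= step_max" shows "5 * (a * \<bar>lam\<bar>) <= 1"
proof -
 have "a * \<bar>lam\<bar> <= step_max * (\<bar>lam\<bar> + 1)" using assms step_max by (intro mult_mono) auto
 then show ?thesis using step_max(4) by linarith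
qed

lemma resolvent_error:
 assumes "0 <= a" "a <= e" "0 <= l" "l <= 9 * L * e" "0 <= d" "d <= 4 * L * e" "e <= 1"
 shows "k^2 * (a * L * l + a * \<bar>lam\<bar> * l^2 + d^2 + l^2) <= error_const * e^2 / 2"
proof -
 have e: "0 <= e" using assms by linarith
 have l2: "l^2 <= 81 * (L^2 * e^2)" using power_mono[OF assms(4,3), of 2] by (simp add: power_mult_distrib)
 have d2: "d^2 <= 16 * (L^2 * e^2)" using power_mono[OF assms(6,5), of 2] by (simp add: power_mult_distrib)
 have "a * L * l <= e * L * (9 * L * e)" using assms L1 e by (intro mult_mono) auto
 then have 1: "a * L * l <= 9 * (L^2 * e^2)" by (simp add: power2_eq_square mult_ac)
 have "a * \<bar>lam\<bar> * l^2 <= 1 * \<bar>lam\<bar> * (81 * (L^2 * e^2))" using assms l2 by (intro mult_mono) auto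
 then have 2: "a * \<bar>lam\<bar> * l^2 <= 81 * \<bar>lam\<bar> * (L^2 * e^2)" by simp
 have "a * L * l + a * \<bar>lam\<bar> * l^2 + d^2 + l^2 <= (106 + 81 * \<bar>lam\<bar>) * (L^2 * e^2)"
  using 1 2 l2 d2 by (simp add: distrib_right)
 then have "k^2 * (a * L * l + a * \<bar>lam\<bar> * l^2 + d^2 + l^2) <= k^2 * ((106 + 81 * \<bar>lam\<bar>) * (L^2 * e^2))"
  by (intro mult_left_mono) auto
 then show ?thesis by (simp add: error_const_def mult_ac)
qed

text \<open>The variational inequality at \<open>p\<close> is tested with \<open>q\<close> and the
  one at \<open>q\<close> with \<open>p\<close>. In the sum the chords of the diagonals
  \<open>x q\<close> and \<open>y p\<close> are exchanged for those of the sides by the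
  quadrilateral inequality, and the product \<open>2 dist x y D\<close> is split into
  squares.\<close>

theorem resolvent_pair:
 fixes x y :: 'x
 assumes e: "e <= step_max" and a: "0 <= a" "a <= e" and b: "0 <= b" "b <= e" and xy: "dist x y <= e"
 defines "p \<equiv> resolvent a x" and "q \<equiv> resolvent b y"
 shows "(1 - error_const * e^2 + lam * (a + b)) * (dist p q)^2 + 2 * (b - a) * (f q - f p) <= (dist x y)^2"
proof -
 have e1: "0 <= e" "e <= 1" using a e step_max by linarith+
 have ad: "5 * (a * \<bar>lam\<bar>) <= 1" "5 * (b * \<bar>lam\<bar>) <= 1" using step_admissible a b e by auto
 have Le: "L * a <= L * e" "L * b <= L * e" "e <= L * e"
  using a b L1 e1 by (auto intro!: mult_left_mono simp: mult_le_cancel_right1)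
 have "L * e <= L * step_max" using e L1 by simp
 then have Le9: "9 * (L * e) <= R" using step_max(3) by (simp add: mult.assoc)
 note Le = Le Le9
 have xp: "dist x p <= 4 * (L * e)" using resolvent_displacement[OF a(1) ad(1), of x] Le by (simp add: p_def mult_ac)
 have yq: "dist y q <= 4 * (L * e)" using resolvent_displacement[OF b(1) ad(2), of y] Le by (simp add: q_def mult_ac)
 have xq: "dist x q <= 5 * (L * e)" using dist_triangle[of x q y] xy yq Le by linarith
 have yp: "dist y p <= 5 * (L * e)" using dist_triangle[of y p x] xy xp Le by (simp add: dist_commute)
 have pq: "dist p q <= 9 * (L * e)" using dist_triangle3[of p q x] xp xq by (simp add: dist_commute)
 have R: "0 < R" "R < \<rho>" "0 <= L * e" using R0 rho0 L1 e1 by (auto simp: R_def)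
 define U where "U = (%a b::'x. (2 - 2 * cos (k * dist a b)) / k^2)"
 define D where "D = dist p q"
 have A: "(1 + lam * a - error_const * e^2 / 2) * D^2 <= 2 * a * (f q - f p) + U x q - U x p"
 proof -
  have "k^2 * (a * L * D + a * \<bar>lam\<bar> * D^2 + (dist x p)^2 + D^2) <= error_const * e^2 / 2"
   using a pq xp e1 by (intro resolvent_error) (auto simp: D_def)
  then have "(1 + lam * a - error_const * e^2 / 2) * D^2 <= (1 + lam * a - k^2 * (a * L * D + a * \<bar>lam\<bar> * D^2 + (dist x p)^2 + D^2)) * D^2"
   by (intro mult_right_mono) auto
  also have "... <= 2 * a * (f q - f p) + U x q - U x p"
   using resolvent_variational_inequality[OF a(1) ad(1), of x q] xq Le R by (simp add: U_def D_def p_def)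
  finally show ?thesis .
 qed
 have B: "(1 + lam * b - error_const * e^2 / 2) * D^2 <= 2 * b * (f p - f q) + U y p - U y q"
 proof -
  have "k^2 * (b * L * D + b * \<bar>lam\<bar> * D^2 + (dist y q)^2 + D^2) <= error_const * e^2 / 2"
   using b pq yq e1 by (intro resolvent_error) (auto simp: D_def)
  then have "(1 + lam * b - error_const * e^2 / 2) * D^2 <= (1 + lam * b - k^2 * (b * L * D + b * \<bar>lam\<bar> * D^2 + (dist y q)^2 + D^2)) * D^2"
   by (intro mult_right_mono) auto
  also have "... <= 2 * b * (f p - f q) + U y p - U y q"
   using resolvent_variational_inequality[OF b(1) ad(2), of y p] yp Le R by (simp add: U_def D_def q_def dist_commute)
  finally show ?thesis .
 qed
 have "(2 - 2 * cos (k * dist x q)) + (2 - 2 * cos (k * dist y p))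
   <= (2 - 2 * cos (k * dist x p)) + (2 - 2 * cos (k * dist y q)) + k^2 * (2 * dist x y * D)"
  using quadrilateral_inequality[OF st, of x y p q] xy xp yq pq xq Le R by (simp add: D_def power2_eq_square mult_ac)
 then have "((2 - 2 * cos (k * dist x q)) + (2 - 2 * cos (k * dist y p))) / k^2
   <= ((2 - 2 * cos (k * dist x p)) + (2 - 2 * cos (k * dist y q)) + k^2 * (2 * dist x y * D)) / k^2"
  by (rule divide_right_mono) simp
 then have C: "U x q + U y p <= U x p + U y q + 2 * dist x y * D"
  using k0 by (simp add: U_def add_divide_distrib diff_divide_distrib)
 have "2 * dist x y * D <= (dist x y)^2 + D^2" using zero_le_power2[of "dist x y - D"] by (simp add: power2_diff)
 moreover have "(1 + lam * a - error_const * e^2 / 2) * D^2 + (1 + lam * b - error_const * e^2 / 2) * D^2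
   = (1 - error_const * e^2 + lam * (a + b)) * D^2 + D^2" by (simp add: field_simps)
 moreover have "2 * a * (f q - f p) + 2 * b * (f p - f q) = - (2 * (b - a) * (f q - f p))" by (simp add: algebra_simps)
 ultimately show ?thesis using A B C unfolding D_def[symmetric] by linarith
qed

lemma resolvent_dist:
 assumes "0 <= a" "a <= step_max"
 shows "dist x (resolvent a x) <= 4 * L * a"
 using resolvent_displacement assms step_admissible by blast

lemma resolvent_zero: "resolvent 0 x = x"
 using resolvent_dist[of 0 x] step_max by simp

lemma error_const_nonneg: "0 <= error_const" by (simp add: error_const_def)

text \<open>For \<open>dist x y <= e\<close> the pair inequality is a quadratic inequality for the
  distance of the images; for larger distances the displacement bound \<open>4 L e\<close> for each
  point is enough.\<close>

lemma resolvent_Lipschitz: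
 fixes x y :: 'x
 assumes a: "0 <= a" "a <= e" and b: "0 <= b" "b <= e" and e: "e <= step_max" "0 < e"
  "error_const * e^2 <= 1 / 4" "8 * (\<bar>lam\<bar> * e) <= 1"
 shows "dist (resolvent a x) (resolvent b y) <= (1 + 8 * L) * (dist x y + \<bar>a - b\<bar>)"
proof -
 define p q where "p = resolvent a x" and "q = resolvent b y"
 define D r where "D = dist p q" and "r = dist x y"
 have nn: "0 <= D" "0 <= r" by (auto simp: D_def r_def)
 have ab: "4 * L * a <= 4 * L * e" "4 * L * b <= 4 * L * e" using a b L1 by auto
 show ?thesis
 proof (cases "r <= e")
  case True
  have "(1 - error_const * e^2 + lam * (a + b)) * D^2 + 2 * (b - a) * (f q - f p) <= r^2"
   unfolding D_def r_def p_def q_def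
   by (rule resolvent_pair) (use a b e True in \<open>auto simp: r_def\<close>)
  moreover have "1 / 2 * D^2 <= (1 - error_const * e^2 + lam * (a + b)) * D^2"
  proof (rule mult_right_mono)
   have "\<bar>lam * (a + b)\<bar> <= \<bar>lam\<bar> * (2 * e)" unfolding abs_mult using a b by (intro mult_left_mono) auto
   then show "1 / 2 <= 1 - error_const * e^2 + lam * (a + b)" using e by linarith
  qed auto
  moreover have "- (2 * (b - a) * (f q - f p)) <= 2 * \<bar>a - b\<bar> * (L * D)"
  proof -
   have "\<bar>2 * (b - a) * (f q - f p)\<bar> <= 2 * \<bar>a - b\<bar> * (L * D)"
    unfolding abs_mult using f_lip[of q p] by (intro mult_mono) (auto simp: D_def dist_commute)
   then show ?thesis by linarith
  qed
  ultimately have *: "D * D <= 2 * (r * r) + (4 * L * \<bar>a - b\<bar>) * D"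
   by (simp add: power2_eq_square algebra_simps)
  \<comment> \<open>A larger \<open>D\<close> would give \<open>D^2 > 2 r D + 4 L |a - b| D\<close>,
    and \<open>2 r D >= 4 r^2\<close>, against the previous bound.\<close>
  have "D <= 2 * r + 4 * L * \<bar>a - b\<bar>"
  proof (rule ccontr)
   assume **: "\<not> D <= 2 * r + 4 * L * \<bar>a - b\<bar>"
   then have D: "0 < D" "2 * r <= D" using nn L1 by (auto intro: le_less_trans[of 0 "2 * r + 4 * L * \<bar>a - b\<bar>"] order.trans[of "2 * r" "2 * r + 4 * L * \<bar>a - b\<bar>"])
   have "(2 * r + 4 * L * \<bar>a - b\<bar>) * D < D * D" using ** D by (intro mult_strict_right_mono) auto
   moreover have "r * (2 * r) <= r * D" using D nn by (intro mult_left_mono) auto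
   ultimately show False using * mult_nonneg_nonneg[OF nn] by (simp add: algebra_simps)
  qed
  also have "... <= (1 + 8 * L) * (r + \<bar>a - b\<bar>)"
   using L1 nn mult_right_mono[OF L1 nn(2)] mult_right_mono[OF L1, of "\<bar>a - b\<bar>"] by (simp add: algebra_simps)
  finally show ?thesis by (simp add: D_def r_def p_def q_def)
 next
  case False
  have "dist x p <= 4 * L * e" "dist y q <= 4 * L * e"
   using resolvent_dist[of a x] resolvent_dist[of b y] a b e ab by (auto simp: p_def q_def)
  moreover have "D <= dist x p + (r + dist y q)"
   unfolding D_def r_def using dist_triangle3[of p q x] dist_triangle[of x q y] by (simp add: dist_commute)
  ultimately have "D <= r + 8 * L * e" by linarith
  also have "... <= r + 8 * L * r" using False L1 by auto
  also have "... <= (1 + 8 * L) * (r + \<bar>a - b\<bar>)" using L1 by (simp add: algebra_simps)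
  finally show ?thesis by (simp add: D_def r_def p_def q_def)
 qed
qed

end

section \<open>Sobolev functions along line segments\<close>

lemma nn_integral_translate:
 fixes f :: "'a::euclidean_space => ennreal"
 assumes [measurable]: "f \<in> Borel"
 shows "(\<integral>\<^sup>+z. f (z + c) \<partial>lborel) = (\<integral>\<^sup>+z. f z \<partial>lborel)"
proof -
 have "(\<integral>\<^sup>+z. f z \<partial>lborel) = (\<integral>\<^sup>+z. f z \<partial>(distr lborel borel ((+) c)))" by (simp add: lborel_distr_plus)
 also have "... = (\<integral>\<^sup>+z. f (c + z) \<partial>lborel)" by (subst nn_integral_distr) auto
 finally show ?thesis by (simp add: add.commute)
qed

lemma integral_translate:
 fixes f :: "'a::euclidean_space => 'b::{banach, second_countable_topology}"
 assumes [measurable]: "f \<in> Borel"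
 shows "(LI z. f (z + c)) = (LI z. f z)"
  and integrable_translate: "L1 (%z. f (z + c)) \<longleftrightarrow> L1 f"
proof -
 have "(LI z. f z) = (LINT z|distr lborel borel ((+) c). f z)" by (simp add: lborel_distr_plus)
 also have "... = (LI z. f (c + z))" by (subst integral_distr) auto
 finally show "(LI z. f (z + c)) = (LI z. f z)" by (simp add: add.commute)
 have "L1 f \<longleftrightarrow> integrable (distr lborel borel ((+) c)) f" by (simp add: lborel_distr_plus)
 also have "... \<longleftrightarrow> L1 (%z. f (c + z))" by (subst integrable_distr_eq) auto
 finally show "L1 (%z. f (z + c)) \<longleftrightarrow> L1 f" by (simp add: add.commute)
qed

lemma AE_translate:
 fixes P :: "'a::euclidean_space => bool"
 assumes "ae z. P z"
 shows "ae z. P (z + c)"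
proof -
 obtain N where N: "{z. \<not> P z} <= N" "N \<in> sets lborel" "emeasure lborel N = 0"
  using assms by (auto elim: AE_E)
 have [measurable]: "N \<in> sets borel" using N by simp
 have "ae z. z \<notin> N" using N by (intro AE_not_in) auto
 then have "AE z in distr lborel borel ((+) c). z \<notin> N" unfolding lborel_distr_plus .
 then have "ae z. c + z \<notin> N" by (subst (asm) AE_distr_iff) auto
 then show ?thesis by (rule AE_mp) (use N in \<open>auto simp: add.commute\<close>)
qed

text \<open>A version with integrable functions on the whole space, tested only inside
  \<open>Om\<close>: translations, products and mollifications then stay within
  \<open>lborel\<close>, and both functions are Borel.\<close>

definition weak_gradient :: "'a::euclidean_space set => ('a => real) => ('a => 'a) => bool" where
 "weak_gradient Om g G \<longleftrightarrow> L1 g \<and> L1 G \<and>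
   (\<forall>ph v. test_function Om ph --> (LI z. g z * dir_deriv ph v z) = - (LI z. (G z \<bullet> v) * ph z))"

text \<open>The mean of \<open>H\<close> over the segment from \<open>z\<close> to
  \<open>z + v\<close>; the length \<open>norm v\<close> enters separately where distances are
  estimated.\<close>

definition segment_integral :: "('a::euclidean_space => real) => 'a => 'a => real" where
 "segment_integral H z v = (LI t. ind {0..1} t * H (z + t *R v))"

text \<open>For fixed \<open>t\<close> a translation does not change the integral of
  \<open>|H|\<close>, so the iterated integral is the product of the two norms.\<close>

lemma line_Fubini:
 fixes H :: "'a::euclidean_space => real" and k :: "real => real"
 assumes H: "L1 H" and k: "L1 k"
 shows "integrable (lborel \<Otimes>\<^sub>M lborel) (%(t, z). k t * H (z + t *R v))"
proof (rule lborel_pair.Fubini_integrable)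
 have [measurable]: "H \<in> Borel" using H by simp
 have [measurable]: "k \<in> Borel" using k by simp
 show "(%(t, z). k t * H (z + t *R v)) \<in> borel_measurable (lborel \<Otimes>\<^sub>M lborel)"
  by measurable
 have i: "L1 (%z. H (z + t *R v))" for t using H by (simp add: integrable_translate)
 then show "ae t. L1 (%z. case (t, z) of (t, z) => k t * H (z + t *R v))"
  by simp
 have "(LI z. norm (case (t, z) of (t, z) => k t * H (z + t *R v)))
   = \<bar>k t\<bar> * (LI z. \<bar>H z\<bar>)" for t
  using integral_translate[of "%z. \<bar>H z\<bar>" "t *R v"] by (simp add: abs_mult)
 then show "L1 (%t. LI z. norm (case (t, z) of (t, z) => k t * H (z + t *R v)))"
  using k by (simp add: integrable_mult_left)
qed

lemma segment_Fubini:
 fixes H :: "'a::euclidean_space => real"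
 assumes "L1 H"
 shows "integrable (lborel \<Otimes>\<^sub>M lborel) (%(t::real, z). ind {0..1} t * H (z + t *R v))"
 by (rule line_Fubini[OF assms]) simp

lemma segment_integral_integrable:
 fixes H :: "'a::euclidean_space => real"
 assumes H: "L1 H"
 shows "L1 (%z. segment_integral H z v)"
  and "ae z. L1 (%t. ind {0..1} t * H (z + t *R v))"
  and "(LI z. segment_integral H z v) = (LI z. H z)"
proof -
 have [measurable]: "H \<in> Borel" using H by simp
 note F = segment_Fubini[OF H, of v]
 then have F': "integrable (lborel \<Otimes>\<^sub>M lborel) (%(t, z). (%t z. ind {0..1} t * H (z + t *R v)) t z)" by simp
 show "L1 (%z. segment_integral H z v)"
  using lborel_pair.integrable_snd[OF F'] by (simp add: segment_integral_def)
 show "ae z. L1 (%t. ind {0..1} t * H (z + t *R v))"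
  using lborel_pair.AE_integrable_snd[OF F'] by simp
 have "(LI z. segment_integral H z v) = (LI t. LI z. ind {0..1} t * H (z + t *R v))"
  unfolding segment_integral_def by (rule lborel_pair.Fubini_integral[OF F'])
 also have "... = (LI t. ind {0..1::real} t * (LI z. H z))"
  by (simp add: integral_translate)
 finally show "(LI z. segment_integral H z v) = (LI z. H z)" by simp
qed

lemma AE_lborel_prod_iff:
 fixes Q :: "'a::euclidean_space \<times> 'b::euclidean_space => bool"
 assumes [measurable]: "Measurable.pred borel Q"
 shows "(ae p. Q p) \<longleftrightarrow> (ae y. ae x. Q (x, y))"
  and "(ae p. Q p) \<longleftrightarrow> (ae x. ae y. Q (x, y))"
proof -
 define N where "N = {p. \<not> Q p}"
 have N[measurable]: "N \<in> sets borel" unfolding N_def by measurable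
 have N': "N \<in> sets (lborel \<Otimes>\<^sub>M lborel)" using N unfolding lborel_prod by simp
 have Nx: "(%x. (x, y)) -` N \<in> sets borel" and Ny: "Pair x -` N \<in> sets borel" for x y
  using N by (auto intro!: measurable_sets_borel[where M=borel])
 have 0: "(ae p. Q p) \<longleftrightarrow> emeasure lborel N = 0"
  using AE_iff_measurable[of N lborel Q] N by (auto simp: N_def)
 have "emeasure lborel N = (\<integral>\<^sup>+y. emeasure lborel ((%x. (x, y)) -` N) \<partial>lborel)"
  using lborel_pair.emeasure_pair_measure_alt2[OF N'] by (simp add: lborel_prod)
 moreover have "(%y. emeasure lborel ((%x. (x, y)) -` N)) \<in> borel_measurable lborel"
  by (rule lborel_pair.measurable_emeasure_Pair2[OF N'])
 ultimately have "emeasure lborel N = 0 \<longleftrightarrow> (ae y. emeasure lborel ((%x. (x, y)) -` N) = 0)"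
  by (simp add: nn_integral_0_iff_AE)
 also have "... \<longleftrightarrow> (ae y. ae x. Q (x, y))"
 proof (rule AE_cong)
  fix y :: 'b
  show "emeasure lborel ((%x. (x, y)) -` N) = 0 \<longleftrightarrow> (ae x. Q (x, y))"
   using AE_iff_measurable[of "(%x. (x, y)) -` N" lborel "%x. Q (x, y)"] Nx by (auto simp: N_def)
 qed
 finally show "(ae p. Q p) \<longleftrightarrow> (ae y. ae x. Q (x, y))" using 0 by simp
 have "emeasure lborel N = (\<integral>\<^sup>+x. emeasure lborel (Pair x -` N) \<partial>lborel)"
  using lborel.emeasure_pair_measure_alt[OF N'] by (simp add: lborel_prod)
 moreover have "(%x. emeasure lborel (Pair x -` N)) \<in> borel_measurable lborel"
  by (rule lborel.measurable_emeasure_Pair[OF N'])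
 ultimately have "emeasure lborel N = 0 \<longleftrightarrow> (ae x. emeasure lborel (Pair x -` N) = 0)"
  by (simp add: nn_integral_0_iff_AE)
 also have "... \<longleftrightarrow> (ae x. ae y. Q (x, y))"
 proof (rule AE_cong)
  fix x :: 'a
  show "emeasure lborel (Pair x -` N) = 0 \<longleftrightarrow> (ae y. Q (x, y))"
   using AE_iff_measurable[of "Pair x -` N" lborel "%y. Q (x, y)"] Ny by (auto simp: N_def)
 qed
 finally show "(ae p. Q p) \<longleftrightarrow> (ae x. ae y. Q (x, y))" using 0 by simp
qed

text \<open>An exceptional set that is Borel makes Fubini's theorem available for predicates whose
  own measurability is unknown.\<close>

lemma AE_lborel_borel_null:
 fixes P :: "'a::euclidean_space => bool"
 assumes "ae x. P x"
 obtains N where "N \<in> sets borel" "ae x. x \<notin> N" "!!x. x \<notin> N ==> P x"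
proof -
 obtain N where N: "{z. \<not> P z} <= N" "N \<in> sets lborel" "emeasure lborel N = 0"
  using assms by (auto elim: AE_E)
 then show ?thesis using that[of N] AE_not_in[of N lborel] by (auto simp: null_sets_def)
qed

lemma AE_scale:
 fixes P :: "'a::euclidean_space => bool"
 assumes "ae z. P z" "c \<noteq> 0"
 shows "ae z. P (c *R z)"
proof -
 obtain N where N: "N \<in> sets borel" "ae x. x \<notin> N" "!!x. x \<notin> N ==> P x"
  using AE_lborel_borel_null[OF assms(1)] by blast
 note [measurable] = N(1)
 have "AE z in density (distr lborel borel (%x. 0 + c *R x)) (%_. ennreal (\<bar>c\<bar>^DIM('a))). z \<notin> N"
  unfolding lborel_affine[OF assms(2), of "0::'a", symmetric] by (rule N(2))
 then have "AE z in distr lborel borel (%x. 0 + c *R x). z \<notin> N"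
  using assms(2) by (subst (asm) AE_density) auto
 then have "ae z. c *R z \<notin> N" by (subst (asm) AE_distr_iff) auto
 then show ?thesis by (rule AE_mp) (use N in auto)
qed

section \<open>Mollification\<close>

lemma L1_translate_triangle:
 fixes f s :: "'a::euclidean_space => real"
 assumes f: "L1 f" and s: "L1 s"
 shows "(LI z. \<bar>f (z + v) - f z\<bar>) <= (LI z. \<bar>s (z + v) - s z\<bar>) + 2 * (LI z. \<bar>s z - f z\<bar>)"
proof -
 have m[measurable]: "f \<in> Borel" "s \<in> Borel" using f s by auto
 have i: "L1 (%z. f (z + v))" "L1 (%z. s (z + v))"
  using f s by (simp_all add: integrable_translate)
 have t: "(LI z. \<bar>s (z + v) - f (z + v)\<bar>) = (LI z. \<bar>s z - f z\<bar>)"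
  by (rule integral_translate[of "%z. \<bar>s z - f z\<bar>"]) simp
 have "(LI z. \<bar>f (z + v) - f z\<bar>) <= (LI z. \<bar>s (z + v) - s z\<bar> + (\<bar>s (z + v) - f (z + v)\<bar> + \<bar>s z - f z\<bar>))"
  using f s i by (intro integral_mono) auto
 also have "... = (LI z. \<bar>s (z + v) - s z\<bar>) + ((LI z. \<bar>s (z + v) - f (z + v)\<bar>) + (LI z. \<bar>s z - f z\<bar>))"
  using f s i by (simp add: integral_add)
 finally show ?thesis using t by simp
qed

text \<open>Integrating \<open>ind U z - ind U z * ind U (z + v)\<close> restricts attention to
  points of \<open>U\<close>, where openness gives convergence; the boundary of \<open>U\<close>,
  which may have positive measure, never enters.\<close>

lemma L1_translate_indicator_open:
 fixes U :: "'a::euclidean_space set"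
 assumes U: "open U" "emeasure lborel U < \<infinity>" and V: "V \<longlonglongrightarrow> 0"
 shows "(%n. LI z. \<bar>ind U (z + V n) - ind U z :: real\<bar>) \<longlonglongrightarrow> 0"
proof -
 have [measurable]: "U \<in> sets borel" using U by simp
 have i: "L1 (ind U :: 'a => real)" using U by (simp add: less_top[symmetric])
 then have it: "L1 (%z. ind U (z + v) :: real)" for v by (simp add: integrable_translate)
 have ip: "L1 (%z. ind U z * ind U (z + v) :: real)" for v
  by (rule Bochner_Integration.integrable_bound[OF i]) (auto simp: indicator_def)
 have eq: "(LI z. \<bar>ind U (z + v) - ind U z :: real\<bar>)
   = 2 * (LI z. ind U z - ind U z * ind U (z + v))" for v
 proof -
  have "(LI z. \<bar>ind U (z + v) - ind U z :: real\<bar>)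
    = (LI z. (ind U z + ind U (z + v)) - 2 * (ind U z * ind U (z + v)))"
   by (intro Bochner_Integration.integral_cong) (auto simp: indicator_def)
  also have "... = (LI z. ind U z) + (LI z. ind U (z + v)) - 2 * (LI z. ind U z * ind U (z + v))"
   using i it ip by (simp add: integral_add integral_diff)
  also have "(LI z. ind U (z + v) :: real) = (LI z. ind U z)"
   by (rule integral_translate) simp
  finally show ?thesis using i ip by (simp add: integral_diff del: integral_indicator)
 qed
 have "(%n. LI z. ind U z - ind U z * ind U (z + V n) :: real) \<longlonglongrightarrow> (LINT z|(lborel::'a measure). 0)"
 proof (rule integral_dominated_convergence[where w="ind U"])
  show "ae z. (%n. ind U z - ind U z * ind U (z + V n) :: real) \<longlonglongrightarrow> 0"
  proof (rule AE_I2)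
   fix z
   show "(%n. ind U z - ind U z * ind U (z + V n) :: real) \<longlonglongrightarrow> 0"
   proof (cases "z \<in> U")
    case True
    have "(%n. z + V n) \<longlonglongrightarrow> z + 0" by (intro tendsto_intros V)
    then have "\<forall>\<^sub>F n in sequentially. z + V n \<in> U" using U(1) True by (intro topological_tendstoD) auto
    then have "\<forall>\<^sub>F n in sequentially. ind U z - ind U z * ind U (z + V n) = (0::real)"
     by eventually_elim (use True in auto)
    then show ?thesis by (rule tendsto_eventually)
   qed simp
  qed
 qed (use i in \<open>auto simp: indicator_def\<close>)
 then have "(%n. 2 * (LI z. ind U z - ind U z * ind U (z + V n) :: real)) \<longlonglongrightarrow> 2 * 0"
  by (intro tendsto_mult_left) simp
 then show ?thesis unfolding eq by simp
qed

lemma L1_translate_approx: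
 fixes f :: "'a::euclidean_space => real"
 assumes f: "L1 f"
  and approx: "!!e::real. e > 0 ==> \<exists>s. L1 s \<and> (LI z. \<bar>s z - f z\<bar>) < e \<and>
   (%n. LI z. \<bar>s (z + V n) - s z\<bar>) \<longlonglongrightarrow> 0"
 shows "(%n. LI z. \<bar>f (z + V n) - f z\<bar>) \<longlonglongrightarrow> 0"
proof (rule LIMSEQ_I)
 fix e :: real assume "0 < e"
 then obtain s where s: "L1 s" "(LI z. \<bar>s z - f z\<bar>) < e / 4"
  "(%n. LI z. \<bar>s (z + V n) - s z\<bar>) \<longlonglongrightarrow> 0" using approx[of "e / 4"] by auto
 obtain N where N: "!!n. n \<ge> N ==> norm ((LI z. \<bar>s (z + V n) - s z\<bar>) - 0) < e / 2"
  using LIMSEQ_D[OF s(3), of "e / 2"] \<open>0 < e\<close> by auto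
 have "norm ((LI z. \<bar>f (z + V n) - f z\<bar>) - 0) < e" if "n \<ge> N" for n
 proof -
  have "0 <= (LI z. \<bar>f (z + V n) - f z\<bar>)" by simp
  then show ?thesis using L1_translate_triangle[OF f s(1), of "V n"] N[OF that] s(2) by simp
 qed
 then show "\<exists>N. \<forall>n\<ge>N. norm ((LI z. \<bar>f (z + V n) - f z\<bar>) - 0) < e" by blast
qed

text \<open>Induction over integrable functions: a set of finite measure is approximated from
  outside by an open set, and sums and limits are handled by the triangle inequality.\<close>

lemma L1_translate_sequence:
 fixes f :: "'a::euclidean_space => real"
 assumes "L1 f" and V: "V \<longlonglongrightarrow> 0"
 shows "(%n. LI z. \<bar>f (z + V n) - f z\<bar>) \<longlonglongrightarrow> 0"
 using assms(1)
proof (induction rule: integrable_induct)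
 case (base A c)
 have A[measurable]: "A \<in> sets borel" using base by simp
 have iA: "L1 (%z. ind A z :: real)" using base by (simp add: less_top[symmetric])
 have "(%n. LI z. \<bar>ind A (z + V n) - ind A z :: real\<bar>) \<longlonglongrightarrow> 0"
 proof (rule L1_translate_approx[OF iA])
  fix e :: real assume "0 < e"
  then obtain U where U: "open U" "A <= U" "emeasure lborel (U - A) < ennreal e"
   using outer_regular_lborel[OF A] by blast
  have [measurable]: "U \<in> sets borel" using U by simp
  have "U = A \<union> (U - A)" using U by auto
  then have "emeasure lborel U <= emeasure lborel A + emeasure lborel (U - A)"
   by (metis A \<open>U \<in> sets borel\<close> emeasure_subadditive sets.Diff sets_lborel)
  also have "... < \<infinity>" using base less_trans[OF U(3), of top] by simp
  finally have fin: "emeasure lborel U < \<infinity>" .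
  have "(LI z. \<bar>ind U z - ind A z :: real\<bar>) = (LI z. ind (U - A) z)"
   using U(2) by (intro Bochner_Integration.integral_cong) (auto simp: indicator_def)
  also have "... = measure lborel (U - A)" by simp
  also have "... < e"
  proof -
   have "emeasure lborel (U - A) = ennreal (measure lborel (U - A))"
    using less_trans[OF U(3), of top] by (intro emeasure_eq_ennreal_measure) auto
   then show ?thesis using U(3) \<open>0 < e\<close> by (simp add: ennreal_less_iff)
  qed
  finally have "(LI z. \<bar>ind U z - ind A z :: real\<bar>) < e" .
  then show "\<exists>s. L1 s \<and> (LI z. \<bar>s z - ind A z\<bar>) < e \<and>
    (%n. LI z. \<bar>s (z + V n) - s z :: real\<bar>) \<longlonglongrightarrow> 0"
   using L1_translate_indicator_open[OF U(1) fin V] fin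
   by (intro exI[of _ "ind U"]) (auto simp: less_top[symmetric])
 qed
 then have "(%n. \<bar>c\<bar> * (LI z. \<bar>ind A (z + V n) - ind A z :: real\<bar>)) \<longlonglongrightarrow> \<bar>c\<bar> * 0"
  by (rule tendsto_mult_left)
 moreover have "\<bar>ind A (z + V n) *R c - ind A z *R c\<bar> = \<bar>c\<bar> * \<bar>ind A (z + V n) - ind A z\<bar>" for z n
  by (simp add: abs_mult[symmetric] algebra_simps)
 ultimately show ?case by simp
next
 case (add f g)
 note [measurable] = borel_measurable_integrable[OF add.hyps(1)] borel_measurable_integrable[OF add.hyps(2)]
 have i: "L1 (%z. f (z + v))" "L1 (%z. g (z + v))" for v
  using add.hyps by (simp_all add: integrable_translate)
 have lim: "(%n. (LI z. \<bar>f (z + V n) - f z\<bar>) + (LI z. \<bar>g (z + V n) - g z\<bar>)) \<longlonglongrightarrow> 0"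
  using tendsto_add[OF add.IH] by simp
 have "(LI z. \<bar>f (z + v) + g (z + v) - (f z + g z)\<bar>) <= (LI z. \<bar>f (z + v) - f z\<bar> + \<bar>g (z + v) - g z\<bar>)" for v
  using add.hyps i by (intro integral_mono) auto
 also have "(LI z. \<bar>f (z + v) - f z\<bar> + \<bar>g (z + v) - g z\<bar>) = (LI z. \<bar>f (z + v) - f z\<bar>) + (LI z. \<bar>g (z + v) - g z\<bar>)" for v
  using add.hyps i by (intro Bochner_Integration.integral_add) auto
 finally show ?case
  by (intro tendsto_sandwich[OF _ _ tendsto_const lim]) auto
next
 case (lim f s)
 show ?case
 proof (rule L1_translate_approx)
  fix e :: real assume "0 < e"
  have "(%i. LI z. \<bar>s i z - f z\<bar>) \<longlonglongrightarrow> (LINT z|(lborel::'a measure). 0)"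
  proof (rule integral_dominated_convergence[where w="%z. 3 * \<bar>f z\<bar>"])
   show "ae z. (%i. \<bar>s i z - f z\<bar>) \<longlonglongrightarrow> 0"
    using lim.hyps(2) by (intro AE_I2 tendsto_rabs_zero) (simp add: LIM_zero_iff)
   show "ae z. norm \<bar>s i z - f z\<bar> <= 3 * \<bar>f z\<bar>" for i
   proof (rule AE_I2)
    fix z show "norm \<bar>s i z - f z\<bar> <= 3 * \<bar>f z\<bar>" using lim.hyps(3)[of z i] by simp
   qed
  qed (use lim.hyps in auto)
  then have "\<forall>\<^sub>F i in sequentially. (LI z. \<bar>s i z - f z\<bar>) < e"
   using \<open>0 < e\<close> by (intro order_tendstoD) auto
  then obtain i where "(LI z. \<bar>s i z - f z\<bar>) < e" by (auto simp: eventually_sequentially)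
  then show "\<exists>s. L1 s \<and> (LI z. \<bar>s z - f z\<bar>) < e \<and> (%n. LI z. \<bar>s (z + V n) - s z\<bar>) \<longlonglongrightarrow> 0"
   using lim.hyps(1) lim.IH by blast
 qed (rule lim.hyps)
qed

lemma L1_translate_continuous:
 fixes f :: "'a::euclidean_space => real"
 assumes "L1 f" "0 < e"
 obtains d where "d > 0" "!!v. norm v < d ==> (LI z. \<bar>f (z + v) - f z\<bar>) < e"
proof -
 have "((%v. LI z. \<bar>f (z + v) - f z\<bar>) \<longlongrightarrow> 0) (at 0)"
  unfolding tendsto_at_iff_sequentially o_def using L1_translate_sequence[OF assms(1)] by blast
 from tendstoD[OF this assms(2)] obtain d where d: "d > 0"
  "!!v. v \<noteq> 0 ==> norm v < d ==> \<bar>LI z. \<bar>f (z + v) - f z\<bar>\<bar> < e"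
  unfolding eventually_at by auto
 show thesis
 proof
  show "(LI z. \<bar>f (z + v) - f z\<bar>) < e" if "norm v < d" for v
   using d(2)[OF _ that] assms(2) by (cases "v = 0") auto
 qed (rule d)
qed

lemma mollifier_exists:
 assumes "r > 0"
 shows "\<exists>ph :: 'a::euclidean_space => real. test_function (ball 0 r) ph \<and> (\<forall>x. 0 <= ph x) \<and> (LI x. ph x) = 1"
proof -
 have "{0} <= ball (0::'a) r" using assms by simp
 from test_function_plateau[OF compact_sing open_ball this] obtain \<zeta> :: "'a => real" and V
  where "test_function (ball 0 r) \<zeta>" "!!x. 0 <= \<zeta> x" "open V" "{0} <= V" "!!x. x \<in> V ==> \<zeta> x = 1"
  by metis
 note \<zeta> = this
 note i = test_function_integrable[OF \<zeta>(1)]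
 \<comment> \<open>A vanishing integral would make the nonempty open set \<open>V\<close>
   null.\<close>
 have "(LI x. \<zeta> x) \<noteq> 0"
 proof
  assume "(LI x. \<zeta> x) = 0"
  then have "ae x. \<zeta> x = 0" using integral_nonneg_eq_0_iff_AE[OF i] \<zeta>(2) by auto
  then have "ae x. x \<notin> V" by eventually_elim (use \<zeta>(5) in force)
  then have "V \<in> null_sets lborel" using \<zeta>(3) by (subst AE_iff_null_sets) auto
  then have "negligible V" by (simp add: negligible_iff_null_sets null_sets_completionI)
  then show False using \<zeta>(3,4) open_not_negligible by auto
 qed
 then have "(LI x. \<zeta> x) > 0" using \<zeta>(2) by (simp add: order_less_le integral_nonneg_AE)
 then show ?thesis
  using \<zeta>(2) by (intro exI[of _ "%x. (1 / (LI x. \<zeta> x)) * \<zeta> x"] conjI test_function_cmult \<zeta>(1)) auto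
qed

lemma smooth_lipschitz:
 fixes ph :: "'a::euclidean_space => real"
 assumes "test_function U ph"
 obtains B where "B \<ge> 0" "!!x y. \<bar>ph x - ph y\<bar> <= B * norm (x - y)"
proof -
 note s = test_function_smooth[OF assms]
 have "\<exists>B. \<forall>x. \<bar>dir_deriv ph b x\<bar> <= B" for b
  using test_function_bounded[OF test_function_dir_deriv[OF assms, of b]] by metis
 then obtain B where B: "!!b x. \<bar>dir_deriv ph b x\<bar> <= B b" by metis
 define C where "C = (\<Sum>b\<in>(Basis::'a set). B b)"
 have "norm (dir_deriv ph v x) <= C * norm v" for v x
 proof -
  have "norm (gradient ph x) <= (\<Sum>b\<in>Basis. \<bar>gradient ph x \<bullet> b\<bar>)" by (rule norm_le_l1)
  also have "... <= C" unfolding C_def using B by (intro sum_mono) (simp add: dir_deriv_gradient[OF s, symmetric])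
  finally show ?thesis using Cauchy_Schwarz_ineq2[of "gradient ph x" v]
   by (simp add: dir_deriv_gradient[OF s]) (meson mult_right_mono norm_ge_zero order_trans)
 qed
 then have "onorm (%v. dir_deriv ph v x) <= C" for x by (rule onorm_le)
 then have "\<bar>ph x - ph y\<bar> <= C * norm (x - y)" for x y
  using differentiable_bound[of UNIV ph "%x v. dir_deriv ph v x" C x y] smooth_has_derivative[OF s] by simp
 moreover have "0 <= C" unfolding C_def using B by (intro sum_nonneg) (meson abs_ge_zero order_trans)
 ultimately show thesis using that by blast
qed

text \<open>The mean value inequality for \<open>ph\<close> minus its linear part at
  \<open>x\<close>, on the ball about \<open>x\<close> that reaches \<open>y\<close>.\<close>

lemma test_function_Taylor:
 fixes ph :: "'a::euclidean_space => real"
 assumes "test_function U ph"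
 obtains B where "B \<ge> 0" "!!x y. \<bar>ph y - ph x - dir_deriv ph (y - x) x\<bar> <= B * (norm (y - x))^2"
proof -
 note s = test_function_smooth[OF assms]
 have "\<exists>B. \<forall>x y. \<bar>dir_deriv ph b x - dir_deriv ph b y\<bar> <= B * norm (x - y)" for b
  using smooth_lipschitz[OF test_function_dir_deriv[OF assms, of b]] by metis
 then obtain B where B: "!!b x y. \<bar>dir_deriv ph b x - dir_deriv ph b y\<bar> <= B b * norm (x - y)" by metis
 define C where "C = (\<Sum>b\<in>(Basis::'a set). \<bar>B b\<bar>)"
 have grad: "norm (gradient ph x - gradient ph y) <= C * norm (x - y)" for x y
 proof -
  have "norm (gradient ph x - gradient ph y) <= (\<Sum>b\<in>Basis. \<bar>(gradient ph x - gradient ph y) \<bullet> b\<bar>)" by (rule norm_le_l1)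
  also have "... = (\<Sum>b\<in>Basis. \<bar>dir_deriv ph b x - dir_deriv ph b y\<bar>)"
   by (simp add: dir_deriv_gradient[OF s] inner_diff_left)
  also have "... <= (\<Sum>b\<in>Basis. \<bar>B b\<bar> * norm (x - y))"
   by (intro sum_mono order_trans[OF B] mult_right_mono) auto
  finally show ?thesis by (simp add: C_def sum_distrib_right)
 qed
 have C0: "0 <= C" by (simp add: C_def sum_nonneg)
 have "\<bar>ph y - ph x - dir_deriv ph (y - x) x\<bar> <= C * (norm (y - x))^2" for x y
 proof -
  define F where "F = (%z. ph z - gradient ph x \<bullet> z)"
  have "(F has_derivative (%v. (gradient ph z - gradient ph x) \<bullet> v)) (at z within S)" for z S
   unfolding F_def using smooth_has_derivative[OF s, of z]
   by (auto intro!: derivative_eq_intros has_derivative_at_withinI[OF smooth_has_derivative[OF s]]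
     simp: inner_diff_left dir_deriv_gradient[OF s])
  moreover have "onorm (%v. (gradient ph z - gradient ph x) \<bullet> v) <= C * norm (y - x)" if "z \<in> cball x (norm (y - x))" for z
  proof (rule onorm_le)
   fix v
   have "norm (gradient ph z - gradient ph x) <= C * norm (y - x)"
    using that C0 by (intro order_trans[OF grad] mult_left_mono) (auto simp: dist_norm norm_minus_commute)
   then show "norm ((gradient ph z - gradient ph x) \<bullet> v) <= C * norm (y - x) * norm v"
    using Cauchy_Schwarz_ineq2[of "gradient ph z - gradient ph x" v] mult_right_mono[of _ _ "norm v"] by fastforce
  qed
  ultimately have "norm (F y - F x) <= C * norm (y - x) * norm (y - x)"
   by (intro differentiable_bound[of "cball x (norm (y - x))" F "%z v. (gradient ph z - gradient ph x) \<bullet> v"])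
    (auto simp: dist_norm norm_minus_commute)
  then show ?thesis
   by (simp add: F_def dir_deriv_gradient[OF s] inner_diff_right power2_eq_square mult.assoc algebra_simps)
 qed
 then show thesis using that C0 by blast
qed

text \<open>Integration against \<open>ph (y - z)\<close>, with no reflection of the kernel:
  derivatives in \<open>z\<close> fall on \<open>ph\<close> with a minus sign, which the minus sign
  in the definition of weak gradients cancels.\<close>

definition mollify :: "('a::euclidean_space => real) => ('a => real) => 'a => real" where
 "mollify ph g z = (LI y. g y * ph (y - z))"

lemma mollify_integrand:
 assumes "test_function U ph" "L1 g"
 shows "L1 (%y. g y * ph (y - z))"
proof -
 obtain B where B: "B > 0" "!!x. \<bar>ph x\<bar> <= B" using test_function_bounded[OF assms(1)] by blast
 have [measurable]: "ph \<in> Borel" by (rule smooth_borel_measurable[OF test_function_smooth[OF assms(1)]])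
 note [measurable] = borel_measurable_integrable[OF assms(2)]
 show ?thesis
 proof (rule Bochner_Integration.integrable_bound)
  show "L1 (%y. B * \<bar>g y\<bar>)" using assms by simp
  show "ae y. norm (g y * ph (y - z)) <= norm (B * \<bar>g y\<bar>)"
   using B by (intro AE_I2) (auto simp: abs_mult mult.commute[of B] intro!: mult_left_mono)
 qed measurable
qed

lemma mollify_translate:
 assumes "test_function U ph" "L1 g"
 shows "mollify ph g z = (LI y. g (z + y) * ph y)"
  and "L1 (%y. g (z + y) * ph y)"
proof -
 have m: "(%y. g y * ph (y - z)) \<in> Borel"
  using borel_measurable_integrable[OF mollify_integrand[OF assms]] by simp
 from integral_translate[OF m, of z] show "mollify ph g z = (LI y. g (z + y) * ph y)"
  by (simp add: mollify_def add.commute)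
 from integrable_translate[OF m, of z] mollify_integrand[OF assms]
 show "L1 (%y. g (z + y) * ph y)" by (simp add: add.commute)
qed

text \<open>The second order Taylor remainder of \<open>ph\<close> is bounded uniformly in the base
  point, so it can be integrated against \<open>|g|\<close>.\<close>

lemma mollify_has_derivative:
 assumes ph: "test_function U ph" and g: "L1 g"
 shows "(mollify ph g has_derivative (%v. - mollify (dir_deriv ph v) g z)) (at z)"
proof -
 note s = test_function_smooth[OF ph] and D = test_function_dir_deriv[OF ph]
 obtain B where B: "B \<ge> 0" "!!x y. \<bar>ph y - ph x - dir_deriv ph (y - x) x\<bar> <= B * (norm (y - x))^2"
  using test_function_Taylor[OF ph] by blast
 note lin = linear_dir_deriv[OF s]
 have add: "mollify (dir_deriv ph (a + b)) g z = mollify (dir_deriv ph a) g z + mollify (dir_deriv ph b) g z" for a b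
  unfolding mollify_def
  by (subst Bochner_Integration.integral_add[symmetric]) (auto intro!: mollify_integrand[OF D g] simp: linear_add[OF lin] distrib_left)
 have scale: "mollify (dir_deriv ph (c *R a)) g z = c * mollify (dir_deriv ph a) g z" for c a
  unfolding mollify_def by (simp add: linear_cmul[OF lin] mult.left_commute)
 have bl: "bounded_linear (%v. - mollify (dir_deriv ph v) g z)"
  by (intro linear_conv_bounded_linear[THEN iffD1] linearI) (simp_all add: add scale)
 define C where "C = B * (LI y. \<bar>g y\<bar>)"
 have est: "norm (mollify ph g w - mollify ph g z - (- mollify (dir_deriv ph (w - z)) g z)) <= C * (norm (w - z))^2" for w
 proof -
  have i: "L1 (%y. g y * ph (y - w))" "L1 (%y. g y * ph (y - z))"
   "L1 (%y. g y * dir_deriv ph (w - z) (y - z))"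
   by (intro mollify_integrand[OF ph g] mollify_integrand[OF D g])+
  have neg: "dir_deriv ph (w - z) x = - dir_deriv ph (z - w) x" for x
   using linear_neg[OF linear_dir_deriv[OF s, of x], of "w - z"] by simp
  have "mollify ph g w - mollify ph g z - (- mollify (dir_deriv ph (w - z)) g z)
    = (LI y. g y * ph (y - w) - g y * ph (y - z) + g y * dir_deriv ph (w - z) (y - z))"
   unfolding mollify_def using i by simp
  also have "norm ... <= (LI y. B * (norm (w - z))^2 * \<bar>g y\<bar>)"
  proof (rule order_trans[OF integral_norm_bound integral_mono])
   fix y
   have "\<bar>ph (y - w) - ph (y - z) - dir_deriv ph (z - w) (y - z)\<bar> <= B * (norm (w - z))^2"
    using B(2)[of "y - w" "y - z"] by (simp add: norm_minus_commute)
   then have "\<bar>g y\<bar> * \<bar>ph (y - w) - ph (y - z) - dir_deriv ph (z - w) (y - z)\<bar> <= \<bar>g y\<bar> * (B * (norm (w - z))^2)"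
    by (rule mult_left_mono) simp
   then show "norm (g y * ph (y - w) - g y * ph (y - z) + g y * dir_deriv ph (w - z) (y - z)) <= B * (norm (w - z))^2 * \<bar>g y\<bar>"
    unfolding abs_mult[symmetric] by (simp add: neg algebra_simps)
  qed (use i g in auto)
  finally show ?thesis by (simp add: C_def mult.commute mult.left_commute)
 qed
 show ?thesis
 proof (rule has_derivativeI_sandwich[of 1, OF _ bl])
  show "((%w. C * norm (w - z)) \<longlongrightarrow> 0) (at z)" by (auto intro!: tendsto_eq_intros)
  show "norm (mollify ph g w - mollify ph g z - (- mollify (dir_deriv ph (w - z)) g z)) / norm (w - z) <= C * norm (w - z)"
   if "w \<noteq> z" for w
   using est[of w] that by (simp add: divide_le_eq power2_eq_square mult.assoc)
 qed simp
qed

lemma mollify_smooth: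
 assumes ph: "test_function U ph" and g: "L1 g"
 shows "smooth (mollify ph g)" "dir_deriv (mollify ph g) v z = - mollify (dir_deriv ph v) g z"
proof -
 have "C_k k (mollify ph g)" for k using ph
 proof (induction k arbitrary: ph)
  case 0
  show ?case unfolding C_k.simps by (rule has_derivative_continuous_on[OF mollify_has_derivative[OF 0 g]])
 next
  case (Suc k)
  then show ?case
   by (intro C_k_SucI[OF mollify_has_derivative[OF _ g]] C_k_uminus Suc.IH test_function_dir_deriv)
 qed
 then show "smooth (mollify ph g)" by (simp add: smooth_def)
 show "dir_deriv (mollify ph g) v z = - mollify (dir_deriv ph v) g z"
  by (rule dir_deriv_eq[OF mollify_has_derivative[OF ph g]])
qed

text \<open>If the ball of radius \<open>r\<close> about \<open>z\<close> lies in \<open>Om\<close>,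
  then the kernel centred at \<open>z\<close> is itself a test function for the weak
  gradient.\<close>

lemma mollify_weak_gradient:
 assumes ph: "test_function (ball 0 r) ph" and wg: "weak_gradient Om g G" and z: "cball z r <= Om"
 shows "dir_deriv (mollify ph g) v z = mollify ph (%y. G y \<bullet> v) z"
proof -
 have g: "L1 g" using wg by (simp add: weak_gradient_def)
 define \<psi> where "\<psi> = (%y. ph ((-z) + 1 *R y))"
 obtain K where K: "compact K" "K <= ball 0 r" "!!x. x \<notin> K ==> ph x = 0"
  using ph unfolding test_function_iff by blast
 have "test_function Om \<psi>"
 proof (rule test_functionI)
  show "smooth \<psi>" unfolding \<psi>_def by (rule smooth_affine[OF test_function_smooth[OF ph]])
  show "compact ((+) z ` K)" by (rule compact_translation[OF K(1)])
  show "(+) z ` K <= Om" using K(2) z by (force simp: dist_norm)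
  show "\<psi> x = 0" if "x \<notin> (+) z ` K" for x
   using K(3)[of "x - z"] that image_eqI[of x "(+) z" "x - z" K] by (auto simp: \<psi>_def)
 qed
 then have eq: "(LI y. g y * dir_deriv \<psi> v y) = - (LI y. (G y \<bullet> v) * \<psi> y)"
  using wg by (simp add: weak_gradient_def)
 have "C_k (Suc 0) ph" using test_function_smooth[OF ph] unfolding smooth_def by blast
 then have "dir_deriv \<psi> v y = dir_deriv ph v (y - z)" for y
  unfolding \<psi>_def by (subst dir_deriv_affine) auto
 with eq show ?thesis
  unfolding mollify_smooth(2)[OF ph g] by (simp add: mollify_def \<psi>_def)
qed

text \<open>The error is an average over \<open>y\<close> of the translation differences of
  \<open>f\<close>, weighted by \<open>ph\<close>, and only \<open>y\<close> with
  \<open>norm y < d\<close> contribute.\<close>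

lemma mollify_L1:
 fixes f :: "'a::euclidean_space => real"
 assumes ph: "test_function (ball 0 d) ph" "!!x. 0 <= ph x" "(LI x. ph x) = 1"
  and f: "L1 f" and d: "!!v. norm v < d ==> (LI z. \<bar>f (z + v) - f z\<bar>) <= e"
 shows "L1 (mollify ph f)" "(LI z. \<bar>mollify ph f z - f z\<bar>) <= e"
proof -
 have [measurable]: "ph \<in> Borel" by (rule smooth_borel_measurable[OF test_function_smooth[OF ph(1)]])
 note [measurable] = borel_measurable_integrable[OF f]
 note phj = test_function_integrable[OF ph(1)]
 define \<omega> where "\<omega> = (%v. LI z. \<bar>f (z + v) - f z\<bar>)"
 have it: "L1 (%z. f (z + v))" for v using f by (simp add: integrable_translate)
 have le: "ph y * \<omega> y <= ph y * e" for y
 proof (cases "norm y < d")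
  case True then show ?thesis using d ph(2) by (auto simp: \<omega>_def intro!: mult_left_mono)
 next
  case False then show ?thesis using test_function_outside[OF ph(1), of y] by simp
 qed
 have \<omega>0: "0 <= \<omega> y" for y by (simp add: \<omega>_def)
 have m: "(%(y, z). ph y * (f (z + y) - f z)) \<in> borel_measurable (lborel \<Otimes>\<^sub>M lborel)" by measurable
 have \<omega>m: "\<omega> \<in> borel_measurable lborel" unfolding \<omega>_def by measurable
 have ab: "(LI z. norm (ph y * (f (z + y) - f z))) = ph y * \<omega> y" for y
  using ph(2) by (simp add: abs_mult \<omega>_def)
 have ph\<omega>: "L1 (%y. ph y * \<omega> y)"
 proof (rule Bochner_Integration.integrable_bound)
  show "L1 (%y. ph y * e)" using phj by simp
  show "ae y. norm (ph y * \<omega> y) <= norm (ph y * e)"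
  proof (rule AE_I2)
   fix y
   have "\<bar>ph y * \<omega> y\<bar> = ph y * \<omega> y" using ph(2) \<omega>0 by simp
   also have "... <= \<bar>ph y * e\<bar>" using le[of y] by linarith
   finally show "norm (ph y * \<omega> y) <= norm (ph y * e)" by simp
  qed
 qed (use \<omega>m in measurable)
 have F: "integrable (lborel \<Otimes>\<^sub>M lborel) (%(y, z). ph y * (f (z + y) - f z))"
  by (rule lborel_pair.Fubini_integrable[OF m]) (use it f ph\<omega> in \<open>auto simp: ab simp del: real_norm_def\<close>)
 have Fn: "integrable (lborel \<Otimes>\<^sub>M lborel) (%(y, z). \<bar>ph y * (f (z + y) - f z)\<bar>)"
  using integrable_norm[OF F] by (simp add: case_prod_unfold)
 have eq: "mollify ph f z - f z = (LI y. ph y * (f (z + y) - f z))" for z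
 proof -
  have "(LI y. ph y * (f (z + y) - f z)) = (LI y. f (z + y) * ph y - f z * ph y)"
   by (simp add: algebra_simps)
  also have "... = mollify ph f z - f z * (LI y. ph y)"
   using mollify_translate[OF ph(1) f, of z] phj by simp
  finally show ?thesis by (simp add: ph(3))
 qed
 have int: "L1 (%z. mollify ph f z - f z)"
  unfolding eq using lborel_pair.integrable_snd[OF F] by simp
 from Bochner_Integration.integrable_add[OF this f] show "L1 (mollify ph f)" by simp
 have "(LI z. \<bar>mollify ph f z - f z\<bar>) <= (LI z. LI y. \<bar>ph y * (f (z + y) - f z)\<bar>)"
 proof (rule integral_mono)
  show "L1 (%z. LI y. \<bar>ph y * (f (z + y) - f z)\<bar>)"
   using lborel_pair.integrable_snd[OF Fn] by simp
  show "\<bar>mollify ph f z - f z\<bar> <= (LI y. \<bar>ph y * (f (z + y) - f z)\<bar>)" for z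
   unfolding eq by (rule integral_abs_bound)
 qed (use int in simp)
 also have "... = (LI y. LI z. \<bar>ph y * (f (z + y) - f z)\<bar>)"
  using lborel_pair.Fubini_integral[OF Fn] by simp
 also have "... = (LI y. ph y * \<omega> y)" using ab by simp
 also have "... <= (LI y. ph y * e)" using phj ph\<omega> le by (intro integral_mono) auto
 finally show "(LI z. \<bar>mollify ph f z - f z\<bar>) <= e" by (simp add: ph(3))
qed

text \<open>At each index one kernel serves a whole finite family, with errors at most
  \<open>(1/2)^j\<close>, so that the errors are summable.\<close>

lemma mollifier_sequence:
 fixes f :: "'i => 'a::euclidean_space => real"
 assumes I: "finite I" and f: "!!i. i \<in> I ==> L1 (f i)"
 shows "\<exists>ph :: nat => 'a => real. \<forall>j. test_function (ball 0 ((1/2)^j)) (ph j) \<and> (\<forall>x. 0 <= ph j x) \<and>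
  (LI x. ph j x) = 1 \<and>
  (\<forall>i\<in>I. L1 (mollify (ph j) (f i)) \<and> (LI z. \<bar>mollify (ph j) (f i) z - f i z\<bar>) <= (1/2)^j)"
proof -
 have "\<exists>ph. test_function (ball 0 ((1/2)^j)) ph \<and> (\<forall>x. 0 <= ph x) \<and> (LI x. ph x) = 1 \<and>
  (\<forall>i\<in>I. L1 (mollify ph (f i)) \<and> (LI z. \<bar>mollify ph (f i) z - f i z\<bar>) <= (1/2)^j)" for j :: nat
 proof -
  have "\<exists>d>0. \<forall>v. norm v < d --> (LI z. \<bar>f i (z + v) - f i z\<bar>) < (1/2)^j" if "i \<in> I" for i
   by (rule L1_translate_continuous[OF f[OF that], of "(1/2)^j"], simp, blast)
  then have "\<forall>i\<in>I. \<exists>d. d > 0 \<and> (\<forall>v. norm v < d --> (LI z. \<bar>f i (z + v) - f i z\<bar>) < (1/2)^j)" by simp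
  from bchoice[OF this] obtain d where d: "!!i. i \<in> I ==> d i > 0"
   "!!i v. i \<in> I ==> norm v < d i ==> (LI z. \<bar>f i (z + v) - f i z\<bar>) < (1/2)^j" by blast
  define r where "r = Min (insert ((1/2)^j) (d ` I))"
  have r: "r > 0" "r <= (1/2)^j" "!!i. i \<in> I ==> r <= d i" unfolding r_def using I d(1) by auto
  obtain ph :: "'a => real" where ph: "test_function (ball 0 r) ph" "!!x. 0 <= ph x" "(LI x. ph x) = 1"
   using mollifier_exists[OF r(1)] by blast
  have "L1 (mollify ph (f i))" "(LI z. \<bar>mollify ph (f i) z - f i z\<bar>) <= (1/2)^j" if "i \<in> I" for i
   using mollify_L1[OF ph f[OF that], of "(1/2)^j"] d(2)[OF that] r(3)[OF that] by (force intro: less_imp_le)+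
  moreover have "test_function (ball 0 ((1/2)^j)) ph" by (rule test_function_mono[OF ph(1)]) (use r(2) in auto)
  ultimately show ?thesis using ph(2,3) by blast
 qed
 from choice[OF allI[OF this]] show ?thesis .
qed

text \<open>The sum over \<open>j\<close> of the errors \<open>|f j - f0|\<close> is integrable; its
  finiteness almost everywhere gives pointwise convergence, and the sum itself is a dominating
  function.\<close>

lemma fast_L1_convergence:
 fixes f :: "nat => 'a => real"
 assumes f: "integrable M f0" "!!j. integrable M (f j)" "!!j. (LINT z|M. \<bar>f j z - f0 z\<bar>) <= (1/2)^j"
 obtains F where "integrable M F" "!!z. 0 <= F z" "AE z in M. (\<forall>j. \<bar>f j z - f0 z\<bar> <= F z) \<and> (%j. f j z) \<longlonglongrightarrow> f0 z"
proof -
 define F where "F = (%z. \<Sum>j. \<bar>f j z - f0 z\<bar>)"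
 have i: "integrable M (%z. \<bar>f j z - f0 z\<bar>)" for j using f by auto
 have sum: "summable (%j. LINT z|M. \<bar>f j z - f0 z\<bar>)"
  by (rule summable_comparison_test'[of "%j. (1/2)^j" 0]) (use f(3) in \<open>auto simp: summable_geometric\<close>)
 have ae: "AE z in M. summable (%j. \<bar>f j z - f0 z\<bar>)"
 proof -
  have "(\<integral>\<^sup>+z. (\<Sum>j. ennreal \<bar>f j z - f0 z\<bar>) \<partial>M) = (\<Sum>j. \<integral>\<^sup>+z. ennreal \<bar>f j z - f0 z\<bar> \<partial>M)"
   using i by (intro nn_integral_suminf) auto
  also have "... = (\<Sum>j. ennreal (LINT z|M. \<bar>f j z - f0 z\<bar>))" using i by (simp add: nn_integral_eq_integral)
  also have "... \<noteq> \<infinity>" by (rule ennreal_suminf_neq_top[OF sum, folded infinity_ennreal_def]) simp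
  finally have "AE z in M. (\<Sum>j. ennreal \<bar>f j z - f0 z\<bar>) \<noteq> \<infinity>"
   using f by (intro nn_integral_PInf_AE) auto
  then show ?thesis by eventually_elim (auto intro: summable_suminf_not_top)
 qed
 have "integrable M F" unfolding F_def by (rule integrable_suminf[OF i]) (use ae sum in auto)
 moreover have "AE z in M. (\<forall>j. \<bar>f j z - f0 z\<bar> <= F z) \<and> (%j. f j z) \<longlonglongrightarrow> f0 z"
  using ae
 proof eventually_elim
  case (elim z)
  have "\<bar>f j z - f0 z\<bar> <= F z" for j
   unfolding F_def using sum_le_suminf[OF elim, of "{j}"] by auto
  moreover have "(%j. f j z - f0 z) \<longlonglongrightarrow> 0" using summable_LIMSEQ_zero[OF elim] by (simp add: tendsto_rabs_zero_iff)
  ultimately show ?case by (simp add: LIM_zero_iff)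
 qed
 then have "AE z in M. (\<forall>j. \<bar>f j z - f0 z\<bar> <= \<bar>F z\<bar>) \<and> (%j. f j z) \<longlonglongrightarrow> f0 z"
  by eventually_elim (meson abs_ge_self order_trans)
 ultimately show thesis using that[of "%z. \<bar>F z\<bar>"] by simp
qed

section \<open>Lebesgue differentiation along lines\<close>

text \<open>By Fubini the measure of the complement is the integral over \<open>z\<close> of the
  time in \<open>[0,1]\<close> that the line through \<open>z\<close> spends there.\<close>

lemma AE_along_line:
 fixes S :: "'a::euclidean_space set"
 assumes S[measurable]: "S \<in> sets borel" and ae: "ae z. ae t. z + t *R v \<in> S"
 shows "ae z. z \<in> S"
proof -
 define T where "T = - S"
 have T[measurable]: "T \<in> sets borel" using S by (simp add: T_def)
 have m: "(%(z, t::real). ind {0..1} t * ind T (z + t *R v) :: ennreal) \<in> borel_measurable (lborel \<Otimes>\<^sub>M lborel)"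
  by measurable
 have "emeasure lborel T = (\<integral>\<^sup>+z. ind T z \<partial>lborel)" by simp
 also have "... = (\<integral>\<^sup>+t. ind {0..1::real} t * (\<integral>\<^sup>+z. ind T z \<partial>lborel) \<partial>lborel)"
  by (subst nn_integral_multc) auto
 also have "... = (\<integral>\<^sup>+t. \<integral>\<^sup>+z. ind {0..1::real} t * ind T (z + t *R v) \<partial>lborel \<partial>lborel)"
  by (subst nn_integral_cmult) (auto simp: nn_integral_translate[of "ind T"])
 also have "... = (\<integral>\<^sup>+z. \<integral>\<^sup>+t. ind {0..1::real} t * ind T (z + t *R v) \<partial>lborel \<partial>lborel)"
  by (rule lborel_pair.Fubini'[OF m])
 also have "... = (\<integral>\<^sup>+z. 0 \<partial>(lborel :: 'a measure))"
 proof (rule nn_integral_cong_AE, rule AE_mp[OF ae], intro AE_I2 impI)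
  fix z assume "ae t. z + t *R v \<in> S"
  then have "ae t. ind {0..1::real} t * ind T (z + t *R v) = (0::ennreal)"
   by (auto elim!: eventually_mono simp: T_def)
  then show "(\<integral>\<^sup>+t. ind {0..1::real} t * ind T (z + t *R v) \<partial>lborel) = 0"
   by (subst nn_integral_0_iff_AE) auto
 qed
 finally have "emeasure lborel T = 0" by simp
 then show ?thesis by (subst AE_iff_measurable[of T]) (auto simp: T_def)
qed

lemma integral_upto_eq_HK:
 fixes f :: "real => real"
 assumes "L1 (%t. ind {a..b} t * f t)" "a <= c" "c <= d" "d <= b"
 shows "f integrable_on {c..d}" "(LI t. ind {c..d} t * f t) = integral {c..d} f"
proof -
 have "L1 (%t. ind {c..d} t *R (ind {a..b} t * f t))"
  by (rule integrable_mult_indicator) (use assms in auto)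
 also have "(%t. ind {c..d} t *R (ind {a..b} t * f t)) = (%t. ind {c..d} t *R f t)"
  using assms by (auto simp: indicator_def fun_eq_iff)
 finally have "set_integrable lborel {c..d} f" by (simp add: set_integrable_def)
 from set_borel_integral_eq_integral[OF this]
 show "f integrable_on {c..d}" "(LI t. ind {c..d} t * f t) = integral {c..d} f"
  by (auto simp: set_lebesgue_integral_def)
qed

lemma Lebesgue_differentiation_real:
 fixes f :: "real => real"
 assumes f: "!!n::nat. L1 (%t. ind {- real n..real n} t * f t)"
 shows "ae t. ((%h. (LI s. ind {0..h} s * f (t + s)) / h) \<longlongrightarrow> f t) (at_right 0)"
proof -
 have HK: "f integrable_on {c..d}" "(LI t. ind {c..d} t * f t) = integral {c..d} f" if "c <= d" for c d
 proof -
  obtain n :: nat where n: "\<bar>c\<bar> + \<bar>d\<bar> <= real n" using real_arch_simple by blast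
  then have "- real n <= c" "d <= real n" by auto
  from integral_upto_eq_HK[OF f[of n] this(1) that this(2)]
  show "f integrable_on {c..d}" "(LI t. ind {c..d} t * f t) = integral {c..d} f" by auto
 qed
 have on: "f integrable_on cbox a b" for a b using HK(1)[of a b] by (cases "a <= b") auto
 obtain N where N: "negligible N" "!!x e. x \<notin> N ==> 0 < e ==>
   \<exists>d>0. \<forall>h. 0 < h \<and> h < d --> norm (integral (cbox x (x + h *R One)) f /\<^sub>R h ^ DIM(real) - f x) < e"
  using integrable_ccontinuous_explicit[of f] on by blast
 have "AE x in lebesgue. x \<notin> N" using N(1) by (simp add: AE_not_in negligible_iff_null_sets)
 then have "ae x. x \<notin> N" by (simp add: AE_completion_iff)
 then show ?thesis
 proof (rule AE_mp, intro AE_I2 impI)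
  fix x assume x: "x \<notin> N"
  have eq: "(LI s. ind {0..h} s * f (x + s)) = integral {x..x+h} f" if "h > 0" for h
  proof -
   have "(LI t. ind {x..x+h} t * f t) = \<bar>1\<bar> * (LI s. ind {x..x+h} (x + 1 * s) * f (x + 1 * s))"
    using lborel_integral_real_affine[of 1 "%t. ind {x..x+h} t * f t" x] by simp
   also have "... = (LI s. ind {0..h} s * f (x + s))" by (simp add: indicator_def)
   finally show ?thesis using HK(2)[of x "x + h"] that by simp
  qed
  show "((%h. (LI s. ind {0..h} s * f (x + s)) / h) \<longlongrightarrow> f x) (at_right 0)"
  proof (rule tendstoI)
   fix e :: real assume "0 < e"
   from N(2)[OF x this] obtain d where d: "d > 0" "\<forall>h. 0 < h \<and> h < d --> norm (integral (cbox x (x + h *R One)) f /\<^sub>R h ^ DIM(real) - f x) < e"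
    by blast
   have "(LI s. ind {0..h} s * f (x + s)) / h = integral (cbox x (x + h *R One)) f /\<^sub>R h ^ DIM(real)" if "h > 0" for h
    unfolding eq[OF that] by (simp add: divide_inverse)
   note eq2 = this
   show "\<forall>\<^sub>F h in at_right 0. dist ((LI s. ind {0..h} s * f (x + s)) / h) (f x) < e"
    unfolding eventually_at_right_field
    using d by (intro exI[of _ d]) (simp add: eq2 dist_norm del: scaleR_conv_of_real)
  qed
 qed
qed

text \<open>The condition at rational parameters is countable, so the base points where it holds
  form a Borel set; continuity recovers the limit over all real parameters.\<close>

lemma rational_tendsto_at_right:
 fixes \<Psi> :: "real => real"
 assumes cont: "continuous_on {0<..1} \<Psi>"
  and lim: "!!i::nat. \<exists>j::nat. \<forall>q. 0 < real_of_rat q \<and> real_of_rat q < 1 / Suc j --> \<bar>\<Psi> (real_of_rat q) - l\<bar> <= 1 / Suc i"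
 shows "(\<Psi> \<longlongrightarrow> l) (at_right 0)"
proof (rule tendstoI)
 fix e :: real assume "0 < e"
 then obtain i :: nat where i: "1 / Suc i < e" using reals_Archimedean[of e] by (auto simp: divide_inverse)
 obtain j :: nat where j: "!!h. h \<in> \<rat> ==> 0 < h ==> h < 1 / Suc j ==> \<bar>\<Psi> h - l\<bar> <= 1 / Suc i" using lim[of i] unfolding Rats_def by blast
 have "\<bar>\<Psi> h - l\<bar> <= 1 / Suc i" if h: "0 < h" "h < 1 / Suc j" for h
 proof -
  have j1: "1 / (1 + real j) <= 1" by simp
  have c: "continuous_on {0<..<1 / Suc j} (%h. \<bar>\<Psi> h - l\<bar>)"
   by (intro continuous_intros continuous_on_subset[OF cont]) (auto intro: less_imp_le[OF less_le_trans[OF _ j1]])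
  have "h \<in> closure (\<rat> \<inter> {0<..<1 / Suc j})"
  proof -
   have "\<exists>y\<in>\<rat> \<inter> {0<..<1 / Suc j}. dist y h < e" if "e > 0" for e
   proof -
    have "max 0 (h - e) < h" using h that by simp
    from Rats_dense_in_real[OF this] obtain r where "r \<in> \<rat>" "max 0 (h - e) < r" "r < h" by blast
    then show ?thesis using h by (intro bexI[of _ r]) (auto simp: dist_real_def)
   qed
   then show ?thesis by (simp add: closure_approachable)
  qed
  then obtain s where s: "!!n. s n \<in> \<rat> \<inter> {0<..<1 / Suc j}" "s \<longlonglongrightarrow> h" unfolding closure_sequential by blast
  have "(%n. \<bar>\<Psi> (s n) - l\<bar>) \<longlonglongrightarrow> \<bar>\<Psi> h - l\<bar>"
   using continuous_on_tendsto_compose[OF c s(2)] s(1) h by auto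
  then show ?thesis by (rule LIMSEQ_le_const2) (use s(1) j in auto)
 qed
 then show "\<forall>\<^sub>F h in at_right 0. dist (\<Psi> h) l < e"
  unfolding eventually_at_right_field using i by (intro exI[of _ "1 / Suc j"]) (force simp: dist_real_def)
qed

text \<open>On one line this is Lebesgue's theorem for a function of \<open>t\<close>, valid at
  almost every point of the line. \<open>AE_along_line\<close> turns it into almost every base point
  for a fixed direction, and Fubini's theorem treats all directions.\<close>

lemma Lebesgue_differentiation_lines:
 fixes H :: "'a::euclidean_space \<times> 'a => real"
 assumes H[measurable]: "H \<in> Borel" and Hi: "!!v. L1 (%z. H (z, v))"
 shows "ae p. (\<forall>n::nat. L1 (%t. ind {- real n..real n} t * H (pt p t, snd p))) \<and>
  ((%h. (LI t. ind {0..h} t * H (pt p t, snd p)) / h) \<longlongrightarrow> H p) (at_right 0)"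
proof -
 define I where "I = (%p::'a\<times>'a. \<forall>n::nat. L1 (%t. ind {- real n..real n} t * H (pt p t, snd p)))"
 define A where "A = (%(p::'a\<times>'a) h. LI t. ind {0..h} t * H (pt p t, snd p))"
 \<comment> \<open>A Borel form of the conclusion: the limit is expressed by countably many
   conditions at rational \<open>h\<close>.\<close>
 define S where "S = (%p. I p \<and> (\<forall>i::nat. \<exists>j::nat. \<forall>q. 0 < real_of_rat q \<and> real_of_rat q < 1 / Suc j --> \<bar>A p (real_of_rat q) / real_of_rat q - H p\<bar> <= 1 / Suc i))"
 have Hm[measurable]: "(%(p::'a\<times>'a, t::real). H (pt p t, snd p)) \<in> borel_measurable (borel \<Otimes>\<^sub>M borel)"
 proof -
  have "continuous_on UNIV (%(p::'a\<times>'a, t::real). (pt p t, snd p))"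
   unfolding case_prod_unfold by (intro continuous_intros)
  then have "(%(p::'a\<times>'a, t::real). (pt p t, snd p)) \<in> Borel"
   by (rule borel_measurable_continuous_onI)
  from measurable_compose[OF this H] show ?thesis by (simp add: case_prod_unfold borel_prod)
 qed
 have Hm'[measurable]: "(%(p::'a\<times>'a, t::real). H (pt p t, snd p)) \<in> borel_measurable (borel \<Otimes>\<^sub>M lborel)"
  using Hm by (simp cong: measurable_cong_sets)
 have [measurable]: "(%p. A p h) \<in> Borel" for h
  unfolding A_def by measurable
 have I_meas[measurable]: "Measurable.pred borel I"
 proof -
  have "I = (%p. \<forall>n::nat. (\<integral>\<^sup>+t. ennreal \<bar>ind {- real n..real n} t * H (pt p t, snd p)\<bar> \<partial>lborel) < \<infinity>)"
   unfolding I_def integrable_iff_bounded by (auto simp: fun_eq_iff)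
  also have "Measurable.pred borel ..." by measurable
  finally show ?thesis .
 qed
 have S_meas[measurable]: "Measurable.pred borel S"
  unfolding S_def by measurable
 have I_ae: "ae z. I (z, v)" for v
 proof -
  have "ae z. L1 (%t. ind {- real n..real n} t * H (z + t *R v, v))" for n :: nat
  proof -
   have "integrable (lborel \<Otimes>\<^sub>M lborel) (%(t, z). (%t z. ind {- real n..real n} t * H (z + t *R v, v)) t z)"
    using line_Fubini[OF Hi[of v], of "ind {- real n..real n}" v] by simp
   from lborel_pair.AE_integrable_snd[OF this] show ?thesis by simp
  qed
  then show ?thesis unfolding I_def by (simp add: AE_all_countable)
 qed
 have "ae z. S (z, v)" for v
 proof -
  have m: "{z. S (z, v)} \<in> sets borel" by measurable
  have "ae z. z \<in> {z. S (z, v)}"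
  proof (rule AE_along_line[OF m, of v], rule AE_mp[OF I_ae[of v]], rule AE_I2, rule impI)
   fix z assume Iz: "I (z, v)"
   define f where "f = (%t. H (z + t *R v, v))"
   have fi: "L1 (%t. ind {- real n..real n} t * f t)" for n :: nat
    using Iz by (simp add: I_def f_def)
   from Lebesgue_differentiation_real[OF fi]
   show "ae t. z + t *R v \<in> {z. S (z, v)}"
   proof (rule AE_mp, intro AE_I2 impI)
    fix t assume lim: "((%h. (LI s. ind {0..h} s * f (t + s)) / h) \<longlongrightarrow> f t) (at_right 0)"
    have fs: "H (z + t *R v + s *R v, v) = f (t + s)" for s by (simp add: f_def algebra_simps)
    \<comment> \<open>Moving the base point along its line shifts the parameter, so integrability on
      all bounded intervals is inherited; this is why \<open>I\<close> asks for every
      \<open>n\<close>.\<close>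
    have "I (z + t *R v, v)"
     unfolding I_def
    proof (intro allI)
     fix n :: nat
     obtain m :: nat where m: "real n + \<bar>t\<bar> <= real m" using real_arch_simple by blast
     have "L1 (%s. ind {- real m..real m} (t + 1 * s) * f (t + 1 * s))"
      using lborel_integrable_real_affine[OF fi[of m], of 1 t] by simp
     then have "L1 (%s. ind {- real n..real n} s *R (ind {- real m..real m} (t + 1 * s) * f (t + 1 * s)))"
      by (intro integrable_mult_indicator) auto
     also have "(%s. ind {- real n..real n} s *R (ind {- real m..real m} (t + 1 * s) * f (t + 1 * s)))
       = (%s. ind {- real n..real n} s * f (t + s))"
      using m by (auto simp: indicator_def fun_eq_iff)
     finally show "L1 (%s. ind {- real n..real n} s * H (fst (z + t *R v, v) + s *R snd (z + t *R v, v), snd (z + t *R v, v)))"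
      by (simp add: fs)
    qed
    moreover have "\<exists>j::nat. \<forall>q. 0 < real_of_rat q \<and> real_of_rat q < 1 / Suc j --> \<bar>A (z + t *R v, v) (real_of_rat q) / real_of_rat q - H (z + t *R v, v)\<bar> <= 1 / Suc i" for i :: nat
    proof -
     have "\<forall>\<^sub>F h in at_right 0. dist ((LI s. ind {0..h} s * f (t + s)) / h) (f t) < 1 / Suc i"
      by (rule tendstoD[OF lim]) simp
     then obtain b where b: "b > 0" "!!h. 0 < h ==> h < b ==> dist ((LI s. ind {0..h} s * f (t + s)) / h) (f t) < 1 / Suc i"
      unfolding eventually_at_right_field by auto
     obtain j :: nat where "1 / Suc j < b" using reals_Archimedean[OF b(1)] by (auto simp: divide_inverse)
     then show ?thesis
      using b(2) by (intro exI[of _ j]) (force simp: A_def fs dist_real_def f_def intro: less_imp_le)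
    qed
    ultimately show "z + t *R v \<in> {z. S (z, v)}" by (simp add: S_def)
   qed
  qed
  then show ?thesis by simp
 qed
 then have "ae p. S p" by (subst AE_lborel_prod_iff(1)) auto
 then show ?thesis
 proof (rule AE_mp, intro AE_I2 impI conjI)
  fix p assume p: "S p"
  then have Ip: "I p" by (simp add: S_def)
  then show "\<forall>n::nat. L1 (%t. ind {- real n..real n} t * H (pt p t, snd p))" by (simp add: I_def)
  define f where "f = (%t. H (pt p t, snd p))"
  have f1: "L1 (%t. ind {- real 1..real 1} t * f t)" using Ip unfolding I_def f_def by blast
  have Af: "A p h = integral {0..h} f" if "h \<in> {0..1}" for h
   using integral_upto_eq_HK(2)[OF f1, of 0 h] that by (simp add: A_def f_def)
  have "continuous_on {0..1} (%h. integral {0..h} f)"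
   using integral_upto_eq_HK(1)[OF f1, of 0 1] by (intro indefinite_integral_continuous_1) auto
  then have "continuous_on {0..1} (A p)" by (rule continuous_on_eq) (simp add: Af)
  then have "continuous_on {0<..1} (A p)" by (rule continuous_on_subset) auto
  then have "continuous_on {0<..1} (%h. A p h / h)"
   by (intro continuous_on_divide continuous_on_id) auto
  then show "((%h. (LI t. ind {0..h} t * H (pt p t, snd p)) / h) \<longlongrightarrow> H p) (at_right 0)"
   using rational_tendsto_at_right[of "%h. A p h / h" "H p"] p by (simp add: S_def A_def)
 qed
qed

lemma borel_measurable_line_comp:
 fixes f :: "'a::euclidean_space => 'b::topological_space"
 assumes "f \<in> Borel"
 shows "(%p::'a \<times> 'a. f (pt p t)) \<in> Borel"
proof -
 have "(%p::'a \<times> 'a. pt p t) \<in> Borel"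
  by (intro borel_measurable_continuous_onI continuous_intros)
 from measurable_compose[OF this assms] show ?thesis .
qed

lemma borel_measurable_line_integral:
 fixes H :: "'a::euclidean_space \<times> 'a => real" and k :: "real => real"
 assumes H: "H \<in> Borel" and [measurable]: "k \<in> Borel"
 shows "(%p. LI t. k t * H (pt p t, snd p)) \<in> Borel"
  and "Measurable.pred borel (%p. L1 (%t. k t * H (pt p t, snd p)))"
proof -
 have Hm: "(%(p::'a\<times>'a, t::real). H (pt p t, snd p)) \<in> borel_measurable (borel \<Otimes>\<^sub>M borel)"
 proof -
  have "continuous_on UNIV (%(p::'a\<times>'a, t::real). (pt p t, snd p))"
   unfolding case_prod_unfold by (intro continuous_intros)
  then have "(%(p::'a\<times>'a, t::real). (pt p t, snd p)) \<in> Borel"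
   by (rule borel_measurable_continuous_onI)
  from measurable_compose[OF this H] show ?thesis by (simp add: case_prod_unfold borel_prod)
 qed
 have [measurable]: "(%(p::'a\<times>'a, t::real). H (pt p t, snd p)) \<in> borel_measurable (borel \<Otimes>\<^sub>M lborel)"
  using Hm by (simp cong: measurable_cong_sets)
 show "(%p. LI t. k t * H (pt p t, snd p)) \<in> Borel"
  by measurable
 have "(%p. L1 (%t. k t * H (pt p t, snd p)))
   = (%p. (\<integral>\<^sup>+t. ennreal \<bar>k t * H (pt p t, snd p)\<bar> \<partial>lborel) < \<infinity>)"
  unfolding integrable_iff_bounded by (auto simp: fun_eq_iff)
 also have "Measurable.pred borel ..." by measurable
 finally show "Measurable.pred borel (%p. L1 (%t. k t * H (pt p t, snd p)))" .
qed

lemma AE_lines_avoid_null: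
 fixes N :: "'a::euclidean_space set"
 assumes N: "N \<in> sets borel" "ae z. z \<notin> N"
 shows "ae p. ae t::real. pt p t \<notin> N"
proof -
 have "(%q::('a \<times> 'a) \<times> real. fst (fst q) + snd q *R snd (fst q)) \<in> Borel"
  by (intro borel_measurable_continuous_onI continuous_intros)
 moreover have "Measurable.pred borel (%z. z \<notin> N)" using N(1) by measurable
 ultimately have m: "Measurable.pred borel (%q::('a \<times> 'a) \<times> real. fst (fst q) + snd q *R snd (fst q) \<notin> N)"
  by (rule measurable_compose)
 have m2: "Measurable.pred borel (%p::'a \<times> 'a. pt p t \<notin> N)" for t
  using measurable_compose[OF borel_measurable_line_comp[OF measurable_ident], of "%z. z \<notin> N" "count_space UNIV" t] N(1)
  by (simp add: id_def)
 have "ae p. pt p t \<notin> N" for t :: real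
  by (subst AE_lborel_prod_iff(1)[OF m2]) (auto intro!: AE_I2 AE_translate[OF N(2)])
 then show ?thesis
  using AE_lborel_prod_iff(1)[OF m] AE_lborel_prod_iff(2)[OF m] by simp
qed

lemma AE_line_avoid_null:
 fixes N :: "'a::euclidean_space set"
 assumes N: "N \<in> sets borel" "ae z. z \<notin> N"
 shows "ae z. ae t::real. z + t *R v \<notin> N"
proof -
 have "(%q::'a \<times> real. fst q + snd q *R v) \<in> Borel"
  by (intro borel_measurable_continuous_onI continuous_intros)
 moreover have "Measurable.pred borel (%z. z \<notin> N)" using N(1) by measurable
 ultimately have m: "Measurable.pred borel (%q::'a \<times> real. fst q + snd q *R v \<notin> N)"
  by (rule measurable_compose)
 show ?thesis using AE_lborel_prod_iff(1)[OF m] AE_lborel_prod_iff(2)[OF m] AE_translate[OF N(2)] by simp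
qed

lemma AE_lines_integrable:
 fixes H :: "'a::euclidean_space => real"
 assumes "L1 H"
 shows "ae p. L1 (%t. ind {0..1} t * H (pt p t))"
proof -
 have "(%p::'a \<times> 'a. H (fst p)) \<in> Borel"
  using borel_measurable_line_comp[of H 0] assms by auto
 from borel_measurable_line_integral(2)[OF this, of "ind {0..1}"]
 have m: "Measurable.pred borel (%p::'a\<times>'a. L1 (%t. ind {0..1} t * H (pt p t)))" by simp
 show ?thesis
  by (subst AE_lborel_prod_iff(1)[OF m]) (auto intro!: AE_I2 segment_integral_integrable(2)[OF assms])
qed

lemma AE_unit_interval_ex:
 assumes "ae t::real. P t" "a < b"
 shows "\<exists>t. a < t \<and> t < b \<and> P t"
proof (rule ccontr)
 assume "\<not> ?thesis"
 then have "ae t. t \<notin> {a<..<b}" using assms(1) by (auto elim: eventually_mono)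
 then have "{a<..<b} \<in> null_sets lborel" by (subst AE_iff_null_sets) auto
 then show False using assms(2) by (auto simp: null_sets_def)
qed

section \<open>Sobolev functions as primitives on segments\<close>

lemma line_in_segment: "t \<in> {0..1} ==> x + t *R v \<in> closed_segment x (x + v)"
 unfolding in_segment by (intro exI[of _ t]) (auto simp: algebra_simps)

text \<open>Quantified over all segments subject to two conditions, and not over almost all: the
  conditions hold for almost every \<open>z\<close> with \<open>v\<close> fixed as well as for
  almost every pair, and both forms are used.\<close>

definition line_primitive ::
  "'a::euclidean_space set => ('a => 'a) => ('a => real) => 'a set => ('a => real) => bool" where
 "line_primitive Om G gt N H \<longleftrightarrow> (\<forall>x v. closed_segment x (x + v) <= Om --> (ae t::real. x + t *R v \<notin> N) -->
   L1 (%t. ind {0..1} t * H (x + t *R v)) -->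
   L1 (%t. ind {0..1} t * (G (x + t *R v) \<bullet> v)) \<and>
   (\<forall>t\<in>{0..1}. gt (x + t *R v) - gt x = integral {0..t} (%s. G (x + s *R v) \<bullet> v)))"

text \<open>Mollifications of \<open>g\<close> that converge fast in \<open>L1\<close> are dominated by \<open>H\<close>, and \<open>gt\<close> is their pointwise limit.\<close>

lemma weak_gradient_lines:
 fixes g :: "'a::euclidean_space => real"
 assumes wg: "weak_gradient Om g G" and Om: "open Om"
 shows "\<exists>gt N H. N \<in> sets borel \<and> (ae z. z \<notin> N) \<and> (\<forall>z. z \<notin> N --> gt z = g z) \<and> L1 H \<and>
  line_primitive Om G gt N H"
proof -
 have g: "L1 g" and G: "L1 G" using wg by (auto simp: weak_gradient_def)
 have Gb: "L1 (%z. G z \<bullet> b)" for b using G by simp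
 \<comment> \<open>\<open>None\<close> stands for \<open>g\<close> and \<open>Some b\<close> for the
   component of \<open>G\<close> along \<open>b\<close>; one sequence of kernels has to serve all of
   them.\<close>
 define f where "f = (%i. case i of None => g | Some b => (%z. G z \<bullet> b))"
 define I where "I = insert None (Some ` (Basis :: 'a set))"
 have fI: "L1 (f i)" for i using g Gb by (cases i) (auto simp: f_def)
 have "finite I" by (simp add: I_def)
 from mollifier_sequence[OF this fI] obtain ph :: "nat => 'a => real" where
  ph_all: "\<forall>j. test_function (ball 0 ((1/2)^j)) (ph j) \<and> (\<forall>x. 0 <= ph j x) \<and> (LI x. ph j x) = 1 \<and>
  (\<forall>i\<in>I. L1 (mollify (ph j) (f i)) \<and> (LI z. \<bar>mollify (ph j) (f i) z - f i z\<bar>) <= (1/2)^j)" ..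
 then have ph: "test_function (ball 0 ((1/2)^j)) (ph j)" for j by simp
 have mi: "L1 (mollify (ph j) (f i))"
  and ml: "(LI z. \<bar>mollify (ph j) (f i) z - f i z\<bar>) <= (1/2)^j" if "i \<in> I" for i j
  using ph_all that by simp_all
 have "\<forall>i\<in>I. \<exists>F. L1 F \<and> (ae z. (\<forall>j. \<bar>mollify (ph j) (f i) z - f i z\<bar> <= F z) \<and> (%j. mollify (ph j) (f i) z) \<longlonglongrightarrow> f i z)"
 proof
  fix i assume i: "i \<in> I"
  show "\<exists>F. L1 F \<and> (ae z. (\<forall>j. \<bar>mollify (ph j) (f i) z - f i z\<bar> <= F z) \<and> (%j. mollify (ph j) (f i) z) \<longlonglongrightarrow> f i z)"
   by (rule fast_L1_convergence[OF fI mi[OF i] ml[OF i]]) blast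
 qed
 from bchoice[OF this] obtain F where F_all: "\<forall>i\<in>I. L1 (F i) \<and>
  (ae z. (\<forall>j. \<bar>mollify (ph j) (f i) z - f i z\<bar> <= F i z) \<and> (%j. mollify (ph j) (f i) z) \<longlonglongrightarrow> f i z)" ..
 have F: "L1 (F i)"
  "ae z. (\<forall>j. \<bar>mollify (ph j) (f i) z - f i z\<bar> <= F i z) \<and> (%j. mollify (ph j) (f i) z) \<longlonglongrightarrow> f i z" if "i \<in> I" for i
  using bspec[OF F_all that] by simp_all
 have "ae z. \<forall>i\<in>I. (\<forall>j. \<bar>mollify (ph j) (f i) z - f i z\<bar> <= F i z) \<and> (%j. mollify (ph j) (f i) z) \<longlonglongrightarrow> f i z"
  using F(2) by (intro AE_finite_allI) (auto simp: I_def)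
 then obtain N where N: "N \<in> sets borel" "ae z. z \<notin> N" and
  NI: "!!z. z \<notin> N ==> \<forall>i\<in>I. (\<forall>j. \<bar>mollify (ph j) (f i) z - f i z\<bar> <= F i z) \<and> (%j. mollify (ph j) (f i) z) \<longlonglongrightarrow> f i z"
  using AE_lborel_borel_null by blast
 have conv: "(%j. mollify (ph j) g z) \<longlonglongrightarrow> g z" if "z \<notin> N" for z
  using bspec[OF NI[OF that], of None] by (simp add: I_def f_def)
 have convG: "(%j. mollify (ph j) (%y. G y \<bullet> b) z) \<longlonglongrightarrow> G z \<bullet> b"
  "\<bar>mollify (ph j) (%y. G y \<bullet> b) z\<bar> <= F (Some b) z + \<bar>G z \<bullet> b\<bar>" if "z \<notin> N" "b \<in> Basis" for z b j
 proof -
  have *: "(\<forall>j. \<bar>mollify (ph j) (f (Some b)) z - f (Some b) z\<bar> <= F (Some b) z) \<and> (%j. mollify (ph j) (f (Some b)) z) \<longlonglongrightarrow> f (Some b) z"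
   using bspec[OF NI[OF that(1)], of "Some b"] that(2) by (simp add: I_def)
  then show "(%j. mollify (ph j) (%y. G y \<bullet> b) z) \<longlonglongrightarrow> G z \<bullet> b" by (simp add: f_def)
  have "\<bar>mollify (ph j) (%y. G y \<bullet> b) z - G z \<bullet> b\<bar> <= F (Some b) z" using * by (simp add: f_def)
  then show "\<bar>mollify (ph j) (%y. G y \<bullet> b) z\<bar> <= F (Some b) z + \<bar>G z \<bullet> b\<bar>" by linarith
 qed
 \<comment> \<open>Off \<open>N\<close> this dominates the mollifications of all components of
   \<open>G\<close>, at every index.\<close>
 define H where "H = (%z. \<Sum>b\<in>Basis. F (Some b) z + \<bar>G z \<bullet> b\<bar>)"
 have H: "L1 H" unfolding H_def
  by (intro Bochner_Integration.integrable_sum Bochner_Integration.integrable_add F(1) integrable_abs Gb) (simp add: I_def)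
 \<comment> \<open>Taken at every point: on an admissible segment the limit exists at each
   parameter, also where the segment meets \<open>N\<close>.\<close>
 define gt where "gt = (%z. lim (%j. mollify (ph j) g z))"
 have "gt z = g z" if "z \<notin> N" for z using conv[OF that] by (simp add: gt_def limI)
 moreover have "L1 (%t. ind {0..1} t * (G (x + t *R v) \<bullet> v)) \<and>
   (\<forall>t\<in>{0..1}. gt (x + t *R v) - gt x = integral {0..t} (%s. G (x + s *R v) \<bullet> v))"
  if seg: "closed_segment x (x + v) <= Om" and p1: "ae t::real. x + t *R v \<notin> N"
   and p2: "L1 (%t. ind {0..1} t * H (x + t *R v))" for x v
 proof -
  define m where "m = (%j. mollify (ph j) g)"
  define D where "D = (%j t. dir_deriv (m j) v (x + t *R v))"
  define E where "E = (%t. G (x + t *R v) \<bullet> v)"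
  have sm: "smooth (m j)" for j unfolding m_def by (rule mollify_smooth(1)[OF ph g])
  have cD: "continuous_on UNIV (D j)" for j unfolding D_def
   by (rule continuous_on_compose2[OF smooth_continuous_on[OF smooth_dir_deriv[OF sm], of UNIV]]) (auto intro!: continuous_intros)
  have der: "((%t. m j (x + t *R v)) has_real_derivative D j t) (at t)" for j t
  proof -
   have "((%t. x + t *R v) has_derivative (%h. h *R v)) (at t)" by (auto intro!: derivative_eq_intros)
   from has_derivative_compose[OF this smooth_has_derivative[OF sm]]
   show ?thesis by (simp add: has_field_derivative_def D_def linear_cmul[OF linear_dir_deriv[OF sm]] mult.commute[of _ "dir_deriv _ _ _"] fun_eq_iff)
  qed
  have ftc: "(LI s. ind {0..t} s * D j s) = m j (x + t *R v) - m j x" if "0 <= t" for t j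
   using integral_FTC_Icc_real[OF that der, of j] continuous_on_eq_continuous_at[THEN iffD1, OF _ cD, of j]
   by (simp add: mult.commute[of "ind _ _"])
  obtain r where r: "r > 0" "(\<Union>y\<in>closed_segment x (x + v). cball y r) <= Om"
   using compact_subset_open_imp_cball_epsilon_subset[OF compact_segment Om seg] by blast
  \<comment> \<open>From index \<open>J\<close> on the kernels are narrower than the margin
    \<open>r\<close> of the segment inside \<open>Om\<close>, so derivatives of mollifications are
    mollifications of \<open>G\<close>.\<close>
  obtain J where J: "(1/2)^J < r" using real_arch_pow_inv[of r "1/2"] r(1) by auto
  have Deq: "D j t = (\<Sum>b\<in>Basis. (v \<bullet> b) * mollify (ph j) (%y. G y \<bullet> b) (x + t *R v))" if "t \<in> {0..1}" "j \<ge> J" for j t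
  proof -
   have "(1/2::real)^j <= (1/2)^J" using that(2) by (intro power_decreasing) auto
   then have "cball (x + t *R v) ((1/2)^j) <= cball (x + t *R v) r" using J by (intro subset_cball) linarith
   also have "... <= Om" using r(2) line_in_segment[OF that(1), of x v] by blast
   finally have "dir_deriv (m j) b (x + t *R v) = mollify (ph j) (%y. G y \<bullet> b) (x + t *R v)" for b
    unfolding m_def by (rule mollify_weak_gradient[OF ph wg])
   moreover have "D j t = (\<Sum>b\<in>Basis. (v \<bullet> b) * dir_deriv (m j) b (x + t *R v))"
    unfolding D_def by (subst dir_deriv_gradient[OF sm]) (simp add: gradient_def inner_sum_left inner_sum_right mult.commute inner_commute)
   ultimately show ?thesis by simp
  qed
  have Ei: "L1 (%s. ind {0..1} s * E s)"
  proof (rule Bochner_Integration.integrable_bound)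
   show "L1 (%s. norm v * (ind {0..1} s * H (x + s *R v)))" using p2 by (rule integrable_mult_right)
   have [measurable]: "G \<in> Borel" using G by simp
   show "(%s. ind {0..1} s * E s) \<in> borel_measurable lborel" unfolding E_def by measurable
   show "ae s. norm (ind {0..1} s * E s) <= norm (norm v * (ind {0..1} s * H (x + s *R v)))"
    using p1
   proof eventually_elim
    fix s assume s: "x + s *R v \<notin> N"
    define y where "y = x + s *R v"
    have "norm (G y) <= (\<Sum>b\<in>Basis. \<bar>G y \<bullet> b\<bar>)" by (rule norm_le_l1)
    also have "... <= H y" unfolding H_def
    proof (rule sum_mono)
     fix b :: 'a assume "b \<in> Basis"
     then have "\<bar>mollify (ph 0) (f (Some b)) y - f (Some b) y\<bar> <= F (Some b) y"
      using bspec[OF NI[of y], of "Some b"] s by (simp add: I_def y_def)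
     then show "\<bar>G y \<bullet> b\<bar> <= F (Some b) y + \<bar>G y \<bullet> b\<bar>" by linarith
    qed
    finally have "norm (G y) <= H y" .
    then have "norm v * norm (G y) <= norm v * H y" by (rule mult_left_mono) simp
    then have "\<bar>E s\<bar> <= \<bar>norm v * H y\<bar>" using Cauchy_Schwarz_ineq2[of "G y" v] by (simp add: E_def y_def mult.commute)
    then show "norm (ind {0..1} s * E s) <= norm (norm v * (ind {0..1} s * H (x + s *R v)))"
     by (simp add: y_def indicator_def)
   qed
  qed
  have lim: "(%j. m j (x + t *R v) - m j x) \<longlonglongrightarrow> (LI s. ind {0..t} s * E s)" if t: "t \<in> {0..1}" for t
  proof -
   have "(%j. LI s. ind {0..t} s * D (j + J) s) \<longlonglongrightarrow> (LI s. ind {0..t} s * E s)"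
   proof (rule integral_dominated_convergence)
    show "L1 (%s. norm v * (ind {0..1} s * H (x + s *R v)))" using p2 by (rule integrable_mult_right)
    have "(%s. ind {0..t} s * (ind {0..1} s * E s)) \<in> borel_measurable lborel" using Ei by measurable
    also have "(%s. ind {0..t} s * (ind {0..1} s * E s)) = (%s. ind {0..t} s * E s)"
     using t by (auto simp: indicator_def)
    finally show "(%s. ind {0..t} s * E s) \<in> borel_measurable lborel" .
    have [measurable]: "D j \<in> Borel" for j by (rule borel_measurable_continuous_onI[OF cD])
    show "(%s. ind {0..t} s * D (j + J) s) \<in> borel_measurable lborel" for j by measurable
    show "ae s. (%j. ind {0..t} s * D (j + J) s) \<longlonglongrightarrow> ind {0..t} s * E s"
     using p1
    proof eventually_elim
     fix s assume s: "x + s *R v \<notin> N"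
     show "(%j. ind {0..t} s * D (j + J) s) \<longlonglongrightarrow> ind {0..t} s * E s"
     proof (cases "s \<in> {0..t}")
      case True
      have "(%j. \<Sum>b\<in>Basis. (v \<bullet> b) * mollify (ph (j + J)) (%y. G y \<bullet> b) (x + s *R v)) \<longlonglongrightarrow> (\<Sum>b\<in>Basis. (v \<bullet> b) * (G (x + s *R v) \<bullet> b))"
       by (intro tendsto_sum tendsto_mult_left LIMSEQ_ignore_initial_segment convG(1)[OF s])
      moreover have "(\<Sum>b\<in>Basis. (v \<bullet> b) * (G (x + s *R v) \<bullet> b)) = E s"
       unfolding E_def by (simp add: euclidean_inner[of "G (x + s *R v)" v] mult.commute)
      moreover have "D (j + J) s = (\<Sum>b\<in>Basis. (v \<bullet> b) * mollify (ph (j + J)) (%y. G y \<bullet> b) (x + s *R v))" for j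
       by (rule Deq) (use True t in auto)
      ultimately show ?thesis using True by simp
     qed simp
    qed
    show "ae s. norm (ind {0..t} s * D (j + J) s) <= norm v * (ind {0..1} s * H (x + s *R v))" for j
     using p1
    proof eventually_elim
     fix s assume s: "x + s *R v \<notin> N"
     show "norm (ind {0..t} s * D (j + J) s) <= norm v * (ind {0..1} s * H (x + s *R v))"
     proof (cases "s \<in> {0..t}")
      case True
      have "D (j + J) s = (\<Sum>b\<in>Basis. (v \<bullet> b) * mollify (ph (j + J)) (%y. G y \<bullet> b) (x + s *R v))"
       by (rule Deq) (use True t in auto)
      also have "\<bar>...\<bar> <= (\<Sum>b\<in>Basis. \<bar>(v \<bullet> b) * mollify (ph (j + J)) (%y. G y \<bullet> b) (x + s *R v)\<bar>)" by (rule sum_abs)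
      also have "... <= (\<Sum>b\<in>Basis. norm v * (F (Some b) (x + s *R v) + \<bar>G (x + s *R v) \<bullet> b\<bar>))"
       unfolding abs_mult by (intro sum_mono mult_mono convG(2)[OF s] Basis_le_norm) auto
      finally show ?thesis using True t by (simp add: H_def sum_distrib_left)
     next
      case False
      have "0 <= H (x + s *R v)" unfolding H_def
       by (intro sum_nonneg order_trans[OF abs_ge_zero convG(2)[OF s, of _ 0]])
      then show ?thesis using False by simp
     qed
    qed
   qed
   also have "(%j. LI s. ind {0..t} s * D (j + J) s) = (%j. m (j + J) (x + t *R v) - m (j + J) x)"
    using t by (intro ext ftc) simp
   finally show ?thesis by (rule LIMSEQ_offset)
  qed
  \<comment> \<open>Convergence at a single point of the segment off \<open>N\<close> suffices, as
    the increments along the segment converge everywhere.\<close>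
  obtain s where s: "0 < s" "s < 1" "x + s *R v \<notin> N" using AE_unit_interval_ex[OF p1, of 0 1] by auto
  define A where "A = g (x + s *R v) - (LI r. ind {0..s} r * E r)"
  have mx: "(%j. m j x) \<longlonglongrightarrow> A"
   using tendsto_diff[OF conv[OF s(3)] lim[of s]] s by (simp add: A_def m_def)
  have gA: "gt (x + t *R v) = A + integral {0..t} E" if t: "t \<in> {0..1}" for t
  proof -
   have "(%j. m j (x + t *R v)) \<longlonglongrightarrow> A + (LI s. ind {0..t} s * E s)"
    using tendsto_add[OF mx lim[OF t]] by simp
   moreover have "(LI s. ind {0..t} s * E s) = integral {0..t} E"
    using integral_upto_eq_HK(2)[OF Ei, of 0 t] t by simp
   ultimately show ?thesis unfolding gt_def m_def by (simp add: limI)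
  qed
  from gA[of 0] have "gt x = A" by simp
  then show ?thesis using Ei gA by (simp add: E_def[abs_def])
 qed
 ultimately show ?thesis using N(1,2) H unfolding line_primitive_def by (intro exI[of _ gt] exI[of _ N] exI[of _ H]) simp
qed

lemma weak_gradient_segment_identity:
 assumes wg: "weak_gradient Om g G" and Om: "open Om"
 shows "ae z. closed_segment z (z + v) <= Om --> g (z + v) - g z = segment_integral (%z. G z \<bullet> v) z v"
proof -
 obtain gt N H where N: "N \<in> sets borel" "ae z. z \<notin> N" "\<forall>z. z \<notin> N --> gt z = g z" and H: "L1 H"
  and ln: "line_primitive Om G gt N H"
  using weak_gradient_lines[OF wg Om] by blast
 from AE_line_avoid_null[OF N(1,2), of v] segment_integral_integrable(2)[OF H, of v] N(2) AE_translate[OF N(2), of v]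
 show ?thesis
 proof eventually_elim
  case (elim z)
  show ?case
  proof
  assume seg: "closed_segment z (z + v) <= Om"
  have "L1 (%t. ind {0..1} t * (G (z + t *R v) \<bullet> v))"
   and t: "\<forall>t\<in>{0..1}. gt (z + t *R v) - gt z = integral {0..t} (%s. G (z + s *R v) \<bullet> v)"
   using ln[unfolded line_primitive_def, rule_format, OF seg elim(1,2)] by blast+
  from integral_upto_eq_HK(2)[OF this(1), of 0 1] bspec[OF t, of 1] 
  show "g (z + v) - g z = segment_integral (%z. G z \<bullet> v) z v"
   using N(3) elim by (simp add: segment_integral_def)
  qed
 qed
qed

text \<open>A version that is continuous on the segment agrees with the constructed primitive on a
  dense set of parameters, hence everywhere on the segment. This frees later arguments from the
  choice of the version.\<close>

lemma weak_gradient_primitive: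
 fixes g gt :: "'a::euclidean_space => real"
 assumes wg: "weak_gradient Om g G" and Om: "open Om" and eq: "ae z. z \<in> Om --> gt z = g z"
 shows "ae p. segment_in Om p -->
   continuous_on {0..1} (%t. gt (pt p t)) -->
   L1 (%t. ind {0..1} t * (G (pt p t) \<bullet> snd p)) \<and>
   (\<forall>t\<in>{0..1}. gt (pt p t) - gt (fst p) = integral {0..t} (%s. G (pt p s) \<bullet> snd p))"
 and "\<exists>gt. (ae z. gt z = g z) \<and>
  (ae p. segment_in Om p --> continuous_on {0..1} (%t. gt (pt p t)))"
proof -
 obtain g' N H where N: "N \<in> sets borel" "ae z. z \<notin> N" "\<forall>z. z \<notin> N --> g' z = g z" and H: "L1 H"
  and ln: "line_primitive Om G g' N H"
  using weak_gradient_lines[OF wg Om] by blast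
 have c': "continuous_on {0..1} (%t. g' (x + t *R v))"
  if "L1 (%t. ind {0..1} t * (G (x + t *R v) \<bullet> v))"
   "\<forall>t\<in>{0..1}. g' (x + t *R v) - g' x = integral {0..t} (%s. G (x + s *R v) \<bullet> v)" for x v
 proof (rule continuous_on_eq)
  show "continuous_on {0..1} (%t. g' x + integral {0..t} (%s. G (x + s *R v) \<bullet> v))"
   by (intro continuous_intros indefinite_integral_continuous_1) (use integral_upto_eq_HK(1)[OF that(1), of 0 1] in auto)
  show "g' x + integral {0..t} (%s. G (x + s *R v) \<bullet> v) = g' (x + t *R v)" if "t \<in> {0..1}" for t
   using bspec[OF \<open>\<forall>t\<in>_. _\<close> that] by linarith
 qed
 have "ae z. g' z = g z" using N(2) by eventually_elim (use N(3) in blast)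
 moreover have "ae p. segment_in Om p --> continuous_on {0..1} (%t. g' (pt p t))"
  using AE_lines_avoid_null[OF N(1,2)] AE_lines_integrable[OF H]
 proof eventually_elim
  case (elim p)
  show ?case using ln[unfolded line_primitive_def, rule_format, OF _ elim] c' by blast
 qed
 ultimately show "\<exists>gt. (ae z. gt z = g z) \<and>
  (ae p. segment_in Om p --> continuous_on {0..1} (%t. gt (pt p t)))" by blast
 obtain M where M: "M \<in> sets borel" "ae z. z \<notin> M" "!!z. z \<notin> M ==> z \<in> Om --> gt z = g z"
  using AE_lborel_borel_null[OF eq] by blast
 from AE_lines_avoid_null[OF N(1,2)] AE_lines_avoid_null[OF M(1,2)] AE_lines_integrable[OF H]
 show "ae p. segment_in Om p -->
   continuous_on {0..1} (%t. gt (pt p t)) -->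
   L1 (%t. ind {0..1} t * (G (pt p t) \<bullet> snd p)) \<and>
   (\<forall>t\<in>{0..1}. gt (pt p t) - gt (fst p) = integral {0..t} (%s. G (pt p s) \<bullet> snd p))"
 proof (eventually_elim, intro impI)
  fix p :: "'a \<times> 'a"
  assume e: "ae t::real. pt p t \<notin> N" "ae t::real. pt p t \<notin> M"
   "L1 (%t. ind {0..1} t * H (pt p t))"
   and seg: "segment_in Om p" and c: "continuous_on {0..1} (%t. gt (pt p t))"
  have i: "L1 (%t. ind {0..1} t * (G (pt p t) \<bullet> snd p))"
   and id: "\<forall>t\<in>{0..1}. g' (pt p t) - g' (fst p) = integral {0..t} (%s. G (pt p s) \<bullet> snd p)"
   using ln[unfolded line_primitive_def, rule_format, OF seg e(1,3)] by blast+
  have cl: "closed {t\<in>{0..1}. gt (pt p t) = g' (pt p t)}"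
   using continuous_closed_preimage_constant[OF continuous_on_diff[OF c c'[OF i id]], of 0] by simp
  have same: "gt (pt p t) = g' (pt p t)" if t: "t \<in> {0..1}" for t
  proof -
   have "t \<in> closure {t\<in>{0..1}. gt (pt p t) = g' (pt p t)}"
    unfolding closure_approachable
   proof (intro allI impI)
    fix r :: real assume "0 < r"
    then have "max 0 (t - r) < min 1 (t + r)" using t by auto
    moreover have "ae t. pt p t \<notin> N \<and> pt p t \<notin> M" using e(1,2) by eventually_elim simp
    ultimately obtain s where s: "max 0 (t - r) < s" "s < min 1 (t + r)" "pt p s \<notin> N" "pt p s \<notin> M"
     using AE_unit_interval_ex by blast
    then have "gt (pt p s) = g' (pt p s)"
     using M(3) N(3) subsetD[OF seg line_in_segment[of s]] by simp
    then show "\<exists>y\<in>{t\<in>{0..1}. gt (pt p t) = g' (pt p t)}. dist y t < r"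
     using s by (intro bexI[of _ s]) (auto simp: dist_real_def)
   qed
   then show ?thesis using cl by (simp add: closure_closed)
  qed
  from i id same[of 0] same show "L1 (%t. ind {0..1} t * (G (pt p t) \<bullet> snd p)) \<and>
   (\<forall>t\<in>{0..1}. gt (pt p t) - gt (fst p) = integral {0..t} (%s. G (pt p s) \<bullet> snd p))"
   by simp
 qed
qed

section \<open>Metric velocities of Sobolev maps\<close>

lemma abs_cont_on_continuous:
 fixes c :: "real => 'x::metric_space"
 assumes "abs_cont_on a b c"
 shows "continuous_on {a..b} c"
 unfolding continuous_on_iff
proof (intro ballI allI impI)
 fix t and e :: real assume t: "t \<in> {a..b}" and "0 < e"
 then obtain d where d: "d > 0" and ac: "!!(N::nat set) l r. finite N ==> (\<forall>i\<in>N. a <= l i \<and> l i <= r i \<and> r i <= b) ==>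
   disjoint_family_on (%i. {l i<..<r i}) N ==> (\<Sum>i\<in>N. r i - l i) < d ==> (\<Sum>i\<in>N. dist (c (l i)) (c (r i))) < e"
  using assms unfolding abs_cont_on_def by meson
 have *: "dist (c s) (c r) < e" if "s <= r" "a <= s" "r <= b" "r - s < d" for s r
  using ac[of "{0}" "%_. s" "%_. r"] that by (simp add: disjoint_family_on_def)
 show "\<exists>d>0. \<forall>x'\<in>{a..b}. dist x' t < d --> dist (c x') (c t) < e"
 proof (intro exI conjI ballI impI)
  fix s assume s: "s \<in> {a..b}" "dist s t < d"
  show "dist (c s) (c t) < e"
   using *[of s t] *[of t s] s t by (cases "s <= t") (auto simp: dist_real_def dist_commute)
 qed (rule d)
qed

text \<open>Choosing \<open>x k\<close> close to \<open>a\<close> makes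
  \<open>dist (x k) b - dist (x k) a\<close> almost \<open>dist b a\<close>. In this way scalar
  estimates for countably many distance functions become estimates in the target space.\<close>

lemma dist_le_by_dense_family:
 fixes x :: "nat => 'x::metric_space"
 assumes a: "a \<in> closure (range x)" and le: "!!k. \<bar>dist (x k) b - dist (x k) a\<bar> <= C"
 shows "dist b a <= C"
proof (rule field_le_epsilon)
 fix e :: real assume "0 < e"
 then obtain k where k: "dist (x k) a < e / 2"
  using a unfolding closure_approachable by (metis half_gt_zero rangeE)
 have "dist b a <= dist (x k) b + dist (x k) a" by (metis dist_commute dist_triangle)
 also have "... <= C + 2 * dist (x k) a" using le[of k] by linarith
 finally show "dist b a <= C + e" using k by linarith
qed

text \<open>The countable data of a Sobolev map: Borel versions \<open>g k\<close> of the distances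
  to a sequence whose closure contains almost all values, with weak gradients bounded by one
  \<open>h\<close> at every point and not only almost everywhere.\<close>

locale sobolev_map =
 fixes Om :: "'a::euclidean_space set" and u :: "'a => 'x::metric_space"
  and x :: "nat => 'x" and g :: "nat => 'a => real" and G :: "nat => 'a => 'a" and h :: "'a => real"
 assumes open_domain: "open Om"
  and values_ae: "ae z. z \<in> Om --> u z \<in> closure (range x) \<and> (\<forall>k. dist (x k) (u z) = g k z)"
  and wgrad: "!!k. weak_gradient Om (g k) (G k)"
  and G_le: "!!k z. norm (G k z) <= h z"
  and h_int: "L1 h" and h2_int: "L1 (%z. (h z)^2)"
begin

lemma h_nonneg: "0 <= h z" using G_le[of 0 z] norm_ge_zero order_trans by blast

lemma G_meas[measurable]: "G k \<in> Borel"
 using wgrad[of k] by (auto simp: weak_gradient_def dest: borel_measurable_integrable)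

lemma h_meas[measurable]: "h \<in> Borel" using h_int by simp

text \<open>The metric velocity in the direction \<open>v\<close>, as the supremum of the
  derivatives of the distance functions; unlike a limit of difference quotients it is visibly Borel
  and defined everywhere.\<close>

definition speed :: "'a => 'a => real" where
 "speed z v = (SUP k. \<bar>G k z \<bullet> v\<bar>)"

lemma speed_bdd: "bdd_above (range (%k. \<bar>G k z \<bullet> v\<bar>))"
proof (rule bdd_aboveI2)
 show "\<bar>G k z \<bullet> v\<bar> <= h z * norm v" for k
  using Cauchy_Schwarz_ineq2[of "G k z" v] G_le[of k z] by (meson mult_right_mono norm_ge_zero order_trans)
qed

lemma speed_upper: "\<bar>G k z \<bullet> v\<bar> <= speed z v"
 unfolding speed_def by (rule cSUP_upper[OF _ speed_bdd]) simp

lemma speed_nonneg: "0 <= speed z v"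
 using speed_upper[of 0 z v] abs_ge_zero order_trans by blast

lemma speed_le: "speed z v <= h z * norm v"
 unfolding speed_def
proof (rule cSUP_least)
 show "\<bar>G k z \<bullet> v\<bar> <= h z * norm v" for k
  using Cauchy_Schwarz_ineq2[of "G k z" v] G_le[of k z] by (meson mult_right_mono norm_ge_zero order_trans)
qed simp

lemma speed_scale: "speed z (c *R v) = \<bar>c\<bar> * speed z v"
proof (cases "c = 0")
 case True
 then show ?thesis by (simp add: speed_def)
next
 case False
 show ?thesis
 proof (rule antisym)
  show "speed z (c *R v) <= \<bar>c\<bar> * speed z v"
   unfolding speed_def[of z "c *R v"]
   by (rule cSUP_least) (auto simp: abs_mult intro!: mult_left_mono speed_upper)
  have "speed z v <= speed z (c *R v) / \<bar>c\<bar>"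
   unfolding speed_def[of z v]
  proof (rule cSUP_least)
   show "\<bar>G k z \<bullet> v\<bar> <= speed z (c *R v) / \<bar>c\<bar>" for k
    using speed_upper[of k z "c *R v"] False by (simp add: abs_mult pos_le_divide_eq mult.commute)
  qed simp
  then show "\<bar>c\<bar> * speed z v <= speed z (c *R v)" using False by (simp add: pos_le_divide_eq mult.commute)
 qed
qed

lemma speed_meas: "(%p. speed (fst p) (snd p)) \<in> Borel"
proof -
 have "(%p. \<bar>G k (fst p) \<bullet> snd p\<bar>) \<in> Borel" for k
  unfolding borel_prod[symmetric] by measurable
 then show ?thesis unfolding speed_def
  by (intro borel_measurable_cSUP) (auto intro: speed_bdd)
qed

lemma speed_meas_pair[measurable]: "(%(z, v). speed z v) \<in> borel_measurable (borel \<Otimes>\<^sub>M borel)"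
 using speed_meas by (simp add: borel_prod case_prod_unfold)

lemma speed_int: "L1 (%z. speed z v)"
proof (rule Bochner_Integration.integrable_bound)
 show "L1 (%z. h z * norm v)" using h_int by simp
 have "(%z. (%(z, v). speed z v) (z, v)) \<in> Borel" by measurable
 then show "(%z. speed z v) \<in> borel_measurable lborel" by simp
 show "ae z. norm (speed z v) <= norm (h z * norm v)"
  using speed_le speed_nonneg h_nonneg by (intro AE_I2) (auto simp: abs_mult)
qed

text \<open>Weaker than absolute continuity: continuity on almost every segment is what the
  differentiation of \<open>w\<close> uses, and it is preserved when \<open>w\<close> is composed
  with a continuous map.\<close>

definition representative :: "('a => 'x) => bool" where
 "representative w \<longleftrightarrow> (ae z. z \<in> Om --> w z = u z) \<and>
   (ae p. segment_in Om p --> continuous_on {0..1} (%t. w (pt p t)))"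

text \<open>Almost every line avoids the exceptional set at all rational parameters, and continuity
  carries the closure condition to the other parameters.\<close>

lemma closure_on_segments:
 assumes w: "ae z. z \<in> Om --> w z = u z"
 shows "ae p. segment_in Om p --> continuous_on {0..1} (%t. w (pt p t)) -->
  (\<forall>t\<in>{0..1}. w (pt p t) \<in> closure (range x))"
proof -
 have "ae z. z \<in> Om --> w z \<in> closure (range x)"
  using w values_ae by eventually_elim auto
 then obtain N where N: "N \<in> sets borel" "ae z. z \<notin> N" "!!z. z \<notin> N ==> z \<in> Om --> w z \<in> closure (range x)"
  using AE_lborel_borel_null by blast
 define Q where "Q = (%p::'a\<times>'a. \<forall>q::rat. pt p (real_of_rat q) \<notin> N)"
 have [measurable]: "Measurable.pred borel (%p::'a\<times>'a. pt p t \<in> N)" for t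
  using measurable_sets[OF borel_measurable_line_comp[OF measurable_ident] N(1), of t]
  by (simp add: pred_def vimage_def id_def)
 have Q_meas: "Measurable.pred borel Q" unfolding Q_def by measurable
 have "ae z. Q (z, v)" for v
  unfolding Q_def AE_all_countable using AE_translate[OF N(2)] by auto
 then have "ae p. Q p" by (subst AE_lborel_prod_iff(1)[OF Q_meas]) auto
 then show ?thesis
 proof (rule AE_mp, intro AE_I2 impI ballI)
  fix p t assume Q: "Q p" and seg: "segment_in Om p"
   and cont: "continuous_on {0..1} (%t. w (pt p t))" and t: "t \<in> {0..1::real}"
  have "t \<in> closure (\<rat> \<inter> {0..1})"
  proof -
   have "\<exists>y\<in>\<rat> \<inter> {0..1}. dist y t < e" if "e > 0" for e
   proof -
    have "max 0 (t - e) < min 1 (t + e)" using t that by auto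
    from Rats_dense_in_real[OF this] obtain r where "r \<in> \<rat>" "max 0 (t - e) < r" "r < min 1 (t + e)" by blast
    then show ?thesis by (intro bexI[of _ r]) (auto simp: dist_real_def)
   qed
   then show ?thesis by (simp add: closure_approachable)
  qed
  then obtain s where s: "!!n. s n \<in> \<rat> \<inter> {0..1}" "s \<longlonglongrightarrow> t" unfolding closure_sequential by blast
  have "(%n. w (fst p + s n *R snd p)) \<longlonglongrightarrow> w (pt p t)"
   using continuous_on_tendsto_compose[OF cont s(2) t] s(1) by auto
  note a = this
  have b: "w (fst p + s n *R snd p) \<in> closure (range x)" for n
  proof -
   have "fst p + s n *R snd p \<in> closed_segment (fst p) (fst p + snd p)"
    unfolding in_segment using s(1)[of n] by (intro exI[of _ "s n"]) (auto simp: algebra_simps)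
   moreover have "fst p + s n *R snd p \<notin> N" using Q s(1)[of n] unfolding Q_def by (auto elim!: Rats_cases)
   ultimately show ?thesis using N(3) seg by blast
  qed
  show "w (pt p t) \<in> closure (range x)"
   using closed_sequentially[OF closed_closure _ a] b by blast
 qed
qed

end

lemma AE_scale_direction:
 fixes P :: "'a::euclidean_space \<times> 'a => bool"
 assumes "ae p. P p" "c \<noteq> 0"
 shows "ae p. P (fst p, c *R snd p)"
proof -
 obtain N where N: "N \<in> sets borel" "ae p. p \<notin> N" "!!p. p \<notin> N ==> P p"
  using AE_lborel_borel_null[OF assms(1)] by blast
 have m1: "Measurable.pred borel (%p. p \<notin> N)" using N(1) by measurable
 have "(%p::'a\<times>'a. (fst p, c *R snd p)) \<in> Borel"
  by (intro borel_measurable_continuous_onI continuous_intros)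
 from measurable_compose[OF this m1]
 have m2: "Measurable.pred borel (%p::'a\<times>'a. (fst p, c *R snd p) \<notin> N)" .
 have "ae v. ae z. (z, v) \<notin> N"
  using N(2) by (subst (asm) AE_lborel_prod_iff(1)[OF m1])
 from AE_scale[OF this assms(2)] have "ae p. (fst p, c *R snd p) \<notin> N"
  by (subst AE_lborel_prod_iff(1)[OF m2]) simp
 then show ?thesis by (rule AE_mp) (use N(3) in auto)
qed

text \<open>The shear from \<open>(z, v)\<close> to \<open>(z, z + v)\<close> respects null sets; it
  passes from almost every pair of endpoints to almost every base point and direction.\<close>

lemma AE_shear:
 fixes P :: "'a::euclidean_space \<times> 'a => bool"
 assumes "ae p. P p"
 shows "ae p. P (fst p, fst p + snd p)"
proof -
 obtain N where N: "N \<in> sets borel" "ae p. p \<notin> N" "!!p. p \<notin> N ==> P p"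
  using AE_lborel_borel_null[OF assms(1)] by blast
 have m1: "Measurable.pred borel (%p. p \<notin> N)" using N(1) by measurable
 have "(%p::'a\<times>'a. (fst p, fst p + snd p)) \<in> Borel"
  by (intro borel_measurable_continuous_onI continuous_intros)
 from measurable_compose[OF this m1]
 have m2: "Measurable.pred borel (%p::'a\<times>'a. (fst p, fst p + snd p) \<notin> N)" .
 have "ae z. ae y. (z, y) \<notin> N"
  using N(2) by (subst (asm) AE_lborel_prod_iff(2)[OF m1])
 then have "ae z. ae v. (z, z + v) \<notin> N"
 proof eventually_elim
  case (elim z)
  from AE_translate[OF elim, of z] show ?case by (simp add: add.commute)
 qed
 then have "ae p. (fst p, fst p + snd p) \<notin> N"
  by (subst AE_lborel_prod_iff(2)[OF m2]) simp
 then show ?thesis by (rule AE_mp) (use N(3) in auto)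
qed

lemma tendsto_at_right_rescale:
 fixes D :: "real => real"
 assumes lim: "((%t. D (c * t) / t) \<longlongrightarrow> c * l) (at_right 0)" and c: "c > 0"
 shows "((%t. D t / t) \<longlongrightarrow> l) (at_right 0)"
proof -
 have "filterlim (%t. t / c) (at_right 0) (at_right 0)"
 proof (rule tendsto_imp_filterlim_at_right)
  show "\<forall>\<^sub>F t in at_right 0. 0 < t / c" using c by (auto simp: eventually_at_right_field intro!: exI[of _ 1])
  have "((%t. t / c) \<longlongrightarrow> 0 / c) (at_right 0)" using c by (intro tendsto_intros) auto
  then show "((%t. t / c) \<longlongrightarrow> 0) (at_right 0)" by simp
 qed
 from filterlim_compose[OF lim this] have "((%t. D (c * (t / c)) / (t / c) / c) \<longlongrightarrow> c * l / c) (at_right 0)"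
  using c by (intro tendsto_divide) auto
 then show ?thesis using c by (simp add: field_simps)
qed

context sobolev_map
begin

text \<open>Each distance function bounds the difference quotient of \<open>w\<close> from below by
  a quotient that tends to \<open>|G k z \<bullet> v|\<close>. From above the increments of all
  distance functions are bounded by the integral of \<open>speed\<close>, hence so is the distance.
  Lebesgue differentiation makes the two bounds meet.\<close>

lemma speed_limit_forward:
 assumes rep: "representative w"
 shows "ae p. segment_in Om p -->
  ((%t. dist (w (pt p t)) (w (fst p)) / t) \<longlongrightarrow> speed (fst p) (snd p)) (at_right 0)"
proof -
 have wu: "ae z. z \<in> Om --> w z = u z"
  and wc: "ae p. segment_in Om p --> continuous_on {0..1} (%t. w (pt p t))"
  using rep by (auto simp: representative_def)
 have "ae z. z \<in> Om --> dist (x k) (w z) = g k z" for k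
  using wu values_ae by eventually_elim auto
 then have prim: "ae p. \<forall>k. segment_in Om p -->
   continuous_on {0..1} (%t. dist (x k) (w (pt p t))) -->
   L1 (%t. ind {0..1} t * (G k (pt p t) \<bullet> snd p)) \<and>
   (\<forall>t\<in>{0..1}. dist (x k) (w (pt p t)) - dist (x k) (w (fst p)) = integral {0..t} (%s. G k (pt p s) \<bullet> snd p))"
  unfolding AE_all_countable using weak_gradient_primitive(1)[OF wgrad open_domain, of "%z. dist (x _) (w z)"] by blast
 have leb: "ae p. \<forall>k. (\<forall>n::nat. L1 (%t. ind {- real n..real n} t * (G k (pt p t) \<bullet> snd p))) \<and>
  ((%h. (LI t. ind {0..h} t * (G k (pt p t) \<bullet> snd p)) / h) \<longlongrightarrow> G k (fst p) \<bullet> snd p) (at_right 0)"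
  unfolding AE_all_countable
 proof
  fix k
  have m: "(%p::'a\<times>'a. G k (fst p) \<bullet> snd p) \<in> Borel"
   unfolding borel_prod[symmetric] by measurable
  have i: "L1 (%z. G k z \<bullet> v)" for v using wgrad[of k] by (auto simp: weak_gradient_def)
  show "ae p. (\<forall>n::nat. L1 (%t. ind {- real n..real n} t * (G k (pt p t) \<bullet> snd p))) \<and>
  ((%h. (LI t. ind {0..h} t * (G k (pt p t) \<bullet> snd p)) / h) \<longlongrightarrow> G k (fst p) \<bullet> snd p) (at_right 0)"
   using Lebesgue_differentiation_lines[OF m] i by simp
 qed
 have lebM: "ae p. (\<forall>n::nat. L1 (%t. ind {- real n..real n} t * speed (pt p t) (snd p))) \<and>
  ((%h. (LI t. ind {0..h} t * speed (pt p t) (snd p)) / h) \<longlongrightarrow> speed (fst p) (snd p)) (at_right 0)"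
  using Lebesgue_differentiation_lines[OF speed_meas] speed_int by simp
 from prim leb lebM wc closure_on_segments[OF wu]
 show ?thesis
 proof (eventually_elim, intro impI)
  fix p :: "'a \<times> 'a"
  obtain z v where p: "p = (z, v)" by force
  define f where "f = (%k s. G k (z + s *R v) \<bullet> v)"
  define m where "m = (%s. speed (z + s *R v) v)"
  define D where "D = (%t. dist (w (z + t *R v)) (w z))"
  assume 1: "\<forall>k. segment_in Om p -->
   continuous_on {0..1} (%t. dist (x k) (w (pt p t))) -->
   L1 (%t. ind {0..1} t * (G k (pt p t) \<bullet> snd p)) \<and>
   (\<forall>t\<in>{0..1}. dist (x k) (w (pt p t)) - dist (x k) (w (fst p)) = integral {0..t} (%s. G k (pt p s) \<bullet> snd p))"
   and 2: "\<forall>k. (\<forall>n::nat. L1 (%t. ind {- real n..real n} t * (G k (pt p t) \<bullet> snd p))) \<and>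
  ((%h. (LI t. ind {0..h} t * (G k (pt p t) \<bullet> snd p)) / h) \<longlongrightarrow> G k (fst p) \<bullet> snd p) (at_right 0)"
   and 3: "(\<forall>n::nat. L1 (%t. ind {- real n..real n} t * speed (pt p t) (snd p))) \<and>
  ((%h. (LI t. ind {0..h} t * speed (pt p t) (snd p)) / h) \<longlongrightarrow> speed (fst p) (snd p)) (at_right 0)"
   and 4: "segment_in Om p --> continuous_on {0..1} (%t. w (pt p t))"
   and 5: "segment_in Om p --> continuous_on {0..1} (%t. w (pt p t)) -->
  (\<forall>t\<in>{0..1}. w (pt p t) \<in> closure (range x))"
   and seg: "segment_in Om p"
  have cont: "continuous_on {0..1} (%t. w (z + t *R v))" using 4 seg p by simp
  have cont': "continuous_on {0..1} (%t. dist (x k) (w (z + t *R v)))" for k by (intro continuous_intros cont)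
  have wz: "w z \<in> closure (range x)" using 5 seg cont p by (auto dest!: bspec[of _ _ 0])
  have fi: "L1 (%t. ind {- real 1..real 1} t * f k t)" for k
   using conjunct1[OF spec[OF 2, of k], THEN spec, of 1] unfolding f_def p fst_conv snd_conv .
  have mi: "L1 (%t. ind {- real 1..real 1} t * m t)"
   using conjunct1[OF 3, THEN spec, of 1] unfolding m_def p fst_conv snd_conv .
  have fHK: "f k integrable_on {0..h}" "(LI t. ind {0..h} t * f k t) = integral {0..h} (f k)" if "0 <= h" "h <= 1" for h k
   using integral_upto_eq_HK[OF fi, of 0 h k] that by auto
  have mHK: "m integrable_on {0..h}" "(LI t. ind {0..h} t * m t) = integral {0..h} m" if "0 <= h" "h <= 1" for h
   using integral_upto_eq_HK[OF mi, of 0 h] that by auto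
  have prim: "dist (x k) (w (z + t *R v)) - dist (x k) (w z) = integral {0..t} (f k)" if "0 <= t" "t <= 1" for t k
   using 1 seg cont' that unfolding p f_def by auto
  have lower: "\<bar>integral {0..t} (f k)\<bar> <= D t" if "0 <= t" "t <= 1" for t k
   using prim[OF that, of k] dist_triangle[of "x k" "w (z + t *R v)" "w z"]
    dist_triangle[of "x k" "w z" "w (z + t *R v)"] dist_commute[of "w z" "w (z + t *R v)"]
   unfolding D_def by linarith
  have upper: "D t <= integral {0..t} m" if "0 <= t" "t <= 1" for t
   unfolding D_def
  proof (rule dist_le_by_dense_family[OF wz])
   fix k
   have "norm (integral {0..t} (f k)) <= integral {0..t} m"
    by (rule integral_norm_bound_integral) (use that fHK mHK speed_upper in \<open>auto simp: f_def m_def\<close>)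
   then show "\<bar>dist (x k) (w (z + t *R v)) - dist (x k) (w z)\<bar> <= integral {0..t} m"
    using prim[OF that, of k] by simp
  qed
  have ev: "\<forall>\<^sub>F h in at_right (0::real). 0 < h \<and> h <= 1"
   unfolding eventually_at_right_field by (intro exI[of _ 1]) auto
  have "((%t. D t / t) \<longlongrightarrow> speed z v) (at_right 0)"
  proof (rule order_tendstoI)
   fix a assume "a < speed z v"
   then obtain k where k: "a < \<bar>G k z \<bullet> v\<bar>" unfolding speed_def using less_cSUP_iff[OF _ speed_bdd] by auto
   have "((%h. (LI t. ind {0..h} t * f k t) / h) \<longlongrightarrow> G k z \<bullet> v) (at_right 0)"
    using 2 unfolding f_def p by simp
   then have "((%h. \<bar>(LI t. ind {0..h} t * f k t) / h\<bar>) \<longlongrightarrow> \<bar>G k z \<bullet> v\<bar>) (at_right 0)"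
    by (rule tendsto_rabs)
   from order_tendstoD(1)[OF this k] ev
   show "\<forall>\<^sub>F h in at_right 0. a < D h / h"
   proof eventually_elim
    case (elim h)
    then have "\<bar>(LI t. ind {0..h} t * f k t) / h\<bar> <= D h / h"
     using lower[of h k] fHK(2)[of h k] by (simp add: divide_right_mono)
    then show ?case using elim by linarith
   qed
  next
   fix b assume b: "speed z v < b"
   have "((%h. (LI t. ind {0..h} t * m t) / h) \<longlongrightarrow> speed z v) (at_right 0)"
    using 3 unfolding m_def p by simp
   from order_tendstoD(2)[OF this b] ev
   show "\<forall>\<^sub>F h in at_right 0. D h / h < b"
   proof eventually_elim
    case (elim h)
    then have "D h / h <= (LI t. ind {0..h} t * m t) / h"
     using upper[of h] mHK(2)[of h] by (simp add: divide_right_mono)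
    then show ?case using elim by linarith
   qed
  qed
  then show "((%t. dist (w (pt p t)) (w (fst p)) / t) \<longlongrightarrow> speed (fst p) (snd p)) (at_right 0)"
   by (simp add: D_def p)
 qed
qed

text \<open>Short multiples \<open>v / (n + 1)\<close> and \<open>- v / (n + 1)\<close> of a
  direction lead to segments inside the domain; homogeneity of \<open>speed\<close> undoes the
  scaling, and the two signs give the two sides of the limit.\<close>

theorem speed_limit:
 assumes rep: "representative w"
 shows "ae p. fst p \<in> Om -->
  ((%t. dist (w (pt p t)) (w (fst p)) / \<bar>t\<bar>) \<longlongrightarrow> speed (fst p) (snd p)) (at 0)"
proof -
 define P where "P = (%p. segment_in Om p -->
  ((%t. dist (w (pt p t)) (w (fst p)) / t) \<longlongrightarrow> speed (fst p) (snd p)) (at_right 0))"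
 have P: "ae p. P p" unfolding P_def by (rule speed_limit_forward[OF rep])
 have 1: "ae p. \<forall>n. P (fst p, (1 / real (Suc n)) *R snd p)"
  unfolding AE_all_countable using AE_scale_direction[OF P] by auto
 have 2: "ae p. \<forall>n. P (fst p, (- (1 / real (Suc n))) *R snd p)"
  unfolding AE_all_countable using AE_scale_direction[OF P] by (auto simp del: scaleR_minus_left)
 from 1 2 show ?thesis
 proof (eventually_elim, intro impI)
  fix p :: "'a \<times> 'a" assume 1: "\<forall>n. P (fst p, (1 / real (Suc n)) *R snd p)"
   and 2: "\<forall>n. P (fst p, (- (1 / real (Suc n))) *R snd p)" and Om: "fst p \<in> Om"
  obtain z v where p: "p = (z, v)" by force
  obtain r where r: "r > 0" "ball z r <= Om" using Om p open_domain openE by force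
  obtain n :: nat where n: "norm v / r < real (Suc n)" using reals_Archimedean2 less_trans of_nat_less_iff by (metis lessI)
  define d where "d = 1 / real (Suc n)"
  have d: "0 < d" "d * norm v < r" using n r by (auto simp: d_def field_simps)
  have key: "((%t. dist (w (z + t *R (c *R v))) (w z) / t) \<longlongrightarrow> d * speed z v) (at_right 0)" if "c = d \<or> c = - d" for c
  proof -
   have "closed_segment z (z + c *R v) <= ball z r"
    using r d that by (intro closed_segment_subset) (auto simp: dist_norm)
   then have "closed_segment z (z + c *R v) <= Om" using r by blast
   moreover have "P (z, c *R v)" using 1 2 that p unfolding d_def by (metis fst_conv snd_conv)
   moreover have "speed z (c *R v) = d * speed z v" using that d by (auto simp: speed_scale)
   ultimately show ?thesis by (simp add: P_def)
  qed
  have R: "((%t. dist (w (z + t *R v)) (w z) / t) \<longlongrightarrow> speed z v) (at_right 0)"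
   by (rule tendsto_at_right_rescale[where c=d]) (use key[of d] d in \<open>auto simp: mult.commute\<close>)
  have L: "((%t. dist (w (z + (- t) *R v)) (w z) / t) \<longlongrightarrow> speed z v) (at_right 0)"
   by (rule tendsto_at_right_rescale[where c=d]) (use key[of "- d"] d in \<open>auto simp: mult.commute\<close>)
  have "((%t. dist (w (z + t *R v)) (w z) / \<bar>t\<bar>) \<longlongrightarrow> speed z v) (at 0)"
  proof (rule filterlim_split_at)
   show "((%t. dist (w (z + t *R v)) (w z) / \<bar>t\<bar>) \<longlongrightarrow> speed z v) (at_right 0)"
    by (rule Lim_transform_eventually[OF R]) (auto simp: eventually_at_right_field intro!: exI[of _ 1])
   show "((%t. dist (w (z + t *R v)) (w z) / \<bar>t\<bar>) \<longlongrightarrow> speed z v) (at_left 0)"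
    unfolding filterlim_at_left_to_right
    by (simp, rule Lim_transform_eventually[OF L]) (auto simp: eventually_at_right_field intro!: exI[of _ 1])
  qed
  then show "((%t. dist (w (pt p t)) (w (fst p)) / \<bar>t\<bar>) \<longlongrightarrow> speed (fst p) (snd p)) (at 0)"
   by (simp add: p)
 qed
qed

end

section \<open>The energy density\<close>

lemma AE_lborel_prodD:
 fixes P :: "'a::euclidean_space \<times> 'b::euclidean_space => bool"
 assumes "ae p. P p"
 shows "ae x. ae y. P (x, y)"
proof -
 obtain N where N: "N \<in> sets borel" "ae p. p \<notin> N" "!!p. p \<notin> N ==> P p"
  using AE_lborel_borel_null[OF assms(1)] by blast
 have m1: "Measurable.pred borel (%p. p \<notin> N)" using N(1) by measurable
 have "ae x. ae y. (x, y) \<notin> N"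
  using N(2) by (subst (asm) AE_lborel_prod_iff(2)[OF m1])
 then show ?thesis
 proof eventually_elim
  case (elim x)
  then show ?case by eventually_elim (use N(3) in auto)
 qed
qed

lemma sgn_measurable[measurable]: "(sgn :: 'a::euclidean_space => 'a) \<in> Borel"
 unfolding sgn_div_norm[abs_def] by measurable

text \<open>Almost every ray meets almost every direction: if \<open>P\<close> fails at a unit vector it fails on the
 whole ray through it.\<close>

lemma sphere_AE:
 fixes P :: "'a::euclidean_space => bool"
 assumes ae: "ae v. P v" and scale: "!!c v. 0 < c ==> P (c *R v) ==> P v"
 shows "AE v in sphere_measure. P v"
proof -
 obtain N where N: "N \<in> sets borel" "ae v. v \<notin> N" "!!v. v \<notin> N ==> P v"
  using AE_lborel_borel_null[OF ae] by blast
 note [measurable] = N(1)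
 \<comment> \<open>\<open>Q v\<close> says that the part of the ray through \<open>v\<close> with
   factors in \<open>(0,1)\<close> lies in the null set up to measure 0. Unlike \<open>P\<close>, it
   is a Borel condition, so its measure under the radial projection can be computed.\<close>
 define Q where "Q = (%v. (\<integral>\<^sup>+r. ind {0<..<1} r * ind (- N) (r *R v) \<partial>lborel) = (0::ennreal))"
 define C where "C = - N"
 have [measurable]: "C \<in> sets borel" using N by (simp add: C_def)
 have Q_meas[measurable]: "Measurable.pred borel Q"
 proof -
  have "(%(v, r). ind {0<..<1::real} r * ind C (r *R v) :: ennreal) \<in> borel_measurable (borel \<Otimes>\<^sub>M lborel)"
   by measurable
  then show ?thesis unfolding Q_def C_def[symmetric] by measurable
 qed
 have Q_iff: "Q v \<longleftrightarrow> (ae r. 0 < r --> r < 1 --> r *R v \<in> N)" for v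
  unfolding Q_def C_def[symmetric]
  by (subst nn_integral_0_iff_AE) (auto simp: C_def indicator_def intro!: AE_cong)
 have "ae v. ae r. 0 < r --> r *R v \<notin> N"
 proof -
  have m: "Measurable.pred borel (%p::'a \<times> real. 0 < snd p --> snd p *R fst p \<notin> N)"
   unfolding borel_prod[symmetric] by measurable
  have "ae v. 0 < r --> r *R v \<notin> N" for r
   using AE_scale[OF N(2), of r] by auto
  then have "ae p. 0 < snd p --> snd p *R fst p \<notin> N"
   by (subst AE_lborel_prod_iff(1)[OF m]) simp
  then show ?thesis by (subst (asm) AE_lborel_prod_iff(2)[OF m]) simp
 qed
 then have nQ: "ae y. y \<in> ball 0 1 - {0} --> \<not> Q (sgn y)"
 proof eventually_elim
  case (elim y)
  show ?case
  proof (intro impI notI)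
   assume y: "y \<in> ball 0 1 - {0}" and "Q (sgn y)"
   then have q: "ae r. 0 < r --> r < 1 --> r *R sgn y \<in> N" by (simp add: Q_iff)
   have "ae r. 0 < norm y * r --> norm y * r < 1 --> (norm y * r) *R sgn y \<in> N"
    using AE_scale[OF q, of "norm y"] y by simp
   with elim have "ae r. \<not> (0 < r \<and> r < (1::real))"
   proof eventually_elim
    case (elim r)
    show ?case
    proof
     assume r: "0 < r \<and> r < 1"
     have "norm y * r < 1" using y r mult_strict_mono[of "norm y" 1 r 1] by simp
     moreover have "(norm y * r) *R sgn y = r *R y" using y by (simp add: sgn_div_norm mult.commute)
     ultimately show False using elim r y by simp
    qed
   qed
   then have "emeasure lborel {r::real. 0 < r \<and> r < 1} = 0"
    by (subst (asm) AE_iff_measurable[of "{r::real. 0 < r \<and> r < 1}"]) auto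
   moreover have "{r::real. 0 < r \<and> r < 1} = {0<..<1}" by auto
   ultimately show False by simp
  qed
 qed
 define R where "R = restrict_space (lborel :: 'a measure) (ball 0 1 - {0})"
 have [measurable]: "sgn \<in> R \<rightarrow>\<^sub>M (borel :: 'a measure)"
  unfolding R_def by (intro measurable_restrict_space1) simp
 have "AE y in R. \<not> Q (sgn y)"
  unfolding R_def using nQ by (subst AE_restrict_space_iff) auto
 then have "AE v in distr R borel sgn. \<not> Q v" by (subst AE_distr_iff) auto
 then have "emeasure (distr R borel sgn) {v. Q v} = 0"
  by (subst (asm) AE_iff_measurable[of "{v. Q v}"]) auto
 then have "{v. Q v} \<in> null_sets (scale_measure (of_nat DIM('a)) (distr R borel sgn))"
  by (intro null_setsI) auto
 from AE_not_in[OF this] have "AE v in sphere_measure. v \<notin> {v. Q v}"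
  unfolding sphere_measure_def R_def by (rule AE_completion)
 then show ?thesis
 proof eventually_elim
  case (elim v)
  then have "\<not> (ae r. 0 < r --> r < 1 --> r *R v \<in> N)" by (simp add: Q_iff)
  then obtain r where "0 < r" "r *R v \<notin> N" by (metis (mono_tags, lifting) AE_I2)
  then show ?case using N(3) scale by blast
 qed
qed

lemma sphere_integral:
 fixes f :: "'a::euclidean_space => real"
 assumes [measurable]: "f \<in> Borel"
 shows "(LINT v|sphere_measure. f v) = DIM('a) * (LI v. ind (ball 0 1 - {0}) v * f (sgn v))"
proof -
 define R where "R = restrict_space (lborel :: 'a measure) (ball 0 1 - {0})"
 define D where "D = distr R borel sgn"
 have [measurable]: "sgn \<in> R \<rightarrow>\<^sub>M (borel :: 'a measure)"
  unfolding R_def by (intro measurable_restrict_space1) simp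
 have fD: "f \<in> borel_measurable (scale_measure (of_nat DIM('a)) D)"
  by (simp add: D_def measurable_def sets_scale_measure space_scale_measure) (use assms in \<open>simp add: measurable_def\<close>)
 have "(LINT v|sphere_measure. f v) = (LINT v|scale_measure (of_nat DIM('a)) D. f v)"
  unfolding sphere_measure_def R_def[symmetric] D_def[symmetric] by (rule integral_completion[OF fD])
 also have "scale_measure (of_nat DIM('a)) D = density D (%_. ennreal (real DIM('a)))"
  by (rule measure_eqI) (auto simp: emeasure_density_const ennreal_of_nat_eq_real_of_nat)
 also have "(LINT v|density D (%_. ennreal (real DIM('a))). f v) = (LINT v|D. real DIM('a) * f v)"
  by (subst integral_density) (auto simp: D_def)
 also have "... = real DIM('a) * (LINT v|D. f v)" by simp
 also have "(LINT v|D. f v) = (LINT v|R. f (sgn v))"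
  unfolding D_def by (rule integral_distr) auto
 also have "... = (LI v. ind (ball 0 1 - {0}) v *R f (sgn v))"
  unfolding R_def by (rule integral_restrict_space) auto
 finally show ?thesis by simp
qed

lemma lborel_distr_reflection:
 fixes b :: "'a::euclidean_space"
 assumes b: "b \<in> Basis"
 shows "distr lborel borel (%v. v - (2 * (v \<bullet> b)) *R b) = (lborel :: 'a measure)"
proof -
 define c where "c = (%j::'a. if j = b then - 1 else 1::real)"
 have T: "(%v::'a. v - (2 * (v \<bullet> b)) *R b) = (%v. 0 + (\<Sum>j\<in>Basis. (c j * (v \<bullet> j)) *R j))"
 proof
  fix v :: 'a
  show "v - (2 * (v \<bullet> b)) *R b = 0 + (\<Sum>j\<in>Basis. (c j * (v \<bullet> j)) *R j)"
   by (rule euclidean_eqI) (use b in \<open>auto simp: c_def inner_diff_left inner_Basis\<close>)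
 qed
 have "lborel = density (distr lborel borel (%v::'a. 0 + (\<Sum>j\<in>Basis. (c j * (v \<bullet> j)) *R j))) (%_. (\<Prod>j\<in>Basis. \<bar>c j\<bar>))"
  by (rule lborel_affine_euclidean) (auto simp: c_def)
 also have "(\<Prod>j\<in>(Basis::'a set). \<bar>c j\<bar>) = 1" by (rule prod.neutral) (auto simp: c_def)
 finally show ?thesis unfolding T by (simp add: density_1)
qed

lemma lborel_distr_swap:
 fixes b c :: "'a::euclidean_space"
 assumes bc: "b \<in> Basis" "c \<in> Basis"
 defines "T \<equiv> %v::'a. \<Sum>j\<in>Basis. (v \<bullet> Transposition.transpose b c j) *R j"
 shows "distr lborel borel T = lborel"
proof (rule lborel_eqI[symmetric])
 let ?\<tau> = "Transposition.transpose b c"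
 have perm: "?\<tau> permutes Basis" using bc by (simp add: permutes_swap_id)
 have \<tau>B: "?\<tau> j \<in> Basis \<longleftrightarrow> j \<in> Basis" for j using permutes_in_image[OF perm] .
 have Tin: "T v \<bullet> j = v \<bullet> ?\<tau> j" if "j \<in> Basis" for v j
  unfolding T_def using that by (simp add: inner_sum_left inner_Basis if_distrib sum.delta cong: if_cong)
 have Tm[measurable]: "T \<in> Borel" unfolding T_def by measurable
 fix l u :: 'a assume le: "!!b. b \<in> Basis ==> l \<bullet> b <= u \<bullet> b"
 have "T -` box l u = box (T l) (T u)"
 proof (intro set_eqI iffI)
  fix v assume "v \<in> T -` box l u"
  then have *: "l \<bullet> j < v \<bullet> ?\<tau> j \<and> v \<bullet> ?\<tau> j < u \<bullet> j" if "j \<in> Basis" for j using that Tin by (auto simp: mem_box)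
  show "v \<in> box (T l) (T u)" unfolding mem_box using *[of "?\<tau> _"] \<tau>B Tin by auto
 next
  fix v assume "v \<in> box (T l) (T u)"
  then have *: "l \<bullet> ?\<tau> j < v \<bullet> j \<and> v \<bullet> j < u \<bullet> ?\<tau> j" if "j \<in> Basis" for j using that Tin by (auto simp: mem_box)
  show "v \<in> T -` box l u" using *[of "?\<tau> _"] \<tau>B Tin by (auto simp: mem_box)
 qed
 then have "emeasure (distr lborel borel T) (box l u) = emeasure lborel (box (T l) (T u))"
  by (simp add: emeasure_distr)
 also have "... = (\<Prod>j\<in>Basis. (T u - T l) \<bullet> j)"
  using le \<tau>B Tin by (intro emeasure_lborel_box) auto
 also have "(\<Prod>j\<in>Basis. (T u - T l) \<bullet> j) = (\<Prod>j\<in>Basis. (u - l) \<bullet> ?\<tau> j)"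
  by (intro prod.cong refl) (simp add: inner_diff_left Tin)
 also have "... = (\<Prod>j\<in>Basis. (u - l) \<bullet> j)"
  using prod.permute[OF perm, of "%j. (u - l) \<bullet> j"] by (simp add: o_def)
 finally show "emeasure (distr lborel borel T) (box l u) = ennreal (\<Prod>j\<in>Basis. (u - l) \<bullet> j)" by simp
qed simp

definition pball :: "'a::euclidean_space set" where "pball = ball 0 1 - {0}"

lemma pball_sets[measurable]: "pball \<in> sets borel" by (simp add: pball_def)

lemma pball_finite: "emeasure lborel (pball :: 'a::euclidean_space set) < \<infinity>"
proof -
 have "emeasure lborel (pball :: 'a set) <= emeasure lborel (ball 0 1 :: 'a set)"
  by (intro emeasure_mono) (auto simp: pball_def)
 then show ?thesis using emeasure_lborel_ball_finite[of 0 1] by (rule order.strict_trans1)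
qed

lemma pball_integrable_bounded:
 fixes f :: "'a::euclidean_space => real"
 assumes "f \<in> Borel" "!!v. v \<in> pball ==> \<bar>f v\<bar> <= B"
 shows "L1 (%v. ind pball v * f v)"
proof (rule Bochner_Integration.integrable_bound)
 show "L1 (%v::'a. B * ind pball v)"
  using pball_finite[where 'a='a] by (intro integrable_mult_right integrable_real_indicator) auto
 show "ae v. norm (ind pball v * f v) <= norm (B * ind pball v)"
  using assms(2) by (intro AE_I2) (auto simp: indicator_def intro: order_trans[OF _ abs_ge_self])
 show "(%v. ind pball v * f v) \<in> borel_measurable lborel" using assms(1) by simp
qed

text \<open>Reflecting a coordinate kills the mixed moments, swapping two coordinates equates the
  diagonal ones, and their sum is the volume of the ball because
  \<open>|v|^2 / |v|^2 = 1\<close>.\<close>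

lemma sphere_second_moment:
 fixes A B :: "'a::euclidean_space"
 shows "(LI v. ind pball v * ((A \<bullet> v) * (B \<bullet> v) / (norm v)^2)) = measure lborel (ball 0 1 :: 'a set) / DIM('a) * (A \<bullet> B)"
  and "L1 (%v. ind pball v * ((A \<bullet> v) * (B \<bullet> v) / (norm v)^2))"
proof -
 define I where "I = (%A B::'a. LI v. ind pball v * ((A \<bullet> v) * (B \<bullet> v) / (norm v)^2))"
 have int: "L1 (%v. ind pball v * ((A \<bullet> v) * (B \<bullet> v) / (norm v)^2))" for A B :: 'a
 proof (rule pball_integrable_bounded[where B="norm A * norm B"])
  fix v :: 'a assume "v \<in> pball"
  then have v: "norm v > 0" by (auto simp: pball_def)
  have "\<bar>A \<bullet> v\<bar> * \<bar>B \<bullet> v\<bar> <= (norm A * norm v) * (norm B * norm v)"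
   by (intro mult_mono Cauchy_Schwarz_ineq2) auto
  then show "\<bar>(A \<bullet> v) * (B \<bullet> v) / (norm v)^2\<bar> <= norm A * norm B"
   using v by (simp add: abs_mult divide_le_eq power2_eq_square mult_ac)
 qed measurable
 then show "L1 (%v. ind pball v * ((A \<bullet> v) * (B \<bullet> v) / (norm v)^2))" .
 have off: "I b c = 0" if "b \<in> Basis" "c \<in> Basis" "b \<noteq> c" for b c
 proof -
  define T where "T = (%v::'a. v - (2 * (v \<bullet> b)) *R b)"
  have Tm[measurable]: "T \<in> Borel" unfolding T_def by measurable
  have nT: "norm (T v) = norm v" for v
  proof -
   have "T v \<bullet> T v = v \<bullet> v" unfolding T_def using that
    by (simp add: inner_diff_left inner_diff_right inner_commute algebra_simps)
   then show ?thesis by (simp add: norm_eq_sqrt_inner)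
  qed
  have T0: "T v \<in> pball \<longleftrightarrow> v \<in> pball" for v using nT[of v] by (simp add: pball_def) (metis norm_eq_zero)
  have "I b c = (LINT v|distr lborel borel T. ind pball v * ((b \<bullet> v) * (c \<bullet> v) / (norm v)^2))"
   unfolding I_def T_def lborel_distr_reflection[OF that(1)] ..
  also have "... = (LI v. ind pball (T v) * ((b \<bullet> T v) * (c \<bullet> T v) / (norm (T v))^2))"
  proof (rule integral_distr)
   show "(%v. ind pball v * ((b \<bullet> v) * (c \<bullet> v) / (norm v)^2)) \<in> Borel" by measurable
  qed (use Tm in simp)
  also have "... = (LI v. - (ind pball v * ((b \<bullet> v) * (c \<bullet> v) / (norm v)^2)))"
  proof (rule Bochner_Integration.integral_cong[OF refl])
   fix v
   have "b \<bullet> T v = - (b \<bullet> v)" "c \<bullet> T v = c \<bullet> v"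
    unfolding T_def using that by (simp_all add: inner_diff_right inner_Basis inner_commute)
   then show "ind pball (T v) * ((b \<bullet> T v) * (c \<bullet> T v) / (norm (T v))^2) = - (ind pball v * ((b \<bullet> v) * (c \<bullet> v) / (norm v)^2))"
    by (simp add: nT T0 indicator_def)
  qed
  also have "... = - I b c" by (simp add: I_def)
  finally show ?thesis by simp
 qed
 have diag: "I b b = I c c" if bc: "b \<in> Basis" "c \<in> Basis" for b c
 proof -
  define T where "T = (%v::'a. \<Sum>j\<in>Basis. (v \<bullet> Transposition.transpose b c j) *R j)"
  have Tm[measurable]: "T \<in> Borel" unfolding T_def by measurable
  have Tin: "T v \<bullet> j = v \<bullet> Transposition.transpose b c j" if "j \<in> Basis" for v j
   unfolding T_def using that by (simp add: inner_sum_left inner_Basis if_distrib sum.delta cong: if_cong)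
  have perm: "Transposition.transpose b c permutes Basis" using bc by (simp add: permutes_swap_id)
  have nT: "norm (T v) = norm v" for v
  proof -
   have "T v \<bullet> T v = (\<Sum>j\<in>Basis. (v \<bullet> Transposition.transpose b c j) * (v \<bullet> Transposition.transpose b c j))"
    by (subst euclidean_inner) (simp add: Tin)
   also have "... = (\<Sum>j\<in>Basis. (v \<bullet> j) * (v \<bullet> j))"
    using sum.permute[OF perm, of "%j. (v \<bullet> j) * (v \<bullet> j)"] by (simp add: o_def)
   finally show ?thesis by (simp add: norm_eq_sqrt_inner euclidean_inner[of v v])
  qed
  have T0: "T v \<in> pball \<longleftrightarrow> v \<in> pball" for v using nT[of v] by (simp add: pball_def) (metis norm_eq_zero)
  have "I b b = (LINT v|distr lborel borel T. ind pball v * ((b \<bullet> v) * (b \<bullet> v) / (norm v)^2))"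
   unfolding I_def T_def lborel_distr_swap[OF that] ..
  also have "... = (LI v. ind pball (T v) * ((b \<bullet> T v) * (b \<bullet> T v) / (norm (T v))^2))"
  proof (rule integral_distr)
   show "(%v. ind pball v * ((b \<bullet> v) * (b \<bullet> v) / (norm v)^2)) \<in> Borel" by measurable
  qed (use Tm in simp)
  also have "... = I c c"
   unfolding I_def
  proof (rule Bochner_Integration.integral_cong[OF refl])
   fix v
   have "b \<bullet> T v = c \<bullet> v" using Tin[OF bc(1), of v] by (simp add: inner_commute)
   then show "ind pball (T v) * ((b \<bullet> T v) * (b \<bullet> T v) / (norm (T v))^2) = ind pball v * ((c \<bullet> v) * (c \<bullet> v) / (norm v)^2)"
    by (simp add: nT T0 indicator_def)
  qed
  finally show ?thesis .
 qed
 define \<omega> where "\<omega> = measure lborel (ball 0 1 :: 'a set)"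
 have tot: "(\<Sum>b\<in>(Basis::'a set). I b b) = \<omega>"
 proof -
  have "(\<Sum>b\<in>(Basis::'a set). I b b) = (LI v. (\<Sum>b\<in>(Basis::'a set). ind pball v * ((b \<bullet> v) * (b \<bullet> v) / (norm v)^2)))"
   unfolding I_def by (rule Bochner_Integration.integral_sum[symmetric]) (rule int)
  also have "... = (LI v. ind pball (v::'a))"
  proof (rule Bochner_Integration.integral_cong[OF refl])
   fix v :: 'a
   have "(\<Sum>b\<in>(Basis::'a set). (b \<bullet> v) * (b \<bullet> v)) = (norm v)^2"
    unfolding power2_norm_eq_inner by (subst euclidean_inner[of v v]) (simp add: inner_commute)
   then have "(\<Sum>b\<in>(Basis::'a set). ind pball v * ((b \<bullet> v) * (b \<bullet> v) / (norm v)^2)) = ind pball v * ((norm v)^2 / (norm v)^2)"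
    by (simp flip: sum_distrib_left sum_divide_distrib)
   also have "... = ind pball v" by (auto simp: indicator_def pball_def)
   finally show "(\<Sum>b\<in>(Basis::'a set). ind pball v * ((b \<bullet> v) * (b \<bullet> v) / (norm v)^2)) = ind pball v" .
  qed
  also have "... = measure lborel (pball :: 'a set)" by simp
  also have "... = \<omega>"
   unfolding \<omega>_def pball_def by (rule measure_eq_AE) (use AE_lborel_singleton[of "0::'a"] in \<open>auto elim!: eventually_mono\<close>)
  finally show ?thesis .
 qed
 have diag': "I b b = \<omega> / DIM('a)" if "b \<in> Basis" for b
 proof -
  have "(\<Sum>c\<in>(Basis::'a set). I c c) = (\<Sum>c\<in>(Basis::'a set). I b b)" by (intro sum.cong refl diag that)
  then have "DIM('a) * I b b = \<omega>" using tot by simp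
  then show ?thesis by (simp add: field_simps)
 qed
 have "I A B = (LI v. (\<Sum>b\<in>Basis. \<Sum>c\<in>Basis. (A \<bullet> b) * (B \<bullet> c) * (ind pball v * ((b \<bullet> v) * (c \<bullet> v) / (norm v)^2))))"
  unfolding I_def
 proof (rule Bochner_Integration.integral_cong[OF refl])
  fix v :: 'a
  have "(A \<bullet> v) * (B \<bullet> v) = (\<Sum>b\<in>Basis. \<Sum>c\<in>Basis. (A \<bullet> b) * (B \<bullet> c) * ((b \<bullet> v) * (c \<bullet> v)))"
   by (subst euclidean_inner[of A v], subst euclidean_inner[of B v]) (simp add: sum_product inner_commute mult_ac)
  then show "ind pball v * ((A \<bullet> v) * (B \<bullet> v) / (norm v)^2)
   = (\<Sum>b\<in>Basis. \<Sum>c\<in>Basis. (A \<bullet> b) * (B \<bullet> c) * (ind pball v * ((b \<bullet> v) * (c \<bullet> v) / (norm v)^2)))"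
   by (simp add: sum_distrib_left sum_divide_distrib mult_ac)
 qed
 also have "... = (\<Sum>b\<in>Basis. LI v. (\<Sum>c\<in>Basis. (A \<bullet> b) * (B \<bullet> c) * (ind pball v * ((b \<bullet> v) * (c \<bullet> v) / (norm v)^2))))"
  by (rule Bochner_Integration.integral_sum) (intro Bochner_Integration.integrable_sum integrable_mult_right int)
 also have "... = (\<Sum>b\<in>Basis. \<Sum>c\<in>Basis. LI v. (A \<bullet> b) * (B \<bullet> c) * (ind pball v * ((b \<bullet> v) * (c \<bullet> v) / (norm v)^2)))"
  by (intro sum.cong refl Bochner_Integration.integral_sum integrable_mult_right int)
 also have "... = (\<Sum>b\<in>Basis. \<Sum>c\<in>Basis. (A \<bullet> b) * (B \<bullet> c) * I b c)"
  unfolding I_def by (intro sum.cong refl integral_mult_right_zero)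
 also have "... = (\<Sum>b\<in>Basis. \<Sum>c\<in>Basis. if c = b then (A \<bullet> b) * (B \<bullet> b) * (\<omega> / DIM('a)) else 0)"
  using off diag' by (intro sum.cong refl) auto
 also have "... = \<omega> / DIM('a) * (A \<bullet> B)"
  by (subst euclidean_inner[of A B]) (simp add: sum_distrib_left mult_ac)
 finally show "(LI v. ind pball v * ((A \<bullet> v) * (B \<bullet> v) / (norm v)^2)) = measure lborel (ball 0 1 :: 'a set) / DIM('a) * (A \<bullet> B)"
  by (simp add: I_def \<omega>_def)
qed

lemma (in complete_measure) measurable_AE_eq:
 fixes f f' :: "'a => real"
 assumes g: "f' \<in> borel_measurable M" and ae: "AE x in M. f x = f' x"
 shows "f \<in> borel_measurable M"
proof (rule measurableI)
 fix A :: "real set" assume "A \<in> sets borel"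
 show "f -` A \<inter> space M \<in> sets M"
 proof (rule in_sets_AE)
  show "AE x in M. (x \<in> f' -` A \<inter> space M) = (x \<in> f -` A \<inter> space M)" using ae by eventually_elim auto
  show "f' -` A \<inter> space M \<in> sets M" using g \<open>A \<in> sets borel\<close> by (rule measurable_sets)
 qed auto
qed simp

context sobolev_map
begin

text \<open>Polar coordinates replace the integral over the sphere by one over the punctured unit ball.\<close>

definition edens :: "'a => real" where
 "edens z = DIM('a) / measure lborel (ball 0 1 :: 'a set) * (LI v. ind pball v * ((speed z v)^2 / (norm v)^2))"

lemma speed_quotient_int: "L1 (%v. ind pball v * ((speed z v)^2 / (norm v)^2))"
proof (rule pball_integrable_bounded[where B="(h z)^2"])
 have "(%v. (%(z, v). speed z v) (z, v)) \<in> Borel" by measurable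
 then have [measurable]: "(%v. speed z v) \<in> Borel" by simp
 show "(%v. (speed z v)^2 / (norm v)^2) \<in> Borel" by measurable
 fix v :: 'a assume "v \<in> pball"
 then have v: "0 < norm v" by (auto simp: pball_def)
 have "(speed z v)^2 <= (h z * norm v)^2" by (intro power_mono speed_le speed_nonneg)
 then show "\<bar>(speed z v)^2 / (norm v)^2\<bar> <= (h z)^2" using v by (simp add: divide_le_eq power_mult_distrib)
qed

lemma unit_ball_measure_pos: "measure lborel (ball 0 1 :: 'a set) > 0"
 by (rule content_ball_pos) simp

lemma edens_nonneg: "0 <= edens z"
 unfolding edens_def using unit_ball_measure_pos
 by (intro mult_nonneg_nonneg Bochner_Integration.integral_nonneg) auto

lemma measure_pball: "measure lborel (pball :: 'a set) = measure lborel (ball 0 1 :: 'a set)"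
 unfolding pball_def by (rule measure_eq_AE) (use AE_lborel_singleton[of "0::'a"] in \<open>auto elim!: eventually_mono\<close>)

lemma edens_le: "edens z <= DIM('a) * (h z)^2"
proof -
 define \<omega> where "\<omega> = measure lborel (ball 0 1 :: 'a set)"
 have \<omega>: "\<omega> > 0" unfolding \<omega>_def by (rule unit_ball_measure_pos)
 have "(LI v. ind pball v * ((speed z v)^2 / (norm v)^2)) <= (LI v. ind (pball :: 'a set) v * (h z)^2)"
 proof (rule integral_mono)
  show "L1 (%v. ind (pball :: 'a set) v * (h z)^2)"
   using pball_finite[where 'a='a] by (intro integrable_mult_left integrable_real_indicator) auto
  fix v :: 'a
  have "(speed z v)^2 <= (h z * norm v)^2" by (intro power_mono speed_le speed_nonneg)
  then show "ind pball v * ((speed z v)^2 / (norm v)^2) <= ind pball v * (h z)^2"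
   by (cases "v = 0") (auto simp: indicator_def divide_le_eq power_mult_distrib)
 qed (rule speed_quotient_int)
 also have "... = \<omega> * (h z)^2" by (simp add: \<omega>_def measure_pball)
 finally have "DIM('a) / \<omega> * (LI v. ind pball v * ((speed z v)^2 / (norm v)^2)) <= DIM('a) / \<omega> * (\<omega> * (h z)^2)"
  using \<omega> by (intro mult_left_mono) auto
 then show ?thesis using \<omega> by (simp add: edens_def \<omega>_def)
qed

lemma edens_meas[measurable]: "edens \<in> Borel"
proof -
 have "(%(z, v). ind pball v * ((speed z v)^2 / (norm v)^2)) \<in> borel_measurable (borel \<Otimes>\<^sub>M lborel)"
 proof -
  have "(%(z, v). ind pball v * ((speed z v)^2 / (norm v)^2)) \<in> borel_measurable (borel \<Otimes>\<^sub>M borel)"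
   by measurable
  then show ?thesis by (simp cong: measurable_cong_sets)
 qed
 then show ?thesis unfolding edens_def[abs_def] by measurable
qed

lemma edens_int: "L1 edens"
proof (rule Bochner_Integration.integrable_bound)
 show "L1 (%z. DIM('a) * (h z)^2)" using h2_int by simp
 show "ae z. norm (edens z) <= norm (DIM('a) * (h z)^2)"
  using edens_le edens_nonneg by (intro AE_I2) auto
qed simp

lemma representativeI:
 assumes "segment_ac_representative Om u w"
 shows "representative w"
proof -
 have "AE z in lebesgue_on Om. w z = u z" using assms by (simp add: segment_ac_representative_def)
 then have "AE z in lebesgue. z \<in> Om --> w z = u z"
  using open_domain by (subst (asm) AE_restrict_space_iff) auto
 then have 1: "ae z. z \<in> Om --> w z = u z" by (simp add: AE_completion_iff)
 have "ae p. closed_segment (fst p) (snd p) <= Om --> abs_cont_on 0 1 (%t. w (fst p + t *R (snd p - fst p)))"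
  using assms by (simp add: segment_ac_representative_def case_prod_unfold)
 from AE_shear[OF this]
 have "ae p. segment_in Om p --> continuous_on {0..1} (%t. w (pt p t))"
  by eventually_elim (auto dest: abs_cont_on_continuous)
 with 1 show ?thesis by (simp add: representative_def)
qed

text \<open>The representative that \<open>SOME\<close> selects is unknown, but any representative
  has metric velocity \<open>speed\<close> for almost every base point and direction; homogeneity in
  the direction carries this to almost every point of the sphere.\<close>

theorem energy_density_eq:
 assumes ex: "\<exists>w. segment_ac_representative Om u w"
 shows "ae z. z \<in> Om --> energy_density Om u z = edens z"
proof -
 define w where "w = (SOME w. segment_ac_representative Om u w)"
 have rep: "representative w" using someI_ex[OF ex] unfolding w_def by (rule representativeI)
 from AE_lborel_prodD[OF speed_limit[OF rep]]
 show ?thesis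
 proof eventually_elim
  case (elim z)
  show ?case
  proof
   assume z: "z \<in> Om"
   define P where "P = (%v. ((%t. dist (w (z + t *R v)) (w z) / \<bar>t\<bar>) \<longlongrightarrow> speed z v) (at 0))"
   have "ae v. P v" using elim z by (simp add: P_def)
   then have "AE v in sphere_measure. P v"
   proof (rule sphere_AE)
    fix c :: real and v assume c: "0 < c" and "P (c *R v)"
    then have "((%t. dist (w (z + t *R (c *R v))) (w z) / \<bar>t\<bar>) \<longlongrightarrow> c * speed z v) (at 0)"
     by (simp add: P_def speed_scale)
    moreover have "filterlim (%t. t / c) (at 0) (at 0)"
    proof (rule filterlim_atI)
     have "((%t. t / c) \<longlongrightarrow> 0 / c) (at 0)" using c by (intro tendsto_intros) auto
     then show "((%t. t / c) \<longlongrightarrow> 0) (at 0)" by simp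
     show "\<forall>\<^sub>F t in at 0. t / c \<noteq> 0" using c by (auto simp: eventually_at intro!: exI[of _ 1])
    qed
    ultimately have "((%t. dist (w (z + (t / c) *R (c *R v))) (w z) / \<bar>t / c\<bar>) \<longlongrightarrow> c * speed z v) (at 0)"
     by (rule filterlim_compose)
    then have "((%t. dist (w (z + (t / c) *R (c *R v))) (w z) / \<bar>t / c\<bar> / c) \<longlongrightarrow> c * speed z v / c) (at 0)"
     using c by (intro tendsto_divide) auto
    then show "P v" using c by (simp add: P_def)
   qed
   then have mv: "AE v in sphere_measure. (metric_velocity Om u z v)^2 = (speed z v)^2"
   proof eventually_elim
    case (elim v)
    then have "Lim (at 0) (%t. dist (w (z + t *R v)) (w z) / \<bar>t\<bar>) = speed z v"
     unfolding P_def by (intro tendsto_Lim) auto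
    then show ?case by (simp add: metric_velocity_def w_def[symmetric])
   qed
   have "(%v. (%(z, v). speed z v) (z, v)) \<in> Borel" by measurable
   then have [measurable]: "(%v. speed z v) \<in> Borel" by simp
   have sm: "(%v. (speed z v)^2) \<in> borel_measurable (sphere_measure :: 'a measure)"
   proof -
    have "(%v. (speed z v)^2) \<in> Borel" by measurable
    then show ?thesis unfolding sphere_measure_def
     by (intro measurable_completion) (simp add: measurable_def sets_scale_measure space_scale_measure)
   qed
   have "(%v. (metric_velocity Om u z v)^2) \<in> borel_measurable (sphere_measure :: 'a measure)"
    using sm mv unfolding sphere_measure_def by (rule completion.measurable_AE_eq)
   then have "(LINT v|sphere_measure. (metric_velocity Om u z v)^2) = (LINT v|sphere_measure. (speed z v)^2)"
    using sm mv by (rule integral_cong_AE)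
   also have "... = DIM('a) * (LI v. ind pball v * (speed z (sgn v))^2)"
    by (subst sphere_integral) (auto simp: pball_def)
   also have "(%v. ind pball v * (speed z (sgn v))^2) = (%v. ind pball v * ((speed z v)^2 / (norm v)^2))"
    by (auto simp: fun_eq_iff sgn_div_norm speed_scale power_mult_distrib divide_simps)
   finally show "energy_density Om u z = edens z" by (simp add: energy_density_def edens_def)
  qed
 qed
qed

end

section \<open>Existence of absolutely continuous representatives\<close>

lemma AE_lebesgue_on_borel:
 assumes "S \<in> sets borel"
 shows "(AE z in lebesgue_on S. P z) \<longleftrightarrow> (ae z. z \<in> S --> P z)"
proof -
 have "S \<in> sets lebesgue" using assms by (simp add: sets_completionI_sets)
 then show ?thesis by (simp add: AE_restrict_space_iff AE_completion_iff)
qed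

text \<open>Splitting \<open>f\<close> at a height \<open>n\<close> leaves a remainder
  \<open>max 0 (f - n)\<close> of integral below \<open>e / 2\<close>; the rest contributes at most
  \<open>n\<close> times the total length of the intervals.\<close>

lemma integral_abs_cont_on:
 fixes f :: "real => real" and c :: "real => 'x::metric_space"
 assumes f: "L1 f" "!!t. 0 <= f t"
  and c: "!!s t. a <= s ==> s <= t ==> t <= b ==> dist (c s) (c t) <= (LI r. ind {s..t} r * f r)"
 shows "abs_cont_on a b c"
 unfolding abs_cont_on_def
proof (intro allI impI)
 fix e :: real assume "0 < e"
 have [measurable]: "f \<in> Borel" using f by simp
 have "(%n. LI t. max 0 (f t - real n)) \<longlonglongrightarrow> (LINT t|(lborel::real measure). 0)"
 proof (rule integral_dominated_convergence[where w=f])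
  show "ae t. (%n. max 0 (f t - real n)) \<longlonglongrightarrow> 0"
  proof (rule AE_I2)
   fix t
   have "\<forall>\<^sub>F n in sequentially. max 0 (f t - real n) = 0"
   proof (rule eventually_sequentiallyI)
    fix n assume "nat \<lceil>f t\<rceil> <= n"
    then have "f t <= real n" by linarith
    then show "max 0 (f t - real n) = 0" by simp
   qed
   then show "(%n. max 0 (f t - real n)) \<longlonglongrightarrow> 0" by (rule tendsto_eventually)
  qed
 qed (use f in auto)
 then have "\<forall>\<^sub>F n in sequentially. (LI t. max 0 (f t - real n)) < e / 2"
  using \<open>0 < e\<close> by (intro order_tendstoD) auto
 then obtain n where n: "(LI t. max 0 (f t - real n)) < e / 2" by (auto simp: eventually_sequentially)
 define k where "k = (%t. max 0 (f t - real n))"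
 have k: "L1 k" unfolding k_def
  by (rule Bochner_Integration.integrable_bound[OF f(1)]) (use f(2) in auto)
 show "\<exists>d>0. \<forall>(N::nat set) l r. finite N --> (\<forall>i\<in>N. a <= l i \<and> l i <= r i \<and> r i <= b) -->
   disjoint_family_on (%i. {l i<..<r i}) N --> (\<Sum>i\<in>N. r i - l i) < d --> (\<Sum>i\<in>N. dist (c (l i)) (c (r i))) < e"
 proof (intro exI[of _ "e / (2 * (real n + 1))"] conjI allI impI)
  fix N :: "nat set" and l r :: "nat => real"
  assume N: "finite N" and lr: "\<forall>i\<in>N. a <= l i \<and> l i <= r i \<and> r i <= b"
   and dj: "disjoint_family_on (%i. {l i<..<r i}) N" and small: "(\<Sum>i\<in>N. r i - l i) < e / (2 * (real n + 1))"
  have ki: "L1 (%t. ind {l i<..<r i} t * k t)" for i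
   using integrable_mult_indicator[OF _ k, of "{l i<..<r i}"] by simp
  have *: "dist (c (l i)) (c (r i)) <= real n * (r i - l i) + (LI t. ind {l i<..<r i} t * k t)" if "i \<in> N" for i
  proof -
   have li: "l i <= r i" using lr that by auto
   have "dist (c (l i)) (c (r i)) <= (LI t. ind {l i..r i} t * f t)" using c lr that by auto
   also have "... <= (LI t. real n * ind {l i..r i} t + ind {l i..r i} t * k t)"
   proof (rule integral_mono)
    show "L1 (%t. ind {l i..r i} t * f t)"
     using integrable_mult_indicator[OF _ f(1), of "{l i..r i}"] by simp
    show "L1 (%t. real n * ind {l i..r i} t + ind {l i..r i} t * k t)"
     using integrable_mult_indicator[OF _ k, of "{l i..r i}"]
     by (intro Bochner_Integration.integrable_add integrable_mult_right)
      (auto intro: integrable_real_indicator simp: emeasure_lborel_Icc_eq)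
   qed (auto simp: indicator_def k_def)
   also have "... = real n * (r i - l i) + (LI t. ind {l i..r i} t * k t)"
    using integrable_mult_indicator[OF _ k, of "{l i..r i}"] li by simp
   also have "(LI t. ind {l i..r i} t * k t) = (LI t. ind {l i<..<r i} t * k t)"
   proof (rule integral_cong_AE)
    show "ae t. ind {l i..r i} t * k t = ind {l i<..<r i} t * k t"
     using AE_lborel_singleton[of "l i"] AE_lborel_singleton[of "r i"]
     by eventually_elim (auto simp: indicator_def)
   qed (auto simp: k_def)
   finally show ?thesis .
  qed
  have "(\<Sum>i\<in>N. dist (c (l i)) (c (r i))) <= real n * (\<Sum>i\<in>N. r i - l i) + (\<Sum>i\<in>N. LI t. ind {l i<..<r i} t * k t)"
   using sum_mono[OF *, of N "%i. i"] by (simp add: sum.distrib sum_distrib_left)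
  also have "(\<Sum>i\<in>N. LI t. ind {l i<..<r i} t * k t) = (LI t. (\<Sum>i\<in>N. ind {l i<..<r i} t) * k t)"
   using ki by (simp add: sum_distrib_right)
  also have "... <= (LI t. k t)"
  proof (rule integral_mono)
   show "L1 (%t. (\<Sum>i\<in>N. ind {l i<..<r i} t) * k t)" using ki by (simp add: sum_distrib_right)
   fix t
   have "(\<Sum>i\<in>N. ind {l i<..<r i} t) = (ind (\<Union>i\<in>N. {l i<..<r i}) t :: real)"
    by (rule indicator_UN_disjoint[OF N dj, symmetric])
   then show "(\<Sum>i\<in>N. ind {l i<..<r i} t) * k t <= k t" by (simp add: indicator_def k_def)
  qed (rule k)
  also have "... < e / 2" using n by (simp add: k_def)
  also have "real n * (\<Sum>i\<in>N. r i - l i) <= real n * (e / (2 * (real n + 1)))" using small by (intro mult_left_mono) auto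
  also have "... <= e / 2" using \<open>0 < e\<close> by (simp add: field_simps)
  finally show "(\<Sum>i\<in>N. dist (c (l i)) (c (r i))) < e" by simp
 qed (use \<open>0 < e\<close> in simp)
qed

lemma AE_unshear:
 fixes P :: "'a::euclidean_space \<times> 'a => bool"
 assumes "ae p. P p"
 shows "ae p. P (fst p, snd p - fst p)"
proof -
 obtain N where N: "N \<in> sets borel" "ae p. p \<notin> N" "!!p. p \<notin> N ==> P p"
  using AE_lborel_borel_null[OF assms(1)] by blast
 have m1: "Measurable.pred borel (%p. p \<notin> N)" using N(1) by measurable
 have "(%p::'a\<times>'a. (fst p, snd p - fst p)) \<in> Borel"
  by (intro borel_measurable_continuous_onI continuous_intros)
 from measurable_compose[OF this m1]
 have m2: "Measurable.pred borel (%p::'a\<times>'a. (fst p, snd p - fst p) \<notin> N)" .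
 have "ae z. ae y. (z, y) \<notin> N"
  using N(2) by (subst (asm) AE_lborel_prod_iff(2)[OF m1])
 then have "ae z. ae y. (z, y - z) \<notin> N"
 proof eventually_elim
  case (elim z)
  from AE_translate[OF elim, of "- z"] show ?case by simp
 qed
 then have "ae p. (fst p, snd p - fst p) \<notin> N"
  by (subst AE_lborel_prod_iff(2)[OF m2]) simp
 then show ?thesis by (rule AE_mp) (use N(3) in auto)
qed

context sobolev_map begin

text \<open>The representative is read off from the distances: \<open>w z\<close> is the point of
  the closure whose distances to the sequence are the continuous versions \<open>gt k z\<close>.
  Where such a point exists it is unique. On a good segment it exists at every parameter, as the
  limit of values of \<open>u\<close> at parameters off the exceptional set, by
  completeness.\<close>

lemma segment_ac_representative_exists:
 assumes complete: "complete (UNIV :: 'x set)"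
 shows "\<exists>w. segment_ac_representative Om u w"
proof -
 have "\<forall>k. \<exists>gt. (ae z. gt z = g k z) \<and>
  (ae p. segment_in Om p --> continuous_on {0..1} (%t. gt (pt p t)))"
  by (intro allI weak_gradient_primitive(2)[OF wgrad open_domain]) (rule AE_I2, rule impI, rule refl)
 from choice[OF this] obtain gt where gt: "\<forall>k. (ae z. gt k z = g k z) \<and>
  (ae p. segment_in Om p --> continuous_on {0..1} (%t. gt k (pt p t)))" ..
 define w where "w = (%z. SOME c. c \<in> closure (range x) \<and> (\<forall>k. dist (x k) c = gt k z))"
 have w_eq: "w z = c" if c: "c \<in> closure (range x)" "!!k. dist (x k) c = gt k z" for z c
 proof -
  have "\<exists>c. c \<in> closure (range x) \<and> (\<forall>k. dist (x k) c = gt k z)" using c by blast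
  then have "w z \<in> closure (range x) \<and> (\<forall>k. dist (x k) (w z) = gt k z)" unfolding w_def by (rule someI_ex)
  then show ?thesis using dist_le_by_dense_family[OF c(1), of "w z" 0] c(2) by simp
 qed
 have "ae z. z \<in> Om --> u z \<in> closure (range x) \<and> (\<forall>k. dist (x k) (u z) = gt k z)"
 proof -
  have "ae z. \<forall>k. gt k z = g k z" unfolding AE_all_countable using gt by blast
  with values_ae show ?thesis by eventually_elim auto
 qed
 then obtain N where N: "N \<in> sets borel" "ae z. z \<notin> N"
  "!!z. z \<notin> N ==> z \<in> Om --> u z \<in> closure (range x) \<and> (\<forall>k. dist (x k) (u z) = gt k z)"
  using AE_lborel_borel_null by blast
 have wu: "w z = u z" if "z \<notin> N" "z \<in> Om" for z using N(3)[OF that(1)] that(2) w_eq by blast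
 have "ae z. z \<in> Om --> w z = u z" using N(2) by eventually_elim (simp add: wu)
 then have 1: "AE z in lebesgue_on Om. w z = u z"
  using open_domain by (simp add: AE_lebesgue_on_borel)
 have "ae p. \<forall>k. segment_in Om p -->
   continuous_on {0..1} (%t. gt k (pt p t)) \<and>
   (\<forall>t\<in>{0..1}. gt k (pt p t) - gt k (fst p) = integral {0..t} (%s. G k (pt p s) \<bullet> snd p)) \<and>
   L1 (%t. ind {0..1} t * (G k (pt p t) \<bullet> snd p))"
  unfolding AE_all_countable
 proof
  fix k
  have "ae z. z \<in> Om --> gt k z = g k z" using gt by (auto elim: eventually_mono)
  from weak_gradient_primitive(1)[OF wgrad open_domain this] gt[rule_format, of k, THEN conjunct2]
  show "ae p. segment_in Om p -->
   continuous_on {0..1} (%t. gt k (pt p t)) \<and>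
   (\<forall>t\<in>{0..1}. gt k (pt p t) - gt k (fst p) = integral {0..t} (%s. G k (pt p s) \<bullet> snd p)) \<and>
   L1 (%t. ind {0..1} t * (G k (pt p t) \<bullet> snd p))"
   by eventually_elim blast
 qed
 with AE_lines_avoid_null[OF N(1,2)] AE_lines_integrable[OF h_int]
 have "ae p. segment_in Om p --> abs_cont_on 0 1 (%t. w (pt p t))"
 proof (eventually_elim, intro impI)
  fix p assume p1: "ae t::real. pt p t \<notin> N"
   and p2: "L1 (%t. ind {0..1} t * h (pt p t))"
   and p3: "\<forall>k. segment_in Om p -->
   continuous_on {0..1} (%t. gt k (pt p t)) \<and>
   (\<forall>t\<in>{0..1}. gt k (pt p t) - gt k (fst p) = integral {0..t} (%s. G k (pt p s) \<bullet> snd p)) \<and>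
   L1 (%t. ind {0..1} t * (G k (pt p t) \<bullet> snd p))"
   and seg: "segment_in Om p"
  define \<gamma> where "\<gamma> = (%t. pt p t)"
  define E where "E = (%k s. G k (\<gamma> s) \<bullet> snd p)"
  have cont: "continuous_on {0..1} (%t. gt k (\<gamma> t))" and Ei: "L1 (%t. ind {0..1} t * E k t)"
   and prim: "!!t. t \<in> {0..1} ==> gt k (\<gamma> t) - gt k (fst p) = integral {0..t} (E k)" for k
   using p3 seg by (auto simp: \<gamma>_def E_def)
  \<comment> \<open>Bounds the derivatives of all \<open>gt j\<close> along the segment at once, so
    it controls distances in the target.\<close>
  define k where "k = (%t. norm (snd p) * (ind {0..1} t * h (\<gamma> t)))"
  have k: "L1 k" unfolding k_def \<gamma>_def using p2 by (rule integrable_mult_right)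
  have k0: "0 <= k t" for t using h_nonneg by (simp add: k_def)
  have ki: "L1 (%r. ind {s..t} r * k r)" for s t
   using integrable_mult_indicator[OF _ k, of "{s..t}"] by simp
  define \<Psi> where "\<Psi> = (%s t. LI r. ind {s..t} r * k r)"
  have gtd: "\<bar>gt j (\<gamma> t) - gt j (\<gamma> s)\<bar> <= \<Psi> s t" if st: "0 <= s" "s <= t" "t <= 1" for s t j
  proof -
   have "gt j (\<gamma> t) - gt j (\<gamma> s) = integral {0..t} (E j) - integral {0..s} (E j)"
    using prim[of s j] prim[of t j] st by simp
   also have "... = integral {s..t} (E j)"
    using Henstock_Kurzweil_Integration.integral_combine[of 0 s t "E j"] integral_upto_eq_HK(1)[OF Ei, of 0 t j] st by simp
   also have "... = (LI r. ind {s..t} r * E j r)"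
    using integral_upto_eq_HK(2)[OF Ei, of s t j] st by simp
   also have "\<bar>...\<bar> <= (LI r. \<bar>ind {s..t} r * E j r\<bar>)" by (rule integral_abs_bound)
   also have "... <= \<Psi> s t" unfolding \<Psi>_def
   proof (rule integral_mono)
    have "L1 (%r. ind {s..t} r *R (ind {0..1} r * E j r))"
     by (rule integrable_mult_indicator[OF _ Ei]) simp
    also have "(%r. ind {s..t} r *R (ind {0..1} r * E j r)) = (%r. ind {s..t} r * E j r)"
     using st by (auto simp: indicator_def)
    finally show "L1 (%r. \<bar>ind {s..t} r * E j r\<bar>)" by (rule integrable_abs)
    fix r
    have "\<bar>E j r\<bar> <= norm (G j (\<gamma> r)) * norm (snd p)" unfolding E_def by (rule Cauchy_Schwarz_ineq2)
    also have "... <= h (\<gamma> r) * norm (snd p)" by (rule mult_right_mono[OF G_le]) simp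
    finally show "\<bar>ind {s..t} r * E j r\<bar> <= ind {s..t} r * k r"
     using st by (auto simp: indicator_def k_def mult.commute)
   qed (rule ki)
   finally show ?thesis .
  qed
  have inOm: "\<gamma> t \<in> Om" if "t \<in> {0..1}" for t using seg line_in_segment[OF that] by (auto simp: \<gamma>_def)
  have good: "w (\<gamma> t) \<in> closure (range x) \<and> (\<forall>j. dist (x j) (w (\<gamma> t)) = gt j (\<gamma> t))" if t: "t \<in> {0..1}" for t
  proof -
   have "\<exists>s. s \<in> {0..1} \<and> \<bar>s - t\<bar> < 1 / Suc n \<and> \<gamma> s \<notin> N" for n :: nat
   proof -
    define e where "e = 1 / real (Suc n)"
    have "0 < e" by (simp add: e_def)
    then have "max 0 (t - e) < min 1 (t + e)" using t by auto
    from AE_unit_interval_ex[OF p1 this] obtain s where "max 0 (t - e) < s" "s < min 1 (t + e)" "\<gamma> s \<notin> N"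
     by (auto simp: \<gamma>_def)
    then show ?thesis unfolding e_def[symmetric] by (intro exI[of _ s]) (auto simp: abs_less_iff)
   qed
   then obtain s where s: "!!n::nat. s n \<in> {0..1}" "!!n. \<bar>s n - t\<bar> < 1 / Suc n" "!!n. \<gamma> (s n) \<notin> N" by metis
   have slim: "s \<longlonglongrightarrow> t"
   proof (rule LIM_zero_cancel, rule Lim_null_comparison)
    show "\<forall>\<^sub>F n in sequentially. norm (s n - t) <= 1 / Suc n" using s(2) by (intro always_eventually allI) (simp add: less_imp_le)
    show "(%n. 1 / real (Suc n)) \<longlonglongrightarrow> 0" by (rule lim_1_over_n[THEN LIMSEQ_Suc])
   qed
   have us: "u (\<gamma> (s n)) \<in> closure (range x)" "dist (x j) (u (\<gamma> (s n))) = gt j (\<gamma> (s n))" for n j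
    using N(3)[OF s(3)] inOm[OF s(1)] by auto
   have "Cauchy (%n. u (\<gamma> (s n)))"
   proof (rule metric_CauchyI)
    fix e :: real assume "0 < e"
    have "continuous_on {0..1} (%t. integral {0..t} k)"
     by (rule indefinite_integral_continuous_1) (use integral_upto_eq_HK(1)[of 0 1 k 0 1] ki in simp)
    then have "(%n. integral {0..s n} k) \<longlonglongrightarrow> integral {0..t} k"
     by (rule continuous_on_tendsto_compose[OF _ slim t]) (simp add: s(1) del: atLeastAtMost_iff)
    then have "Cauchy (%n. integral {0..s n} k)" by (rule LIMSEQ_imp_Cauchy)
    from metric_CauchyD[OF this \<open>0 < e\<close>]
    obtain M where M: "!!m n. m \<ge> M ==> n \<ge> M ==> \<bar>integral {0..s m} k - integral {0..s n} k\<bar> < e"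
     unfolding dist_real_def by blast
    have "dist (u (\<gamma> (s m))) (u (\<gamma> (s n))) < e" if mn: "m \<ge> M" "n \<ge> M" "s n <= s m" for m n
    proof -
     have "\<bar>dist (x j) (u (\<gamma> (s m))) - dist (x j) (u (\<gamma> (s n)))\<bar> <= \<Psi> (s n) (s m)" for j
      unfolding us using gtd[of "s n" "s m" j] mn(3) s(1)[of n] s(1)[of m] by simp
     from dist_le_by_dense_family[OF us(1) this]
     have "dist (u (\<gamma> (s m))) (u (\<gamma> (s n))) <= \<Psi> (s n) (s m)" .
     also have "... = integral {s n..s m} k" unfolding \<Psi>_def
      using integral_upto_eq_HK(2)[OF ki[of 0 1], of "s n" "s m"] s(1)[of n] s(1)[of m] mn(3) by simp
     also have "... = integral {0..s m} k - integral {0..s n} k"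
      using Henstock_Kurzweil_Integration.integral_combine[of 0 "s n" "s m" k]
       integral_upto_eq_HK(1)[OF ki[of 0 1], of 0 "s m"] s(1)[of n] s(1)[of m] mn(3) by simp
     finally show ?thesis using M[OF mn(1,2)] by linarith
    qed
    then show "\<exists>M. \<forall>m\<ge>M. \<forall>n\<ge>M. dist (u (\<gamma> (s m))) (u (\<gamma> (s n))) < e"
     by (metis dist_commute linear)
   qed
   then obtain c where c: "(%n. u (\<gamma> (s n))) \<longlonglongrightarrow> c" using complete unfolding complete_def by blast
   have "c \<in> closure (range x)"
    using closed_sequentially[OF closed_closure us(1) c] .
   moreover have "dist (x j) c = gt j (\<gamma> t)" for j
   proof (rule LIMSEQ_unique)
    show "(%n. dist (x j) (u (\<gamma> (s n)))) \<longlonglongrightarrow> dist (x j) c" by (intro tendsto_intros c)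
    show "(%n. dist (x j) (u (\<gamma> (s n)))) \<longlonglongrightarrow> gt j (\<gamma> t)"
     unfolding us using cont[of j] slim s(1) t by (intro continuous_on_tendsto_compose[of "{0..1}" "%t. gt j (\<gamma> t)"]) auto
   qed
   ultimately show ?thesis using w_eq[of c "\<gamma> t"] by simp
  qed
  have "abs_cont_on 0 1 (%t. w (\<gamma> t))"
  proof (rule integral_abs_cont_on[OF k k0])
   fix s t :: real assume st: "0 <= s" "s <= t" "t <= 1"
   have "\<bar>dist (x j) (w (\<gamma> s)) - dist (x j) (w (\<gamma> t))\<bar> <= \<Psi> s t" for j
    using gtd[OF st, of j] good[of s] good[of t] st by (simp add: abs_minus_commute)
   then show "dist (w (\<gamma> s)) (w (\<gamma> t)) <= (LI r. ind {s..t} r * k r)"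
    using dist_le_by_dense_family[of "w (\<gamma> t)" x "w (\<gamma> s)"] good[of t] st by (simp add: \<Psi>_def)
  qed
  then show "abs_cont_on 0 1 (%t. w (pt p t))" by (simp add: \<gamma>_def)
 qed
 from AE_unshear[OF this]
 have "AE (y, z) in lborel. closed_segment y z <= Om --> abs_cont_on 0 1 (%t. w (y + t *R (z - y)))"
  by (simp add: case_prod_unfold)
 with 1 show ?thesis unfolding segment_ac_representative_def by blast
qed

end

section \<open>Positive functionals on test functions\<close>

text \<open>One minus the product of the complementary plateaus increases with the number of factors
  and is eventually 1 at each point of \<open>U\<close>.\<close>

lemma open_exhaustion_test_functions:
 fixes U :: "'a::euclidean_space set"
 assumes "open U"
 shows "\<exists>\<zeta> :: nat => 'a => real. (\<forall>k. test_function U (\<zeta> k)) \<and>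
  (\<forall>k x. 0 <= \<zeta> k x \<and> \<zeta> k x <= \<zeta> (Suc k) x \<and> \<zeta> k x <= 1) \<and> (\<forall>x\<in>U. \<exists>k. \<forall>j\<ge>k. \<zeta> j x = 1)"
proof -
 obtain C where C: "!!n::nat. compact (C n)" "!!n. C n <= U" "\<Union>(range C) = U"
  using open_Union_compact_subsets[OF assms] by metis
 have "\<exists>\<xi>. test_function U \<xi> \<and> (\<forall>x. 0 <= \<xi> x \<and> \<xi> x <= 1) \<and> (\<forall>x\<in>C n. \<xi> x = 1)" for n
  using test_function_plateau[OF C(1) assms C(2), of n] by (metis subsetD)
 then obtain \<xi> where \<xi>: "!!n. test_function U (\<xi> n)" "!!n x. 0 <= \<xi> n x" "!!n x. \<xi> n x <= 1" "!!n x. x \<in> C n ==> \<xi> n x = 1"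
  by metis
 have "\<exists>K. compact K \<and> K <= U \<and> (\<forall>x. x \<notin> K --> \<xi> n x = 0)" for n
  using \<xi>(1)[of n] by (simp add: test_function_iff)
 then obtain K where K: "!!n. compact (K n)" "!!n. K n <= U" "!!n x. x \<notin> K n ==> \<xi> n x = 0" by metis
 define \<zeta> where "\<zeta> = (%k x. 1 - (\<Prod>i\<le>k. 1 - \<xi> i x))"
 have p: "0 <= (\<Prod>i\<le>k. 1 - \<xi> i x)" "(\<Prod>i\<le>k. 1 - \<xi> i x) <= 1" for k x
  using \<xi>(2,3) by (auto intro!: prod_nonneg prod_le_1)
 have "test_function U (\<zeta> k)" for k
 proof (rule test_functionI)
  show "smooth (\<zeta> k)" unfolding \<zeta>_def by (intro smooth_intros test_function_smooth[OF \<xi>(1)])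
  show "compact (\<Union>i\<le>k. K i)" using K by (intro compact_UN) auto
  show "\<zeta> k x = 0" if "x \<notin> (\<Union>i\<le>k. K i)" for x using that K(3) by (simp add: \<zeta>_def)
 qed (use K in auto)
 moreover have "0 <= \<zeta> k x \<and> \<zeta> k x <= \<zeta> (Suc k) x \<and> \<zeta> k x <= 1" for k x
 proof -
  have "(\<Prod>i\<le>k. 1 - \<xi> i x) * (1 - \<xi> (Suc k) x) <= (\<Prod>i\<le>k. 1 - \<xi> i x) * 1"
   using \<xi>(2)[of "Suc k" x] p by (intro mult_left_mono) auto
  then show ?thesis using p[of x k] by (simp add: \<zeta>_def)
 qed
 moreover have "\<exists>k. \<forall>j\<ge>k. \<zeta> j x = 1" if x: "x \<in> U" for x
 proof -
  obtain n where n: "x \<in> C n" using x C(3) by blast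
  have "\<zeta> j x = 1" if "j \<ge> n" for j
   unfolding \<zeta>_def using \<xi>(4)[OF n] that by (auto simp: prod_zero_iff intro!: bexI[of _ n])
  then show ?thesis by blast
 qed
 ultimately show ?thesis by blast
qed

locale positive_functional =
 fixes Om :: "'a::euclidean_space set" and T :: "('a => real) => real"
 assumes open_domain: "open Om"
  and add: "!!ph \<psi>. test_function Om ph ==> test_function Om \<psi> ==> T (%x. ph x + \<psi> x) = T ph + T \<psi>"
  and scale: "!!ph c. test_function Om ph ==> T (%x. c * ph x) = c * T ph"
  and pos: "!!ph. test_function Om ph ==> (!!x. 0 <= ph x) ==> 0 <= T ph"
begin

lemma zero: "T (%x. 0) = 0" using scale[OF test_function_zero, of 0] by simp

lemma diff: "test_function Om ph ==> test_function Om \<psi> ==> T (%x. ph x - \<psi> x) = T ph - T \<psi>"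
 using add[of ph "%x. - 1 * \<psi> x"] scale[of \<psi> "- 1"] test_function_cmult[of Om \<psi> "- 1"] by simp

lemma mono: "test_function Om ph ==> test_function Om \<psi> ==> (!!x. ph x <= \<psi> x) ==> T ph <= T \<psi>"
 using pos[of "%x. \<psi> x - ph x"] diff[of \<psi> ph] test_function_diff[of Om \<psi> ph] by simp

lemma sum: "(!!i. i \<in> I ==> test_function Om (ph i)) ==> T (%x. \<Sum>i\<in>I. ph i x) = (\<Sum>i\<in>I. T (ph i))"
proof (induction I rule: infinite_finite_induct)
 case (insert i I)
 then show ?case using add[OF _ test_function_sum, of "ph i" I ph] by simp
qed (simp_all add: zero)

text \<open>A compactness argument in the manner of Dini: on a compact set that carries
  \<open>\<eta>\<close> some finite partial sum exceeds \<open>\<eta> - e\<close>, and the loss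
  \<open>e\<close> is paid for by a plateau function \<open>\<xi>\<close>.\<close>

lemma Daniell:
 assumes \<eta>: "test_function Om \<eta>" and ph: "!!i::nat. test_function Om (ph i)" "!!i x. 0 <= ph i x"
  and le: "!!x. ennreal (\<eta> x) <= (\<Sum>i. ennreal (ph i x))"
 shows "ennreal (T \<eta>) <= (\<Sum>i. ennreal (T (ph i)))"
proof (rule ennreal_le_epsilon)
 obtain K where K: "compact K" "K <= Om" "!!x. x \<notin> K ==> \<eta> x = 0" using \<eta> unfolding test_function_iff by blast
 obtain \<xi> V where \<xi>: "test_function Om \<xi>" "!!x. 0 <= \<xi> x" "!!x. \<xi> x <= 1" "open V" "K <= V" "!!x. x \<in> V ==> \<xi> x = 1"
  using test_function_plateau[OF K(1) open_domain K(2)] by metis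
 fix e' :: real assume "0 < e'"
 \<comment> \<open>Chosen so that the plateau term \<open>e T \<xi>\<close> is at most
   \<open>e'\<close>; the added 1 guards against \<open>T \<xi> = 0\<close>.\<close>
 define e where "e = e' / (T \<xi> + 1)"
 have T\<xi>: "0 <= T \<xi>" using pos[OF \<xi>(1,2)] .
 then have e: "0 < e" "e * T \<xi> <= e'" using \<open>0 < e'\<close> by (auto simp: e_def field_simps)
 define W where "W = (%n. {x. \<eta> x - e < (\<Sum>i<n. ph i x)})"
 have "open (W n)" for n unfolding W_def
  by (intro open_Collect_less continuous_intros smooth_continuous_on test_function_smooth[OF \<eta>] test_function_smooth[OF ph(1)])
 moreover have "K <= (\<Union>n. W n)"
 proof
  fix x assume "x \<in> K"
  show "x \<in> (\<Union>n. W n)"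
  proof (cases "\<eta> x > 0")
   case True
   then have "ennreal (\<eta> x - e) < ennreal (\<eta> x)" using e by (intro ennreal_lessI) auto
   from less_le_trans[OF this le] obtain n where "ennreal (\<eta> x - e) < (\<Sum>i<n. ennreal (ph i x))" unfolding suminf_eq_SUP less_SUP_iff by blast
   then have "ennreal (\<eta> x - e) < ennreal (\<Sum>i<n. ph i x)" using ph(2) by (simp add: sum_ennreal)
   then have "\<eta> x - e < (\<Sum>i<n. ph i x)" by (metis ennreal_leI not_le)
   then show ?thesis by (auto simp: W_def)
  next
   case False
   then have "x \<in> W 0" using e by (simp add: W_def)
   then show ?thesis by blast
  qed
 qed
 ultimately obtain J where J: "finite J" "K <= (\<Union>n\<in>J. W n)"
  using compactE_image[OF K(1), of UNIV W] by (metis UNIV_I)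
 define n where "n = Max (insert 0 J)"
 have KW: "K <= W n"
 proof
  fix x assume "x \<in> K"
  then obtain j where j: "j \<in> J" "x \<in> W j" using J by blast
  then have "j <= n" using J(1) by (simp add: n_def)
  then have "(\<Sum>i<j. ph i x) <= (\<Sum>i<n. ph i x)" using ph(2) by (intro sum_mono2) auto
  then show "x \<in> W n" using j by (auto simp: W_def)
 qed
 have "T \<eta> <= T (%x. (\<Sum>i<n. ph i x) + e * \<xi> x)"
 proof (rule mono[OF \<eta>])
  show "test_function Om (%x. (\<Sum>i<n. ph i x) + e * \<xi> x)"
   by (intro test_function_add test_function_sum test_function_cmult ph \<xi>)
  show "\<eta> x <= (\<Sum>i<n. ph i x) + e * \<xi> x" for x
  proof (cases "x \<in> K")
   case True
   then have "\<xi> x = 1" using \<xi> by auto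
   then show ?thesis using KW True by (auto simp: W_def)
  qed (use K(3) ph(2) \<xi>(2) e in \<open>simp add: sum_nonneg\<close>)
 qed
 also have "... = (\<Sum>i<n. T (ph i)) + e * T \<xi>"
  using add[of "%x. \<Sum>i<n. ph i x" "%x. e * \<xi> x"] test_function_sum[of "{..<n}" Om ph] test_function_cmult[OF \<xi>(1)]
   sum[of "{..<n}" ph] scale[OF \<xi>(1)] ph(1) by simp
 also have "... <= (\<Sum>i<n. T (ph i)) + e'" using e by simp
 finally have "ennreal (T \<eta>) <= ennreal ((\<Sum>i<n. T (ph i)) + e')" by (rule ennreal_leI)
 also have "... = (\<Sum>i<n. ennreal (T (ph i))) + ennreal e'"
  using pos[OF ph] \<open>0 < e'\<close> by (simp add: ennreal_plus sum_nonneg sum_ennreal)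
 also have "... <= (\<Sum>i. ennreal (T (ph i))) + ennreal e'" by (intro add_right_mono sum_le_suminf) auto
 finally show "ennreal (T \<eta>) <= (\<Sum>i. ennreal (T (ph i))) + ennreal e'" .
qed

definition covers :: "'a set => (nat => 'a => real) set" where
 "covers A = {ph. (\<forall>i. test_function Om (ph i)) \<and> (\<forall>i x. 0 <= ph i x) \<and> (\<forall>x\<in>A. 1 <= (\<Sum>i. ennreal (ph i x)))}"

text \<open>Countable covers by test functions in place of covers by open sets: countable
  subadditivity is a double series, and bounds on \<open>T\<close> transfer term by term to the
  measure.\<close>

definition outer :: "'a set => ennreal" where
 "outer A = (INF ph\<in>covers A. \<Sum>i. ennreal (T (ph i)))"

lemma coversI: "(!!i. test_function Om (ph i)) ==> (!!i x. 0 <= ph i x) ==>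
  (!!x. x \<in> A ==> 1 <= (\<Sum>i. ennreal (ph i x))) ==> ph \<in> covers A"
 by (simp add: covers_def)

lemma outer_le: "ph \<in> covers A ==> outer A <= (\<Sum>i. ennreal (T (ph i)))"
 unfolding outer_def by (rule INF_lower)

lemma outer_close:
 assumes "0 < (e::real)" "outer A < \<infinity>"
 shows "\<exists>ph\<in>covers A. (\<Sum>i. ennreal (T (ph i))) <= outer A + ennreal e"
proof -
 have "outer A < outer A + ennreal e" using assms by (auto simp: ennreal_add_left_cancel_less less_top[symmetric] dest!: ennreal_cases[of "outer A"])
 then obtain ph where "ph \<in> covers A" "(\<Sum>i. ennreal (T (ph i))) < outer A + ennreal e"
  unfolding outer_def INF_less_iff by blast
 then show ?thesis by (auto intro: less_imp_le)
qed

lemma outer_double: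
 fixes ph :: "nat => nat => 'a => real"
 assumes "!!i k. test_function Om (ph i k)" "!!i k x. 0 <= ph i k x"
  and "!!x. x \<in> A ==> 1 <= (\<Sum>i. \<Sum>k. ennreal (ph i k x))"
 shows "outer A <= (\<Sum>i. \<Sum>k. ennreal (T (ph i k)))"
proof -
 define \<psi> where "\<psi> = (%n. case_prod ph (prod_decode n))"
 have s: "(\<Sum>n. F (prod_decode n)) = (\<Sum>i. \<Sum>k. F (i, k))" for F :: "nat \<times> nat => ennreal"
  by (rule suminf_ennreal_2dimen) simp
 have "\<psi> \<in> covers A"
  using assms s[of "%p. ennreal (case_prod ph p _)"]
  by (intro coversI) (auto simp: \<psi>_def case_prod_unfold)
 from outer_le[OF this] show ?thesis
  using s[of "%p. ennreal (T (case_prod ph p))"] by (simp add: \<psi>_def)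
qed

lemma outer_empty: "outer {} = 0"
proof -
 have "(%i x. 0) \<in> covers {}" by (simp add: covers_def test_function_zero)
 from outer_le[OF this] show ?thesis by (simp add: zero)
qed

lemma outer_mono: "A <= B ==> outer A <= outer B"
 unfolding outer_def by (rule INF_superset_mono) (auto simp: covers_def)

lemma outer_UN_le: "outer (\<Union>i. A i) <= (\<Sum>i::nat. outer (A i))"
proof (rule ennreal_le_epsilon)
 fix e :: real assume fin: "(\<Sum>i. outer (A i)) < top" and "0 < e"
 have "outer (A i) < \<infinity>" for i
  using fin sum_le_suminf[of "%i. outer (A i)" "{i}"] by (auto intro: le_less_trans)
 then have "\<exists>ph\<in>covers (A i). (\<Sum>k. ennreal (T (ph k))) <= outer (A i) + ennreal (e * (1/2) ^ Suc i)" for i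
  using \<open>0 < e\<close> by (intro outer_close) auto
 then obtain ph where ph: "!!i. ph i \<in> covers (A i)" "!!i. (\<Sum>k. ennreal (T (ph i k))) <= outer (A i) + ennreal (e * (1/2) ^ Suc i)"
  by metis
 have "outer (\<Union>i. A i) <= (\<Sum>i. \<Sum>k. ennreal (T (ph i k)))"
 proof (rule outer_double)
  fix x assume "x \<in> (\<Union>i. A i)"
  then obtain i where "x \<in> A i" by blast
  then have "1 <= (\<Sum>k. ennreal (ph i k x))" using ph(1)[of i] by (simp add: covers_def)
  also have "... <= (\<Sum>i. \<Sum>k. ennreal (ph i k x))" using sum_le_suminf[of "%i. \<Sum>k. ennreal (ph i k x)" "{i}"] by simp
  finally show "1 <= (\<Sum>i. \<Sum>k. ennreal (ph i k x))" .
 qed (use ph(1) in \<open>auto simp: covers_def\<close>)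
 also have "... <= (\<Sum>i. outer (A i) + ennreal (e * (1/2) ^ Suc i))" by (intro suminf_le ph(2)) auto
 also have "... = (\<Sum>i. outer (A i)) + (\<Sum>i. ennreal (e * (1/2) ^ Suc i))" by (intro suminf_add[symmetric]) auto
 also have "(\<Sum>i. ennreal (e * (1/2) ^ Suc i)) = ennreal e"
  using \<open>0 < e\<close> sums_mult[OF power_half_series, of e] by (intro suminf_ennreal_eq) auto
 finally show "outer (\<Union>i. A i) <= (\<Sum>i. outer (A i)) + ennreal e" .
qed

lemma outer_measure_space_outer: "outer_measure_space (Pow Om) outer"
 unfolding outer_measure_space_def positive_def increasing_def countably_subadditive_def
 by (auto simp: outer_empty intro: outer_mono outer_UN_le)

text \<open>The increments of an exhaustion of \<open>U\<close>, multiplied by \<open>ph\<close>.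
  Their partial sums have compact support in \<open>U\<close>, while the whole series is
  \<open>ph\<close> on \<open>U\<close>; the shifted \<open>\<zeta>'\<close> starts with 0 so that
  the sums telescope.\<close>

lemma open_cover_limit:
 assumes U: "open U" "U <= Om" and ph: "smooth ph" "!!x. 0 <= ph x"
 obtains \<beta> where "!!k::nat. test_function Om (\<beta> k)" "!!k x. 0 <= \<beta> k x" "!!n x. (\<Sum>k<n. \<beta> k x) <= ph x"
  "!!n. test_function U (%x. \<Sum>k<n. \<beta> k x)" "!!x. x \<in> U ==> (\<Sum>k. ennreal (\<beta> k x)) = ennreal (ph x)"
proof -
 obtain \<zeta> :: "nat => 'a => real" where \<zeta>: "!!k. test_function U (\<zeta> k)"
  "!!k x. 0 <= \<zeta> k x" "!!k x. \<zeta> k x <= \<zeta> (Suc k) x" "!!k x. \<zeta> k x <= 1" "!!x. x \<in> U ==> \<exists>k. \<forall>j\<ge>k. \<zeta> j x = 1"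
  using open_exhaustion_test_functions[OF U(1)] by blast
 define \<zeta>' where "\<zeta>' = (%k x. case k of 0 => 0 | Suc k => \<zeta> k x)"
 define \<beta> where "\<beta> = (%k x. (\<zeta>' (Suc k) x - \<zeta>' k x) * ph x)"
 have t: "test_function U (\<zeta>' k)" for k using \<zeta>(1) by (cases k) (auto simp: \<zeta>'_def test_function_zero)
 have inc: "\<zeta>' k x <= \<zeta>' (Suc k) x" for k x using \<zeta>(2,3) by (cases k) (auto simp: \<zeta>'_def)
 have t2: "test_function U (\<beta> k)" for k unfolding \<beta>_def
  by (intro test_function_mult test_function_diff t ph)
 have s: "(\<Sum>k<n. \<beta> k x) = \<zeta>' n x * ph x" for n x
  by (induction n) (auto simp: \<beta>_def algebra_simps \<zeta>'_def)
 have b0: "0 <= \<beta> k x" for k x unfolding \<beta>_def using inc[of k x] ph(2) by simp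
 show thesis
 proof (rule that[of \<beta>])
  show "test_function Om (\<beta> k)" for k by (rule test_function_mono[OF t2 U(2)])
  show "(\<Sum>k<n. \<beta> k x) <= ph x" for n x
   unfolding s using \<zeta>(4) ph(2) by (cases n) (auto simp: \<zeta>'_def mult_left_le_one_le \<zeta>(2))
  show "test_function U (%x. \<Sum>k<n. \<beta> k x)" for n by (intro test_function_sum t2)
  show "(\<Sum>k. ennreal (\<beta> k x)) = ennreal (ph x)" if xU: "x \<in> U" for x
  proof (rule suminf_ennreal_eq)
   obtain k where k: "!!j. j \<ge> k ==> \<zeta> j x = 1" using \<zeta>(5)[OF xU] by blast
   have "\<forall>\<^sub>F n in sequentially. (\<Sum>k<n. \<beta> k x) = ph x"
   proof (rule eventually_sequentiallyI)
    fix n assume "Suc k <= n"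
    then show "(\<Sum>k<n. \<beta> k x) = ph x" unfolding s using k by (cases n) (auto simp: \<zeta>'_def)
   qed
   then show "(%k. \<beta> k x) sums ph x" unfolding sums_def by (rule tendsto_eventually)
  qed (rule b0)
 qed (rule b0)
qed

text \<open>Each cover function is split: the series of its pieces inside \<open>U\<close> covers
  \<open>A \<inter> U\<close>, and the function minus finitely many pieces still covers
  \<open>A - U\<close>, where the pieces vanish. What is counted twice is the tail of a convergent
  series, made at most \<open>(e / 2) (1/2)^(i+1)\<close>.\<close>

lemma open_lambda_system:
 assumes U: "open U" "U <= Om"
 shows "outer (A \<inter> U) + outer (A - U) <= outer A"
proof (rule ennreal_le_epsilon)
 fix e :: real assume fin: "outer A < top" and "0 < e"
 obtain ph where ph: "ph \<in> covers A" "(\<Sum>i. ennreal (T (ph i))) <= outer A + ennreal (e / 2)"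
  using outer_close[of "e / 2" A] fin \<open>0 < e\<close> by auto
 have pht: "test_function Om (ph i)" and ph0: "0 <= ph i x" for i x using ph(1) by (auto simp: covers_def)
 have "\<exists>\<beta>. (\<forall>k::nat. test_function Om (\<beta> k)) \<and> (\<forall>k x. 0 <= \<beta> k x) \<and> (\<forall>n x. (\<Sum>k<n. \<beta> k x) <= ph i x) \<and>
   (\<forall>n. test_function U (%x. \<Sum>k<n. \<beta> k x)) \<and> (\<forall>x\<in>U. (\<Sum>k. ennreal (\<beta> k x)) = ennreal (ph i x))" for i
  by (rule open_cover_limit[OF U test_function_smooth[OF pht] ph0]) blast
 then obtain \<beta> where \<beta>: "!!i k. test_function Om (\<beta> i k)" "!!i k x. 0 <= \<beta> i k x" "!!i n x. (\<Sum>k<n. \<beta> i k x) <= ph i x"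
   "!!i n. test_function U (%x. \<Sum>k<n. \<beta> i k x)" "!!i x. x \<in> U ==> (\<Sum>k. ennreal (\<beta> i k x)) = ennreal (ph i x)" by metis
 have bT: "0 <= T (\<beta> i k)" for i k by (rule pos[OF \<beta>(1,2)])
 have sl: "T (%x. \<Sum>k<n. \<beta> i k x) = (\<Sum>k<n. T (\<beta> i k))" for i n by (rule sum[OF \<beta>(1)])
 have ts: "test_function Om (%x. \<Sum>k<n. \<beta> i k x)" for i n by (intro test_function_sum \<beta>)
 have le: "(\<Sum>k<n. T (\<beta> i k)) <= T (ph i)" for i n unfolding sl[symmetric] by (rule mono[OF ts pht \<beta>(3)])
 have sm: "summable (%k. T (\<beta> i k))" for i
  by (rule summableI_nonneg_bounded[OF bT le])
 have "\<exists>n. (\<Sum>k. T (\<beta> i k)) - (\<Sum>k<n. T (\<beta> i k)) <= (e / 2) * (1/2) ^ Suc i" for i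
 proof -
  have "0 < (e / 2) * (1/2) ^ Suc i" using \<open>0 < e\<close> by simp
  from LIMSEQ_D[OF summable_LIMSEQ[OF sm[of i]] this] obtain n where
   "norm ((\<Sum>k<n. T (\<beta> i k)) - (\<Sum>k. T (\<beta> i k))) < (e / 2) * (1/2) ^ Suc i" by blast
  then show ?thesis unfolding real_norm_def by (intro exI[of _ n]) linarith
 qed
 then obtain n where n: "!!i. (\<Sum>k. T (\<beta> i k)) - (\<Sum>k<n i. T (\<beta> i k)) <= (e / 2) * (1/2) ^ Suc i" by metis
 have 1: "outer (A \<inter> U) <= (\<Sum>i. \<Sum>k. ennreal (T (\<beta> i k)))"
  using ph(1) \<beta>(5) by (intro outer_double \<beta>) (auto simp: covers_def)
 define \<psi> where "\<psi> = (%i x. ph i x - (\<Sum>k<n i. \<beta> i k x))"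
 have \<psi>t: "test_function Om (\<psi> i)" and \<psi>0: "0 <= \<psi> i x" for i x
  unfolding \<psi>_def using \<beta>(3) by (auto intro: test_function_diff pht ts)
 have "\<psi> \<in> covers (A - U)"
 proof (rule coversI[OF \<psi>t \<psi>0])
  fix x assume x: "x \<in> A - U"
  then have "\<psi> i x = ph i x" for i using test_function_outside[OF \<beta>(4)] by (simp add: \<psi>_def)
  then show "1 <= (\<Sum>i. ennreal (\<psi> i x))" using ph(1) x by (simp add: covers_def)
 qed
 then have 2: "outer (A - U) <= (\<Sum>i. ennreal (T (\<psi> i)))" by (rule outer_le)
 have "outer (A \<inter> U) + outer (A - U) <= (\<Sum>i. \<Sum>k. ennreal (T (\<beta> i k))) + (\<Sum>i. ennreal (T (\<psi> i)))"
  using 1 2 by (rule add_mono)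
 also have "... = (\<Sum>i. (\<Sum>k. ennreal (T (\<beta> i k))) + ennreal (T (\<psi> i)))" by (rule suminf_add) auto
 also have "... <= (\<Sum>i. ennreal (T (ph i)) + ennreal ((e / 2) * (1/2) ^ Suc i))"
 proof (rule suminf_le)
  fix i
  have "(\<Sum>k. ennreal (T (\<beta> i k))) = ennreal (\<Sum>k. T (\<beta> i k))" by (rule suminf_ennreal2[OF bT sm])
  moreover have "T (\<psi> i) = T (ph i) - (\<Sum>k<n i. T (\<beta> i k))" unfolding \<psi>_def sl[symmetric] by (rule diff[OF pht ts])
  moreover have "0 <= (\<Sum>k. T (\<beta> i k))" by (rule suminf_nonneg[OF sm bT])
  moreover have "(\<Sum>k. T (\<beta> i k)) + T (\<psi> i) <= T (ph i) + (e / 2) * (1/2) ^ Suc i"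
   using n[of i] calculation(2) by linarith
  moreover have "0 <= (e / 2) * (1/2) ^ Suc i" using \<open>0 < e\<close> by simp
  ultimately show "(\<Sum>k. ennreal (T (\<beta> i k))) + ennreal (T (\<psi> i)) <= ennreal (T (ph i)) + ennreal ((e / 2) * (1/2) ^ Suc i)"
   using pos[OF \<psi>t \<psi>0, of i] pos[OF pht ph0, of i] by (metis ennreal_leI ennreal_plus)
 qed auto
 also have "... = (\<Sum>i. ennreal (T (ph i))) + (\<Sum>i. ennreal ((e / 2) * (1/2) ^ Suc i))" by (intro suminf_add[symmetric]) auto
 also have "(\<Sum>i. ennreal ((e / 2) * (1/2) ^ Suc i)) = ennreal (e / 2)"
  using \<open>0 < e\<close> sums_mult[OF power_half_series, of "e / 2"] by (intro suminf_ennreal_eq) auto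
 also have "(\<Sum>i. ennreal (T (ph i))) + ennreal (e / 2) <= outer A + ennreal (e / 2) + ennreal (e / 2)"
  by (intro add_right_mono ph(2))
 also have "... = outer A + ennreal e" using \<open>0 < e\<close> by (simp add: add.assoc flip: ennreal_plus)
 finally show "outer (A \<inter> U) + outer (A - U) <= outer A + ennreal e" .
qed

text \<open>By Caratheodory the outer measure is countably additive on a sigma-algebra that contains
  the open subsets of \<open>Om\<close>, hence its Borel subsets.\<close>

lemma measure_space_outer: "measure_space Om (sets (restrict_space borel Om)) outer"
proof -
 interpret P: sigma_algebra Om "Pow Om" by (rule sigma_algebra_Pow)
 define L where "L = lambda_system Om (Pow Om) outer"
 have ms: "measure_space Om L outer" unfolding L_def by (rule P.caratheodory_lemma[OF outer_measure_space_outer])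
 then interpret L: sigma_algebra Om L by (simp add: measure_space_def)
 have sub: "subadditive (Pow Om) outer"
  using outer_measure_space_outer by (intro P.countably_subadditive_subadditive) (auto simp: outer_measure_space_def)
 have op: "U \<in> L" if "open U" "U <= Om" for U
  unfolding L_def P.lambda_system_eq
 proof (intro CollectI conjI ballI)
  fix A assume A: "A \<in> Pow Om"
  have "outer ((A \<inter> U) \<union> (A - U)) <= outer (A \<inter> U) + outer (A - U)"
   using A by (intro subadditiveD[OF sub]) auto
  moreover have "(A \<inter> U) \<union> (A - U) = A" by auto
  ultimately show "outer (A \<inter> U) + outer (A - U) = outer A"
   using open_lambda_system[OF that, of A] by (intro antisym) auto
 qed (use that in auto)
 have "A \<inter> Om \<in> L" if "A \<in> sigma_sets UNIV {S. open S}" for A using that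
 proof induction
  case (Compl A)
  have "(UNIV - A) \<inter> Om = Om - (A \<inter> Om)" by auto
  then show ?case using L.compl_sets[OF Compl.IH] by simp
 next
  case (Union A)
  have "(\<Union>i. A i) \<inter> Om = (\<Union>i. A i \<inter> Om)" by auto
  then show ?case using L.countable_UN[of "%i. A i \<inter> Om" UNIV] Union.IH by auto
 qed (use op open_domain in \<open>auto intro: open_Int\<close>)
 then have "sets (restrict_space borel Om) <= L"
  by (auto simp: sets_restrict_space borel_def sets_measure_of Int_commute)
 then show ?thesis
  using sets.sigma_algebra_axioms[of "restrict_space borel Om"] by (intro measure_down[OF ms]) (simp_all add: space_restrict_space)
qed

definition riesz :: "'a measure" where
 "riesz = measure_of Om (sets (restrict_space borel Om)) outer"

lemma sets_riesz[measurable_cong]: "sets riesz = sets (restrict_space borel Om)"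
 and space_riesz: "space riesz = Om"
 and emeasure_riesz: "A \<in> sets borel ==> A <= Om ==> emeasure riesz A = outer A"
proof -
 have sa: "sigma_algebra Om (sets (restrict_space borel Om))"
  using measure_space_outer by (simp add: measure_space_def)
 show "sets riesz = sets (restrict_space borel Om)" "space riesz = Om"
  unfolding riesz_def using sigma_algebra.sigma_sets_eq[OF sa] sa
  by (auto simp: sets_measure_of space_measure_of sigma_algebra_iff2)
 show "emeasure riesz A = outer A" if "A \<in> sets borel" "A <= Om"
  unfolding riesz_def using measure_space_outer that open_domain
  by (intro emeasure_measure_of_sigma[OF sa]) (auto simp: measure_space_def sets_restrict_space_iff)
qed

end

section \<open>The constructed measure represents the functional\<close>

text \<open>The number of naturals below \<open>t\<close> is the ceiling of \<open>t\<close>, and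
  dropping the index 0 brings the count to at most \<open>t\<close>: a layer cake sandwich with unit
  steps.\<close>

lemma count_below:
 fixes t :: real
 assumes "0 <= t" "t <= real M"
 shows "t <= (\<Sum>i<M. of_bool (real i < t))" "(\<Sum>i\<in>{1..<M}. of_bool (real i < t)) <= t"
proof -
 have "(\<Sum>i<M. of_bool (real i < t)) = real (card {i\<in>{..<M}. real i < t})" by (simp add: of_bool_def flip: sum.inter_filter)
 also have "{i\<in>{..<M}. real i < t} = {..<nat \<lceil>t\<rceil>}"
 proof -
  have "real i < t \<longleftrightarrow> i < nat \<lceil>t\<rceil>" for i by (simp add: less_ceiling_iff zless_nat_eq_int_zless)
  moreover have "nat \<lceil>t\<rceil> <= M" using assms by (simp add: ceiling_le_iff nat_le_iff)
  ultimately show ?thesis by (intro set_eqI, unfold mem_Collect_eq lessThan_iff) (meson less_le_trans)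
 qed
 finally show "t <= (\<Sum>i<M. of_bool (real i < t))" using real_nat_ceiling_ge[of t] by simp
 have "(\<Sum>i\<in>{1..<M}. of_bool (real i < t)) = real (card {i\<in>{1..<M}. real i < t})" by (simp add: of_bool_def flip: sum.inter_filter)
 also have "card {i\<in>{1..<M}. real i < t} <= card {1..<nat \<lceil>t\<rceil>}"
  by (rule card_mono) (auto simp: less_ceiling_iff zless_nat_eq_int_zless)
 finally show "(\<Sum>i\<in>{1..<M}. of_bool (real i < t)) <= t" using assms by simp linarith
qed

context positive_functional begin

text \<open>Partial sums of an exhaustion of \<open>U\<close> are test functions with values in
  \<open>[0,1]\<close>, so for open sets the infimum over covers is controlled by a supremum from
  inside.\<close>

lemma outer_open_le:
 assumes U: "open U" "U <= Om"
  and le: "!!\<psi>. test_function U \<psi> ==> (!!x. 0 <= \<psi> x) ==> (!!x. \<psi> x <= 1) ==> ennreal (T \<psi>) <= B"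
 shows "outer U <= B"
proof -
 obtain \<beta> where \<beta>: "!!k::nat. test_function Om (\<beta> k)" "!!k x. 0 <= \<beta> k x" "!!n x. (\<Sum>k<n. \<beta> k x) <= 1"
  "!!n. test_function U (%x. \<Sum>k<n. \<beta> k x)" "!!x. x \<in> U ==> (\<Sum>k. ennreal (\<beta> k x)) = ennreal 1"
  using open_cover_limit[OF U smooth_const[of 1]] zero_le_one by metis
 have "outer U <= (\<Sum>k. ennreal (T (\<beta> k)))" by (rule outer_le, rule coversI[OF \<beta>(1,2)]) (simp only: \<beta>(5) ennreal_1 order_refl)
 also have "... = (SUP n. \<Sum>k<n. ennreal (T (\<beta> k)))" by (rule suminf_eq_SUP)
 also have "... <= B"
 proof (rule SUP_least)
  fix n
  have "(\<Sum>k<n. ennreal (T (\<beta> k))) = ennreal (T (%x. \<Sum>k<n. \<beta> k x))"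
   using sum[of "{..<n}" \<beta>] \<beta>(1) pos[OF \<beta>(1,2)] by (simp add: sum_ennreal)
  also have "... <= B" by (rule le[OF \<beta>(4)]) (use \<beta> in \<open>auto intro: sum_nonneg\<close>)
  finally show "(\<Sum>k<n. ennreal (T (\<beta> k))) <= B" .
 qed
 finally show ?thesis .
qed

lemma outer_le_test:
 assumes \<xi>: "test_function Om \<xi>" "!!x. 0 <= \<xi> x" "!!x. x \<in> A ==> 1 <= \<xi> x"
 shows "outer A <= ennreal (T \<xi>)"
proof -
 define ph where "ph = (%i::nat. if i = 0 then \<xi> else (%x. 0))"
 have s: "(\<Sum>i. ennreal (ph i x)) = ennreal (\<xi> x)" for x
  using suminf_finite[of "{0}" "%i. ennreal (ph i x)"] by (simp add: ph_def)
 have "outer A <= (\<Sum>i. ennreal (T (ph i)))"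
 proof (rule outer_le, rule coversI)
  show "test_function Om (ph i)" "0 <= ph i x" for i x using \<xi>(1,2) by (simp_all add: ph_def test_function_zero)
  show "1 <= (\<Sum>i. ennreal (ph i x))" if "x \<in> A" for x
   unfolding s ennreal_1[symmetric] by (rule ennreal_leI[OF \<xi>(3)[OF that]])
 qed
 also have "... = ennreal (T \<xi>)"
  using suminf_finite[of "{0}" "%i. ennreal (T (ph i))"] by (simp add: ph_def zero)
 finally show ?thesis .
qed

lemma riesz_compact_finite:
 assumes "compact K" "K <= Om"
 shows "emeasure riesz K < \<infinity>"
proof -
 obtain \<xi> V where \<xi>: "test_function Om \<xi>" "!!x. 0 <= \<xi> x" "K <= V" "!!x. x \<in> V ==> \<xi> x = 1"
  using test_function_plateau[OF assms(1) open_domain assms(2)] by metis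
 have "emeasure riesz K = outer K" using assms by (intro emeasure_riesz) (auto simp: compact_imp_closed)
 also have "... <= ennreal (T \<xi>)" by (rule outer_le_test[OF \<xi>(1,2)]) (use \<xi> in auto)
 also have "... < \<infinity>" by simp
 finally show ?thesis .
qed

text \<open>Otherwise \<open>outer_open_le\<close> would bound \<open>outer U\<close> by
  \<open>r - e\<close>; the zero function shows that this number would be positive.\<close>

lemma outer_open_approx:
 assumes U: "open U" "U <= Om" "outer U = ennreal r" "0 <= r" and e: "0 < (e::real)"
 shows "\<exists>\<psi>. test_function U \<psi> \<and> (\<forall>x. 0 <= \<psi> x \<and> \<psi> x <= 1) \<and> r <= T \<psi> + e"
proof (rule ccontr)
 assume H: "\<not> ?thesis"
 then have "\<not> r <= T (%x. 0) + e" using test_function_zero[of U] by (metis zero_le_one order_refl)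
 then have r: "e < r" by (simp add: zero)
 have "outer U <= ennreal (r - e)"
 proof (intro outer_open_le[OF U(1,2)] ennreal_leI)
  fix \<psi> assume "test_function U \<psi>" "!!x. 0 <= \<psi> x" "!!x. \<psi> x <= 1"
  then have "\<not> r <= T \<psi> + e" using H by blast
  then show "T \<psi> <= r - e" by linarith
 qed
 then show False using U(3) r e by (simp add: ennreal_le_iff)
qed

lemma riesz_measurable: "f \<in> Borel ==> f \<in> borel_measurable riesz"
 by (metis measurable_cong_sets measurable_restrict_space1 sets_riesz)

text \<open>At scale \<open>1 / N\<close> both the integral and \<open>T ph\<close> lie between
  \<open>S / N\<close> and \<open>(o' 0 + S) / N\<close>, where \<open>S\<close> sums the measures
  of superlevel sets of \<open>ph\<close>. For \<open>T\<close> the lower bound comes from test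
  functions inside the superlevel sets and the upper one from covers of them.\<close>

lemma riesz_integral_nonneg:
 assumes ph: "test_function Om ph" "!!x. 0 <= ph x"
 shows "integrable riesz ph \<and> (LINT z|riesz. ph z) = T ph"
proof -
 obtain K where K: "compact K" "K <= Om" "!!x. x \<notin> K ==> ph x = 0" using ph(1) unfolding test_function_iff by blast
 obtain B where B: "B > 0" "!!x. \<bar>ph x\<bar> <= B" using test_function_bounded[OF ph(1)] by blast
 note sm = test_function_smooth[OF ph(1)]
 define U where "U = (%c. {x. c < ph x})"
 have U: "open (U c)" for c unfolding U_def by (intro open_Collect_less continuous_intros smooth_continuous_on[OF sm])
 have UK: "U c <= K" if "0 <= c" for c using K(3) that by (force simp: U_def)
 define o' where "o' = (%c. measure riesz (U c))"
 have fin: "emeasure riesz (U c) < \<infinity>" if "0 <= c" for c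
 proof -
  have "emeasure riesz (U c) <= emeasure riesz K"
   using UK[OF that] K by (intro emeasure_mono) (auto simp: sets_riesz sets_restrict_space_iff open_domain compact_imp_closed)
  then show ?thesis using riesz_compact_finite[OF K(1,2)] by (rule le_less_trans)
 qed
 then have oe: "outer (U c) = ennreal (o' c)" if "0 <= c" for c
 proof -
  have "emeasure riesz (U c) = outer (U c)" using U UK[OF that] K(2) by (intro emeasure_riesz) auto
  then show ?thesis using fin[OF that] emeasure_eq_ennreal_measure[of riesz "U c"] by (simp add: o'_def less_top)
 qed
 have UI: "integrable riesz (ind (U c) :: 'a => real)" if "0 <= c" for c
  using fin[OF that] U UK[OF that] K(2)
  by (intro integrable_real_indicator) (auto simp: sets_riesz sets_restrict_space_iff open_domain)
 have Ui: "(LINT z|riesz. ind (U c) z) = o' c" if "0 <= c" for c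
  using UK[OF that] K(2) by (simp add: o'_def space_riesz Int_absorb1 inf.absorb1)
 have int: "integrable riesz ph"
 proof (rule Bochner_Integration.integrable_bound)
  show "integrable riesz (%z. B * ind (U 0) z)" using UI[of 0] by simp
  show "AE z in riesz. norm (ph z) <= norm (B * ind (U 0) z)"
   using B ph(2) by (intro AE_I2) (auto simp: indicator_def U_def not_less antisym)
 qed (rule riesz_measurable[OF smooth_borel_measurable[OF sm]])
 have main: "\<bar>(LINT z|riesz. ph z) - T ph\<bar> <= o' 0 / real N" if N: "N > 0" for N :: nat
 proof -
  \<comment> \<open>Large enough that the superlevel sets at heights \<open>i / N\<close> with
    \<open>i >= M\<close> are empty.\<close>
  define M where "M = nat \<lceil>real N * B\<rceil> + 1"
  define V where "V = (%i::nat. U (real i / real N))"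
  have c0: "0 <= real i / real N" for i by simp
  have MB: "real N * ph x <= real M" for x
  proof -
   have "real N * ph x <= real N * B" using B(2)[of x] N by (intro mult_left_mono) auto
   then show ?thesis unfolding M_def by linarith
  qed
  have Vb: "ind (V i) x = of_bool (real i < real N * ph x)" for i x
   using N by (simp add: V_def U_def indicator_def divide_less_eq mult.commute)
  have low: "real N * ph x <= (\<Sum>i<M. ind (V i) x)" and up: "(\<Sum>i\<in>{1..<M}. ind (V i) x) <= real N * ph x" for x
   unfolding Vb using count_below[of "real N * ph x" M] MB ph(2) by auto
  have split: "(\<Sum>i<M. F i) = F 0 + (\<Sum>i\<in>{1..<M}. F i)" for F :: "nat => real"
   using sum.atLeast_Suc_lessThan[of 0 M F] by (simp add: M_def lessThan_atLeast0)
  have M1: "real (M - Suc 0) = real M - 1" by (simp add: M_def)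
  define S where "S = (\<Sum>i\<in>{1..<M}. o' (real i / real N))"
  have I1: "real N * (LINT z|riesz. ph z) <= o' 0 + S"
  proof -
   have "real N * (LINT z|riesz. ph z) = (LINT z|riesz. real N * ph z)" by simp
   also have "... <= (LINT z|riesz. (\<Sum>i<M. ind (V i) z))"
    using int UI[OF c0] low by (intro integral_mono) (auto simp: V_def)
   also have "... = (\<Sum>i<M. o' (real i / real N))" using UI[OF c0] Ui[OF c0] by (simp add: V_def)
   finally show ?thesis unfolding split by (simp add: S_def)
  qed
  have I2: "S <= real N * (LINT z|riesz. ph z)"
  proof -
   have "S = (LINT z|riesz. (\<Sum>i\<in>{1..<M}. ind (V i) z))" using UI[OF c0] Ui[OF c0] by (simp add: V_def S_def)
   also have "... <= (LINT z|riesz. real N * ph z)"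
    using int UI[OF c0] up by (intro integral_mono) (auto simp: V_def)
   finally show ?thesis by simp
  qed
  have I3: "S <= real N * T ph"
  proof (rule field_le_epsilon)
   fix e :: real assume "0 < e"
   define d where "d = e / real M"
   have d: "0 < d" "real M * d = e" using \<open>0 < e\<close> by (auto simp: d_def M_def)
   have "\<exists>\<psi>. test_function (V i) \<psi> \<and> (\<forall>x. 0 <= \<psi> x \<and> \<psi> x <= 1) \<and> o' (real i / real N) <= T \<psi> + d" for i
    unfolding V_def using U UK[OF c0] K(2) oe[OF c0] d
    by (intro outer_open_approx) (auto simp: o'_def)
   then obtain \<psi> where \<psi>: "!!i. test_function (V i) (\<psi> i)" "!!i x. 0 <= \<psi> i x" "!!i x. \<psi> i x <= 1"
    "!!i. o' (real i / real N) <= T (\<psi> i) + d" by metis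
   have t: "test_function Om (\<psi> i)" for i
    by (rule test_function_mono[OF \<psi>(1)]) (use UK[OF c0] K(2) in \<open>auto simp: V_def\<close>)
   have "S <= (\<Sum>i\<in>{1..<M}. T (\<psi> i) + d)" unfolding S_def by (intro sum_mono \<psi>(4))
   also have "... <= (\<Sum>i\<in>{1..<M}. T (\<psi> i)) + e" using d by (simp add: sum.distrib M1 algebra_simps)
   also have "(\<Sum>i\<in>{1..<M}. T (\<psi> i)) = T (%x. \<Sum>i\<in>{1..<M}. \<psi> i x)" using sum[of "{1..<M}" \<psi>] t by simp
   also have "... <= T (%x. real N * ph x)"
   proof (rule mono)
    show "test_function Om (%x. \<Sum>i\<in>{1..<M}. \<psi> i x)" by (intro test_function_sum t)
    fix x
    have "\<psi> i x <= ind (V i) x" for i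
     using \<psi>(3)[of i x] test_function_outside[OF \<psi>(1), of x i] by (auto simp: indicator_def)
    then have "(\<Sum>i\<in>{1..<M}. \<psi> i x) <= (\<Sum>i\<in>{1..<M}. ind (V i) x)" by (simp add: sum_mono)
    then show "(\<Sum>i\<in>{1..<M}. \<psi> i x) <= real N * ph x" using up[of x] by linarith
   qed (intro test_function_cmult ph)
   finally show "S <= real N * T ph + e" using scale[OF ph(1)] by simp
  qed
  have I4: "real N * T ph <= o' 0 + S"
  proof (rule field_le_epsilon)
   fix e :: real assume "0 < e"
   define d where "d = e / real M"
   have d: "0 < d" "real M * d = e" using \<open>0 < e\<close> by (auto simp: d_def M_def)
   have "\<exists>\<gamma>\<in>covers (V i). (\<Sum>k. ennreal (T (\<gamma> k))) <= outer (V i) + ennreal d" for i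
    unfolding V_def using oe[OF c0] d by (intro outer_close) auto
   then obtain \<gamma> where \<gamma>: "!!i. \<gamma> i \<in> covers (V i)" "!!i. (\<Sum>k. ennreal (T (\<gamma> i k))) <= outer (V i) + ennreal d" by metis
   have \<gamma>t: "test_function Om (\<gamma> i k)" and \<gamma>0: "0 <= \<gamma> i k x" and \<gamma>1: "x \<in> V i ==> 1 <= (\<Sum>k. ennreal (\<gamma> i k x))" for i k x
    using \<gamma>(1)[of i] by (auto simp: covers_def)
   have "ennreal (T (%x. real N * ph x)) <= (\<Sum>k. ennreal (T (%x. \<Sum>i<M. \<gamma> i k x)))"
   proof (rule Daniell)
    fix x
    have "ennreal (real N * ph x) <= ennreal (\<Sum>i<M. ind (V i) x)" by (intro ennreal_leI low)
    also have "... = (\<Sum>i<M. ennreal (ind (V i) x))" by (simp add: sum_ennreal)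
    also have "... <= (\<Sum>i<M. \<Sum>k. ennreal (\<gamma> i k x))"
     by (intro sum_mono) (use \<gamma>1 in \<open>auto simp: indicator_def\<close>)
    also have "... = (\<Sum>k. \<Sum>i<M. ennreal (\<gamma> i k x))" by (intro suminf_sum[symmetric]) simp
    also have "... = (\<Sum>k. ennreal (\<Sum>i<M. \<gamma> i k x))" using \<gamma>0 by (simp add: sum_ennreal)
    finally show "ennreal (real N * ph x) <= (\<Sum>k. ennreal (\<Sum>i<M. \<gamma> i k x))" .
   qed (auto intro!: test_function_cmult ph test_function_sum \<gamma>t sum_nonneg \<gamma>0)
   also have "... = (\<Sum>k. \<Sum>i<M. ennreal (T (\<gamma> i k)))"
    using pos[OF \<gamma>t \<gamma>0] by (simp add: sum_ennreal sum[OF \<gamma>t])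
   also have "... = (\<Sum>i<M. \<Sum>k. ennreal (T (\<gamma> i k)))" by (intro suminf_sum) simp
   also have "... <= (\<Sum>i<M. ennreal (o' (real i / real N) + d))"
   proof (rule sum_mono)
    fix i show "(\<Sum>k. ennreal (T (\<gamma> i k))) <= ennreal (o' (real i / real N) + d)"
     using \<gamma>(2)[of i] oe[OF c0, of i] d by (simp add: V_def ennreal_plus o'_def)
   qed
   also have "... = ennreal (\<Sum>i<M. o' (real i / real N) + d)" using d by (intro sum_ennreal) (auto simp: o'_def)
   finally have "T (%x. real N * ph x) <= (\<Sum>i<M. o' (real i / real N) + d)"
    using d by (subst (asm) ennreal_le_iff) (auto intro!: sum_nonneg simp: o'_def)
   then show "real N * T ph <= o' 0 + S + e"
    unfolding sum.distrib split using scale[OF ph(1)] d by (simp add: S_def M1 algebra_simps)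
  qed
  have "\<bar>real N * (LINT z|riesz. ph z) - real N * T ph\<bar> <= o' 0" using I1 I2 I3 I4 by linarith
  then have "real N * \<bar>(LINT z|riesz. ph z) - T ph\<bar> <= o' 0" using N by (simp add: abs_mult flip: right_diff_distrib)
  then show ?thesis using N by (simp add: pos_le_divide_eq mult.commute)
 qed
 have "\<bar>(LINT z|riesz. ph z) - T ph\<bar> <= 0"
 proof (rule LIMSEQ_le_const)
  show "(%n. o' 0 * (1 / real (Suc n))) \<longlonglongrightarrow> 0"
   using tendsto_mult_left[OF lim_1_over_n[THEN LIMSEQ_Suc], of "o' 0"] by simp
  show "\<exists>N. \<forall>n\<ge>N. \<bar>(LINT z|riesz. ph z) - T ph\<bar> <= o' 0 * (1 / real (Suc n))"
   using main[of "Suc _"] by simp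
 qed
 then show ?thesis using int by simp
qed

text \<open>Adding a multiple of a plateau function makes any test function nonnegative.\<close>

theorem riesz_integral:
 assumes ph: "test_function Om ph"
 shows "integrable riesz ph" "(LINT z|riesz. ph z) = T ph"
proof -
 obtain K where K: "compact K" "K <= Om" "!!x. x \<notin> K ==> ph x = 0" using ph(1) unfolding test_function_iff by blast
 obtain B where B: "B > 0" "!!x. \<bar>ph x\<bar> <= B" using test_function_bounded[OF ph(1)] by blast
 obtain \<xi> V where \<xi>: "test_function Om \<xi>" "!!x. 0 <= \<xi> x" "K <= V" "!!x. x \<in> V ==> \<xi> x = 1"
  using test_function_plateau[OF K(1) open_domain K(2)] by metis
 have t: "test_function Om (%x. B * \<xi> x)" by (rule test_function_cmult[OF \<xi>(1)])
 have t2: "test_function Om (%x. ph x + B * \<xi> x)" by (rule test_function_add[OF ph t])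
 have "0 <= ph x + B * \<xi> x" for x
 proof (cases "x \<in> K")
  case True
  then have "\<xi> x = 1" using \<xi> by auto
  then show ?thesis using B(2)[of x] by simp
 qed (use K(3) B \<xi>(2) in simp)
 from riesz_integral_nonneg[OF t2 this] riesz_integral_nonneg[OF t] B \<xi>(2)
 have 1: "integrable riesz (%x. ph x + B * \<xi> x)" "integrable riesz (%x. B * \<xi> x)"
  "(LINT z|riesz. ph z + B * \<xi> z) = T ph + T (%x. B * \<xi> x)" "(LINT z|riesz. B * \<xi> z) = T (%x. B * \<xi> x)"
  using add[OF ph t] by auto
 from Bochner_Integration.integrable_diff[OF 1(1,2)] show "integrable riesz ph" by simp
 from Bochner_Integration.integral_diff[OF 1(1,2)] show "(LINT z|riesz. ph z) = T ph" using 1(3,4) by simp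
qed

text \<open>For open sets the bound holds by approximation from inside; the measure with density
  \<open>k\<close> is finite, so outer regularity extends it to Borel sets.\<close>

lemma riesz_le_density:
 assumes k: "L1 k" "!!z. 0 <= k z"
  and le: "!!ph. test_function Om ph ==> (!!x. 0 <= ph x) ==> T ph <= (LI z. ph z * k z)"
  and A: "A \<in> sets borel" "A <= Om"
 shows "emeasure riesz A <= (\<integral>\<^sup>+z. ennreal (k z) * ind A z \<partial>lborel)"
proof -
 have [measurable]: "k \<in> Borel" using k by simp
 define D where "D = density lborel (%z. ennreal (k z))"
 have De: "emeasure D S = (\<integral>\<^sup>+z. ennreal (k z) * ind S z \<partial>lborel)" if "S \<in> sets borel" for S
  unfolding D_def using that by (subst emeasure_density) auto
 have op: "emeasure riesz U <= emeasure D U" if U: "open U" "U <= Om" for U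
 proof -
  have "outer U <= emeasure D U"
  proof (rule outer_open_le[OF U])
   fix \<psi> assume \<psi>: "test_function U \<psi>" "!!x. 0 <= \<psi> x" "!!x. \<psi> x <= 1"
   have [measurable]: "\<psi> \<in> Borel" by (rule smooth_borel_measurable[OF test_function_smooth[OF \<psi>(1)]])
   have i: "L1 (%z. \<psi> z * k z)"
    by (rule Bochner_Integration.integrable_bound[OF k(1)]) (use \<psi> k in \<open>auto simp: abs_mult mult_left_le_one_le\<close>)
   have "ennreal (T \<psi>) <= ennreal (LI z. \<psi> z * k z)"
    by (intro ennreal_leI le test_function_mono[OF \<psi>(1) U(2)] \<psi>)
   also have "... = (\<integral>\<^sup>+z. ennreal (\<psi> z * k z) \<partial>lborel)"
    using i \<psi>(2) k(2) by (intro nn_integral_eq_integral[symmetric]) auto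
   also have "... <= (\<integral>\<^sup>+z. ennreal (k z) * ind U z \<partial>lborel)"
   proof (rule nn_integral_mono)
    fix z show "ennreal (\<psi> z * k z) <= ennreal (k z) * ind U z"
     using \<psi> k(2) test_function_outside[OF \<psi>(1), of z]
     by (cases "z \<in> U") (auto intro!: ennreal_leI simp: mult_left_le_one_le)
   qed
   finally show "ennreal (T \<psi>) <= emeasure D U" using U De by simp
  qed
  then show ?thesis using emeasure_riesz U by simp
 qed
 have fin: "emeasure D (space D) \<noteq> \<infinity>"
 proof -
  have "space D = UNIV" by (simp add: D_def)
  then have "emeasure D (space D) = (\<integral>\<^sup>+z. ennreal (k z) \<partial>lborel)" using De[of UNIV] by simp
  also have "... = ennreal (LI z. k z)" using k by (intro nn_integral_eq_integral) auto
  finally show ?thesis by simp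
 qed
 have sD: "sets D = sets borel" by (simp add: D_def)
 have "emeasure riesz A <= emeasure D U" if "A <= U" "open U" for U
 proof -
  have "emeasure riesz A <= emeasure riesz (U \<inter> Om)"
   using that A open_domain by (intro emeasure_mono) (auto simp: sets_riesz sets_restrict_space_iff)
  also have "... <= emeasure D (U \<inter> Om)" using that open_domain by (intro op) auto
  also have "... <= emeasure D U" using that by (intro emeasure_mono) (auto simp: sD)
  finally show ?thesis .
 qed
 then have "emeasure riesz A <= (INF U\<in>{U. A <= U \<and> open U}. emeasure D U)" by (intro INF_greatest) auto
 also have "... = emeasure D A" using outer_regular[OF sD fin A(1)] by simp
 finally show ?thesis using De[OF A(1)] by simp
qed

end

section \<open>Weak gradients from difference quotients\<close>

text \<open>Integration by parts in discrete form: the difference quotient of \<open>ph\<close> is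
  shifted onto \<open>g\<close>, where the segment bound applies. Moving \<open>ph z\<close> to
  \<open>ph (z + s v)\<close> under the segment integral costs the Lipschitz term of
  \<open>Q\<close>, and Taylor's formula the other one.\<close>

lemma difference_quotient_bound:
 fixes g H :: "'a::euclidean_space => real"
 assumes g: "L1 g" and H: "L1 H" "!!z. 0 <= H z"
  and diff: "!!K. compact K ==> K <= Om ==> \<exists>d>0. \<forall>v. norm v < d -->
   (ae z. z \<in> K --> \<bar>g (z + v) - g z\<bar> <= norm v * segment_integral H z v)"
  and ph: "test_function Om ph" "!!z. 0 <= ph z" and b: "norm b = 1"
 shows "\<bar>LI z. g z * dir_deriv ph b z\<bar> <= (LI z. H z * ph z)"
proof -
 obtain K where K: "compact K" "K <= Om" "!!x. x \<notin> K ==> ph x = 0" using ph(1) unfolding test_function_iff by blast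
 obtain d where d: "d > 0" "!!v. norm v < d ==> ae z. z \<in> K --> \<bar>g (z + v) - g z\<bar> <= norm v * segment_integral H z v"
  using diff[OF K(1,2)] by blast
 obtain B where B: "B \<ge> 0" "!!x y. \<bar>ph x - ph y\<bar> <= B * norm (x - y)" using smooth_lipschitz[OF ph(1)] by blast
 obtain C where C: "C \<ge> 0" "!!x y. \<bar>ph y - ph x - dir_deriv ph (y - x) x\<bar> <= C * (norm (y - x))^2"
  using test_function_Taylor[OF ph(1)] by blast
 note sm = test_function_smooth[OF ph(1)]
 have [measurable]: "ph \<in> Borel" by (rule smooth_borel_measurable[OF sm])
 note [measurable] = borel_measurable_integrable[OF g] borel_measurable_integrable[OF H(1)]
 have gp: "L1 (%z. g z * \<psi> (z - c))" if "test_function Om \<psi>" for \<psi> c by (rule mollify_integrand[OF that g])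
 have gs: "L1 (%z. g (z + v) * ph z)" for v
  using mollify_translate(2)[OF ph(1) g, of v] by (simp add: add.commute)
 have Hph: "L1 (%z. H z * ph z)" using mollify_integrand[OF ph(1) H(1), of 0] by simp
 define Q where "Q = B * (LI z. H z) + C * (LI z. \<bar>g z\<bar>)"
 have main: "\<bar>LI z. g z * dir_deriv ph b z\<bar> <= (LI z. H z * ph z) + t * Q" if t: "0 < t" "t < d" for t
 proof -
  define v where "v = t *R b"
  have nv: "norm v = t" using t b by (simp add: v_def)
  have Dv: "dir_deriv ph v z = t * dir_deriv ph b z" for z
   unfolding v_def by (simp add: linear_cmul[OF linear_dir_deriv[OF sm]])
  have Di: "L1 (%z. g z * dir_deriv ph v z)"
   using gp[OF test_function_dir_deriv[OF ph(1), of v], of 0] by simp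
  have g0: "L1 (%z. g z * ph z)" using gp[OF ph(1), of 0] by simp
  have shift: "(LI z. g z * ph (z - v)) = (LI z. g (z + v) * ph z)"
   using integral_translate[of "%z. g z * ph (z - v)" v] by simp
  have "(LI z. g z * dir_deriv ph v z) = (LI z. g z * (ph (z - v) - ph z + dir_deriv ph v z)) - (LI z. g (z + v) * ph z - g z * ph z)"
   using Di g0 gp[OF ph(1), of v] gs[of v] shift by (simp add: algebra_simps)
  moreover have "\<bar>LI z. g z * (ph (z - v) - ph z + dir_deriv ph v z)\<bar> <= C * t^2 * (LI z. \<bar>g z\<bar>)"
  proof -
   have "norm (LI z. g z * (ph (z - v) - ph z + dir_deriv ph v z)) <= (LI z. C * t^2 * \<bar>g z\<bar>)"
   proof (rule order_trans[OF integral_norm_bound integral_mono])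
    fix z
    have "\<bar>ph (z - v) - ph z + dir_deriv ph v z\<bar> <= C * t^2"
     using C(2)[of "z - v" z] linear_neg[OF linear_dir_deriv[OF sm, of z], of v] nv by simp
    then have "\<bar>g z\<bar> * \<bar>ph (z - v) - ph z + dir_deriv ph v z\<bar> <= \<bar>g z\<bar> * (C * t^2)" by (rule mult_left_mono) simp
    then show "norm (g z * (ph (z - v) - ph z + dir_deriv ph v z)) <= C * t^2 * \<bar>g z\<bar>" by (simp add: abs_mult mult.commute)
   qed (use Di g0 gp[OF ph(1), of v] g in \<open>auto simp: distrib_left right_diff_distrib\<close>)
   then show ?thesis by simp
  qed
  moreover have "\<bar>LI z. g (z + v) * ph z - g z * ph z\<bar> <= t * ((LI z. H z * ph z) + B * t * (LI z. H z))"
  proof -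
   define H2 where "H2 = (%z. H z * ph z + B * t * H z)"
   have H2: "L1 H2" unfolding H2_def using Hph H by simp
   have "norm (LI z. g (z + v) * ph z - g z * ph z) <= (LI z. t * segment_integral H2 z v)"
   proof (rule order_trans[OF integral_norm_bound integral_mono_AE])
    show "L1 (%z. t * segment_integral H2 z v)" using segment_integral_integrable(1)[OF H2, of v] by simp
    show "ae z. norm (g (z + v) * ph z - g z * ph z) <= t * segment_integral H2 z v"
     using d(2)[of v, unfolded nv, OF t(2)] segment_integral_integrable(2)[OF H2, of v] segment_integral_integrable(2)[OF H(1), of v]
    proof eventually_elim
     case (elim z)
     have "segment_integral H z v * ph z = (LI s. (ind {0..1} s * H (z + s *R v)) * ph z)"
      unfolding segment_integral_def using elim(3) by simp
     also have "... <= segment_integral H2 z v" unfolding segment_integral_def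
     proof (rule integral_mono)
      fix s :: real
      show "ind {0..1} s * H (z + s *R v) * ph z <= ind {0..1} s * H2 (z + s *R v)"
      proof (cases "s \<in> {0..1}")
       case True
       have "\<bar>ph z - ph (z + s *R v)\<bar> <= B * (s * t)" using B(2)[of z "z + s *R v"] True nv by simp
       also have "... <= B * (1 * t)" using True t B(1) by (intro mult_left_mono mult_right_mono) auto
       finally have "ph z <= ph (z + s *R v) + B * t" by linarith
       from mult_left_mono[OF this H(2)[of "z + s *R v"]] show ?thesis using True by (simp add: H2_def algebra_simps)
      qed simp
     qed (use elim in simp_all)
     finally have le: "segment_integral H z v * ph z <= segment_integral H2 z v" .
     have "\<bar>g (z + v) - g z\<bar> * ph z <= t * segment_integral H z v * ph z"
      using elim(1) K(3)[of z] ph(2)[of z] nv by (cases "z \<in> K") (auto intro: mult_right_mono)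
     also have "... <= t * segment_integral H2 z v" using le t by (simp add: mult.assoc)
     finally show ?case using ph(2)[of z] by (simp add: abs_mult flip: left_diff_distrib)
    qed
   qed (use gs[of v] g0 in auto)
   also have "... = t * (LI z. H2 z)" using segment_integral_integrable(3)[OF H2, of v] by simp
   also have "(LI z. H2 z) = (LI z. H z * ph z) + B * t * (LI z. H z)"
    unfolding H2_def using Hph H by simp
   finally show ?thesis by simp
  qed
  ultimately have "\<bar>LI z. g z * dir_deriv ph v z\<bar> <= t * ((LI z. H z * ph z) + t * Q)"
   by (simp add: Q_def power2_eq_square algebra_simps)
  moreover have "(LI z. g z * dir_deriv ph v z) = t * (LI z. g z * dir_deriv ph b z)"
   unfolding Dv by (simp add: mult.left_commute)
  ultimately show ?thesis using t by (simp add: abs_mult)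
 qed
 show ?thesis
 proof (rule field_le_epsilon)
  fix e :: real assume "0 < e"
  define t where "t = min (d / 2) (e / (\<bar>Q\<bar> + 1))"
  have t: "0 < t" "t < d" using d(1) \<open>0 < e\<close> by (auto simp: t_def)
  have "t * Q <= t * \<bar>Q\<bar>" using t by (intro mult_left_mono) auto
  also have "... <= e / (\<bar>Q\<bar> + 1) * \<bar>Q\<bar>" by (intro mult_right_mono) (auto simp: t_def)
  also have "... <= e" using \<open>0 < e\<close> by (simp add: field_simps)
  finally show "\<bar>LI z. g z * dir_deriv ph b z\<bar> <= (LI z. H z * ph z) + e" using main[OF t] by linarith
 qed
qed

text \<open>The integral of \<open>H ph\<close> minus that of \<open>g dir_deriv ph b\<close> is a
  positive functional of \<open>ph\<close>, at most twice the integral of \<open>H ph\<close>. Its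
  measure has a density \<open>r\<close> with \<open>0 <= r <= 2 H\<close>, and \<open>r - H\<close>
  is the weak derivative.\<close>

lemma partial_derivative_exists:
 fixes g H :: "'a::euclidean_space => real"
 assumes Om: "open Om" and g: "L1 g" and H: "L1 H" "!!z. 0 <= H z"
  and le: "!!ph. test_function Om ph ==> (!!z. 0 <= ph z) ==> \<bar>LI z. g z * dir_deriv ph b z\<bar> <= (LI z. H z * ph z)"
 shows "\<exists>D. D \<in> Borel \<and> (\<forall>z. \<bar>D z\<bar> <= H z) \<and>
  (\<forall>ph. test_function Om ph --> (LI z. g z * dir_deriv ph b z) = - (LI z. D z * ph z))"
proof -
 note [measurable] = borel_measurable_integrable[OF H(1)]
 define T where "T = (%ph. (LI z. H z * ph z) - (LI z. g z * dir_deriv ph b z))"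
 have i: "L1 (%z. H z * ph z)" "L1 (%z. g z * dir_deriv ph b z)" if "test_function Om ph" for ph
  using mollify_integrand[OF that H(1), of 0] mollify_integrand[OF test_function_dir_deriv[OF that, of b] g, of 0] by auto
 interpret positive_functional Om T
 proof
  fix ph \<psi> assume t: "test_function Om ph" "test_function Om \<psi>"
  then show "T (%x. ph x + \<psi> x) = T ph + T \<psi>"
   using i[OF t(1)] i[OF t(2)] by (simp add: T_def dir_deriv_add[OF t[THEN test_function_smooth]] distrib_left)
 next
  fix ph c assume t: "test_function Om ph"
  then show "T (%x. c * ph x) = c * T ph"
   by (simp add: T_def dir_deriv_cmult[OF test_function_smooth[OF t]] mult.left_commute[of _ c] right_diff_distrib)
 next
  fix ph assume "test_function Om ph" "!!x. 0 <= ph x"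
  from le[OF this] show "0 <= T ph" by (simp add: T_def)
 qed (rule Om)
 define k where "k = (%z. 2 * H z)"
 have k: "L1 k" "!!z. 0 <= k z" using H by (auto simp: k_def)
 have [measurable]: "k \<in> Borel" using k by simp
 have "T ph <= (LI z. ph z * k z)" if "test_function Om ph" "!!x. 0 <= ph x" for ph
 proof -
  have "(%z. ph z * k z) = (%z. 2 * (H z * ph z))" by (auto simp: k_def)
  then show ?thesis using le[OF that] by (simp add: T_def)
 qed
 note rle = riesz_le_density[OF k this]
 define N where "N = restrict_space lborel Om"
 have Oms: "Om \<in> sets borel" using Om by simp
 have sN: "sets N = sets (restrict_space borel Om)" by (simp add: N_def sets_restrict_space)
 interpret N: sigma_finite_measure N unfolding N_def
  by (rule sigma_finite_measure_restrict_space) (use Oms in \<open>auto simp: lborel.sigma_finite_measure_axioms\<close>)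
 have nnN: "(\<integral>\<^sup>+z. F z \<partial>N) = (\<integral>\<^sup>+z. F z * ind Om z \<partial>lborel)" for F
  unfolding N_def using Oms by (simp add: nn_integral_restrict_space)
 have sb: "A \<in> sets borel" "A <= Om" if "A \<in> sets N" for A
  using that Oms by (auto simp: sN sets_restrict_space_iff)
 have rN: "emeasure riesz A <= (\<integral>\<^sup>+z. ennreal (k z) * ind A z \<partial>N)" if "A \<in> sets N" for A
 proof -
  have "(\<integral>\<^sup>+z. ennreal (k z) * ind A z \<partial>N) = (\<integral>\<^sup>+z. ennreal (k z) * ind A z \<partial>lborel)"
   unfolding nnN using sb[OF that] by (intro nn_integral_cong) (auto simp: indicator_def)
  then show ?thesis using rle[OF _ _ sb[OF that]] by simp
 qed
 have "absolutely_continuous N riesz"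
  unfolding absolutely_continuous_def
 proof
  fix A assume A: "A \<in> null_sets N"
  have "(\<integral>\<^sup>+z. ennreal (k z) * ind A z \<partial>N) = 0"
   by (rule nn_integral_null_set[OF A])
  then have "emeasure riesz A = 0" using rN[of A] A by (auto simp: null_sets_def)
  then show "A \<in> null_sets riesz" using A by (auto simp: null_sets_def sN sets_riesz)
 qed
 from N.Radon_Nikodym[OF this] obtain f where f[measurable]: "f \<in> borel_measurable N" and fd: "density N f = riesz"
  by (auto simp: sN sets_riesz)
 have km[measurable]: "(%z. ennreal (k z)) \<in> borel_measurable N" by (simp add: N_def measurable_restrict_space1)
 have fk: "AE z in N. f z <= ennreal (k z)"
 proof -
  \<comment> \<open>Where the density exceeds \<open>k\<close>, the bound on the measure forces the
    excess to integrate to 0.\<close>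
  define A where "A = {z\<in>space N. ennreal (k z) < f z}"
  have A[measurable]: "A \<in> sets N" unfolding A_def by measurable
  have "(\<integral>\<^sup>+z. (f z - ennreal (k z)) * ind A z \<partial>N) + (\<integral>\<^sup>+z. ennreal (k z) * ind A z \<partial>N)
   = (\<integral>\<^sup>+z. f z * ind A z \<partial>N)"
   by (subst nn_integral_add[symmetric]) (auto intro!: nn_integral_cong simp: indicator_def A_def diff_add_cancel_ennreal)
  also have "... = emeasure riesz A" unfolding fd[symmetric] by (simp add: emeasure_density)
  also have "... <= (\<integral>\<^sup>+z. ennreal (k z) * ind A z \<partial>N)" by (rule rN[OF A])
  finally have le: "(\<integral>\<^sup>+z. (f z - ennreal (k z)) * ind A z \<partial>N) + (\<integral>\<^sup>+z. ennreal (k z) * ind A z \<partial>N)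
   <= 0 + (\<integral>\<^sup>+z. ennreal (k z) * ind A z \<partial>N)" by simp
  have "(\<integral>\<^sup>+z. ennreal (k z) * ind A z \<partial>N) <= (\<integral>\<^sup>+z. ennreal (k z) \<partial>lborel)"
   unfolding nnN by (intro nn_integral_mono) (auto simp: indicator_def)
  also have "... < \<infinity>" using k by (simp add: nn_integral_eq_integral)
  finally have "(\<integral>\<^sup>+z. (f z - ennreal (k z)) * ind A z \<partial>N) = 0"
   using le by (auto simp: ennreal_add_left_cancel_le add.commute)
  then have "AE z in N. (f z - ennreal (k z)) * ind A z = 0" by (subst (asm) nn_integral_0_iff_AE) auto
  moreover have "AE z in N. z \<in> space N" by (rule AE_space)
  ultimately show ?thesis by eventually_elim (auto simp: A_def indicator_def diff_eq_0_iff_ennreal not_less split: if_splits)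
 qed
 \<comment> \<open>Cutting at \<open>k\<close> makes the bound hold everywhere; it changes the
   density on a null set only.\<close>
 define r where "r = (%z. min (k z) (enn2real (f z)))"
 have r: "0 <= r z" "r z <= 2 * H z" for z using k(2)[of z] by (auto simp: r_def k_def)
 have rm: "r \<in> borel_measurable N" unfolding r_def by (intro borel_measurable_min borel_measurable_enn2real f) (simp add: N_def measurable_restrict_space1)
 have rd: "riesz = density N (%z. ennreal (r z))"
  unfolding fd[symmetric]
 proof (rule density_cong)
  show "AE z in N. f z = ennreal (r z)" using fk
  proof eventually_elim
   case (elim z)
   then have "f z < top" by (auto intro: le_less_trans)
   then have "ennreal (enn2real (f z)) = f z" by simp
   moreover have "enn2real (f z) <= k z" using elim k(2) by (simp add: enn2real_leI)
   ultimately show ?case by (simp add: r_def)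
  qed
 qed (use rm in auto)
 define D where "D = (%z. ind Om z * r z - H z)"
 have mOm: "(%z. ind Om z * r z) \<in> Borel"
  using rm Oms by (simp add: N_def borel_measurable_restrict_space_iff measurable_cong_sets[OF sets_restrict_space_cong[OF sets_lborel] refl])
 show ?thesis
 proof (intro exI[of _ D] conjI allI impI)
  show "D \<in> Borel" unfolding D_def using mOm by measurable
  show "\<bar>D z\<bar> <= H z" for z using r[of z] H(2)[of z] by (auto simp: D_def indicator_def)
  fix ph assume t: "test_function Om ph"
  have [measurable]: "ph \<in> Borel" by (rule smooth_borel_measurable[OF test_function_smooth[OF t]])
  have "T ph = (LINT z|density N (%z. ennreal (r z)). ph z)" using riesz_integral(2)[OF t] rd by simp
  also have "... = (LINT z|N. r z * ph z)"
   using rm r(1) by (subst integral_density) (auto simp: N_def measurable_restrict_space1)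
  also have "... = (LI z. (ind Om z * r z) * ph z)"
   unfolding N_def using Oms by (subst integral_restrict_space) (auto simp: mult.assoc)
  finally have T: "T ph = (LI z. (ind Om z * r z) * ph z)" .
  have "L1 (%z. 2 * (H z * ph z))" using i(1)[OF t] by simp
  then have ri: "L1 (%z. (ind Om z * r z) * ph z)"
  proof (rule Bochner_Integration.integrable_bound)
   show "ae z. norm (ind Om z * r z * ph z) <= norm (2 * (H z * ph z))"
   proof (rule AE_I2)
    fix z
    have "ind Om z * r z * \<bar>ph z\<bar> <= 2 * H z * \<bar>ph z\<bar>" using r[of z] H(2)[of z] by (intro mult_right_mono) (auto simp: indicator_def)
    then show "norm (ind Om z * r z * ph z) <= norm (2 * (H z * ph z))" using r(1) H(2) by (simp add: abs_mult mult.assoc)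
   qed
  qed (use mOm in measurable)
  have "(LI z. D z * ph z) = T ph - (LI z. H z * ph z)"
   unfolding D_def T left_diff_distrib using ri i(1)[OF t] by simp
  then show "(LI z. g z * dir_deriv ph b z) = - (LI z. D z * ph z)" by (simp add: T_def)
 qed
qed

text \<open>The coordinates of the weak gradient are produced one at a time, each bounded by
  \<open>H\<close>; hence the factor \<open>DIM('a)\<close>.\<close>

theorem weak_gradient_exists:
 fixes g H :: "'a::euclidean_space => real"
 assumes Om: "open Om" and g: "L1 g" and H: "L1 H" "!!z. 0 <= H z"
  and diff: "!!K. compact K ==> K <= Om ==> \<exists>d>0. \<forall>v. norm v < d -->
   (ae z. z \<in> K --> \<bar>g (z + v) - g z\<bar> <= norm v * segment_integral H z v)"
 shows "\<exists>G. weak_gradient Om g G \<and> (\<forall>z. norm (G z) <= DIM('a) * H z)"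
proof -
 have "\<forall>b\<in>(Basis::'a set). \<exists>D. D \<in> Borel \<and> (\<forall>z. \<bar>D z\<bar> <= H z) \<and>
  (\<forall>ph. test_function Om ph --> (LI z. g z * dir_deriv ph b z) = - (LI z. D z * ph z))"
  by (intro ballI partial_derivative_exists[OF Om g H] difference_quotient_bound[OF g H diff]) auto
 from bchoice[OF this] obtain D where D: "!!b. b \<in> Basis ==> D b \<in> Borel"
  "!!b z. b \<in> Basis ==> \<bar>D b z\<bar> <= H z"
  "!!b ph. b \<in> Basis ==> test_function Om ph ==> (LI z. g z * dir_deriv ph b z) = - (LI z. D b z * ph z)"
  by blast
 define G where "G = (%z. \<Sum>b\<in>Basis. D b z *R b)"
 have Di: "L1 (D b)" if "b \<in> Basis" for b
  by (rule Bochner_Integration.integrable_bound[OF H(1)]) (use D[OF that] H(2) in auto)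
 have Gi: "L1 G" unfolding G_def using Di by (intro Bochner_Integration.integrable_sum integrable_scaleR_left) auto
 have "norm (G z) <= DIM('a) * H z" for z
 proof -
  have "norm (G z) <= (\<Sum>b\<in>Basis. norm (D b z *R b))" unfolding G_def by (rule norm_sum)
  also have "... <= (\<Sum>b\<in>(Basis::'a set). H z)" using D(2) by (intro sum_mono) auto
  finally show ?thesis by simp
 qed
 moreover have "(LI z. g z * dir_deriv ph v z) = - (LI z. (G z \<bullet> v) * ph z)" if t: "test_function Om ph" for ph v
 proof -
  have i: "L1 (%z. g z * dir_deriv ph b z)" "b \<in> Basis ==> L1 (%z. D b z * ph z)" for b
   using mollify_integrand[OF test_function_dir_deriv[OF t, of b] g, of 0] mollify_integrand[OF t Di, of b 0] by auto
  have dv: "dir_deriv ph v z = (\<Sum>b\<in>Basis. (v \<bullet> b) * dir_deriv ph b z)" for z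
   by (subst dir_deriv_gradient[OF test_function_smooth[OF t]])
    (simp add: gradient_def inner_sum_right inner_commute[of _ v] mult.commute)
  have Gv: "G z \<bullet> v = (\<Sum>b\<in>Basis. (v \<bullet> b) * D b z)" for z
   by (simp add: G_def inner_sum_right inner_commute[of _ v] mult.commute)
  have "(LI z. g z * dir_deriv ph v z) = (LI z. (\<Sum>b\<in>Basis. (v \<bullet> b) * (g z * dir_deriv ph b z)))"
   unfolding dv by (simp add: sum_distrib_left mult.left_commute)
  also have "... = (\<Sum>b\<in>Basis. (v \<bullet> b) * - (LI z. D b z * ph z))" using i by (simp add: D(3)[OF _ t])
  also have "... = - (LI z. (\<Sum>b\<in>Basis. (v \<bullet> b) * (D b z * ph z)))" using i by (simp add: sum_negf)
  also have "... = - (LI z. (G z \<bullet> v) * ph z)"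
   unfolding Gv by (simp add: sum_distrib_right mult.assoc)
  finally show ?thesis .
 qed
 ultimately show ?thesis using g Gi unfolding weak_gradient_def by blast
qed

section \<open>Measurability of compositions and mollification in L2\<close>

text \<open>The space of the second argument may fail to be second countable, and then open sets of
  the product can be more than countable unions of rectangles. A countable basis of the first factor
  suffices: each basic \<open>I\<close> is paired with the largest open \<open>W I\<close> for which
  \<open>F\<close> maps the rectangle into \<open>V\<close>.\<close>

lemma borel_measurable_continuous_pair:
 fixes F :: "'b::second_countable_topology => 'x::topological_space => 'y::topological_space"
 assumes F: "continuous_on UNIV (%(a, y). F a y)" and f: "f \<in> borel_measurable M" and u: "u \<in> borel_measurable M"
 shows "(%z. F (f z) (u z)) \<in> borel_measurable M"
proof (rule borel_measurableI)
 fix V :: "'y set" assume V: "open V"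
 obtain \<B> :: "'b set set" where \<B>: "countable \<B>" "topological_basis \<B>" using ex_countable_basis by blast
 define W where "W = (%I. \<Union>{W. open W \<and> (\<forall>a\<in>I. \<forall>y\<in>W. F a y \<in> V)})"
 have "(%z. F (f z) (u z)) -` V \<inter> space M = (\<Union>I\<in>\<B>. (f -` I \<inter> space M) \<inter> (u -` W I \<inter> space M))"
 proof (intro set_eqI iffI)
  fix z assume z: "z \<in> (%z. F (f z) (u z)) -` V \<inter> space M"
  have "open ((%(a, y). F a y) -` V)" using F V by (simp add: continuous_on_open_vimage)
  moreover have "(f z, u z) \<in> (%(a, y). F a y) -` V" using z by simp
  ultimately obtain A B where AB: "open A" "open B" "f z \<in> A" "u z \<in> B" "A \<times> B <= (%(a, y). F a y) -` V"
   by (rule open_prod_elim) blast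
  obtain I where I: "I \<in> \<B>" "f z \<in> I" "I <= A" using topological_basisE[OF \<B>(2) AB(1,3)] by blast
  have "F a y \<in> V" if "a \<in> I" "y \<in> B" for a y using subsetD[OF AB(5), of "(a, y)"] that I(3) by auto
  then have "u z \<in> W I" unfolding W_def using AB(2,4) by (intro UnionI[of B]) auto
  then show "z \<in> (\<Union>I\<in>\<B>. (f -` I \<inter> space M) \<inter> (u -` W I \<inter> space M))" using I z by blast
 next
  fix z assume "z \<in> (\<Union>I\<in>\<B>. (f -` I \<inter> space M) \<inter> (u -` W I \<inter> space M))"
  then show "z \<in> (%z. F (f z) (u z)) -` V \<inter> space M" by (auto simp: W_def)
 qed
 moreover have "open (W I)" for I unfolding W_def by auto
 note Wo = this
 have "(f -` I \<inter> space M) \<inter> (u -` W I \<inter> space M) \<in> sets M" if "I \<in> \<B>" for I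
  by (rule sets.Int[OF measurable_sets[OF f borel_open[OF topological_basis_open[OF \<B>(2) that]]] measurable_sets[OF u borel_open[OF Wo]]])
 with calculation show "(%z. F (f z) (u z)) -` V \<inter> space M \<in> sets M"
  using sets.countable_UN'[OF \<B>(1), of "%I. (f -` I \<inter> space M) \<inter> (u -` W I \<inter> space M)" M] by (simp add: image_subset_iff)
qed

text \<open>Jensen's inequality bounds the square of a mollification by the mollification of the
  square. The latter converges fast in L1 and therefore has an integrable bound, which gives L2
  convergence by domination.\<close>

lemma mollifier_sequence_L2:
 fixes f :: "'i => 'a::euclidean_space => real"
 assumes I: "finite I" and f: "!!i. i \<in> I ==> L1 (f i)" "!!i. i \<in> I ==> L1 (%z. (f i z)^2)"
 shows "\<exists>ph :: nat => 'a => real. (\<forall>j. test_function (ball 0 ((1/2)^j)) (ph j)) \<and>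
  (\<forall>i\<in>I. (\<forall>j. L1 (%z. (mollify (ph j) (f i) z - f i z)^2)) \<and>
   (%j. LI z. (mollify (ph j) (f i) z - f i z)^2) \<longlonglongrightarrow> 0)"
proof -
 \<comment> \<open>Each function enters together with its square, so that one sequence of kernels
   treats both.\<close>
 define f' where "f' = (%(i, s). if s then (%z. (f i z)^2) else f i)"
 have "finite (I \<times> (UNIV::bool set))" using I by simp
 moreover have "L1 (f' q)" if "q \<in> I \<times> UNIV" for q using that f by (auto simp: f'_def)
 ultimately have "\<exists>ph :: nat => 'a => real. \<forall>j. test_function (ball 0 ((1/2)^j)) (ph j) \<and> (\<forall>x. 0 <= ph j x) \<and>
  (LI x. ph j x) = 1 \<and>
  (\<forall>q\<in>I \<times> UNIV. L1 (mollify (ph j) (f' q)) \<and> (LI z. \<bar>mollify (ph j) (f' q) z - f' q z\<bar>) <= (1/2)^j)"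
  by (rule mollifier_sequence)
 then obtain ph :: "nat => 'a => real" where ph: "test_function (ball 0 ((1/2)^j)) (ph j)" "0 <= ph j x" "(LI x. ph j x) = 1"
  and mq: "\<forall>q\<in>I \<times> UNIV. L1 (mollify (ph j) (f' q)) \<and> (LI z. \<bar>mollify (ph j) (f' q) z - f' q z\<bar>) <= (1/2)^j" for j x
  by blast
 have m: "L1 (mollify (ph j) (f i))" "(LI z. \<bar>mollify (ph j) (f i) z - f i z\<bar>) <= (1/2)^j"
  "L1 (mollify (ph j) (%z. (f i z)^2))" "(LI z. \<bar>mollify (ph j) (%z. (f i z)^2) z - (f i z)^2\<bar>) <= (1/2)^j"
  if "i \<in> I" for i j
  using bspec[OF mq, of "(i, False)" j] bspec[OF mq, of "(i, True)" j] that by (auto simp: f'_def)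
 have "(\<forall>j. L1 (%z. (mollify (ph j) (f i) z - f i z)^2)) \<and>
   (%j. LI z. (mollify (ph j) (f i) z - f i z)^2) \<longlonglongrightarrow> 0" if i: "i \<in> I" for i
 proof -
  have F1: "ae z. (%j. mollify (ph j) (f i) z) \<longlonglongrightarrow> f i z"
   by (rule fast_L1_convergence[OF f(1)[OF i] m(1,2)[OF i]]) (auto elim: eventually_mono)
  have "\<exists>F. L1 F \<and> (ae z. \<forall>j. \<bar>mollify (ph j) (%z. (f i z)^2) z - (f i z)^2\<bar> <= F z)"
   by (rule fast_L1_convergence[OF f(2)[OF i] m(3,4)[OF i]]) (auto elim: eventually_mono)
  then obtain F where F: "L1 F" "ae z. \<forall>j. \<bar>mollify (ph j) (%z. (f i z)^2) z - (f i z)^2\<bar> <= F z" by blast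
  have Jensen: "(mollify (ph j) (f i) z)^2 <= mollify (ph j) (%z. (f i z)^2) z" for j z
  proof -
   define c where "c = mollify (ph j) (f i) z"
   have i1: "L1 (%y. f i (z + y) * ph j y)" "L1 (%y. (f i (z + y))^2 * ph j y)" "L1 (ph j)"
    using mollify_translate(2)[OF ph(1) f(1)[OF i]] mollify_translate(2)[OF ph(1) f(2)[OF i]] test_function_integrable[OF ph(1)] by auto
   have "0 <= (LI y. (f i (z + y) - c)^2 * ph j y)" using ph(2) by (intro integral_nonneg_AE) auto
   also have "... = (LI y. (f i (z + y))^2 * ph j y - 2 * c * (f i (z + y) * ph j y) + c^2 * ph j y)"
    by (simp add: power2_diff algebra_simps)
   also have "... = mollify (ph j) (%z. (f i z)^2) z - 2 * c * c + c^2"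
    using i1 mollify_translate(1)[OF ph(1) f(1)[OF i], of j z] mollify_translate(1)[OF ph(1) f(2)[OF i], of j z] ph(3)
    by (simp add: c_def)
   finally show ?thesis by (simp add: c_def power2_eq_square)
  qed
  have dom: "L1 (%z. 2 * F z + 4 * (f i z)^2)" using F f(2)[OF i] by simp
  have sm: "(%z. (mollify (ph j) (f i) z - f i z)^2) \<in> borel_measurable lborel" for j
   using m(1)[OF i] f(1)[OF i] by measurable
  have le: "ae z. norm ((mollify (ph j) (f i) z - f i z)^2) <= 2 * F z + 4 * (f i z)^2" for j
    using F(2)
   proof eventually_elim
    case (elim z)
    have "\<bar>mollify (ph j) (%z. (f i z)^2) z - (f i z)^2\<bar> <= F z" using elim by blast
    then have "(mollify (ph j) (f i) z)^2 <= F z + (f i z)^2" using Jensen[of j z] by linarith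
    moreover have "(mollify (ph j) (f i) z - f i z)^2 <= 2 * (mollify (ph j) (f i) z)^2 + 2 * (f i z)^2"
     using sum_squares_bound[of "mollify (ph j) (f i) z" "- f i z"] by (simp add: power2_diff)
    ultimately show ?case by simp
   qed
  have "(%j. LI z. (mollify (ph j) (f i) z - f i z)^2) \<longlonglongrightarrow> (LINT z|(lborel :: 'a measure). 0)"
   by (rule integral_dominated_convergence[OF _ sm dom _ le]) (use F1 in \<open>auto elim!: eventually_mono intro!: tendsto_eq_intros\<close>)
  moreover have "L1 (%z. (mollify (ph j) (f i) z - f i z)^2)" for j
   by (rule Bochner_Integration.integrable_bound[OF dom sm]) (use le[of j] in \<open>auto elim!: eventually_mono\<close>)
  ultimately show ?thesis by simp
 qed
 then show ?thesis using ph(1) by blast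
qed

section \<open>Sobolev maps on bounded domains\<close>

lemma borel_version:
 fixes f :: "'a::euclidean_space => 'b::euclidean_space"
 assumes Om: "Om \<in> sets borel" and f: "f \<in> borel_measurable (lebesgue_on Om)"
 shows "\<exists>f'. f' \<in> Borel \<and> (\<forall>z. z \<notin> Om --> f' z = 0) \<and> (ae z. z \<in> Om --> f z = f' z)"
proof -
 define F where "F = (%z. if z \<in> Om then f z else 0)"
 have "F \<in> borel_measurable lebesgue" unfolding F_def using Om by (intro borel_measurable_if_I[OF f]) simp
 then have "\<forall>b\<in>Basis. \<exists>g. g \<in> Borel \<and> (ae z. F z \<bullet> b = g z)"
  using completion_ex_borel_measurable_real[of "%z. F z \<bullet> _" lborel] by auto
 from bchoice[OF this] obtain g where g: "!!b. b \<in> Basis ==> g b \<in> Borel"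
  "!!b. b \<in> Basis ==> ae z. F z \<bullet> b = g b z" by blast
 have "ae z. \<forall>b\<in>Basis. F z \<bullet> b = g b z" using g(2) by (intro AE_finite_allI) auto
 then have "ae z. z \<in> Om --> f z = ind Om z *R (\<Sum>b\<in>Basis. g b z *R b)"
 proof eventually_elim
  case (elim z)
  then have "(\<Sum>b\<in>Basis. g b z *R b) = (\<Sum>b\<in>Basis. (F z \<bullet> b) *R b)" by (intro sum.cong) auto
  then show ?case by (simp add: euclidean_representation F_def)
 qed
 then show ?thesis using g(1) Om
  by (intro exI[of _ "%z. ind Om z *R (\<Sum>b\<in>Basis. g b z *R b)"]) (auto intro!: borel_measurable_scaleR borel_measurable_sum)
qed

lemma indicator_power2: "(ind A z :: real)^2 = ind A z" by (simp add: indicator_def)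

lemma borel_measurable_lebesgue_on: "f \<in> Borel ==> f \<in> borel_measurable (lebesgue_on Om)"
 by (simp add: measurable_completion measurable_restrict_space1)

lemma lebesgue_on_eq_lborel:
 fixes F F' :: "'a::euclidean_space => real"
 assumes Om: "Om \<in> sets borel" and F: "F \<in> borel_measurable (lebesgue_on Om)" and F': "F' \<in> Borel"
  and out: "!!z. z \<notin> Om ==> F' z = 0" and eq: "ae z. z \<in> Om --> F z = F' z"
 shows "integrable (lebesgue_on Om) F \<longleftrightarrow> L1 F'" "(LINT z|lebesgue_on Om. F z) = (LI z. F' z)"
proof -
 have Om': "Om \<inter> space lebesgue \<in> sets lebesgue" using Om by simp
 have ae: "AE z in lebesgue_on Om. F z = F' z" using eq by (simp add: AE_lebesgue_on_borel[OF Om])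
 note m = borel_measurable_lebesgue_on[OF F']
 have ind: "(%z. ind Om z *R F' z) = F'"
 proof
  fix z show "ind Om z *R F' z = F' z" by (cases "z \<in> Om") (auto simp: out)
 qed
 have "integrable (lebesgue_on Om) F \<longleftrightarrow> integrable (lebesgue_on Om) F'" by (rule integrable_cong_AE[OF F m ae])
 also have "... \<longleftrightarrow> L1 F'"
  unfolding integrable_restrict_space[OF Om'] ind by (rule integrable_completion) (use F' in simp)
 finally show "integrable (lebesgue_on Om) F \<longleftrightarrow> L1 F'" .
 have "(LINT z|lebesgue_on Om. F z) = (LINT z|lebesgue_on Om. F' z)" by (rule integral_cong_AE[OF F m ae])
 also have "... = (LI z. F' z)"
  unfolding integral_restrict_space[OF Om'] ind by (rule integral_completion) (use F' in simp)
 finally show "(LINT z|lebesgue_on Om. F z) = (LI z. F' z)" .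
qed

lemma L2_fun_iff:
 fixes F F' :: "'a::euclidean_space => 'b::euclidean_space"
 assumes "Om \<in> sets borel" "F \<in> borel_measurable (lebesgue_on Om)" "F' \<in> Borel"
  "!!z. z \<notin> Om ==> F' z = 0" "ae z. z \<in> Om --> F z = F' z"
 shows "L2_fun Om F \<longleftrightarrow> L1 (%z. (norm (F' z))^2)"
 unfolding L2_fun_def using assms(2)
  lebesgue_on_eq_lborel(1)[OF assms(1), of "%z. (norm (F z))^2" "%z. (norm (F' z))^2"] assms(3,4)
  eventually_mono[OF assms(5), of "%z. z \<in> Om --> (norm (F z))^2 = (norm (F' z))^2"] by simp

lemma integrable_square_bounded:
 fixes F :: "'a::euclidean_space => 'b::euclidean_space"
 assumes Om: "open Om" "bounded Om" and F: "F \<in> Borel" "!!z. z \<notin> Om ==> F z = 0"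
  and i: "L1 (%z. (norm (F z))^2)"
 shows "L1 F"
proof (rule Bochner_Integration.integrable_bound)
 have "L1 (ind Om :: 'a => real)"
  using Om emeasure_bounded_finite[OF Om(2)] by (intro integrable_real_indicator) auto
 then show "L1 (%z. ind Om z + (norm (F z))^2)" using i by (intro Bochner_Integration.integrable_add)
 show "ae z. norm (F z) <= norm (ind Om z + (norm (F z))^2)"
 proof (rule AE_I2)
  fix z
  have "0 <= (norm (F z) - 1)^2 + norm (F z)" by simp
  then have "norm (F z) <= 1 + (norm (F z))^2" by (simp add: power2_diff)
  then show "norm (F z) <= norm (ind Om z + (norm (F z))^2)" using F(2)[of z] by (cases "z \<in> Om") auto
 qed
qed (use F in simp)

lemma W12_gradientI:
 assumes Om: "open Om" and wg: "weak_gradient Om g G" and F: "F \<in> borel_measurable (lebesgue_on Om)"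
  and eq: "ae z. z \<in> Om --> F z = g z" and i: "L1 (%z. (g z)^2)" "L1 (%z. (norm (G z))^2)"
 shows "W12_gradient Om F G"
proof -
 have Oms: "Om \<in> sets borel" using Om by simp
 have [measurable]: "g \<in> Borel" "G \<in> Borel" using wg by (auto simp: weak_gradient_def)
 have "L1 (%z. ind Om z *R (g z)^2)" "L1 (%z. ind Om z *R (norm (G z))^2)"
  using Oms by (intro integrable_mult_indicator i; simp)+
 then have i': "L1 (%z. (norm (ind Om z * g z))^2)" "L1 (%z. (norm (ind Om z *R G z))^2)"
  by (simp_all add: power_mult_distrib indicator_power2)
 have "L2_fun Om F"
  by (subst L2_fun_iff[OF Oms F, of "%z. ind Om z * g z"]) (use eq i' Oms in \<open>auto elim: eventually_mono\<close>)
 moreover have "L2_fun Om G"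
  by (subst L2_fun_iff[OF Oms borel_measurable_lebesgue_on, of _ "%z. ind Om z *R G z"]) (use i' Oms in auto)
 moreover have "(LINT z|lebesgue_on Om. F z * dir_deriv ph v z) = - (LINT z|lebesgue_on Om. (G z \<bullet> v) * ph z)" if t: "test_function Om ph" for ph v
 proof -
  note t' = test_function_dir_deriv[OF t, of v]
  have [measurable]: "ph \<in> Borel" "dir_deriv ph v \<in> Borel"
   using smooth_borel_measurable test_function_smooth t t' by blast+
  have "(LINT z|lebesgue_on Om. F z * dir_deriv ph v z) = (LI z. g z * dir_deriv ph v z)"
   using F eq test_function_outside[OF t']
   by (intro lebesgue_on_eq_lborel(2)[OF Oms] borel_measurable_times[OF F borel_measurable_lebesgue_on]) (auto elim: eventually_mono)
  also have "... = - (LI z. (G z \<bullet> v) * ph z)" using wg t by (simp add: weak_gradient_def)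
  also have "(LI z. (G z \<bullet> v) * ph z) = (LINT z|lebesgue_on Om. (G z \<bullet> v) * ph z)"
   using test_function_outside[OF t] by (intro lebesgue_on_eq_lborel(2)[OF Oms, symmetric] borel_measurable_lebesgue_on) auto
  finally show ?thesis .
 qed
 ultimately show ?thesis unfolding W12_gradient_def by blast
qed

lemma L2_fun_dominated:
 fixes F F1 :: "'a::euclidean_space => real"
 assumes Om: "open Om" "bounded Om" and m: "F \<in> borel_measurable (lebesgue_on Om)" and F1: "L2_fun Om F1"
  and le: "!!z. \<bar>F z\<bar> <= K * \<bar>F1 z\<bar> + C"
 shows "L2_fun Om F"
proof -
 have "emeasure lebesgue Om < \<infinity>" using Om emeasure_bounded_finite[OF Om(2)] by simp
 then interpret finite_measure "lebesgue_on Om" using Om by (intro finite_measureI) (simp add: emeasure_restrict_space)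
 have "integrable (lebesgue_on Om) (%z. 2 * K^2 * (norm (F1 z))^2 + 2 * C^2)"
  using F1 unfolding L2_fun_def by (intro Bochner_Integration.integrable_add integrable_mult_right) auto
 then have "integrable (lebesgue_on Om) (%z. (norm (F z))^2)"
 proof (rule Bochner_Integration.integrable_bound)
  show "AE z in lebesgue_on Om. norm ((norm (F z))^2) <= norm (2 * K^2 * (norm (F1 z))^2 + 2 * C^2)"
  proof (rule AE_I2)
   fix z
   have "(F z)^2 <= (K * \<bar>F1 z\<bar> + C)^2" using le[of z] by (intro abs_le_square_iff[THEN iffD1]) simp
   also have "... <= 2 * (K * \<bar>F1 z\<bar>)^2 + 2 * C^2"
    using sum_squares_bound[of "K * \<bar>F1 z\<bar>" C] by (simp add: power2_sum)
   finally show "norm ((norm (F z))^2) <= norm (2 * K^2 * (norm (F1 z))^2 + 2 * C^2)" by (simp add: power_mult_distrib)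
  qed
 qed (use m in measurable)
 with m show ?thesis by (simp add: L2_fun_def)
qed

lemma L2_map_Lipschitz:
 assumes Om: "open Om" "bounded Om" and p: "L2_map Om p" and q: "!!x y. \<bar>q x - q y\<bar> <= K * dist x y"
 shows "L2_fun Om (%z. q (p z) :: real)"
proof -
 obtain c where c: "L2_fun Om (%z. dist c (p z))" using p by (auto simp: L2_map_def)
 have K: "\<bar>q x - q y\<bar> <= \<bar>K\<bar> * dist x y" for x y
  using q[of x y] mult_right_mono[OF abs_ge_self[of K], of "dist x y"] by simp
 have "\<bar>K\<bar>-lipschitz_on UNIV q" by (rule lipschitz_onI) (simp_all add: dist_real_def K)
 then have "continuous_on UNIV q" by (rule lipschitz_on_continuous_on)
 then have "(%z. q (p z)) \<in> borel_measurable (lebesgue_on Om)"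
  using p borel_measurable_continuous_onI measurable_compose unfolding L2_map_def by blast
 from Om this c show ?thesis
 proof (rule L2_fun_dominated)
  show "\<bar>q (p z)\<bar> <= \<bar>K\<bar> * \<bar>dist c (p z)\<bar> + \<bar>q c\<bar>" for z using K[of "p z" c] by (simp add: dist_commute)
 qed
qed

text \<open>\<open>d\<close> is an abstract distance between the values at two points, bounded along
  segments by an integral of \<open>H\<close>. It is instantiated by the distance of the values of
  one map and by the sum of such distances for two maps.\<close>

locale segment_bound =
 fixes Om :: "'a::euclidean_space set" and d :: "'a => 'a => real" and H :: "'a => real"
 assumes domain: "open Om" "bounded Om"
  and H: "L1 H" "!!z. 0 <= H z" "L1 (%z. (H z)^2)"
  and bound: "!!v. ae z. closed_segment z (z + v) <= Om --> d (z + v) z <= norm v * segment_integral H z v"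
begin

lemma compact_segments:
 assumes "compact K" "K <= Om"
 shows "\<exists>r>0. \<forall>z\<in>K. \<forall>v. norm v < r --> closed_segment z (z + v) <= Om"
proof -
 obtain r where r: "r > 0" "(\<Union>z\<in>K. ball z r) <= Om"
  using compact_subset_open_imp_ball_epsilon_subset[OF assms(1) domain(1) assms(2)] by blast
 have "closed_segment z (z + v) <= Om" if "z \<in> K" "norm v < r" for z v
 proof -
  have "closed_segment z (z + v) <= ball z r" using r that by (intro closed_segment_subset) (auto simp: dist_norm)
  then show ?thesis using r that by blast
 qed
 then show ?thesis using r(1) by blast
qed

lemma function_gradient:
 fixes F :: "'a => real"
 assumes F: "L2_fun Om F" and le: "!!z z'. \<bar>F z - F z'\<bar> <= K * d z z'" and K: "0 <= K"
 shows "\<exists>g G. weak_gradient Om g G \<and> (\<forall>z. norm (G z) <= DIM('a) * (K * H z)) \<and> (ae z. z \<in> Om --> F z = g z) \<and>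
  W12_gradient Om F G"
proof -
 have Oms: "Om \<in> sets borel" using domain by simp
 have Fm: "F \<in> borel_measurable (lebesgue_on Om)" using F by (simp add: L2_fun_def)
 obtain g where g: "g \<in> Borel" "!!z. z \<notin> Om ==> g z = 0" "ae z. z \<in> Om --> F z = g z"
  using borel_version[OF Oms Fm] by blast
 have g2: "L1 (%z. (norm (g z))^2)" using L2_fun_iff[OF Oms Fm g] F by simp
 have gi: "L1 g" by (rule integrable_square_bounded[OF domain g(1,2) g2])
 have "\<exists>G. weak_gradient Om g G \<and> (\<forall>z. norm (G z) <= DIM('a) * (K * H z))"
 proof (rule weak_gradient_exists[OF domain(1) gi])
  fix C assume C: "compact C" "C <= Om"
  obtain r where r: "r > 0" "!!z v. z \<in> C ==> norm v < r ==> closed_segment z (z + v) <= Om" using compact_segments[OF C] by blast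
  show "\<exists>r>0. \<forall>v. norm v < r --> (ae z. z \<in> C --> \<bar>g (z + v) - g z\<bar> <= norm v * segment_integral (%z. K * H z) z v)"
  proof (intro exI[of _ r] conjI allI impI r(1))
   fix v :: 'a assume v: "norm v < r"
   show "ae z. z \<in> C --> \<bar>g (z + v) - g z\<bar> <= norm v * segment_integral (%z. K * H z) z v"
    using g(3) AE_translate[OF g(3), of v] bound[of v]
   proof (eventually_elim, intro impI)
    fix z assume e: "z \<in> Om --> F z = g z" "z + v \<in> Om --> F (z + v) = g (z + v)"
     "closed_segment z (z + v) <= Om --> d (z + v) z <= norm v * segment_integral H z v" and z: "z \<in> C"
    have seg: "closed_segment z (z + v) <= Om" using r(2)[OF z v] .
    then have "z \<in> Om" "z + v \<in> Om" by auto
    then have "\<bar>g (z + v) - g z\<bar> <= K * d (z + v) z" using e le[of "z + v" z] by simp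
    also have "... <= K * (norm v * segment_integral H z v)" using e(3) seg K by (intro mult_left_mono) auto
    also have "... = norm v * segment_integral (%z. K * H z) z v" by (simp add: segment_integral_def mult.left_commute)
    finally show "\<bar>g (z + v) - g z\<bar> <= norm v * segment_integral (%z. K * H z) z v" .
   qed
  qed
 qed (use H K in auto)
 then obtain G where G: "weak_gradient Om g G" "!!z. norm (G z) <= DIM('a) * (K * H z)" by blast
 have "L1 (%z. (DIM('a) * K)^2 * (H z)^2)" using H(3) by simp
 then have G2: "L1 (%z. (norm (G z))^2)"
 proof (rule Bochner_Integration.integrable_bound)
  show "ae z. norm ((norm (G z))^2) <= norm ((DIM('a) * K)^2 * (H z)^2)"
   using power_mono[OF G(2) norm_ge_zero, of _ 2] by (intro AE_I2) (simp add: power_mult_distrib mult.assoc)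
  have "G \<in> Borel" using G(1) by (auto simp: weak_gradient_def)
  then show "(%z. (norm (G z))^2) \<in> borel_measurable lborel" by simp
 qed
 have "W12_gradient Om F G" by (rule W12_gradientI[OF domain(1) G(1) Fm g(3)]) (use g2 G2 in simp_all)
 then show ?thesis using G g(3) by blast
qed

end

lemma (in segment_bound) H_L2: "L2_fun Om (%z. C * H z)"
proof -
 have [measurable]: "H \<in> Borel" using H by simp
 have Oms: "Om \<in> sets borel" using domain by simp
 have "L1 (%z. ind Om z *R (C^2 * (H z)^2))" using Oms H(3) by (intro integrable_mult_indicator) auto
 then have "L1 (%z. (norm (ind Om z * (C * H z)))^2)" by (simp add: power_mult_distrib abs_mult indicator_power2)
 then show ?thesis
  by (subst L2_fun_iff[OF Oms borel_measurable_lebesgue_on, of _ "%z. ind Om z * (C * H z)"]) (use Oms in auto)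
qed

lemma W12_mapI:
 assumes sb: "segment_bound Om (%z z'. dist (p z) (p z')) H" and p: "L2_map Om p"
 shows "W12_map Om p"
proof -
 interpret segment_bound Om "%z z'. dist (p z) (p z')" H by fact
 have "\<exists>G. W12_gradient Om (%z. dist c (p z)) G \<and> (AE z in lebesgue_on Om. norm (G z) <= DIM('a) * H z)" for c
 proof -
  have l: "\<bar>dist c x - dist c y\<bar> <= 1 * dist x y" for x y :: 'b by (metis abs_dist_diff_le dist_commute mult_1)
  from function_gradient[OF L2_map_Lipschitz[OF domain p l] l] obtain G where
   "W12_gradient Om (%z. dist c (p z)) G" "\<forall>z. norm (G z) <= DIM('a) * (1 * H z)" by auto
  then show ?thesis by (intro exI[of _ G]) auto
 qed
 then show ?thesis unfolding W12_map_def using p H_L2[of "DIM('a)"] by blast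
qed

lemma L2_map_dense_sequence:
 assumes "Om \<in> sets borel" "L2_map Om p"
 shows "\<exists>y :: nat => 'x::metric_space. ae z. z \<in> Om --> p z \<in> closure (range y)"
proof -
 obtain D where D: "countable D" "AE z in lebesgue_on Om. p z \<in> closure D" using assms by (auto simp: L2_map_def)
 define y where "y = from_nat_into (insert undefined D)"
 have "range y = insert undefined D" unfolding y_def using D(1) by (intro range_from_nat_into) auto
 then have "closure D <= closure (range y)" by (intro closure_mono) auto
 then show ?thesis using D(2) AE_lebesgue_on_borel[OF assms(1)] by (intro exI[of _ y]) (auto elim!: eventually_mono)
qed

lemma sobolev_mapI:
 fixes H :: "'a::euclidean_space => real"
 assumes sb: "segment_bound Om (%z z'. dist (p z) (p z')) H" and p: "L2_map Om p"
 shows "\<exists>y g G. sobolev_map Om p y g G (%z. DIM('a) * H z)"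
proof -
 interpret segment_bound Om "%z z'. dist (p z) (p z')" H by fact
 have Oms: "Om \<in> sets borel" using domain by simp
 obtain y :: "nat => _" where y: "ae z. z \<in> Om --> p z \<in> closure (range y)" using L2_map_dense_sequence[OF Oms p] ..
 define P where "P = (%k g G. weak_gradient Om g G \<and> (\<forall>z. norm (G z) <= DIM('a) * (1 * H z)) \<and> (ae z. z \<in> Om --> dist (y k) (p z) = g z))"
 have "\<exists>g G. P k g G" for k
 proof -
  have l: "\<bar>dist c x - dist c z\<bar> <= 1 * dist x z" for c x z :: 'b by (metis abs_dist_diff_le dist_commute mult_1)
  from function_gradient[OF L2_map_Lipschitz[OF domain p l, of "y k"] l zero_le_one] show ?thesis unfolding P_def by blast
 qed
 then obtain g G where P: "!!k. P k (g k) (G k)" by metis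
 have gG: "weak_gradient Om (g k) (G k)" "norm (G k z) <= DIM('a) * (1 * H z)" "ae z. z \<in> Om --> dist (y k) (p z) = g k z" for k z
  using P[of k] by (auto simp: P_def)
 have "ae z. \<forall>k. z \<in> Om --> dist (y k) (p z) = g k z" unfolding AE_all_countable using gG(3) by blast
 with y have "ae z. z \<in> Om --> p z \<in> closure (range y) \<and> (\<forall>k. dist (y k) (p z) = g k z)" by eventually_elim auto
 then have "sobolev_map Om p y g G (%z. DIM('a) * H z)"
  using gG(1,2) H domain(1) by unfold_locales (auto simp: power_mult_distrib)
 then show ?thesis by blast
qed

lemma W12_map_sobolev_map:
 fixes u :: "'a::euclidean_space => 'x::metric_space"
 assumes Om: "open Om" "bounded Om" and u: "W12_map Om u"
 shows "\<exists>x g G h. sobolev_map Om u x g G h"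
proof -
 have Oms: "Om \<in> sets borel" using Om by simp
 have L2: "L2_map Om u" using u by (simp add: W12_map_def)
 obtain x :: "nat => _" where x: "ae z. z \<in> Om --> u z \<in> closure (range x)" using L2_map_dense_sequence[OF Oms L2] ..
 obtain h0 :: "'a => real" where h0: "L2_fun Om h0" "!!x. \<exists>G. W12_gradient Om (%z. dist x (u z)) G \<and> (AE z in lebesgue_on Om. norm (G z) <= h0 z)"
  using u unfolding W12_map_def by blast
 have h0m: "h0 \<in> borel_measurable (lebesgue_on Om)" using h0 by (simp add: L2_fun_def)
 obtain h where h: "h \<in> Borel" "!!z. z \<notin> Om ==> h z = 0" "ae z. z \<in> Om --> h0 z = h z"
  using borel_version[OF Oms h0m] by blast
 have h2: "L1 (%z. (norm (h z))^2)" using L2_fun_iff[OF Oms h0m h] h0 by simp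
 have hi: "L1 h" by (rule integrable_square_bounded[OF Om h(1,2) h2])
 define P where "P = (%k g G. weak_gradient Om g G \<and> (\<forall>z. norm (G z) <= \<bar>h z\<bar>) \<and> (ae z. z \<in> Om --> dist (x k) (u z) = g z))"
 have "\<exists>g G. P k g G" for k
 proof -
  define F where "F = (%z. dist (x k) (u z))"
  obtain G0 where G0: "W12_gradient Om F G0" "AE z in lebesgue_on Om. norm (G0 z) <= h0 z" using h0(2) unfolding F_def by blast
  then have F: "L2_fun Om F" and G0L: "L2_fun Om G0" by (auto simp: W12_gradient_def)
  then have Fm: "F \<in> borel_measurable (lebesgue_on Om)" and G0m: "G0 \<in> borel_measurable (lebesgue_on Om)" by (auto simp: L2_fun_def)
  obtain g where g: "g \<in> Borel" "!!z. z \<notin> Om ==> g z = 0" "ae z. z \<in> Om --> F z = g z"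
   using borel_version[OF Oms Fm] by blast
  obtain G1 where G1: "G1 \<in> Borel" "!!z. z \<notin> Om ==> G1 z = 0" "ae z. z \<in> Om --> G0 z = G1 z"
   using borel_version[OF Oms G0m] by blast
  have g2: "L1 (%z. (norm (g z))^2)" using L2_fun_iff[OF Oms Fm g] F by simp
  have gi: "L1 g" by (rule integrable_square_bounded[OF Om g(1,2) g2])
  \<comment> \<open>Set to 0 where the bound fails, which inside the domain happens on a null set
    only, so that the bound holds at every point as \<open>sobolev_map\<close> demands.\<close>
  define G where "G = (%z. if norm (G1 z) <= \<bar>h z\<bar> then G1 z else 0)"
  have Gm[measurable]: "G \<in> Borel" unfolding G_def using G1(1) h(1) by measurable
  have Gh: "norm (G z) <= \<bar>h z\<bar>" for z by (simp add: G_def)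
  have Gi: "L1 G" by (rule Bochner_Integration.integrable_bound[OF hi]) (use Gh in auto)
  have "ae z. z \<in> Om --> norm (G0 z) <= h0 z" using G0(2) by (simp add: AE_lebesgue_on_borel[OF Oms])
  with G1(3) h(3) have GG: "ae z. z \<in> Om --> G0 z = G z"
  proof eventually_elim
   case (elim z)
   then show ?case by (cases "z \<in> Om") (auto simp: G_def)
  qed
  have "weak_gradient Om g G" unfolding weak_gradient_def
  proof (intro conjI gi Gi allI impI)
   fix ph v assume t: "test_function Om ph"
   note t' = test_function_dir_deriv[OF t, of v]
   have [measurable]: "ph \<in> Borel" "dir_deriv ph v \<in> Borel"
    using smooth_borel_measurable test_function_smooth t t' by blast+
   have "(LI z. g z * dir_deriv ph v z) = (LINT z|lebesgue_on Om. F z * dir_deriv ph v z)"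
    using Fm g(1,3) test_function_outside[OF t']
    by (intro lebesgue_on_eq_lborel(2)[OF Oms, symmetric] borel_measurable_times[OF Fm borel_measurable_lebesgue_on]) (auto elim: eventually_mono)
   also have "... = - (LINT z|lebesgue_on Om. (G0 z \<bullet> v) * ph z)" using G0(1) t by (simp add: W12_gradient_def)
   also have "(LINT z|lebesgue_on Om. (G0 z \<bullet> v) * ph z) = (LI z. (G z \<bullet> v) * ph z)"
    using G0m GG test_function_outside[OF t]
    by (intro lebesgue_on_eq_lborel(2)[OF Oms] borel_measurable_times[OF borel_measurable_inner[OF G0m borel_measurable_const] borel_measurable_lebesgue_on])
     (auto elim: eventually_mono)
   finally show "(LI z. g z * dir_deriv ph v z) = - (LI z. (G z \<bullet> v) * ph z)" .
  qed
  then show ?thesis using Gh g(3) unfolding F_def P_def by blast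
 qed
 then obtain g G where P: "!!k. P k (g k) (G k)" by metis
 have gG: "weak_gradient Om (g k) (G k)" "norm (G k z) <= \<bar>h z\<bar>" "ae z. z \<in> Om --> dist (x k) (u z) = g k z" for k z
  using P[of k] by (auto simp: P_def)
 have "ae z. \<forall>k. z \<in> Om --> dist (x k) (u z) = g k z" unfolding AE_all_countable using gG(3) by blast
 with x have "ae z. z \<in> Om --> u z \<in> closure (range x) \<and> (\<forall>k. dist (x k) (u z) = g k z)" by eventually_elim auto
 then have "sobolev_map Om u x g G (%z. \<bar>h z\<bar>)"
  using gG(1,2) hi h2 Om(1) by unfold_locales auto
 then show ?thesis by blast
qed

text \<open>The weak gradients of all distance functions are bounded by the same \<open>h\<close>,
  so their increments share one bound and \<open>dist_le_by_dense_family\<close> applies.\<close>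

lemma (in sobolev_map) dist_le_segment_integral:
 "ae z. closed_segment z (z + v) <= Om --> dist (u (z + v)) (u z) <= norm v * segment_integral h z v"
proof -
 have "ae z. \<forall>k. (closed_segment z (z + v) <= Om --> g k (z + v) - g k z = segment_integral (%z. G k z \<bullet> v) z v) \<and>
   L1 (%t. ind {0..1} t * (G k (z + t *R v) \<bullet> v))"
  unfolding AE_all_countable
 proof
  fix k
  have "L1 (%z. G k z \<bullet> v)" using wgrad[of k] by (simp add: weak_gradient_def)
  from weak_gradient_segment_identity[OF wgrad[of k] open_domain, of v] segment_integral_integrable(2)[OF this, of v]
  show "ae z. (closed_segment z (z + v) <= Om --> g k (z + v) - g k z = segment_integral (%z. G k z \<bullet> v) z v) \<and>
   L1 (%t. ind {0..1} t * (G k (z + t *R v) \<bullet> v))" by eventually_elim blast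
 qed
 with values_ae AE_translate[OF values_ae, of v] segment_integral_integrable(2)[OF h_int, of v] show ?thesis
 proof (eventually_elim, intro impI)
  fix z assume 1: "z \<in> Om --> u z \<in> closure (range x) \<and> (\<forall>k. dist (x k) (u z) = g k z)"
   "z + v \<in> Om --> u (z + v) \<in> closure (range x) \<and> (\<forall>k. dist (x k) (u (z + v)) = g k (z + v))"
   and hi: "L1 (%t. ind {0..1} t * h (z + t *R v))"
   and id: "\<forall>k. (closed_segment z (z + v) <= Om --> g k (z + v) - g k z = segment_integral (%z. G k z \<bullet> v) z v) \<and>
   L1 (%t. ind {0..1} t * (G k (z + t *R v) \<bullet> v))"
   and seg: "closed_segment z (z + v) <= Om"
  have inOm: "z \<in> Om" "z + v \<in> Om" using seg by auto
  have "\<bar>dist (x k) (u (z + v)) - dist (x k) (u z)\<bar> <= norm v * segment_integral h z v" for k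
  proof -
   have "\<bar>dist (x k) (u (z + v)) - dist (x k) (u z)\<bar> = \<bar>segment_integral (%z. G k z \<bullet> v) z v\<bar>"
    using 1 inOm id seg by simp
   also have "... <= (LI t. norm v * (ind {0..1} t * h (z + t *R v)))"
    unfolding segment_integral_def
   proof (rule order_trans[OF integral_abs_bound integral_mono])
    fix t :: real
    have "\<bar>G k (z + t *R v) \<bullet> v\<bar> <= norm (G k (z + t *R v)) * norm v" by (rule Cauchy_Schwarz_ineq2)
    also have "... <= h (z + t *R v) * norm v" by (rule mult_right_mono[OF G_le]) simp
    finally show "\<bar>ind {0..1} t * (G k (z + t *R v) \<bullet> v)\<bar> <= norm v * (ind {0..1} t * h (z + t *R v))"
     by (simp add: abs_mult indicator_def mult.commute)
   qed (use id hi in auto)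
   finally show ?thesis by (simp add: segment_integral_def)
  qed
  then show "dist (u (z + v)) (u z) <= norm v * segment_integral h z v"
   using dist_le_by_dense_family[of "u z" x "u (z + v)"] 1 inOm by blast
 qed
qed

text \<open>Extended by 0 from the compact set \<open>K\<close>, the function has a weak gradient on
  the whole space. Its mollifications by narrow kernels have compact support in \<open>Om\<close>,
  and they converge with their gradients in L2.\<close>

lemma (in segment_bound) W12_zeroI:
 fixes F :: "'a => real"
 assumes F: "L2_fun Om F" and le: "!!z z'. \<bar>F z - F z'\<bar> <= d z z'"
  and K: "compact K" "K <= Om" and out: "!!z. z \<notin> K ==> F z = 0"
 shows "W12_zero Om F"
proof -
 have Oms: "Om \<in> sets borel" using domain by simp
 have Fm: "F \<in> borel_measurable (lebesgue_on Om)" using F by (simp add: L2_fun_def)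
 obtain g0 where g0: "g0 \<in> Borel" "!!z. z \<notin> Om ==> g0 z = 0" "ae z. z \<in> Om --> F z = g0 z"
  using borel_version[OF Oms Fm] by blast
 define g where "g = (%z. ind K z * g0 z)"
 have Ks: "K \<in> sets borel" using K by (simp add: compact_imp_closed)
 have g: "g \<in> Borel" "!!z. z \<notin> Om ==> g z = 0" using g0(1,2) Ks K by (auto simp: g_def indicator_def)
 have gF: "ae z. F z = g z" using g0(3)
 proof eventually_elim
  case (elim z)
  then show ?case using out[of z] K(2) by (auto simp: g_def indicator_def)
 qed
 then have gF': "ae z. z \<in> Om --> F z = g z" by (rule eventually_mono) simp
 have g2: "L1 (%z. (norm (g z))^2)" using L2_fun_iff[OF Oms Fm g gF'] F by simp
 have gi: "L1 g" by (rule integrable_square_bounded[OF domain g g2])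
 obtain r where r: "r > 0" "!!z v. z \<in> K ==> norm v < r ==> closed_segment z (z + v) <= Om" using compact_segments[OF K] by blast
 have "\<exists>G. weak_gradient UNIV g G \<and> (\<forall>z. norm (G z) <= DIM('a) * H z)"
 proof (rule weak_gradient_exists[OF open_UNIV gi H(1,2)])
  fix C :: "'a set"
  show "\<exists>r>0. \<forall>v. norm v < r --> (ae z. z \<in> C --> \<bar>g (z + v) - g z\<bar> <= norm v * segment_integral H z v)"
  proof (intro exI[of _ r] conjI allI impI r(1))
   fix v :: 'a assume v: "norm v < r"
   show "ae z. z \<in> C --> \<bar>g (z + v) - g z\<bar> <= norm v * segment_integral H z v"
    using gF AE_translate[OF gF, of v] bound[of v]
   proof (eventually_elim, intro impI)
    fix z assume e: "F z = g z" "F (z + v) = g (z + v)"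
     "closed_segment z (z + v) <= Om --> d (z + v) z <= norm v * segment_integral H z v"
    \<comment> \<open>If one endpoint lies in \<open>K\<close>, a short segment stays in
      \<open>Om\<close>; otherwise both values are 0. So the bound holds for \<open>z\<close> inside
      the domain or not.\<close>
    show "\<bar>g (z + v) - g z\<bar> <= norm v * segment_integral H z v"
    proof (cases "z \<in> K \<or> z + v \<in> K")
     case True
     have "closed_segment z (z + v) <= Om"
      using True r(2)[of z v] r(2)[of "z + v" "- v"] v by (auto simp: closed_segment_commute)
     then show ?thesis using e le[of "z + v" z] by simp
    next
     case False
     have "0 <= segment_integral H z v" unfolding segment_integral_def using H(2) by (intro integral_nonneg_AE AE_I2) auto
     then show ?thesis using False by (simp add: g_def)
    qed
   qed
  qed
 qed
 then obtain G where G: "weak_gradient UNIV g G" "!!z. norm (G z) <= DIM('a) * H z" by blast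
 have Gi: "L1 G" using G(1) by (simp add: weak_gradient_def)
 then have [measurable]: "G \<in> Borel" by simp
 have H2: "L1 (%z. (DIM('a))^2 * (H z)^2)" using H(3) by simp
 have G2le: "(norm (G z))^2 <= (DIM('a))^2 * (H z)^2" for z
  using power_mono[OF G(2)[of z] norm_ge_zero, of 2] by (simp add: power_mult_distrib)
 have G2: "L1 (%z. (norm (G z))^2)"
  by (rule Bochner_Integration.integrable_bound[OF H2]) (use G2le in auto)
 have wgr: "weak_gradient Om g G" using G(1) test_function_mono[of Om _ UNIV] by (auto simp: weak_gradient_def)
 have W: "W12_gradient Om F G" by (rule W12_gradientI[OF domain(1) wgr Fm gF']) (use g2 G2 in simp_all)
 define I where "I = insert None (Some ` (Basis :: 'a set))"
 define f where "f = (%i. case i of None => g | Some b => (%z. G z \<bullet> b))"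
 have "\<exists>ph :: nat => 'a => real. (\<forall>j. test_function (ball 0 ((1/2)^j)) (ph j)) \<and>
  (\<forall>i\<in>I. (\<forall>j. L1 (%z. (mollify (ph j) (f i) z - f i z)^2)) \<and>
   (%j. LI z. (mollify (ph j) (f i) z - f i z)^2) \<longlonglongrightarrow> 0)"
 proof (rule mollifier_sequence_L2)
  show "finite I" by (simp add: I_def)
  fix i assume "i \<in> I"
  then show "L1 (f i)" using gi Gi by (auto simp: I_def f_def)
  have "L1 (%z. (G z \<bullet> b)^2)" if "b \<in> Basis" for b
  proof (rule Bochner_Integration.integrable_bound[OF G2])
   show "ae z. norm ((G z \<bullet> b)^2) <= norm ((norm (G z))^2)"
    using Basis_le_norm[OF that] by (intro AE_I2) (simp add: abs_le_square_iff[symmetric])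
  qed measurable
  then show "L1 (%z. (f i z)^2)" using \<open>i \<in> I\<close> g2 by (auto simp: I_def f_def)
 qed
 then obtain ph :: "nat => 'a => real" where ph: "!!j. test_function (ball 0 ((1/2)^j)) (ph j)"
  and lim: "!!i. i \<in> I ==> (%j. LI z. (mollify (ph j) (f i) z - f i z)^2) \<longlonglongrightarrow> 0"
  and mint: "!!i j. i \<in> I ==> L1 (%z. (mollify (ph j) (f i) z - f i z)^2)" by blast
 obtain r' where r': "r' > 0" "(\<Union>z\<in>K. cball z r') <= Om"
  using compact_subset_open_imp_cball_epsilon_subset[OF K(1) domain(1) K(2)] by blast
 obtain J where J: "(1/2)^J < r'" using real_arch_pow_inv[of r' "1/2"] r'(1) by auto
 define m where "m = (%j. mollify (ph (j + J)) g)"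
 have t: "test_function Om (m j)" for j
 proof (rule test_functionI)
  show "smooth (m j)" unfolding m_def by (rule mollify_smooth(1)[OF ph gi])
  have c: "{x + y |x y. x \<in> K \<and> y \<in> cball 0 r'} = (\<Union>z\<in>K. cball z r')"
  proof (intro set_eqI iffI)
   fix z assume "z \<in> (\<Union>z\<in>K. cball z r')"
   then obtain w where "w \<in> K" "dist w z <= r'" by auto
   then show "z \<in> {x + y |x y. x \<in> K \<and> y \<in> cball 0 r'}"
    by (intro CollectI exI[of _ w] exI[of _ "z - w"]) (auto simp: dist_norm norm_minus_commute)
  qed (auto simp: dist_norm intro: rev_bexI)
  show "compact (\<Union>z\<in>K. cball z r')" using compact_sums[OF K(1) compact_cball[of 0 r']] c by simp
  fix z assume z: "z \<notin> (\<Union>z\<in>K. cball z r')"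
  have "g y * ph (j + J) (y - z) = 0" for y
  proof (cases "y \<in> K")
   case True
   have "(1/2::real)^(j + J) <= (1/2)^J" by (intro power_decreasing) auto
   moreover have "r' < dist y z" using z True by force
   ultimately have "y - z \<notin> ball 0 ((1/2)^(j + J))" unfolding mem_ball dist_0_norm using J by (simp only: dist_norm not_less)
   from test_function_outside[OF ph this] show ?thesis by simp
  qed (simp add: g_def)
  then have "(%y. g y * ph (j + J) (y - z)) = (%y. 0)" by (rule ext)
  then show "m j z = 0" by (simp add: m_def mollify_def)
 qed (use r' in auto)
 have gb: "gradient (m j) z \<bullet> b = mollify (ph (j + J)) (%y. G y \<bullet> b) z" for j z b
  using mollify_weak_gradient[OF ph[of "j + J"] G(1), of z b] by (simp add: m_def dir_deriv_gradient[OF mollify_smooth(1)[OF ph gi]])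
 have "(%j. LINT z|lebesgue_on Om. (m j z - F z)^2) \<longlonglongrightarrow> 0"
 proof -
  have "(LINT z|lebesgue_on Om. (m j z - F z)^2) = (LI z. (m j z - g z)^2)" for j
  proof (rule lebesgue_on_eq_lborel(2)[OF Oms])
   have mm: "m j \<in> Borel" by (rule smooth_borel_measurable[OF test_function_smooth[OF t]])
   show "(%z. (m j z - F z)^2) \<in> borel_measurable (lebesgue_on Om)"
    using borel_measurable_lebesgue_on[OF mm] Fm by measurable
   show "(%z. (m j z - g z)^2) \<in> Borel" using mm g(1) by measurable
   show "(m j z - g z)^2 = 0" if "z \<notin> Om" for z using test_function_outside[OF t that] g(2)[OF that] by simp
  qed (use gF in \<open>auto elim: eventually_mono\<close>)
  moreover have "(%j. LI z. (m j z - g z)^2) \<longlonglongrightarrow> 0"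
   using LIMSEQ_ignore_initial_segment[OF lim[of None], of J] by (simp add: I_def f_def m_def)
  ultimately show ?thesis by simp
 qed
 moreover have "(%j. LINT z|lebesgue_on Om. (norm (gradient (m j) z - G z))^2) \<longlonglongrightarrow> 0"
 proof (rule tendsto_sandwich[OF _ _ tendsto_const])
  define S where "S = (%j. \<Sum>b\<in>(Basis::'a set). LI z. (mollify (ph (j + J)) (%y. G y \<bullet> b) z - G z \<bullet> b)^2)"
  have "S \<longlonglongrightarrow> (\<Sum>b\<in>(Basis::'a set). 0)" unfolding S_def
   by (intro tendsto_sum) (use LIMSEQ_ignore_initial_segment[OF lim[of "Some _"], where k=J] in \<open>simp add: I_def f_def\<close>)
  then show "S \<longlonglongrightarrow> 0" by simp
  show "\<forall>\<^sub>F j in sequentially. 0 <= (LINT z|lebesgue_on Om. (norm (gradient (m j) z - G z))^2)" by simp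
  show "\<forall>\<^sub>F j in sequentially. (LINT z|lebesgue_on Om. (norm (gradient (m j) z - G z))^2) <= S j"
  proof (rule always_eventually, rule allI)
   fix j
   have n: "(norm (gradient (m j) z - G z))^2 = (\<Sum>b\<in>Basis. (mollify (ph (j + J)) (%y. G y \<bullet> b) z - G z \<bullet> b)^2)" for z
    by (subst power2_norm_eq_inner, subst euclidean_inner) (simp add: inner_diff_left gb power2_eq_square)
   have bi: "L1 (%z. (mollify (ph (j + J)) (%y. G y \<bullet> b) z - G z \<bullet> b)^2)" if "b \<in> Basis" for b
    using mint[of "Some b" "j + J"] that by (simp add: I_def f_def)
   define Q where "Q = (%z. \<Sum>b\<in>Basis. (mollify (ph (j + J)) (%y. G y \<bullet> b) z - G z \<bullet> b)^2)"
   have Qi: "L1 Q" unfolding Q_def by (intro Bochner_Integration.integrable_sum bi)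
   then have Qm: "Q \<in> Borel" by simp
   have "(LINT z|lebesgue_on Om. Q z) = (LI z. ind Om z * Q z)"
    using Qm Oms by (intro lebesgue_on_eq_lborel(2)[OF Oms] borel_measurable_lebesgue_on) auto
   also have "... <= (LI z. Q z)"
    using Qi integrable_mult_indicator[OF _ Qi, of Om] Oms by (intro integral_mono) (auto simp: indicator_def Q_def sum_nonneg)
   also have "... = S j" unfolding Q_def S_def using bi by (intro Bochner_Integration.integral_sum) auto
   finally show "(LINT z|lebesgue_on Om. (norm (gradient (m j) z - G z))^2) <= S j" unfolding n Q_def .
  qed
 qed
 ultimately show ?thesis unfolding W12_zero_def using W t by blast
qed

section \<open>The variation by resolvents\<close>

lemma weak_gradient_direction_limit:
 fixes g gt :: "'a::euclidean_space => real"
 assumes wg: "weak_gradient Om g G" and Om: "open Om" and eq: "ae z. z \<in> Om --> gt z = g z"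
 shows "ae p. segment_in Om p --> continuous_on {0..1} (%t. gt (pt p t)) -->
   ((%t. (gt (pt p t) - gt (fst p)) / t) \<longlongrightarrow> G (fst p) \<bullet> snd p) (at_right 0)"
proof -
 have Gi: "L1 G" using wg by (simp add: weak_gradient_def)
 then have [measurable]: "G \<in> Borel" by simp
 have m: "(%p::'a\<times>'a. G (fst p) \<bullet> snd p) \<in> Borel" unfolding borel_prod[symmetric] by measurable
 have "L1 (%z. G (fst (z, v)) \<bullet> snd (z, v))" for v :: 'a using Gi by simp
 from Lebesgue_differentiation_lines[OF m this] weak_gradient_primitive(1)[OF wg Om eq]
 show ?thesis
 proof eventually_elim
  case (elim p)
  show ?case
  proof (intro impI)
  assume seg: "segment_in Om p" "continuous_on {0..1} (%t. gt (pt p t))"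
  define f where "f = (%t. G (pt p t) \<bullet> snd p)"
  have i: "L1 (%t. ind {0..1} t * f t)"
   and prim: "!!t. t \<in> {0..1} ==> gt (pt p t) - gt (fst p) = integral {0..t} f"
   using elim(2) seg by (auto simp: f_def)
  have "((%h. (LI t. ind {0..h} t * f t) / h) \<longlongrightarrow> G (fst p) \<bullet> snd p) (at_right 0)"
   using elim(1) by (simp add: f_def)
  then show "((%t. (gt (pt p t) - gt (fst p)) / t) \<longlongrightarrow> G (fst p) \<bullet> snd p) (at_right 0)"
  proof (rule Lim_transform_eventually)
   have "(LI s. ind {0..t} s * f s) / t = (gt (pt p t) - gt (fst p)) / t" if "0 < t" "t < 1" for t
    using prim[of t] integral_upto_eq_HK(2)[OF i, of 0 t] that by simp
   then show "\<forall>\<^sub>F t in at_right 0. (LI s. ind {0..t} s * f s) / t = (gt (pt p t) - gt (fst p)) / t"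
    unfolding eventually_at_right_field by (intro exI[of _ 1]) auto
  qed
  qed
 qed
qed

lemma (in sobolev_map) energy_density_integrable:
 assumes "complete (UNIV :: 'x set)"
 shows "energy_density Om u \<in> borel_measurable (lebesgue_on Om)" "integrable (lebesgue_on Om) (energy_density Om u)"
  "energy Om u = (LI z. ind Om z * edens z)"
  "ae z. z \<in> Om --> energy_density Om u z = edens z"
proof -
 have Oms: "Om \<in> sets borel" using open_domain by simp
 show ae: "ae z. z \<in> Om --> energy_density Om u z = edens z"
  by (rule energy_density_eq[OF segment_ac_representative_exists[OF assms]])
 have e[measurable]: "edens \<in> Borel" using edens_int by simp
 have "(%z. ind Om z * energy_density Om u z) \<in> borel_measurable lebesgue"
 proof (rule completion.measurable_AE_eq)
  show "(%z. ind Om z * edens z) \<in> borel_measurable lebesgue" using Oms by (intro measurable_completion) simp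
  show "AE z in lebesgue. ind Om z * energy_density Om u z = ind Om z * edens z"
   unfolding AE_completion_iff using ae by eventually_elim (auto simp: indicator_def)
 qed
 then show m: "energy_density Om u \<in> borel_measurable (lebesgue_on Om)"
  using Oms by (subst borel_measurable_restrict_space_iff) auto
 have "L1 (%z. ind Om z * edens z)" using integrable_mult_indicator[OF _ edens_int, of Om] Oms by simp
 moreover note lebesgue_on_eq_lborel[OF Oms m, of "%z. ind Om z * edens z"]
 ultimately show "integrable (lebesgue_on Om) (energy_density Om u)" "energy Om u = (LI z. ind Om z * edens z)"
  unfolding energy_def using ae Oms by (auto elim: eventually_mono)
qed

locale harmonic_variation = sobolev_map Om u x g G h + resolvent_setup k \<rho> L lam f
 for Om :: "'a::euclidean_space set" and u :: "'a => 'x::metric_space" and x g G h and k \<rho> L lam :: real and f :: "'x => real" +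
 fixes \<eta> :: "'a => real"
 assumes bdd: "bounded Om" and L2u: "L2_map Om u" and \<eta>: "test_function Om \<eta>" and \<eta>01: "!!z. 0 <= \<eta> z" "!!z. \<eta> z <= 1"
  and harm: "harmonic_map Om u"
begin

text \<open>The last two bounds keep the coefficient
  \<open>1 - error_const * e^2 + lam * (a + b)\<close> of the pair inequality at least
  \<open>1/2\<close>.\<close>

definition small :: "real => bool" where
 "small e \<longleftrightarrow> 0 < e \<and> e <= step_max \<and> error_const * e^2 <= 1 / 4 \<and> 8 * (\<bar>lam\<bar> * e) <= 1"

lemma small_eventually: "\<exists>e0>0. \<forall>e. 0 < e \<and> e <= e0 --> small e"
proof (intro exI conjI allI impI)
 define e0 where "e0 = min step_max (min (1 / (4 * (error_const + 1))) (1 / (8 * (\<bar>lam\<bar> + 1))))"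
 show "0 < e0" using step_max(1) error_const_nonneg by (simp add: e0_def add_nonneg_pos)
 fix e assume e: "0 < e \<and> e <= e0"
 then have le: "e <= step_max" "e <= 1 / (4 * (error_const + 1))" "e <= 1 / (8 * (\<bar>lam\<bar> + 1))" by (auto simp: e0_def)
 have "e * (4 * (error_const + 1)) <= 1" using le(2) error_const_nonneg by (subst (asm) pos_le_divide_eq) auto
 moreover have "error_const * e^2 <= error_const * e" using e le(1) step_max(2) error_const_nonneg
  by (intro mult_left_mono) (auto simp: power2_eq_square mult_left_le)
 moreover have "e * (8 * (\<bar>lam\<bar> + 1)) <= 1" using le(3) by (subst (asm) pos_le_divide_eq) auto
 ultimately show "small e" using e le(1) by (simp add: small_def algebra_simps)
qed

text \<open>The parameter is clamped to \<open>[0,1]\<close> so that \<open>F e\<close> is Lipschitz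
  in both variables on the whole product; measurability of the perturbed map follows from this
  continuity.\<close>

definition F :: "real => real => 'x => 'x" where "F e a y = resolvent (e * max 0 (min 1 a)) y"

definition pert :: "real => 'a => 'x" where "pert e z = F e (\<eta> z) (u z)"

lemma F_Lipschitz: "small e ==> dist (F e a y) (F e b z) <= (1 + 8 * L) * (dist y z + \<bar>a - b\<bar>)"
proof -
 assume e: "small e"
 define a' b' where "a' = max 0 (min 1 a)" and "b' = max 0 (min 1 b)"
 have ab: "0 <= a'" "a' <= 1" "0 <= b'" "b' <= 1" "\<bar>a' - b'\<bar> <= \<bar>a - b\<bar>" by (auto simp: a'_def b'_def)
 have e1: "0 < e" "e <= 1" using e step_max(2) by (auto simp: small_def)
 have "dist (F e a y) (F e b z) <= (1 + 8 * L) * (dist y z + \<bar>e * a' - e * b'\<bar>)"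
  unfolding F_def a'_def[symmetric] b'_def[symmetric] using e e1 ab
  by (intro resolvent_Lipschitz[of _ e]) (auto simp: small_def mult_left_le)
 also have "\<bar>e * a' - e * b'\<bar> = e * \<bar>a' - b'\<bar>" using e1 by (simp add: abs_mult flip: right_diff_distrib)
 also have "e * \<bar>a' - b'\<bar> <= 1 * \<bar>a - b\<bar>" using e1 ab by (intro mult_mono) auto
 finally show ?thesis using L1 by simp
qed

lemma F_continuous: "small e ==> continuous_on UNIV (%(a, y). F e a y)"
proof -
 assume e: "small e"
 have "((%q. F e (fst q) (snd q)) \<longlongrightarrow> F e (fst q0) (snd q0)) (at q0)" for q0 :: "real \<times> 'x"
 proof (rule tendsto_dist_iff[THEN iffD2], rule tendsto_sandwich[OF _ _ tendsto_const])
  show "\<forall>\<^sub>F q in at q0. dist (F e (fst q) (snd q)) (F e (fst q0) (snd q0)) <= (1 + 8 * L) * (dist (snd q) (snd q0) + \<bar>fst q - fst q0\<bar>)"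
   using F_Lipschitz[OF e] by simp
  have "((%q. (1 + 8 * L) * (dist (snd q) (snd q0) + \<bar>fst q - fst q0\<bar>)) \<longlongrightarrow> (1 + 8 * L) * (dist (snd q0) (snd q0) + \<bar>fst q0 - fst q0\<bar>)) (at q0)"
   by (intro tendsto_intros)
  then show "((%q. (1 + 8 * L) * (dist (snd q) (snd q0) + \<bar>fst q - fst q0\<bar>)) \<longlongrightarrow> 0) (at q0)" by simp
 qed simp
 then show ?thesis by (simp add: continuous_on_def case_prod_unfold tendsto_within_subset)
qed

lemma pert_eq: "pert e z = resolvent (e * \<eta> z) (u z)"
 using \<eta>01[of z] by (simp add: pert_def F_def)

lemma pert_dist: "small e ==> dist (u z) (pert e z) <= 4 * L * e"
proof -
 assume e: "small e"
 then have e1: "0 < e" "e <= step_max" by (auto simp: small_def)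
 then have b: "0 <= e * \<eta> z" "e * \<eta> z <= e" using \<eta>01[of z] by (auto simp: mult_left_le)
 have "dist (u z) (pert e z) <= 4 * L * (e * \<eta> z)" unfolding pert_eq by (rule resolvent_dist[OF b(1) order_trans[OF b(2) e1(2)]])
 also have "... <= 4 * L * e" by (rule mult_left_mono[OF b(2)]) (use L1 in simp)
 finally show ?thesis .
qed

lemma u_measurable: "u \<in> borel_measurable (lebesgue_on Om)" using L2u by (simp add: L2_map_def)

lemma eta_borel[measurable]: "\<eta> \<in> Borel"
 by (rule smooth_borel_measurable[OF test_function_smooth[OF \<eta>]])

lemma L2_map_pert: assumes e: "small e" shows "L2_map Om (pert e)"
proof -
 have m: "pert e \<in> borel_measurable (lebesgue_on Om)" unfolding pert_def[abs_def]
  by (rule borel_measurable_continuous_pair[OF F_continuous[OF e] borel_measurable_lebesgue_on[OF eta_borel] u_measurable])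
 obtain D where D: "countable D" "AE z in lebesgue_on Om. u z \<in> closure D" using L2u by (auto simp: L2_map_def)
 \<comment> \<open>Images of rational parameters and of a countable set of values: their closure
   contains almost all values of the perturbation.\<close>
 define D' where "D' = (%(a, y). F e a y) ` (\<rat> \<times> D)"
 have "(%(a, y). F e a y) ` closure (\<rat> \<times> D) <= closure D'"
  unfolding D'_def by (rule image_closure_subset) (auto intro: continuous_on_subset[OF F_continuous[OF e]] closure_subset[THEN subsetD])
 then have cl: "F e a y \<in> closure D'" if "y \<in> closure D" for a y using that by (force simp: closure_Times Rats_closure_real)
 have "countable D'" using D(1) by (simp add: D'_def countable_rat)
 moreover have "AE z in lebesgue_on Om. pert e z \<in> closure D'" using D(2) by eventually_elim (simp add: pert_def cl)
 moreover obtain c where c: "L2_fun Om (%z. dist c (u z))" using L2u by (auto simp: L2_map_def)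
 have "L2_fun Om (%z. dist c (pert e z))"
 proof (rule L2_fun_dominated[OF open_domain bdd _ c])
  show "(%z. dist c (pert e z)) \<in> borel_measurable (lebesgue_on Om)"
   by (rule measurable_compose[OF m]) (intro borel_measurable_continuous_onI continuous_intros)
  show "\<bar>dist c (pert e z)\<bar> <= 1 * \<bar>dist c (u z)\<bar> + 4 * L * e" for z
   using dist_triangle[of c "pert e z" "u z"] pert_dist[OF e, of z] by simp
 qed
 ultimately show ?thesis using m unfolding L2_map_def by blast
qed

definition B :: real where "B = (SOME B. 0 <= B \<and> (\<forall>z z'. \<bar>\<eta> z - \<eta> z'\<bar> <= B * norm (z - z')))"

lemma B: "0 <= B" "\<bar>\<eta> z - \<eta> z'\<bar> <= B * norm (z - z')"
proof -
 have "\<exists>B. 0 <= B \<and> (\<forall>z z'. \<bar>\<eta> z - \<eta> z'\<bar> <= B * norm (z - z'))" by (rule smooth_lipschitz[OF \<eta>]) blast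
 from someI_ex[OF this] show "0 <= B" "\<bar>\<eta> z - \<eta> z'\<bar> <= B * norm (z - z')" unfolding B_def by blast+
qed

text \<open>One bound for the difference quotients of \<open>pert e\<close>, independent of
  \<open>e\<close>; the remainders of the energy inequality are uniform because of it.\<close>

definition H :: "'a => real" where "H z = (1 + 8 * L) * (ind Om z * (h z + B))"

lemma Om_borel[measurable]: "Om \<in> sets borel" using open_domain by simp

lemma indicator_Om: "L1 (ind Om :: 'a => real)"
 using emeasure_bounded_finite[OF bdd] by (intro integrable_real_indicator) auto

lemma H: "L1 H" "0 <= H z" "L1 (%z. (H z)^2)"
proof -
 note i = integrable_mult_indicator[OF _ h_int, of Om] integrable_mult_indicator[OF _ h2_int, of Om]
 have "L1 (%z. (1 + 8 * L) * (ind Om z * h z + B * ind Om z))" using i(1) indicator_Om by simp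
 then show "L1 H" by (simp add: H_def[abs_def] algebra_simps)
 have "L1 (%z. (1 + 8 * L)^2 * (ind Om z * (h z)^2 + 2 * B * (ind Om z * h z) + B^2 * ind Om z))"
  using i indicator_Om by simp
 also have "(%z. (1 + 8 * L)^2 * (ind Om z * (h z)^2 + 2 * B * (ind Om z * h z) + B^2 * ind Om z)) = (%z. (H z)^2)"
  unfolding H_def power_mult_distrib indicator_power2 by (simp add: power2_sum algebra_simps)
 finally show "L1 (%z. (H z)^2)" .
 show "0 <= H z" using L1 B(1) h_nonneg[of z] by (simp add: H_def)
qed

lemma H_bound: "ae z. closed_segment z (z + v) <= Om -->
  (1 + 8 * L) * (dist (u (z + v)) (u z) + \<bar>\<eta> (z + v) - \<eta> z\<bar>) <= norm v * segment_integral H z v"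
 using dist_le_segment_integral[of v] segment_integral_integrable(2)[OF h_int, of v]
proof (eventually_elim, intro impI)
 fix z assume elim: "closed_segment z (z + v) <= Om --> dist (u (z + v)) (u z) <= norm v * segment_integral h z v"
  "L1 (%t. ind {0..1} t * h (z + t *R v))" "closed_segment z (z + v) <= Om"
 have "ind {0..1} t * H (z + t *R v) = (1 + 8 * L) * (ind {0..1} t * h (z + t *R v) + B * ind {0..1} t)" for t
  using subsetD[OF elim(3) line_in_segment[of t z v]] by (auto simp: H_def indicator_def)
 then have "segment_integral H z v = (1 + 8 * L) * (segment_integral h z v + B)"
  unfolding segment_integral_def using elim(2) by simp
 moreover have "\<bar>\<eta> (z + v) - \<eta> z\<bar> <= B * norm v" using B(2)[of "z + v" z] by simp
 moreover have "(1 + 8 * L) * (dist (u (z + v)) (u z) + \<bar>\<eta> (z + v) - \<eta> z\<bar>) <= (1 + 8 * L) * (norm v * segment_integral h z v + B * norm v)"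
  using calculation(2) elim L1 by (intro mult_left_mono add_mono) auto
 ultimately show "(1 + 8 * L) * (dist (u (z + v)) (u z) + \<bar>\<eta> (z + v) - \<eta> z\<bar>) <= norm v * segment_integral H z v"
  by (simp add: algebra_simps)
qed

lemma segment_bound_pert: assumes e: "small e" shows "segment_bound Om (%z z'. dist (pert e z) (pert e z')) H"
proof
 fix v
 show "ae z. closed_segment z (z + v) <= Om --> dist (pert e (z + v)) (pert e z) <= norm v * segment_integral H z v"
  using H_bound[of v]
 proof eventually_elim
  case (elim z)
  have "dist (pert e (z + v)) (pert e z) <= (1 + 8 * L) * (dist (u (z + v)) (u z) + \<bar>\<eta> (z + v) - \<eta> z\<bar>)"
   unfolding pert_def by (rule F_Lipschitz[OF e])
  then show ?case using elim order_trans by blast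
 qed
qed (use H open_domain bdd in auto)

text \<open>The distance between the two maps vanishes off the support of \<open>\<eta>\<close>, and
  its increments are at most the sum of the increments of both maps, which is the abstract distance
  used here.\<close>

lemma same_trace_pert: assumes e: "small e" shows "same_trace Om u (pert e)"
proof -
 have "segment_bound Om (%z z'. dist (u z) (u z') + dist (pert e z) (pert e z')) (%z. 2 * H z)"
 proof
  fix v
  show "ae z. closed_segment z (z + v) <= Om -->
   dist (u (z + v)) (u z) + dist (pert e (z + v)) (pert e z) <= norm v * segment_integral (%z. 2 * H z) z v"
   using H_bound[of v]
  proof eventually_elim
   case (elim z)
   define D where "D = dist (u (z + v)) (u z) + \<bar>\<eta> (z + v) - \<eta> z\<bar>"
   have "dist (pert e (z + v)) (pert e z) <= (1 + 8 * L) * D" unfolding pert_def D_def by (rule F_Lipschitz[OF e])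
   moreover have "1 * D <= (1 + 8 * L) * D" unfolding D_def using L1 by (intro mult_right_mono) auto
   moreover have "segment_integral (%z. 2 * H z) z v = 2 * segment_integral H z v"
    by (simp add: segment_integral_def mult.left_commute)
   ultimately show ?case using elim unfolding D_def by (intro impI) (drule mp, assumption, simp)
  qed
 qed (use H open_domain bdd in \<open>auto simp: power_mult_distrib\<close>)
 then interpret segment_bound Om "%z z'. dist (u z) (u z') + dist (pert e z) (pert e z')" "%z. 2 * H z" .
 obtain K where K: "compact K" "K <= Om" "!!z. z \<notin> K ==> \<eta> z = 0" using \<eta> unfolding test_function_iff by blast
 have "continuous_on UNIV (%(a, y). dist y (F e a y))"
  using F_continuous[OF e] by (simp add: case_prod_unfold continuous_on_dist continuous_on_snd)
 from borel_measurable_continuous_pair[OF this borel_measurable_lebesgue_on[OF eta_borel] u_measurable]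
 have m: "(%z. dist (u z) (pert e z)) \<in> borel_measurable (lebesgue_on Om)" by (simp add: pert_def)
 obtain c where c: "L2_fun Om (%z. dist c (u z))" using L2u by (auto simp: L2_map_def)
 have "L2_fun Om (%z. dist (u z) (pert e z))"
  by (rule L2_fun_dominated[OF domain m c, of 0 "4 * L * e"]) (simp add: pert_dist[OF e])
 then show ?thesis unfolding same_trace_def
 proof (rule W12_zeroI[OF _ _ K(1,2)])
  show "\<bar>dist (u z) (pert e z) - dist (u z') (pert e z')\<bar> <= dist (u z) (u z') + dist (pert e z) (pert e z')" for z z'
   using dist_triangle[of "u z" "pert e z" "u z'"] dist_triangle[of "u z'" "pert e z" "pert e z'"]
    dist_triangle[of "u z'" "pert e z'" "u z"] dist_triangle[of "u z" "pert e z'" "pert e z"] by (simp add: dist_commute)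
  show "dist (u z) (pert e z) = 0" if "z \<notin> K" for z using K(3)[OF that] by (simp add: pert_eq resolvent_zero)
 qed
qed

text \<open>\<open>resolvent_pair\<close> is applied to the values at \<open>z\<close> and
  \<open>z + t v\<close> with parameters \<open>e \<eta>(z)\<close> and
  \<open>e \<eta>(z + t v)\<close>. After division by \<open>t^2\<close> the mixed term tends to the
  product of the derivatives of \<open>\<eta>\<close> and of \<open>f\<close> along the perturbed
  map in the direction \<open>v\<close>; its spherical mean, normalised like the energy density, is
  \<open>gradient \<eta> z \<bullet> Hf z\<close>.\<close>

lemma pointwise_energy_inequality:
 assumes e: "small e" and sp: "sobolev_map Om (pert e) y g' G' h'" and wg: "weak_gradient Om gf Hf"
  and gf: "ae z. z \<in> Om --> f (pert e z) = gf z"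
 shows "ae z. z \<in> Om --> (1 - error_const * e^2 + 2 * (lam * e) * \<eta> z) * sobolev_map.edens G' z + 2 * e * (gradient \<eta> z \<bullet> Hf z) <= edens z"
proof -
 interpret P: sobolev_map Om "pert e" y g' G' h' by fact
 have e1: "0 < e" "e <= step_max" using e by (auto simp: small_def)
 define A where "A = (%z. 1 - error_const * e^2 + 2 * (lam * e) * \<eta> z)"
 define I where "I = (%p. A (fst p) * (P.speed (fst p) (snd p))^2 + 2 * e * ((gradient \<eta> (fst p) \<bullet> snd p) * (Hf (fst p) \<bullet> snd p)) <= (speed (fst p) (snd p))^2)"
 obtain w where w: "representative w" using segment_ac_representative_exists[OF complete_UNIV] representativeI by blast
 \<comment> \<open>The resolvent of a representative of \<open>u\<close> is a representative of the
   perturbed map, so both velocities are limits along the same segments.\<close>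
 define wp where "wp = (%z. F e (\<eta> z) (w z))"
 have wu: "ae z. z \<in> Om --> w z = u z"
  and wc: "ae p. segment_in Om p --> continuous_on {0..1} (%t. w (pt p t))"
  using w by (auto simp: representative_def)
 have \<eta>c: "continuous_on S (%t. \<eta> (z + t *R v))" for S z v
  by (rule continuous_on_compose2[OF smooth_continuous_on[OF test_function_smooth[OF \<eta>], of UNIV]]) (auto intro!: continuous_intros)
 have wpc: "continuous_on {0..1} (%t. wp (z + t *R v))" if "continuous_on {0..1} (%t. w (z + t *R v))" for z v
  unfolding wp_def using continuous_on_compose2[OF F_continuous[OF e] continuous_on_Pair[OF \<eta>c that]] by simp
 have wpu: "ae z. z \<in> Om --> wp z = pert e z" using wu by eventually_elim (simp add: wp_def pert_def)
 have "ae p. segment_in Om p --> continuous_on {0..1} (%t. wp (pt p t))"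
  using wc by eventually_elim (blast intro: wpc)
 with wpu have rp: "P.representative wp" unfolding P.representative_def by blast
 have fwp: "ae z. z \<in> Om --> f (wp z) = gf z" using wpu gf by eventually_elim auto
 have fc: "continuous_on UNIV f" using lip by (rule lipschitz_on_continuous_on)
 have "ae p. segment_in Om p --> I p"
  using wc speed_limit[OF w] P.speed_limit[OF rp] weak_gradient_direction_limit[OF wg open_domain fwp]
 proof (eventually_elim, intro impI)
  fix p :: "'a \<times> 'a"
  assume 0: "segment_in Om p --> continuous_on {0..1} (%t. w (pt p t))"
   and 1: "fst p \<in> Om --> ((%t. dist (w (pt p t)) (w (fst p)) / \<bar>t\<bar>) \<longlongrightarrow> speed (fst p) (snd p)) (at 0)"
   and 2: "fst p \<in> Om --> ((%t. dist (wp (pt p t)) (wp (fst p)) / \<bar>t\<bar>) \<longlongrightarrow> P.speed (fst p) (snd p)) (at 0)"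
   and 3: "segment_in Om p --> continuous_on {0..1} (%t. f (wp (pt p t))) -->
    ((%t. (f (wp (pt p t)) - f (wp (fst p))) / t) \<longlongrightarrow> Hf (fst p) \<bullet> snd p) (at_right 0)"
   and seg: "segment_in Om p"
  define z v where "z = fst p" and "v = snd p"
  note defs = z_def[symmetric] v_def[symmetric]
  have z: "z \<in> Om" using seg by (auto simp: z_def)
  note cw = 0[unfolded defs, rule_format, OF seg[unfolded defs]]
  have "continuous_on {0..1} (%t. f (wp (z + t *R v)))" by (rule continuous_on_compose2[OF fc wpc[OF cw]]) simp
  note l3 = 3[unfolded defs, rule_format, OF seg[unfolded defs] this]
  note l1 = tendsto_within_subset[OF 1[unfolded defs, rule_format, OF z], of "{0<..}", simplified]
  note l2 = tendsto_within_subset[OF 2[unfolded defs, rule_format, OF z], of "{0<..}", simplified]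
  have l\<eta>: "((%t. (\<eta> (z + t *R v) - \<eta> z) / t) \<longlongrightarrow> gradient \<eta> z \<bullet> v) (at_right 0)"
  proof -
   have "((%t. z + t *R v) has_derivative (%s. s *R v)) (at 0)" by (auto intro!: derivative_eq_intros)
   from has_derivative_compose[OF this, of \<eta> "%v. dir_deriv \<eta> v z"] smooth_has_derivative[OF test_function_smooth[OF \<eta>], of z]
   have "((%t. \<eta> (z + t *R v)) has_derivative (%s. dir_deriv \<eta> (s *R v) z)) (at 0)" by simp
   then have "((%t. \<eta> (z + t *R v)) has_real_derivative gradient \<eta> z \<bullet> v) (at 0)"
    by (simp add: has_field_derivative_def dir_deriv_gradient[OF test_function_smooth[OF \<eta>]] mult.commute[of _ "gradient \<eta> z \<bullet> v"])
   then show ?thesis unfolding DERIV_def by (simp add: filterlim_at_split)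
  qed
  have "continuous_on UNIV (%t. \<eta> (z + t *R v))" by (rule \<eta>c)
  then have "((%t. \<eta> (z + t *R v)) \<longlongrightarrow> \<eta> (z + 0 *R v)) (at 0)" unfolding continuous_on_def by blast
  then have l\<eta>0: "((%t. \<eta> (z + t *R v)) \<longlongrightarrow> \<eta> z) (at_right 0)" by (simp add: filterlim_at_split)
  define W where "W = (%t. (1 - error_const * e^2 + lam * (e * \<eta> z + e * \<eta> (z + t *R v))) * (dist (wp (z + t *R v)) (wp z) / \<bar>t\<bar>)^2
   + 2 * e * (((\<eta> (z + t *R v) - \<eta> z) / t) * ((f (wp (z + t *R v)) - f (wp z)) / t)))"
  have "(W \<longlongrightarrow> (1 - error_const * e^2 + lam * (e * \<eta> z + e * \<eta> z)) * (P.speed z v)^2 + 2 * e * ((gradient \<eta> z \<bullet> v) * (Hf z \<bullet> v))) (at_right 0)"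
   unfolding W_def by (intro tendsto_intros l2 l\<eta>0 l\<eta> l3)
  moreover have "((%t. (dist (w (z + t *R v)) (w z) / \<bar>t\<bar>)^2) \<longlongrightarrow> (speed z v)^2) (at_right 0)" by (intro tendsto_intros l1)
  moreover have "\<forall>\<^sub>F t in at_right 0. W t <= (dist (w (z + t *R v)) (w z) / \<bar>t\<bar>)^2"
  proof -
   \<comment> \<open>Finite speed makes the two values closer than \<open>e\<close> for small
     \<open>t\<close>, as \<open>resolvent_pair\<close> demands.\<close>
   have "((%t. dist (w (z + t *R v)) (w z) / \<bar>t\<bar> * \<bar>t\<bar>) \<longlongrightarrow> speed z v * \<bar>0\<bar>) (at_right 0)" by (intro tendsto_intros l1)
   then have "\<forall>\<^sub>F t in at_right 0. dist (w (z + t *R v)) (w z) / \<bar>t\<bar> * \<bar>t\<bar> < e" using e1 by (intro order_tendstoD) auto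
   moreover have "\<forall>\<^sub>F t in at_right 0. (0::real) < t" by (simp add: eventually_at_right_less)
   ultimately show ?thesis
   proof eventually_elim
    case (elim t)
    define y where "y = w (z + t *R v)"
    have yz: "dist (w z) y <= e" using elim by (simp add: y_def dist_commute)
    have b: "0 <= e * \<eta> z'" "e * \<eta> z' <= e" for z' using \<eta>01[of z'] e1 by (auto simp: mult_left_le)
    have wpe: "wp z' = resolvent (e * \<eta> z') (w z')" for z' using \<eta>01[of z'] by (simp add: wp_def F_def)
    have "(1 - error_const * e^2 + lam * (e * \<eta> z + e * \<eta> (z + t *R v))) * (dist (wp z) (wp (z + t *R v)))^2
     + 2 * (e * \<eta> (z + t *R v) - e * \<eta> z) * (f (wp (z + t *R v)) - f (wp z)) <= (dist (w z) y)^2"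
     unfolding wpe y_def[symmetric] by (rule resolvent_pair[OF e1(2) b b yz])
    then have "((1 - error_const * e^2 + lam * (e * \<eta> z + e * \<eta> (z + t *R v))) * (dist (wp (z + t *R v)) (wp z))^2
     + 2 * e * ((\<eta> (z + t *R v) - \<eta> z) * (f (wp (z + t *R v)) - f (wp z)))) / t^2 <= (dist y (w z))^2 / t^2"
     using elim by (intro divide_right_mono) (simp_all add: dist_commute algebra_simps)
    moreover have "W t = ((1 - error_const * e^2 + lam * (e * \<eta> z + e * \<eta> (z + t *R v))) * (dist (wp (z + t *R v)) (wp z))^2
     + 2 * e * ((\<eta> (z + t *R v) - \<eta> z) * (f (wp (z + t *R v)) - f (wp z)))) / t^2"
     using elim by (simp add: W_def power_divide power2_eq_square[of t] add_divide_distrib)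
    ultimately show ?case by (simp add: y_def power_divide)
   qed
  qed
  ultimately have "(1 - error_const * e^2 + lam * (e * \<eta> z + e * \<eta> z)) * (P.speed z v)^2 + 2 * e * ((gradient \<eta> z \<bullet> v) * (Hf z \<bullet> v)) <= (speed z v)^2"
   by (intro tendsto_le[of "at_right 0"]) auto
  then show "I p" by (simp add: I_def A_def defs algebra_simps)
 qed
 note seg_ae = this
 \<comment> \<open>Every direction is shortened until its segment stays in the domain; the
   inequality is homogeneous of degree 2 in the direction.\<close>
 have "ae p. \<forall>n. closed_segment (fst p) (fst p + (1 / real (Suc n)) *R snd p) <= Om --> I (fst p, (1 / real (Suc n)) *R snd p)"
  unfolding AE_all_countable using AE_scale_direction[OF seg_ae] by auto
 then have "ae p. fst p \<in> Om --> I p"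
 proof (eventually_elim, intro impI)
  fix p :: "'a \<times> 'a" assume 1: "\<forall>n. closed_segment (fst p) (fst p + (1 / real (Suc n)) *R snd p) <= Om --> I (fst p, (1 / real (Suc n)) *R snd p)"
   and p: "fst p \<in> Om"
  obtain r where r: "r > 0" "ball (fst p) r <= Om" using p open_domain openE by blast
  obtain n :: nat where n: "norm (snd p) / r < real (Suc n)" using reals_Archimedean2 less_trans of_nat_less_iff by (metis lessI)
  define d where "d = 1 / real (Suc n)"
  have d: "0 < d" "d * norm (snd p) < r" using n r by (auto simp: d_def field_simps)
  have "closed_segment (fst p) (pt p d) <= ball (fst p) r"
   using r d by (intro closed_segment_subset) (auto simp: dist_norm)
  then have "I (fst p, d *R snd p)" using 1 r by (auto simp: d_def)
  then have "d^2 * (A (fst p) * (P.speed (fst p) (snd p))^2 + 2 * e * ((gradient \<eta> (fst p) \<bullet> snd p) * (Hf (fst p) \<bullet> snd p))) <= d^2 * (speed (fst p) (snd p))^2"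
   by (simp add: I_def speed_scale P.speed_scale power_mult_distrib power2_eq_square[of d] algebra_simps)
  then show "I p" unfolding I_def using d(1) by simp
 qed
 from AE_lborel_prodD[OF this] show ?thesis
 proof (eventually_elim, intro impI)
  fix z assume ae: "ae v. fst (z, v) \<in> Om --> I (z, v)" and z: "z \<in> Om"
  define \<omega> where "\<omega> = measure lborel (ball 0 1 :: 'a set)"
  have \<omega>: "\<omega> > 0" unfolding \<omega>_def by (rule unit_ball_measure_pos)
  note sm = sphere_second_moment[of "gradient \<eta> z" "Hf z"]
  define q where "q = (%s v. ind pball v * (s / (norm (v::'a))^2) :: real)"
  have qi: "L1 (%v. q ((P.speed z v)^2) v)" "L1 (%v. q ((speed z v)^2) v)"
   "L1 (%v. q ((gradient \<eta> z \<bullet> v) * (Hf z \<bullet> v)) v)"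
   unfolding q_def by (rule P.speed_quotient_int speed_quotient_int sm(2))+
  have le: "(LI v. A z * q ((P.speed z v)^2) v + 2 * e * q ((gradient \<eta> z \<bullet> v) * (Hf z \<bullet> v)) v) <= (LI v. q ((speed z v)^2) v)"
  proof (rule integral_mono_AE)
   show "ae v. A z * q ((P.speed z v)^2) v + 2 * e * q ((gradient \<eta> z \<bullet> v) * (Hf z \<bullet> v)) v <= q ((speed z v)^2) v"
    using ae
   proof eventually_elim
    case (elim v)
    then have "(ind pball v / (norm v)^2) * (A z * (P.speed z v)^2 + 2 * e * ((gradient \<eta> z \<bullet> v) * (Hf z \<bullet> v))) <= (ind pball v / (norm v)^2) * (speed z v)^2"
     using z by (intro mult_left_mono) (auto simp: I_def)
    then show ?case by (simp add: q_def algebra_simps)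
   qed
  qed (use qi in auto)
  have "A z * (LI v. q ((P.speed z v)^2) v) + 2 * e * (\<omega> / DIM('a) * (gradient \<eta> z \<bullet> Hf z)) <= (LI v. q ((speed z v)^2) v)"
  proof -
   have "(LI v. q ((gradient \<eta> z \<bullet> v) * (Hf z \<bullet> v)) v) = \<omega> / DIM('a) * (gradient \<eta> z \<bullet> Hf z)"
    unfolding q_def \<omega>_def by (rule sm(1))
   with le show ?thesis using qi by simp
  qed
  then have "DIM('a) / \<omega> * (A z * (LI v. q ((P.speed z v)^2) v) + 2 * e * (\<omega> / DIM('a) * (gradient \<eta> z \<bullet> Hf z))) <= DIM('a) / \<omega> * (LI v. q ((speed z v)^2) v)"
   using \<omega> by (intro mult_left_mono) auto
  moreover have "DIM('a) / \<omega> * (2 * e * (\<omega> / DIM('a) * (gradient \<eta> z \<bullet> Hf z))) = 2 * e * (gradient \<eta> z \<bullet> Hf z)" using \<omega> by simp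
  ultimately show "(1 - error_const * e^2 + 2 * (lam * e) * \<eta> z) * P.edens z + 2 * e * (gradient \<eta> z \<bullet> Hf z) <= edens z"
   unfolding P.edens_def edens_def \<omega>_def[symmetric] by (simp add: q_def distrib_left A_def mult.left_commute)
 qed
qed

end

context harmonic_variation
begin

text \<open>After integration of the pointwise inequality, minimality of \<open>u\<close> cancels
  the leading terms and the rest is divided by \<open>2 e\<close>. Three errors of order
  \<open>e\<close> remain, the summands of \<open>Q\<close>: the energy density of the perturbation
  in place of that of \<open>u\<close>, the curvature term, and \<open>f\<close> along the
  perturbation in place of \<open>f\<close> along \<open>u\<close>.\<close>

lemma weak_energy_inequality:
 assumes gu: "L1 gu" "ae z. z \<in> Om --> f (u z) = gu z"
 shows "lam * (LI z. \<eta> z * (ind Om z * edens z)) <= (LI z. gu z * laplacian \<eta> z)"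
proof -
 define n :: real where "n = DIM('a)"
 note sm = test_function_smooth[OF \<eta>]
 have d\<eta>: "test_function Om (dir_deriv \<eta> b)" "test_function Om (dir_deriv (dir_deriv \<eta> b) b)" for b
  by (intro test_function_dir_deriv \<eta>)+
 have l\<eta>: "test_function Om (laplacian \<eta>)" unfolding laplacian_def[abs_def] by (intro test_function_sum d\<eta>)
 have "\<exists>b1. \<forall>z. \<bar>dir_deriv \<eta> b z\<bar> <= b1" for b by (rule test_function_bounded[OF d\<eta>(1)[of b]]) blast
 then obtain b1 where b1: "!!b z. \<bar>dir_deriv \<eta> b z\<bar> <= b1 b" by metis
 define B1 where "B1 = (\<Sum>b\<in>Basis. b1 b)"
 have B1: "norm (gradient \<eta> z) <= B1" for z
 proof -
  have "norm (gradient \<eta> z) <= (\<Sum>b\<in>Basis. \<bar>gradient \<eta> z \<bullet> b\<bar>)" by (rule norm_le_l1)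
  also have "... <= B1" unfolding B1_def using b1 by (intro sum_mono) (simp flip: dir_deriv_gradient[OF sm])
  finally show ?thesis .
 qed
 have B10: "0 <= B1" using B1[of 0] norm_ge_zero order_trans by blast
 \<comment> \<open>Bounds the energy density of every perturbation, by \<open>edens_le\<close> with
   \<open>n H\<close> as gradient bound.\<close>
 define D1 where "D1 = (%z. n * (n * H z)^2)"
 define c0 where "c0 = error_const + 2 * \<bar>lam\<bar>"
 define R where "R = (%z. c0 * D1 z + 2 * (B1 * (n * (L * H z))))"
 have c0: "0 <= c0" using error_const_nonneg by (simp add: c0_def)
 have D1: "L1 D1" "0 <= D1 z" for z using H(3) by (auto simp: D1_def power_mult_distrib n_def)
 have R: "L1 R" "0 <= R z" for z
  unfolding R_def using D1 H(1,2) c0 B10 L1 by (auto intro!: add_nonneg_nonneg mult_nonneg_nonneg simp: n_def)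
 define a where "a = (%z. ind Om z * edens z)"
 have a: "L1 a" using integrable_mult_indicator[OF _ edens_int, of Om] by (simp add: a_def)
 define Q where "Q = \<bar>lam\<bar> * (2 * (LI z. R z)) + error_const / 2 * (LI z. D1 z) + 4 * L * L * (LI z. \<bar>laplacian \<eta> z\<bar>)"
 have step: "lam * (LI z. \<eta> z * a z) <= (LI z. gu z * laplacian \<eta> z) + e * Q" if e: "small e" for e
 proof -
  have e1: "0 < e" "e <= 1" using e step_max(2) by (auto simp: small_def)
  interpret sb: segment_bound Om "%z z'. dist (pert e z) (pert e z')" H by (rule segment_bound_pert[OF e])
  note L2p = L2_map_pert[OF e]
  obtain y g' G' where sp: "sobolev_map Om (pert e) y g' G' (%z. DIM('a) * H z)"
   using sobolev_mapI[OF segment_bound_pert[OF e] L2p] by blast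
  interpret P: sobolev_map Om "pert e" y g' G' "%z. DIM('a) * H z" by (rule sp)
  have "\<exists>gf Hf. weak_gradient Om gf Hf \<and> (\<forall>z. norm (Hf z) <= DIM('a) * (L * H z)) \<and> (ae z. z \<in> Om --> f (pert e z) = gf z) \<and>
   W12_gradient Om (%z. f (pert e z)) Hf"
   by (rule sb.function_gradient[OF L2_map_Lipschitz[OF open_domain bdd L2p f_lip] f_lip]) (use L1 in simp)
  then obtain gf Hf where wg: "weak_gradient Om gf Hf" and Hf: "!!z. norm (Hf z) <= n * (L * H z)"
   and gf: "ae z. z \<in> Om --> f (pert e z) = gf z" by (auto simp: n_def)
  define b where "b = (%z. ind Om z * P.edens z)"
  have b: "L1 b" using integrable_mult_indicator[OF _ P.edens_int, of Om] by (simp add: b_def)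
  have b0: "0 <= b z" "b z <= D1 z" for z
   using P.edens_nonneg[of z] P.edens_le[of z] D1(2)[of z] by (auto simp: b_def D1_def n_def indicator_def)
  have ab: "(LI z. a z) <= (LI z. b z)"
   using harm W12_mapI[OF segment_bound_pert[OF e] L2p] same_trace_pert[OF e]
   unfolding harmonic_map_def energy_density_integrable(3)[OF complete_UNIV] P.energy_density_integrable(3)[OF complete_UNIV] a_def b_def by (metis P.energy_density_integrable(3)[OF complete_UNIV])
  define V where "V = (%z. gradient \<eta> z \<bullet> Hf z)"
  have Vs: "V z = (\<Sum>c\<in>Basis. (Hf z \<bullet> c) * dir_deriv \<eta> c z)" for z
   by (simp add: V_def gradient_def inner_sum_right inner_commute[of _ "Hf z"] mult.commute)
  have Hfi: "L1 (%z. Hf z \<bullet> c)" for c using wg by (simp add: weak_gradient_def)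
  have Vci: "L1 (%z. (Hf z \<bullet> c) * dir_deriv \<eta> c z)" for c
   using mollify_integrand[OF d\<eta>(1)[of c] Hfi[of c], of 0] by simp
  have Vi: "L1 V" unfolding Vs[abs_def] by (intro Bochner_Integration.integrable_sum Vci)
  have gfi: "L1 gf" using wg by (simp add: weak_gradient_def)
  \<comment> \<open>The gradient of \<open>f\<close> along the perturbation is removed here: on the
    right only the function itself meets the Laplacian of \<open>\<eta>\<close>.\<close>
  have V: "(LI z. V z) = - (LI z. gf z * laplacian \<eta> z)"
  proof -
   have "(LI z. V z) = (\<Sum>c\<in>Basis. LI z. (Hf z \<bullet> c) * dir_deriv \<eta> c z)"
    unfolding Vs by (intro Bochner_Integration.integral_sum Vci)
   also have "... = (\<Sum>c\<in>Basis. - (LI z. gf z * dir_deriv (dir_deriv \<eta> c) c z))"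
    using wg d\<eta>(1) by (intro sum.cong) (auto simp: weak_gradient_def)
   also have "... = - (LI z. (\<Sum>c\<in>Basis. gf z * dir_deriv (dir_deriv \<eta> c) c z))"
    using mollify_integrand[OF d\<eta>(2) gfi, of _ 0] by (subst Bochner_Integration.integral_sum) (auto simp: sum_negf)
   finally show ?thesis by (simp add: laplacian_def sum_distrib_left)
  qed
  have Vle: "\<bar>V z\<bar> <= B1 * (n * (L * H z))" for z
   unfolding V_def using Cauchy_Schwarz_ineq2[of "gradient \<eta> z" "Hf z"] mult_mono[OF B1 Hf B10 norm_ge_zero, of z z] by linarith
  have Vout: "V z = 0" if "z \<notin> Om" for z unfolding Vs using test_function_outside[OF d\<eta>(1) that] by simp
  have main: "ae z. (1 - error_const * e^2) * b z + 2 * (lam * e) * (\<eta> z * b z) + 2 * e * V z <= a z"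
   using pointwise_energy_inequality[OF e sp wg gf]
  proof eventually_elim
   case (elim z)
   then show ?case using Vout[of z] by (cases "z \<in> Om") (auto simp: a_def b_def V_def algebra_simps)
  qed
  have \<eta>bi: "L1 (%z. \<eta> z * c z)" if "L1 c" for c
  proof (rule Bochner_Integration.integrable_bound[OF that])
   show "ae z. norm (\<eta> z * c z) <= norm (c z)" using \<eta>01 by (intro AE_I2) (auto simp: abs_mult mult_left_le_one_le)
   have [measurable]: "c \<in> Borel" using that by simp
   show "(%z. \<eta> z * c z) \<in> borel_measurable lborel" by measurable
  qed
  have e2: "error_const * e^2 <= error_const * e" using e1 error_const_nonneg by (intro mult_left_mono) (auto simp: power2_eq_square mult_left_le)
  \<comment> \<open>An upper bound for \<open>b\<close> in terms of \<open>a\<close>. Together with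
    the reverse inequality of the integrals, which is minimality, it shows that \<open>a\<close> and
    \<open>b\<close> differ by \<open>O(e)\<close> in L1.\<close>
  have up: "ae z. b z <= a z + e * R z"
   using main
  proof eventually_elim
   case (elim z)
   have "\<bar>2 * (lam * e) * (\<eta> z * b z)\<bar> = (2 * \<bar>lam\<bar> * e) * (\<eta> z * b z)" using e1 b0[of z] \<eta>01[of z] by (simp add: abs_mult)
   also have "... <= (2 * \<bar>lam\<bar> * e) * (1 * b z)" using e1 b0[of z] \<eta>01[of z] by (intro mult_left_mono mult_right_mono) auto
   finally have "(1 - error_const * e) * b z - (2 * \<bar>lam\<bar> * e) * b z + 2 * e * V z <= a z"
    using elim mult_right_mono[OF e2 b0(1)[of z]] by (simp add: algebra_simps)
   then have "b z <= a z + e * (c0 * b z) + 2 * (e * - V z)" by (simp add: c0_def algebra_simps)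
   also have "... <= a z + e * (c0 * D1 z) + 2 * (e * (B1 * (n * (L * H z))))"
    using e1 c0 b0[of z] Vle[of z] by (intro add_mono mult_left_mono) auto
   finally show ?case by (simp add: R_def algebra_simps)
  qed
  have "\<bar>(LI z. \<eta> z * b z) - (LI z. \<eta> z * a z)\<bar> = \<bar>LI z. \<eta> z * b z - \<eta> z * a z\<bar>"
   using \<eta>bi[OF a] \<eta>bi[OF b] by simp
  also have "... <= (LI z. a z - b z + 2 * (e * R z))"
  proof (rule order_trans[OF integral_abs_bound integral_mono_AE])
   show "ae z. \<bar>\<eta> z * b z - \<eta> z * a z\<bar> <= a z - b z + 2 * (e * R z)"
    using up
   proof eventually_elim
    case (elim z)
    have "\<bar>\<eta> z * b z - \<eta> z * a z\<bar> = \<eta> z * \<bar>b z - a z\<bar>" using \<eta>01[of z] by (simp add: abs_mult flip: right_diff_distrib)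
    also have "... <= \<bar>b z - a z\<bar>" using \<eta>01[of z] by (simp add: mult_left_le_one_le)
    finally show ?case using elim R(2)[of z] e1 mult_nonneg_nonneg[of e "R z"] by linarith
   qed
  qed (use a b R \<eta>bi[OF a] \<eta>bi[OF b] in auto)
  also have "... <= 2 * (e * (LI z. R z))" using a b R ab by simp
  finally have diff: "\<bar>(LI z. \<eta> z * b z) - (LI z. \<eta> z * a z)\<bar> <= 2 * (e * (LI z. R z))" .
  have "lam * ((LI z. \<eta> z * a z) - (LI z. \<eta> z * b z)) <= \<bar>lam\<bar> * \<bar>(LI z. \<eta> z * a z) - (LI z. \<eta> z * b z)\<bar>"
   unfolding abs_mult[symmetric] by simp
  also have "... <= \<bar>lam\<bar> * (2 * (e * (LI z. R z)))"
   using diff by (intro mult_left_mono) (auto simp: abs_minus_commute)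
  finally have s1: "lam * (LI z. \<eta> z * a z) <= lam * (LI z. \<eta> z * b z) + \<bar>lam\<bar> * (2 * (e * (LI z. R z)))"
   by (simp add: right_diff_distrib)
  have "(LI z. (1 - error_const * e^2) * b z + 2 * (lam * e) * (\<eta> z * b z) + 2 * e * V z) <= (LI z. a z)"
   using main b Vi \<eta>bi[OF b] a by (intro integral_mono_AE) auto
  then have "(1 - error_const * e^2) * (LI z. b z) + 2 * (lam * e) * (LI z. \<eta> z * b z) + 2 * e * (LI z. V z) <= (LI z. b z)"
   using b Vi \<eta>bi[OF b] ab by simp
  then have "(2 * e) * (lam * (LI z. \<eta> z * b z)) <= (2 * e) * (- (LI z. V z)) + error_const * e^2 * (LI z. b z)"
   by (simp add: algebra_simps)
  also have "... <= (2 * e) * (- (LI z. V z)) + error_const * e^2 * (LI z. D1 z)"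
   using b D1(1) b0(2) error_const_nonneg by (intro add_left_mono mult_left_mono integral_mono) auto
  also have "... = (2 * e) * ((LI z. gf z * laplacian \<eta> z) + e * (error_const / 2 * (LI z. D1 z)))"
   by (simp add: V power2_eq_square algebra_simps)
  finally have s2: "lam * (LI z. \<eta> z * b z) <= (LI z. gf z * laplacian \<eta> z) + e * (error_const / 2 * (LI z. D1 z))"
   using e1 by (simp add: mult_le_cancel_left_pos)
  have li: "L1 (%z. c z * laplacian \<eta> z)" if "L1 c" for c using mollify_integrand[OF l\<eta> that, of 0] by simp
  \<comment> \<open>The convergence is uniform here: resolvents move points by at most
    \<open>4 L e\<close>, and \<open>f\<close> is Lipschitz.\<close>
  have "(LI z. gf z * laplacian \<eta> z) <= (LI z. gu z * laplacian \<eta> z + (4 * L * e * L) * \<bar>laplacian \<eta> z\<bar>)"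
  proof (rule integral_mono_AE)
   show "ae z. gf z * laplacian \<eta> z <= gu z * laplacian \<eta> z + (4 * L * e * L) * \<bar>laplacian \<eta> z\<bar>"
    using gf gu(2)
   proof eventually_elim
    case (elim z)
    show ?case
    proof (cases "z \<in> Om")
     case True
     have "\<bar>gf z - gu z\<bar> <= L * dist (pert e z) (u z)" using f_lip[of "pert e z" "u z"] elim True by simp
     also have "... <= L * (4 * L * e)" using pert_dist[OF e, of z] L1 by (intro mult_left_mono) (auto simp: dist_commute)
     finally have "\<bar>gf z - gu z\<bar> * \<bar>laplacian \<eta> z\<bar> <= L * (4 * L * e) * \<bar>laplacian \<eta> z\<bar>" by (rule mult_right_mono) simp
     then have "(gf z - gu z) * laplacian \<eta> z <= L * (4 * L * e) * \<bar>laplacian \<eta> z\<bar>" unfolding abs_mult[symmetric] by linarith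
     then show ?thesis by (simp add: algebra_simps)
    qed (simp add: test_function_outside[OF l\<eta>])
   qed
  qed (use li[OF gfi] li[OF gu(1)] test_function_integrable[OF l\<eta>] in auto)
  also have "... = (LI z. gu z * laplacian \<eta> z) + e * (4 * L * L * (LI z. \<bar>laplacian \<eta> z\<bar>))"
   using li[OF gu(1)] test_function_integrable[OF l\<eta>] by simp
  finally show ?thesis using s1 s2 by (simp add: Q_def algebra_simps)
 qed
 obtain e0 where e0: "e0 > 0" "!!e. 0 < e ==> e <= e0 ==> small e" using small_eventually by blast
 have "lam * (LI z. \<eta> z * a z) <= (LI z. gu z * laplacian \<eta> z)"
 proof (rule field_le_epsilon)
  fix r :: real assume "0 < r"
  define e where "e = min e0 (r / (\<bar>Q\<bar> + 1))"
  have e: "0 < e" "e <= e0" using e0 \<open>0 < r\<close> by (auto simp: e_def)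
  have "e * Q <= e * \<bar>Q\<bar>" using e by (intro mult_left_mono) auto
  also have "... <= r / (\<bar>Q\<bar> + 1) * \<bar>Q\<bar>" by (intro mult_right_mono) (auto simp: e_def)
  also have "... <= r" using \<open>0 < r\<close> by (simp add: field_simps)
  finally show "lam * (LI z. \<eta> z * a z) <= (LI z. gu z * laplacian \<eta> z) + r"
   using step[OF e0(2)[OF e]] by linarith
 qed
 then show ?thesis by (simp add: a_def)
qed

end

section \<open>The Laplacian as a difference of two measures\<close>

text \<open>A cover of \<open>A\<close> sums to at least 1 on \<open>A\<close>, so the integral of
  \<open>k\<close> over \<open>A\<close> is at most the sum of the integrals of the cover functions
  against \<open>k\<close>, and these are bounded by \<open>T\<close>.\<close>

lemma (in positive_functional) riesz_ge_density:
 assumes k: "L1 k" "!!z. 0 <= k z"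
  and ge: "!!ph. test_function Om ph ==> (!!x. 0 <= ph x) ==> (LI z. ph z * k z) <= T ph"
  and A: "A \<in> sets borel" "A <= Om"
 shows "(\<integral>\<^sup>+z. ennreal (k z) * ind A z \<partial>lborel) <= emeasure riesz A"
 unfolding emeasure_riesz[OF A] outer_def
proof (rule INF_greatest)
 fix ph assume "ph \<in> covers A"
 then have ph: "!!i. test_function Om (ph i)" "!!i x. 0 <= ph i x" "!!x. x \<in> A ==> 1 <= (\<Sum>i. ennreal (ph i x))" by (auto simp: covers_def)
 have [measurable]: "k \<in> Borel" using k by simp
 have [measurable]: "ph i \<in> Borel" for i by (rule smooth_borel_measurable[OF test_function_smooth[OF ph(1)]])
 have "(\<integral>\<^sup>+z. ennreal (k z) * ind A z \<partial>lborel) <= (\<integral>\<^sup>+z. (\<Sum>i. ennreal (ph i z * k z)) \<partial>lborel)"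
 proof (rule nn_integral_mono)
  fix z
  have "ennreal (k z) * ind A z <= (\<Sum>i. ennreal (ph i z)) * ennreal (k z)"
   using mult_right_mono[OF ph(3), of z "ennreal (k z)"] by (auto simp: indicator_def)
  then show "ennreal (k z) * ind A z <= (\<Sum>i. ennreal (ph i z * k z))"
   using ph(2) k(2) by (simp add: ennreal_mult ennreal_suminf_multc)
 qed
 also have "... = (\<Sum>i. \<integral>\<^sup>+z. ennreal (ph i z * k z) \<partial>lborel)" 
  using k(1) smooth_borel_measurable[OF test_function_smooth[OF ph(1)]] by (intro nn_integral_suminf) auto
 also have "... <= (\<Sum>i. ennreal (T (ph i)))"
 proof (rule suminf_le)
  fix i
  have "L1 (%z. ph i z * k z)" using mollify_integrand[OF ph(1)[of i] k(1), of 0] by (simp add: mult.commute)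
  then have "(\<integral>\<^sup>+z. ennreal (ph i z * k z) \<partial>lborel) = ennreal (LI z. ph i z * k z)"
   using ph(2) k(2) by (intro nn_integral_eq_integral) auto
  also have "... <= ennreal (T (ph i))" by (intro ennreal_leI ge ph)
  finally show "(\<integral>\<^sup>+z. ennreal (ph i z * k z) \<partial>lborel) <= ennreal (T (ph i))" .
 qed auto
 finally show "(\<integral>\<^sup>+z. ennreal (k z) * ind A z \<partial>lborel) <= (\<Sum>i. ennreal (T (ph i)))" .
qed

theorem theorem1p5:
  fixes \<Omega> :: "'a::euclidean_space set"
    and u :: "'a \<Rightarrow> 'x::metric_space"
    and f :: "'x \<Rightarrow> real"
    and \<kappa> lam :: real
  assumes "lipschitz_domain \<Omega>"
    and "CAT_space \<kappa> TYPE('x)"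
    and "harmonic_map \<Omega> u"
    and "\<exists>L. L-lipschitz_on UNIV f"
    and "semiconvex lam f"
  shows "W12_loc \<Omega> (f \<circ> u) \<and>
         integrable (lebesgue_on \<Omega>) (energy_density \<Omega> u) \<and>
         (\<exists>\<mu> \<nu>. distributional_laplacian \<Omega> (f \<circ> u) \<mu> \<nu> \<and>
                signed_measure_ge_density \<Omega> \<mu> \<nu> (\<lambda>z. lam * energy_density \<Omega> u z))"
proof -
 have \<Omega>: "open \<Omega>" "bounded \<Omega>" using assms(1) by (auto simp: lipschitz_domain_def)
 then have \<Omega>s[measurable]: "\<Omega> \<in> sets borel" by simp
 have W: "W12_map \<Omega> u" and L2u: "L2_map \<Omega> u" using assms(3) by (auto simp: harmonic_map_def W12_map_def)
 have complete: "complete (UNIV :: 'x set)" using assms(2) by (simp add: CAT_space_def)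
 obtain k \<rho> where st: "stewart k \<rho> TYPE('x)" using CAT_stewart[OF assms(2)] by blast
 obtain L0 where "L0-lipschitz_on UNIV f" using assms(4) by blast
 \<comment> \<open>Raised to at least 1, as the resolvent estimates assume.\<close>
 then have lip: "(max L0 1)-lipschitz_on UNIV f" by (rule lipschitz_on_le) simp
 define L where "L = max L0 1"
 interpret R: resolvent_setup k \<rho> L lam f
  by unfold_locales (use st complete lip assms(5) in \<open>auto simp: L_def\<close>)
 obtain x :: "nat => 'x" and g G h where sm: "sobolev_map \<Omega> u x g G h" using W12_map_sobolev_map[OF \<Omega> W] by blast
 interpret sobolev_map \<Omega> u x g G h by (rule sm)
 have flip: "\<bar>f x - f y\<bar> <= L * dist x y" for x y by (rule R.f_lip)
 have L0: "0 <= L" by (simp add: L_def)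
 have sb: "segment_bound U (%z z'. dist (u z) (u z')) h" if U: "open U" "U <= \<Omega>" for U
 proof
  show "bounded U" using \<Omega>(2) U(2) by (rule bounded_subset)
  show "ae z. closed_segment z (z + v) <= U --> dist (u (z + v)) (u z) <= norm v * segment_integral h z v" for v
   using dist_le_segment_integral[of v] by eventually_elim (use U(2) in blast)
 qed (use U h_int h2_int h_nonneg in auto)
 have L2f: "L2_fun \<Omega> (%z. f (u z))" by (rule L2_map_Lipschitz[OF \<Omega> L2u flip])
 then have fm: "(%z. f (u z)) \<in> borel_measurable (lebesgue_on \<Omega>)" by (simp add: L2_fun_def)
 obtain gu where gu: "L1 gu" "ae z. z \<in> \<Omega> --> f (u z) = gu z"
  using segment_bound.function_gradient[OF sb[OF \<Omega>(1) order_refl] L2f flip L0] by (auto simp: weak_gradient_def)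
 have 1: "W12_loc \<Omega> (f \<circ> u)"
  unfolding W12_loc_def
 proof (intro allI impI)
  fix U assume "open U \<and> compact (closure U) \<and> closure U <= \<Omega>"
  then have U: "open U" "U <= \<Omega>" using closure_subset by blast+
  have r: "lebesgue_on U = restrict_space (lebesgue_on \<Omega>) U" using U \<Omega> by (simp add: restrict_restrict_space Int_absorb1 inf.absorb2)
  have "L2_fun U (%z. f (u z))" unfolding L2_fun_def r
  proof
   show "(%z. f (u z)) \<in> borel_measurable (restrict_space (lebesgue_on \<Omega>) U)" by (rule measurable_restrict_space1[OF fm])
   have U': "U \<inter> space (lebesgue_on \<Omega>) \<in> sets (lebesgue_on \<Omega>)" using U \<Omega> by (auto simp: sets_restrict_space_iff Int_absorb2)
   show "integrable (restrict_space (lebesgue_on \<Omega>) U) (%z. (norm (f (u z)))^2)"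
    using L2f U' U(2) unfolding integrable_restrict_space[OF U'] L2_fun_def
    by (intro integrable_mult_indicator) (auto simp: Int_absorb2)
  qed
  from segment_bound.function_gradient[OF sb[OF U] this flip L0] show "W12 U (f \<circ> u)"
   unfolding W12_def comp_def by blast
 qed
 define a where "a = (%z. ind \<Omega> z * edens z)"
 have a: "L1 a" using integrable_mult_indicator[OF _ edens_int, of \<Omega>] by (simp add: a_def)
 have a0: "0 <= a z" for z by (simp add: a_def edens_nonneg)
 have [measurable]: "edens \<in> Borel" "a \<in> Borel" using edens_int a by auto
 \<comment> \<open>\<open>lam\<close> may be negative, and then the Laplacian alone can fail to be
   positive. Adding the density \<open>km a\<close> makes the functional \<open>T\<close> positive,
   in fact at least \<open>kp\<close> times the integral against \<open>a\<close>; its measure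
   serves as \<open>\<mu>\<close>, and \<open>km a\<close> is the density of
   \<open>\<nu>\<close>.\<close>
 define kp km where "kp = max 0 lam" and "km = max 0 (- lam)"
 have kk: "0 <= kp" "0 <= km" "kp - km = lam" by (auto simp: kp_def km_def)
 define T where "T = (%ph. (LI z. gu z * laplacian ph z) + km * (LI z. a z * ph z))"
 have lt: "test_function \<Omega> (laplacian ph)" if "test_function \<Omega> ph" for ph
  unfolding laplacian_def[abs_def] by (intro test_function_sum test_function_dir_deriv that)
 have i: "L1 (%z. gu z * laplacian ph z)" "L1 (%z. a z * ph z)" if "test_function \<Omega> ph" for ph
  using mollify_integrand[OF lt[OF that] gu(1), of 0] mollify_integrand[OF that a, of 0] by auto
 have lsc: "laplacian (%x. c * ph x) z = c * laplacian ph z" if t: "test_function \<Omega> ph" for c ph z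
 proof -
  have "dir_deriv (%x. c * ph x) b = (%x. c * dir_deriv ph b x)" for b by (rule ext) (rule dir_deriv_cmult[OF test_function_smooth[OF t]])
  then show ?thesis
   by (simp add: laplacian_def dir_deriv_cmult[OF smooth_dir_deriv[OF test_function_smooth[OF t]]] sum_distrib_left)
 qed
 have lad: "laplacian (%x. ph x + \<psi> x) z = laplacian ph z + laplacian \<psi> z" if t: "smooth ph" "smooth \<psi>" for ph \<psi> z
 proof -
  have "dir_deriv (%x. ph x + \<psi> x) b = (%x. dir_deriv ph b x + dir_deriv \<psi> b x)" for b by (rule ext) (rule dir_deriv_add[OF t])
  then show ?thesis by (simp add: laplacian_def dir_deriv_add[OF t[THEN smooth_dir_deriv]] sum.distrib)
 qed
 have main: "kp * (LI z. a z * ph z) <= T ph" if t: "test_function \<Omega> ph" "!!z. 0 <= ph z" for ph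
 proof -
  \<comment> \<open>The variation takes functions with values in \<open>[0,1]\<close>; the
    inequality is linear in the test function, so a bound \<open>C\<close> can be scaled
    away.\<close>
  obtain C where C: "C > 0" "!!z. \<bar>ph z\<bar> <= C" using test_function_bounded[OF t(1)] by blast
  define \<eta> where "\<eta> = (%z. (1 / C) * ph z)"
  have \<eta>: "test_function \<Omega> \<eta>" unfolding \<eta>_def by (rule test_function_cmult[OF t(1)])
  have "ph z <= C" for z using C(2)[of z] by simp
  then interpret harmonic_variation \<Omega> u x g G h k \<rho> L lam f \<eta>
   by unfold_locales (use \<Omega> L2u \<eta> assms(3) t(2) C(1) in \<open>auto simp: \<eta>_def\<close>)
  have "C * (lam * (LI z. \<eta> z * a z)) <= C * (LI z. gu z * laplacian \<eta> z)"
   using weak_energy_inequality[OF gu] C(1) by (intro mult_left_mono) (auto simp: a_def)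
  moreover have "(LI z. gu z * laplacian \<eta> z) = (1 / C) * (LI z. gu z * laplacian ph z)"
   unfolding \<eta>_def lsc[OF t(1)] by (simp add: mult.left_commute)
  moreover have "(LI z. \<eta> z * a z) = (1 / C) * (LI z. a z * ph z)"
   by (simp add: \<eta>_def mult.commute mult.left_commute)
  ultimately have "lam * (LI z. a z * ph z) <= (LI z. gu z * laplacian ph z)" using C(1) by simp
  then show ?thesis unfolding T_def kk(3)[symmetric] by (simp add: algebra_simps)
 qed
 interpret pf: positive_functional \<Omega> T
 proof
  fix ph \<psi> assume t: "test_function \<Omega> ph" "test_function \<Omega> \<psi>"
  show "T (%x. ph x + \<psi> x) = T ph + T \<psi>"
   using i[OF t(1)] i[OF t(2)] by (simp add: T_def lad[OF t[THEN test_function_smooth]] distrib_left)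
 next
  fix ph c assume t: "test_function \<Omega> ph"
  show "T (%x. c * ph x) = c * T ph" by (simp add: T_def lsc[OF t] mult.left_commute[of _ c] distrib_left)
 next
  fix ph assume t: "test_function \<Omega> ph" "!!x. 0 <= ph x"
  have "0 <= kp * (LI z. a z * ph z)" using kk(1) a0 t(2) by (intro mult_nonneg_nonneg integral_nonneg_AE) auto
  then show "0 <= T ph" using main[OF t] by linarith
 qed (rule \<Omega>)
 define N where "N = restrict_space lborel \<Omega>"
 define \<nu> where "\<nu> = density N (%z. ennreal (km * a z))"
 have sN: "sets N = sets (restrict_space borel \<Omega>)" by (simp add: N_def sets_restrict_space)
 have [measurable]: "a \<in> borel_measurable N" "(%z. ennreal (km * a z)) \<in> borel_measurable N" by (auto simp: N_def measurable_restrict_space1)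
 have nu_A: "emeasure \<nu> A = ennreal (km * (LI z. a z * ind A z))" if A: "A \<in> sets borel" "A <= \<Omega>" for A
 proof -
  have "A \<in> sets N" using A by (simp add: sN sets_restrict_space_iff)
  then have "emeasure \<nu> A = (\<integral>\<^sup>+z. ennreal (km * a z) * ind A z \<partial>N)" unfolding \<nu>_def by (subst emeasure_density) auto
  also have "... = (\<integral>\<^sup>+z. ennreal (km * (a z * ind A z)) \<partial>lborel)"
   unfolding N_def using A \<Omega>s by (subst nn_integral_restrict_space) (auto intro!: nn_integral_cong simp: indicator_def)
  also have "... = ennreal (LI z. km * (a z * ind A z))"
   using kk(2) a0 integrable_mult_indicator[OF _ a, of A] A by (intro nn_integral_eq_integral) (auto simp: mult.commute)
  finally show ?thesis by simp
 qed
 have "distributional_laplacian \<Omega> (f \<circ> u) pf.riesz \<nu>"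
  unfolding distributional_laplacian_def locally_finite_measure_def
 proof (intro conjI allI impI)
  show "sets pf.riesz = sets (restrict_space borel \<Omega>)" by (rule pf.sets_riesz)
  show "sets \<nu> = sets (restrict_space borel \<Omega>)" by (simp add: \<nu>_def sN)
  show "emeasure pf.riesz K < \<infinity>" "emeasure \<nu> K < \<infinity>" if "compact K \<and> K <= \<Omega>" for K
   using that pf.riesz_compact_finite nu_A[of K] by (auto simp: compact_imp_closed)
  fix ph assume t: "test_function \<Omega> ph"
  have [measurable]: "ph \<in> Borel" "laplacian ph \<in> Borel"
   using smooth_borel_measurable test_function_smooth t lt[OF t] by blast+
  have "(LINT z|lebesgue_on \<Omega>. (f \<circ> u) z * laplacian ph z) = (LI z. gu z * laplacian ph z)"
   using gu test_function_outside[OF lt[OF t]] fm unfolding comp_def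
   by (intro lebesgue_on_eq_lborel(2)[OF \<Omega>s] borel_measurable_times[OF fm borel_measurable_lebesgue_on]) (auto elim: eventually_mono)
  also have "... = T ph - km * (LI z. a z * ph z)" by (simp add: T_def)
  also have "km * (LI z. a z * ph z) = (LINT z|\<nu>. ph z)"
  proof -
   have "(LINT z|\<nu>. ph z) = (LINT z|N. (km * a z) * ph z)"
    unfolding \<nu>_def using kk(2) a0 by (subst integral_density) (auto simp: N_def measurable_restrict_space1)
   also have "... = (LI z. km * (a z * ph z))"
   proof -
    have "(%z. ind \<Omega> z *R ((km * a z) * ph z)) = (%z. km * (a z * ph z))"
     by (rule ext) (simp add: a_def split: split_indicator)
    then show ?thesis unfolding N_def by (subst integral_restrict_space) (use \<Omega>s in simp, simp only:)
   qed
   finally show ?thesis by simp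
  qed
  finally show "(LINT z|lebesgue_on \<Omega>. (f \<circ> u) z * laplacian ph z) = (LINT z|pf.riesz. ph z) - (LINT z|\<nu>. ph z)"
   by (simp add: pf.riesz_integral[OF t])
 qed
 moreover have "signed_measure_ge_density \<Omega> pf.riesz \<nu> (%z. lam * energy_density \<Omega> u z)"
  unfolding signed_measure_ge_density_def
 proof (intro ballI impI)
  fix A :: "'a set" assume A: "A \<in> sets borel" and cA: "compact (closure A) \<and> closure A <= \<Omega>"
  then have A\<Omega>: "A <= \<Omega>" using closure_subset by blast
  define J where "J = (LI z. a z * ind A z)"
  have ai: "L1 (%z. a z * ind A z)" using integrable_mult_indicator[OF _ a, of A] A by (simp add: mult.commute)
  have J0: "0 <= J" unfolding J_def using a0 by (intro integral_nonneg_AE) auto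
  have nuA: "measure \<nu> A = km * J" using nu_A[OF A A\<Omega>] kk(2) J0 by (simp add: measure_def J_def)
  have "ennreal (kp * J) = (\<integral>\<^sup>+z. ennreal (kp * (a z * ind A z)) \<partial>lborel)"
   using kk(1) a0 ai by (subst nn_integral_eq_integral) (auto simp: J_def)
  also have "... = (\<integral>\<^sup>+z. ennreal (kp * a z) * ind A z \<partial>lborel)" by (intro nn_integral_cong) (auto simp: indicator_def)
  also have "... <= emeasure pf.riesz A"
  proof (rule pf.riesz_ge_density[OF _ _ _ A A\<Omega>])
   fix ph assume t: "test_function \<Omega> ph" "!!x. 0 <= ph x"
   have "(LI z. ph z * (kp * a z)) = kp * (LI z. a z * ph z)" by (simp add: mult.left_commute mult.commute)
   then show "(LI z. ph z * (kp * a z)) <= T ph" using main[OF t] by simp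
  qed (use a a0 kk in auto)
  finally have le: "ennreal (kp * J) <= emeasure pf.riesz A" .
  \<comment> \<open>Finiteness on the compact closure allows the comparison to be read in the
    reals.\<close>
  have "emeasure pf.riesz A <= emeasure pf.riesz (closure A)"
   using cA \<Omega>s by (intro emeasure_mono closure_subset) (auto simp: pf.sets_riesz sets_restrict_space_iff)
  also have "... < \<infinity>" using cA by (intro pf.riesz_compact_finite) auto
  finally have "kp * J <= measure pf.riesz A"
   using le by (simp add: emeasure_eq_ennreal_measure less_top[symmetric] ennreal_le_iff)
  moreover have "(LINT z:A|lebesgue. lam * energy_density \<Omega> u z) = lam * J"
  proof -
   note ed = energy_density_integrable[OF complete]
   have "(LINT z:A|lebesgue. lam * energy_density \<Omega> u z) = (LINT z|lebesgue_on \<Omega>. ind A z * (lam * energy_density \<Omega> u z))"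
    unfolding set_lebesgue_integral_def using \<Omega>s A\<Omega>
    by (subst integral_restrict_space) (auto intro!: Bochner_Integration.integral_cong simp: indicator_def)
   also have "... = (LI z. lam * (a z * ind A z))"
   proof (rule lebesgue_on_eq_lborel(2)[OF \<Omega>s])
    have "(ind A :: 'a => real) \<in> Borel" using A by simp
    from borel_measurable_lebesgue_on[OF this]
    show "(%z. ind A z * (lam * energy_density \<Omega> u z)) \<in> borel_measurable (lebesgue_on \<Omega>)" using ed(1) by measurable
    show "ae z. z \<in> \<Omega> --> ind A z * (lam * energy_density \<Omega> u z) = lam * (a z * ind A z)"
     using ed(4) by eventually_elim (auto simp: a_def)
   qed (use A in \<open>auto simp: a_def\<close>)
   finally show ?thesis by (simp add: J_def)
  qed
  ultimately show "measure pf.riesz A - measure \<nu> A \<ge> (LINT z:A|lebesgue. lam * energy_density \<Omega> u z)"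
   unfolding nuA kk(3)[symmetric] by (simp add: algebra_simps)
 qed
 ultimately show ?thesis using 1 energy_density_integrable(2)[OF complete] by blast
qed

end
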